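(* Let $l$ be a prime with $l\equiv 4\pmod 5$, $d=l$ (allowed only if $l\equiv 3\pmod 4$) or $d=4l$, and let $m_d(x)$ be the minimal polynomial of $\eta=r(w/5)$ over $K=\mathbb{Q}(\sqrt{-l})$. Then the prime ideal $\mathfrak{l}=(\sqrt{-l})$ of $K$ does not divide $\mathrm{disc}(m_d(x))$; consequently the powers of $\eta$ form an $\mathfrak{l}$-integral basis of $K(\eta)/K$.
   Context: Let $R_K$ be the ring of integers of $K$; $5$ splits as $(5)=\wp_5\wp_5'$ in $R_K$. Let $r(\tau)=q^{1/5}\prod_{n\ge1}(1-q^n)^{(n/5)}$, $q=e^{2\pi i\tau}$, be the Rogers–Ramanujan continued fraction. Here $w=(v+\sqrt{-d})/2\in K$ is an algebraic integer with $\wp_5^2\mid w$, and with $N(w)$ odd when $d=4l$, $l\equiv 3\pmod 4$. *)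

theory Defs
  imports "HOL-Analysis.Analysis" "HOL-Number_Theory.Number_Theory"
          "Subresultants.Resultant_Prelim"
begin

text \<open>Rogers--Ramanujan continued fraction
  r(tau) = q^(1/5) * prod_{n>=1} (1 - q^n)^((n/5)),  q = exp(2 pi i tau),
  where q^(1/5) means exp(2 pi i tau / 5) and (n/5) is the Legendre symbol.\<close>
definition rr_cf :: "complex \<Rightarrow> complex" where
  "rr_cf \<tau> = exp (2 * pi * \<i> * \<tau> / 5) *
     (\<Prod>n. (1 - exp (2 * pi * \<i> * \<tau>) ^ Suc n) powi Legendre (int (Suc n)) 5)"

definition alg_int :: "complex \<Rightarrow> bool" where
  "alg_int x \<longleftrightarrow> (\<exists>p :: int poly. lead_coeff p = 1 \<and> poly (map_poly of_int p) x = 0)"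

definition quad_field :: "nat \<Rightarrow> complex set" where
  "quad_field l = {of_rat a + of_rat b * (\<i> * of_real (sqrt (real l))) | a b. True}"

definition ring_of_integers :: "complex set \<Rightarrow> complex set" where
  "ring_of_integers K = {x \<in> K. alg_int x}"

definition is_ideal :: "complex set \<Rightarrow> complex set \<Rightarrow> bool" where
  "is_ideal R I \<longleftrightarrow> I \<subseteq> R \<and> 0 \<in> I \<and> (\<forall>x\<in>I. \<forall>y\<in>I. x + y \<in> I \<and> - x \<in> I)
      \<and> (\<forall>r\<in>R. \<forall>x\<in>I. r * x \<in> I)"

definition ideal_mult :: "complex set \<Rightarrow> complex set \<Rightarrow> complex set \<Rightarrow> complex set" where
  "ideal_mult R I J = \<Inter> {P. is_ideal R P \<and> {a * b | a b. a \<in> I \<and> b \<in> J} \<subseteq> P}"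

definition is_prime_ideal :: "complex set \<Rightarrow> complex set \<Rightarrow> bool" where
  "is_prime_ideal R P \<longleftrightarrow> is_ideal R P \<and> P \<noteq> R \<and>
      (\<forall>x\<in>R. \<forall>y\<in>R. x * y \<in> P \<longrightarrow> x \<in> P \<or> y \<in> P)"

definition principal_ideal :: "complex set \<Rightarrow> complex \<Rightarrow> complex set" where
  "principal_ideal R a = {a * r | r. r \<in> R}"

definition is_subfield :: "complex set \<Rightarrow> bool" where
  "is_subfield F \<longleftrightarrow> 0 \<in> F \<and> 1 \<in> F \<and> (\<forall>x\<in>F. \<forall>y\<in>F. x + y \<in> F \<and> - x \<in> F \<and> x * y \<in> F)
      \<and> (\<forall>x\<in>F. x \<noteq> 0 \<longrightarrow> inverse x \<in> F)"

definition field_adjoin :: "complex set \<Rightarrow> complex \<Rightarrow> complex set" where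
  "field_adjoin K x = \<Inter> {F. is_subfield F \<and> K \<subseteq> F \<and> x \<in> F}"

definition is_min_poly :: "complex set \<Rightarrow> complex \<Rightarrow> complex poly \<Rightarrow> bool" where
  "is_min_poly K x m \<longleftrightarrow> lead_coeff m = 1 \<and> (\<forall>i. Polynomial.coeff m i \<in> K) \<and> poly m x = 0 \<and>
     (\<forall>q. q \<noteq> 0 \<and> (\<forall>i. Polynomial.coeff q i \<in> K) \<and> poly q x = 0 \<longrightarrow> degree m \<le> degree q)"

definition poly_disc :: "complex poly \<Rightarrow> complex" where
  "poly_disc p = (-1) ^ (degree p * (degree p - 1) div 2) * resultant p (pderiv p) / lead_coeff p"

definition loc_integral :: "complex set \<Rightarrow> complex set \<Rightarrow> complex \<Rightarrow> bool" where
  "loc_integral R P x \<longleftrightarrow> (\<exists>a\<in>R. \<exists>b\<in>R. b \<notin> P \<and> x = a / b)"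

end

theory Submission
  imports Defs "HOL-Complex_Analysis.Complex_Analysis" "Jordan_Normal_Form.Char_Poly"
begin

text \<open>
The fifth power of \<open>r(\<tau>)\<close> is the value at the 5-torsion point \<open>\<tau>\<close> of a weight 0 function \<open>s\<close> of
pairs (lattice, 5-torsion point), a quotient of Klein forms; \<open>n\<close> is a companion of weight \<open>- 1\<close>. Symmetric
expressions in the values of \<open>s\<close> and \<open>n\<close> on the \<open>l + 1\<close> superlattices \<open>M\<close> of index \<open>l\<close> are
polynomials in \<open>s\<close>, with \<open>l\<close>-integral coefficients because their expansions at one cusp have such
coefficients; the Frobenius congruences for these expansions determine the polynomials modulo \<open>l\<close>.

Let \<open>lam = \<surd>(-l)\<close> and \<open>L = \<int> + \<int> w\<close>. The condition on \<open>w\<close> makes \<open>lam\<close> act on \<open>w/5\<close> as \<open>1\<close> or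
\<open>- 1\<close>, and one of the superlattices is \<open>M = lam\<inverse> L\<close>. It satisfies \<open>s M = s L\<close> and
\<open>n M = \<plusminus> lam n L\<close>, so in sums over products omitting one superlattice only the term of \<open>M\<close> survives.
Comparing the sums with and without the weight \<open>n\<close> gives \<open>\<beta> ^ l - \<beta> \<in> lam \<beta> \<int>[lam, \<beta>]\<close> locally at
\<open>l\<close> for \<open>\<beta> = \<eta> ^ 5\<close>, and the product over all superlattices shows that \<open>\<beta>\<close> is integral at \<open>l\<close>.
As \<open>5 (l - 1)\<close> divides \<open>l\<^sup>2 - 1\<close>, it follows that \<open>\<eta> ^ (l\<^sup>2) \<equiv> \<eta>\<close> modulo \<open>lam\<close>. Hence the minimal
polynomial divides \<open>X ^ (l\<^sup>2) - X\<close> modulo \<open>lam\<close>, which is separable, so the discriminant is a unit at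
\<open>lam\<close>. On the \<open>l\<close>-local ring generated by \<open>lam\<close> and \<open>\<eta>\<close> one has \<open>x ^ (l\<^sup>2) \<equiv> x\<close> modulo
\<open>lam\<close>; an element \<open>x\<close> of it with \<open>x / lam\<close> integral is nilpotent modulo \<open>lam\<close>, hence divisible by
\<open>lam\<close> in this ring, which is therefore integrally closed.
\<close>

section \<open>Infinite products and Klein forms\<close>

text \<open>Why two sums: let \<open>X\<close> be the product of \<open>s0 - s M\<close> over all
  superlattices except \<open>lam\<close>^-1 L. With b = \<beta>, the unweighted sum gives X = b^l -
  b + l p1(b) and the weighted one e lam X = l p2(b), where e is 1 or -1. As lam^2 = - l, this is X
  = - e lam p2(b): the quotient of \<open>X\<close> by lam is again a polynomial in b. The product
  relation alone only bounds (b^l - b)^2 by l, so that (b^l - b) / lam is integral but possibly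
  outside the ring generated by lam and \<eta>, and it is in this ring that the reduction of the
  minimal polynomial is read off. Since p1 and p2 have no constant term, b can be cancelled, which
  gives b^(l-1) = 1 modulo lam. The condition l = 4 mod 5 enters three times: multiplication by l is
  -1 on 5-torsion, so superlattices keep the cusp of a point; the scalar by which lam acts on w/5
  has square - l = 1 mod 5; and 5 divides l + 1, so that b^(l-1) = 1 can be lifted to the fifth root
  \<eta>. Coefficients are taken in Z localised at l because Newton's identities require division by
  1, ..., l - 1.\<close>

definition qpoch :: "complex \<Rightarrow> complex \<Rightarrow> complex" where
  "qpoch y q = (\<Prod>n. 1 - y * q ^ n)"

lemma qpoch_has_prod:
  assumes "norm q < 1"
  shows "(\<lambda>n. 1 - y * q ^ n) has_prod qpoch y q"
proof -
  have "summable (\<lambda>n. norm y * norm q ^ n)"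
    using assms by (intro summable_mult summable_geometric) auto
  then have "summable (\<lambda>n. norm ((1 - y * q ^ n) - 1))"
    by (simp add: norm_mult norm_power)
  then have "abs_convergent_prod (\<lambda>n. 1 - y * q ^ n)"
    by (simp add: abs_convergent_prod_conv_summable)
  then show ?thesis
    unfolding qpoch_def
    by (intro convergent_prod_has_prod abs_convergent_prod_imp_convergent_prod)
qed

lemma qpoch_tendsto:
  assumes "norm q < 1"
  shows "(\<lambda>N. \<Prod>n<N. 1 - y * q ^ n) \<longlonglongrightarrow> qpoch y q"
  using has_prod_imp_tendsto'[OF qpoch_has_prod[OF assms]] .

lemma qpoch_eq_0_iff:
  assumes "norm q < 1"
  shows "qpoch y q = 0 \<longleftrightarrow> (\<exists>n. y * q ^ n = 1)"
  using has_prod_eq_0_iff[OF qpoch_has_prod[OF assms], of y] by (auto simp: image_iff)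

lemma qpoch_nonzero:
  assumes "norm q < 1" "norm y < 1"
  shows "qpoch y q \<noteq> 0"
proof
  assume "qpoch y q = 0"
  then obtain n where n: "y * q ^ n = 1"
    using qpoch_eq_0_iff[OF assms(1)] by blast
  have "norm (y * q ^ n) \<le> norm y * 1"
    unfolding norm_mult norm_power
    using assms by (intro mult_left_mono power_le_one) auto
  then show False using n assms by auto
qed

lemma qpoch_rec:
  assumes "norm q < 1"
  shows "qpoch y q = (1 - y) * qpoch (y * q) q"
proof -
  have "(\<lambda>N. \<Prod>n<Suc N. 1 - y * q ^ n) \<longlonglongrightarrow> qpoch y q"
    using LIMSEQ_Suc[OF qpoch_tendsto[OF assms]] .
  moreover have "(\<Prod>n<Suc N. 1 - y * q ^ n) = (1 - y) * (\<Prod>n<N. 1 - (y * q) * q ^ n)" for N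
    by (subst prod.lessThan_Suc_shift) (simp add: mult.assoc)
  ultimately have "(\<lambda>N. (1 - y) * (\<Prod>n<N. 1 - (y * q) * q ^ n)) \<longlonglongrightarrow> qpoch y q"
    by simp
  moreover have "(\<lambda>N. (1 - y) * (\<Prod>n<N. 1 - (y * q) * q ^ n)) \<longlonglongrightarrow> (1 - y) * qpoch (y * q) q"
    by (intro tendsto_mult tendsto_const qpoch_tendsto assms)
  ultimately show ?thesis by (rule LIMSEQ_unique)
qed

lemma qpoch_0_right [simp]: "qpoch y 0 = 1 - y"
proof -
  have "qpoch y 0 = (1 - y) * qpoch (y * 0) 0"
    by (rule qpoch_rec) simp
  also have "qpoch (y * 0) 0 = 1" by (simp add: qpoch_def)
  finally show ?thesis by simp
qed

lemma qpoch_0_left [simp]: "qpoch 0 q = 1"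
  by (simp add: qpoch_def)

text \<open>On a compact set the norms of \<open>y\<close> and \<open>q\<close> attain their maxima,
  and the geometric series built from these maxima is the Weierstrass majorant. Holomorphy in both
  arguments jointly is deduced from this.\<close>

lemma qpoch_uniform_limit:
  fixes y q :: "complex \<Rightarrow> complex"
  assumes A: "compact A" and y: "continuous_on A y" and q: "continuous_on A q"
    and q1: "\<And>x. x \<in> A \<Longrightarrow> norm (q x) < 1"
  shows "uniform_limit A (\<lambda>N x. \<Prod>n<N. 1 - y x * q x ^ n) (\<lambda>x. qpoch (y x) (q x)) sequentially"
proof (cases "A = {}")
  case False
  obtain x0 where x0: "x0 \<in> A" "\<And>x. x \<in> A \<Longrightarrow> norm (q x) \<le> norm (q x0)"
    using continuous_attains_sup[OF A False, of "\<lambda>x. norm (q x)"] q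
    by (auto intro: continuous_intros)
  obtain x1 where x1: "x1 \<in> A" "\<And>x. x \<in> A \<Longrightarrow> norm (y x) \<le> norm (y x1)"
    using continuous_attains_sup[OF A False, of "\<lambda>x. norm (y x)"] y
    by (auto intro: continuous_intros)
  have "uniformly_convergent_on A (\<lambda>N x. \<Sum>n<N. norm ((1 - y x * q x ^ n) - 1))"
  proof (rule Weierstrass_m_test')
    show "norm (norm (1 - y x * q x ^ n - 1)) \<le> norm (y x1) * norm (q x0) ^ n" if "x \<in> A" for n x
      using x0(2)[OF that] x1(2)[OF that]
      by (auto simp: norm_mult norm_power intro!: mult_mono power_mono)
    show "summable (\<lambda>n. norm (y x1) * norm (q x0) ^ n)"
      using q1[OF x0(1)] by (intro summable_mult summable_geometric) auto
  qed
  then have "uniformly_convergent_on A (\<lambda>N x. \<Prod>n<N. 1 - y x * q x ^ n)"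
    using y q by (intro uniformly_convergent_on_prod' A continuous_intros) auto
  then obtain g where g: "uniform_limit A (\<lambda>N x. \<Prod>n<N. 1 - y x * q x ^ n) g sequentially"
    by (auto simp: uniformly_convergent_on_def)
  have "g x = qpoch (y x) (q x)" if "x \<in> A" for x
    using LIMSEQ_unique[OF tendsto_uniform_limitI[OF g that] qpoch_tendsto[OF q1[OF that]]] .
  then show ?thesis
    using g by (subst uniform_limit_cong') auto
qed (auto intro: uniform_limit_on_empty simp: uniform_limit_iff)

lemma qpoch_holomorphic [holomorphic_intros]:
  assumes S: "open S" and y: "y holomorphic_on S" and q: "q holomorphic_on S"
    and q1: "\<And>x. x \<in> S \<Longrightarrow> norm (q x) < 1"
  shows "(\<lambda>x. qpoch (y x) (q x)) holomorphic_on S"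
proof (rule holomorphic_uniform_sequence[OF S])
  show "(\<lambda>x. \<Prod>n<N. 1 - y x * q x ^ n) holomorphic_on S" for N
    using y q by (intro holomorphic_intros)
  fix x assume "x \<in> S"
  then obtain d where d: "d > 0" "cball x d \<subseteq> S"
    using S open_contains_cball by blast
  have "uniform_limit (cball x d) (\<lambda>N x. \<Prod>n<N. 1 - y x * q x ^ n) (\<lambda>x. qpoch (y x) (q x)) sequentially"
    using d y q q1
    by (intro qpoch_uniform_limit) (auto intro: continuous_on_subset holomorphic_on_imp_continuous_on)
  then show "\<exists>d. 0 < d \<and> cball x d \<subseteq> S \<and> uniform_limit (cball x d) (\<lambda>N x. \<Prod>n<N. 1 - y x * q x ^ n)
          (\<lambda>x. qpoch (y x) (q x)) sequentially"
    using d by blast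
qed

section \<open>The exponential e(z), lattices and the theta function\<close>

definition ee :: "complex \<Rightarrow> complex" where
  "ee z = exp (2 * of_real pi * \<i> * z)"

lemma ee_add: "ee (a + b) = ee a * ee b"
  by (simp add: ee_def exp_add distrib_left)

lemma ee_minus: "ee (- a) = inverse (ee a)"
  by (simp add: ee_def exp_minus)

lemma ee_diff: "ee (a - b) = ee a / ee b"
  by (simp add: ee_def exp_diff right_diff_distrib)

lemma ee_nonzero [simp]: "ee z \<noteq> 0"
  by (simp add: ee_def)

lemma ee_0 [simp]: "ee 0 = 1"
  by (simp add: ee_def)

lemma ee_eq_1_iff: "ee z = 1 \<longleftrightarrow> z \<in> \<int>"
proof
  assume "ee z = 1"
  then obtain n where n: "Im z = 0" "2 * pi * Re z = of_int (2 * n) * pi"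
    by (auto simp: ee_def exp_eq_1)
  then have "z = of_int n"
    by (simp add: complex_eq_iff)
  then show "z \<in> \<int>" by simp
next
  assume "z \<in> \<int>"
  then obtain n where "z = of_int n" by (auto simp: Ints_def)
  then show "ee z = 1"
    by (auto simp: ee_def exp_eq_1)
qed

lemma ee_of_int [simp]: "ee (of_int n) = 1"
  by (simp add: ee_eq_1_iff)

lemma ee_1 [simp]: "ee 1 = 1"
  by (simp add: ee_eq_1_iff)

lemma ee_of_nat_mult: "ee (of_nat n * z) = ee z ^ n"
  by (simp add: ee_def exp_of_nat_mult [symmetric] mult_ac)

lemma norm_ee: "norm (ee z) = exp (- 2 * pi * Im z)"
  by (simp add: ee_def)

lemma norm_ee_less_1: "Im z > 0 \<Longrightarrow> norm (ee z) < 1"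
  by (simp add: norm_ee)

lemma ee_holomorphic [holomorphic_intros]:
  "f holomorphic_on A \<Longrightarrow> (\<lambda>z. ee (f z)) holomorphic_on A"
  unfolding ee_def by (intro holomorphic_intros)

definition lat :: "complex \<Rightarrow> complex set" where
  "lat \<tau> = {of_int m + of_int n * \<tau> | m n. True}"

lemma latI: "z = of_int m + of_int n * \<tau> \<Longrightarrow> z \<in> lat \<tau>"
  by (auto simp: lat_def)

lemma lat_1 [simp]: "1 \<in> lat \<tau>" by (rule latI[of _ 1 0]) simp
lemma lat_tau [simp]: "\<tau> \<in> lat \<tau>" by (rule latI[of _ 0 1]) simp
lemma lat_0 [simp]: "0 \<in> lat \<tau>" by (rule latI[of _ 0 0]) simp
lemma lat_of_int [simp]: "of_int m \<in> lat \<tau>" by (rule latI[of _ m 0]) simp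

lemma lat_add: "a \<in> lat \<tau> \<Longrightarrow> b \<in> lat \<tau> \<Longrightarrow> a + b \<in> lat \<tau>"
proof -
  assume "a \<in> lat \<tau>" "b \<in> lat \<tau>"
  then obtain m n m' n' where "a = of_int m + of_int n * \<tau>" "b = of_int m' + of_int n' * \<tau>"
    by (auto simp: lat_def)
  then show ?thesis by (intro latI[of _ "m + m'" "n + n'"]) (simp add: algebra_simps)
qed

lemma lat_mult_int: "a \<in> lat \<tau> \<Longrightarrow> of_int k * a \<in> lat \<tau>"
proof -
  assume "a \<in> lat \<tau>"
  then obtain m n where "a = of_int m + of_int n * \<tau>"
    by (auto simp: lat_def)
  then show ?thesis by (intro latI[of _ "k * m" "k * n"]) (simp add: algebra_simps)
qed

lemma lat_uminus: "a \<in> lat \<tau> \<Longrightarrow> - a \<in> lat \<tau>"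
  using lat_mult_int[of a \<tau> "-1"] by simp

lemma lat_diff: "a \<in> lat \<tau> \<Longrightarrow> b \<in> lat \<tau> \<Longrightarrow> a - b \<in> lat \<tau>"
  using lat_add[of a \<tau> "- b"] lat_uminus[of b \<tau>] by simp

text \<open>Up to a constant and a factor exp(c z^2) this is the product formula for the Weierstrass
  sigma function of the lattice, hence also the Klein form without its normalising factors. Those
  factors cancel in the combinations used below.\<close>

definition kf :: "complex \<Rightarrow> complex \<Rightarrow> complex" where
  "kf \<tau> z = exp (- (of_real pi * \<i> * z)) * qpoch (ee z) (ee \<tau>) * qpoch (ee \<tau> / ee z) (ee \<tau>)"

lemma kf_alt:
  assumes "Im \<tau> > 0"
  shows "kf \<tau> z = exp (- (of_real pi * \<i> * z)) * (1 - ee z) *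
           (qpoch (ee z * ee \<tau>) (ee \<tau>) * qpoch (ee \<tau> / ee z) (ee \<tau>))"
  using qpoch_rec[OF norm_ee_less_1[OF assms], of "ee z"] by (simp add: kf_def)

lemma exp_half_ee: "exp (of_real pi * \<i> * z) * exp (of_real pi * \<i> * z) = ee z"
  by (simp add: ee_def exp_add [symmetric] mult_ac)

lemma kf_minus:
  assumes "Im \<tau> > 0"
  shows "kf \<tau> (- z) = - kf \<tau> z"
proof -
  define E where "E = exp (of_real pi * \<i> * z)"
  have E: "ee z = E * E" "E \<noteq> 0" by (simp_all add: E_def exp_half_ee)
  have "kf \<tau> (- z) = E * qpoch (1 / ee z) (ee \<tau>) * qpoch (ee \<tau> * ee z) (ee \<tau>)"
    by (simp add: kf_def E_def ee_minus divide_simps)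
  also have "qpoch (1 / ee z) (ee \<tau>) = (1 - 1 / ee z) * qpoch (ee \<tau> / ee z) (ee \<tau>)"
    using qpoch_rec[OF norm_ee_less_1[OF assms], of "1 / ee z"] by simp
  also have "E * ((1 - 1 / ee z) * qpoch (ee \<tau> / ee z) (ee \<tau>)) * qpoch (ee \<tau> * ee z) (ee \<tau>) =
     - (inverse E * (1 - ee z) * (qpoch (ee z * ee \<tau>) (ee \<tau>) * qpoch (ee \<tau> / ee z) (ee \<tau>)))"
    using E by (simp add: field_simps)
  also have "inverse E = exp (- (of_real pi * \<i> * z))"
    by (simp add: E_def exp_minus)
  finally show ?thesis
    by (simp add: kf_alt[OF assms])
qed

lemma kf_add_1: "kf \<tau> (z + 1) = - kf \<tau> z"
proof -
  have "exp (- (of_real pi * \<i> * (z + 1))) = - exp (- (of_real pi * \<i> * z))"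
    by (simp add: distrib_left exp_diff field_simps exp_minus)
  then show ?thesis by (simp add: kf_def ee_add)
qed

lemma kf_add_tau:
  assumes "Im \<tau> > 0"
  shows "kf \<tau> (z + \<tau>) = - exp (- (of_real pi * \<i> * \<tau>) - 2 * of_real pi * \<i> * z) * kf \<tau> z"
proof -
  have 1: "exp (- (of_real pi * \<i> * (z + \<tau>))) =
      exp (- (of_real pi * \<i> * \<tau>)) * exp (- (of_real pi * \<i> * z))"
    by (simp add: algebra_simps exp_add [symmetric])
  have 2: "qpoch (1 / ee z) (ee \<tau>) = (1 - 1 / ee z) * qpoch (ee \<tau> / ee z) (ee \<tau>)"
    using qpoch_rec[OF norm_ee_less_1[OF assms], of "1 / ee z"] by simp
  have "kf \<tau> (z + \<tau>) = exp (- (of_real pi * \<i> * \<tau>)) * exp (- (of_real pi * \<i> * z)) *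
      qpoch (ee z * ee \<tau>) (ee \<tau>) * qpoch (1 / ee z) (ee \<tau>)"
    by (simp add: kf_def 1 ee_add)
  also have "\<dots> = - (exp (- (of_real pi * \<i> * \<tau>)) / ee z) * kf \<tau> z"
    unfolding 2 kf_alt[OF assms] by (simp add: field_simps)
  also have "exp (- (of_real pi * \<i> * \<tau>)) / ee z = exp (- (of_real pi * \<i> * \<tau>) - 2 * of_real pi * \<i> * z)"
    by (simp add: ee_def exp_diff)
  finally show ?thesis .
qed

lemma kf_holomorphic [holomorphic_intros]:
  assumes "Im \<tau> > 0"
  shows "kf \<tau> holomorphic_on A"
proof -
  have "(\<lambda>z. kf \<tau> z) holomorphic_on UNIV"
    unfolding kf_def using norm_ee_less_1[OF assms]
    by (intro holomorphic_intros) auto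
  then show ?thesis using holomorphic_on_subset by blast
qed

lemma kf_eq_0_iff:
  assumes "Im \<tau> > 0"
  shows "kf \<tau> z = 0 \<longleftrightarrow> z \<in> lat \<tau>"
proof
  assume "kf \<tau> z = 0"
  then have "(\<exists>n. ee z * ee \<tau> ^ n = 1) \<or> (\<exists>n. ee \<tau> / ee z * ee \<tau> ^ n = 1)"
    by (simp add: kf_def qpoch_eq_0_iff[OF norm_ee_less_1[OF assms]])
  then consider n where "ee (z + of_nat n * \<tau>) = 1" | n where "ee (\<tau> - z + of_nat n * \<tau>) = 1"
    unfolding ee_of_nat_mult [symmetric] ee_diff [symmetric] ee_add [symmetric] by blast
  then show "z \<in> lat \<tau>"
  proof cases
    case 1
    then obtain m where "z + of_nat n * \<tau> = of_int m" by (auto simp: ee_eq_1_iff Ints_def)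
    then show ?thesis by (intro latI[of _ m "- int n"]) (simp add: algebra_simps)
  next
    case 2
    then obtain m where "\<tau> - z + of_nat n * \<tau> = of_int m" by (auto simp: ee_eq_1_iff Ints_def)
    then show ?thesis by (intro latI[of _ "- m" "int n + 1"]) (simp add: algebra_simps)
  qed
next
  assume "z \<in> lat \<tau>"
  then obtain m n where z: "z = of_int m + of_int n * \<tau>" by (auto simp: lat_def)
  \<comment> \<open>The first product of \<open>kf\<close> supplies the zeros with n \<le> 0, the
    second those with n > 0.\<close>
  show "kf \<tau> z = 0"
  proof (cases "n \<le> 0")
    case True
    have "ee z * ee \<tau> ^ nat (- n) = 1"
      using True unfolding ee_of_nat_mult [symmetric] ee_add [symmetric] z by simp
    then show ?thesis
      using qpoch_eq_0_iff[OF norm_ee_less_1[OF assms]] by (auto simp: kf_def)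
  next
    case False
    have "ee \<tau> / ee z * ee \<tau> ^ nat (n - 1) = 1"
      using False unfolding ee_of_nat_mult [symmetric] ee_diff [symmetric] ee_add [symmetric] z
      by (simp add: ee_eq_1_iff algebra_simps)
    then show ?thesis
      using qpoch_eq_0_iff[OF norm_ee_less_1[OF assms]] by (auto simp: kf_def)
  qed
qed

text \<open>The only term of the product rule that survives at 0 is the one differentiating 1 -
  e(z). This value later determines the constant by which theta functions of two bases
  differ.\<close>

lemma kf_deriv_0:
  assumes "Im \<tau> > 0"
  shows "(kf \<tau> has_field_derivative (- 2 * of_real pi * \<i> * qpoch (ee \<tau>) (ee \<tau>) ^ 2)) (at 0)"
proof -
  define g where "g = (\<lambda>z. qpoch (ee z * ee \<tau>) (ee \<tau>) * qpoch (ee \<tau> / ee z) (ee \<tau>))"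
  have "g holomorphic_on UNIV"
    unfolding g_def using norm_ee_less_1[OF assms] by (intro holomorphic_intros) auto
  then obtain g' where g': "(g has_field_derivative g') (at 0)"
    using holomorphic_onD field_differentiable_def by (metis UNIV_I open_UNIV holomorphic_on_open)
  have kf: "kf \<tau> = (\<lambda>z. exp (- (of_real pi * \<i> * z)) * (1 - exp (2 * of_real pi * \<i> * z)) * g z)"
    using kf_alt[OF assms] by (auto simp: g_def ee_def)
  show ?thesis unfolding kf
    by (rule derivative_eq_intros g' refl)+ (simp add: g_def power2_eq_square)
qed

text \<open>The shifts that admit a multiplier of the form exp(a z + b) are closed under addition
  and negation, so the cases 1 and \<tau> suffice.\<close>

lemma kf_quasi:
  assumes "Im \<tau> > 0" "\<omega> \<in> lat \<tau>"
  shows "\<exists>a b. \<forall>z. kf \<tau> (z + \<omega>) = exp (a * z + b) * kf \<tau> z"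
proof -
  define Q where "Q = (\<lambda>\<omega>. \<exists>a b. \<forall>z. kf \<tau> (z + \<omega>) = exp (a * z + b) * kf \<tau> z)"
  have add: "Q (\<omega> + \<omega>')" if Q: "Q \<omega>" "Q \<omega>'" for \<omega> \<omega>'
  proof -
    from Q obtain a b a' b' where ab: "\<And>z. kf \<tau> (z + \<omega>) = exp (a * z + b) * kf \<tau> z"
      "\<And>z. kf \<tau> (z + \<omega>') = exp (a' * z + b') * kf \<tau> z" unfolding Q_def by blast
    have "kf \<tau> (z + (\<omega> + \<omega>')) = exp ((a + a') * z + (a' * \<omega> + b + b')) * kf \<tau> z" for z
      by (simp only: add.assoc [symmetric] ab) (simp add: algebra_simps exp_add)
    then show ?thesis unfolding Q_def by blast
  qed
  have neg: "Q (- \<omega>)" if Q: "Q \<omega>" for \<omega>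
  proof -
    from Q obtain a b where ab: "\<And>z. kf \<tau> (z + \<omega>) = exp (a * z + b) * kf \<tau> z" unfolding Q_def by blast
    have "kf \<tau> (z + - \<omega>) = exp (- a * z + (a * \<omega> - b)) * kf \<tau> z" for z
    proof -
      have "kf \<tau> z = exp (a * (z - \<omega>) + b) * kf \<tau> (z + - \<omega>)" using ab[of "z - \<omega>"] by simp
      moreover have "exp (- a * z + (a * \<omega> - b)) * exp (a * (z - \<omega>) + b) = exp 0"
        unfolding exp_add [symmetric] by (simp add: algebra_simps)
      ultimately show ?thesis by (simp add: mult.assoc [symmetric])
    qed
    then show ?thesis unfolding Q_def by blast
  qed
  have m1: "- 1 = exp (of_real pi * \<i>)" by simp
  have "kf \<tau> (z + 1) = exp (0 * z + of_real pi * \<i>) * kf \<tau> z" for z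
    by (simp add: kf_add_1)
  then have Q1: "Q 1" unfolding Q_def by blast
  have "kf \<tau> (z + \<tau>) = exp ((- 2 * of_real pi * \<i>) * z + (of_real pi * \<i> - of_real pi * \<i> * \<tau>)) * kf \<tau> z" for z
    using kf_add_tau[OF assms(1), of z]
    by (simp add: exp_add exp_diff exp_minus field_simps)
  then have Qt: "Q \<tau>" unfolding Q_def by blast
  have "Q 0" unfolding Q_def by (intro exI[of _ 0]) simp
  have nat: "Q (of_nat n * \<omega>)" if "Q \<omega>" for n \<omega>
    by (induction n) (use that \<open>Q 0\<close> add in \<open>auto simp: algebra_simps\<close>)
  have int: "Q (of_int n * \<omega>)" if "Q \<omega>" for n \<omega>
  proof (cases "n \<ge> 0")
    case True
    then show ?thesis using nat[OF that, of "nat n"] by simp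
  next
    case False
    then show ?thesis using neg[OF nat[OF that, of "nat (- n)"]] by simp
  qed
  from assms(2) obtain m n where \<omega>: "\<omega> = of_int m * 1 + of_int n * \<tau>" by (auto simp: lat_def)
  have "Q \<omega>" unfolding \<omega> by (intro add int Q1 Qt)
  then show ?thesis unfolding Q_def .
qed

text \<open>Quasi-periodicity transports the nonzero derivative at 0 to every lattice point.\<close>

lemma kf_simple_zeros:
  assumes "Im \<tau> > 0" "\<omega> \<in> lat \<tau>"
  shows "deriv (kf \<tau>) \<omega> \<noteq> 0"
proof -
  obtain a b where ab: "\<And>z. kf \<tau> (z + \<omega>) = exp (a * z + b) * kf \<tau> z"
    using kf_quasi[OF assms] by blast
  have eq: "kf \<tau> = (\<lambda>z. exp (a * (z - \<omega>) + b) * kf \<tau> (z - \<omega>))"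
  proof
    fix z show "kf \<tau> z = exp (a * (z - \<omega>) + b) * kf \<tau> (z - \<omega>)"
      using ab[of "z - \<omega>"] by (simp only: diff_add_cancel)
  qed
  have d: "(kf \<tau> has_field_derivative (- 2 * of_real pi * \<i> * qpoch (ee \<tau>) (ee \<tau>) ^ 2)) (at (\<omega> - \<omega>))"
    using kf_deriv_0[OF assms(1)] by simp
  have k0: "kf \<tau> 0 = 0" using kf_eq_0_iff[OF assms(1), of 0] by simp
  have "((\<lambda>z. kf \<tau> (z - \<omega>)) has_field_derivative
      (- 2 * of_real pi * \<i> * qpoch (ee \<tau>) (ee \<tau>) ^ 2) * 1) (at \<omega>)"
    by (rule DERIV_chain2[where f = "kf \<tau>" and g = "\<lambda>z. z - \<omega>"])
       (use d in \<open>auto intro!: derivative_eq_intros\<close>)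
  note kd = this
  have "((\<lambda>z. exp (a * (z - \<omega>) + b) * kf \<tau> (z - \<omega>)) has_field_derivative
     exp b * (- 2 * of_real pi * \<i> * qpoch (ee \<tau>) (ee \<tau>) ^ 2)) (at \<omega>)"
    by (rule derivative_eq_intros kd refl)+ (simp add: k0)
  then have "deriv (kf \<tau>) \<omega> = exp b * (- 2 * of_real pi * \<i> * qpoch (ee \<tau>) (ee \<tau>) ^ 2)"
    by (subst (asm) eq [symmetric]) (rule DERIV_imp_deriv)
  moreover have "qpoch (ee \<tau>) (ee \<tau>) \<noteq> 0"
    using norm_ee_less_1[OF assms(1)] by (intro qpoch_nonzero)
  ultimately show ?thesis by simp
qed

section \<open>Elliptic functions attached to 5-torsion points\<close>

text \<open>Near a zero z0 of \<open>g\<close> both functions are divided by z - z0; the quotient of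
  the two difference quotients is holomorphic there and agrees with the function defined by
  cases.\<close>

lemma quotient_simple_zeros_holomorphic:
  fixes f g :: "complex \<Rightarrow> complex"
  assumes f: "f holomorphic_on UNIV" and g: "g holomorphic_on UNIV"
    and zeros: "\<And>z. g z = 0 \<Longrightarrow> f z = 0 \<and> deriv g z \<noteq> 0"
  shows "(\<lambda>z. if g z = 0 then deriv f z / deriv g z else f z / g z) holomorphic_on UNIV"
    (is "?E holomorphic_on UNIV")
proof -
  have "\<exists>U. open U \<and> z0 \<in> U \<and> ?E holomorphic_on U" for z0
  proof (cases "g z0 = 0")
    case False
    define U where "U = {z. g z \<noteq> 0}"
    have "open U"
      unfolding U_def using holomorphic_on_imp_continuous_on[OF g]
      by (intro open_Collect_neq continuous_on_const) auto
    moreover have "(\<lambda>z. f z / g z) holomorphic_on U"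
      by (intro holomorphic_intros holomorphic_on_subset[OF f] holomorphic_on_subset[OF g]) (auto simp: U_def)
    then have "?E holomorphic_on U"
      by (rule holomorphic_transform) (auto simp: U_def)
    ultimately show ?thesis using False by (auto simp: U_def)
  next
    case True
    define f1 where "f1 = (\<lambda>z. if z = z0 then deriv f z0 else (f z - f z0) / (z - z0))"
    define g1 where "g1 = (\<lambda>z. if z = z0 then deriv g z0 else (g z - g z0) / (z - z0))"
    have f1: "f1 holomorphic_on UNIV" unfolding f1_def by (rule pole_lemma_open) (use f in auto)
    have g1: "g1 holomorphic_on UNIV" unfolding g1_def by (rule pole_lemma_open) (use g in auto)
    define U where "U = {z. g1 z \<noteq> 0}"
    have "open U"
      unfolding U_def using holomorphic_on_imp_continuous_on[OF g1]
      by (intro open_Collect_neq continuous_on_const) auto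
    moreover have "(\<lambda>z. f1 z / g1 z) holomorphic_on U"
      by (intro holomorphic_intros holomorphic_on_subset[OF f1] holomorphic_on_subset[OF g1]) (auto simp: U_def)
    then have "?E holomorphic_on U"
      by (rule holomorphic_transform)
         (use True zeros in \<open>auto simp: U_def f1_def g1_def split: if_splits\<close>)
    moreover have "z0 \<in> U" using True zeros by (auto simp: U_def g1_def)
    ultimately show ?thesis by blast
  qed
  then have "?E field_differentiable at z0" for z0
    using holomorphic_on_imp_differentiable_at by blast
  then show ?thesis by (simp add: holomorphic_on_def)
qed

text \<open>Allows cancelling \<open>g\<close> from identities of entire functions: simple zeros are
  isolated, so \<open>h\<close> vanishes on a punctured neighbourhood and, by continuity, at the
  zero itself.\<close>

lemma mult_simple_zeros_eq_0D:
  fixes g h :: "complex \<Rightarrow> complex"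
  assumes h: "continuous_on UNIV h" and g: "g holomorphic_on UNIV"
    and zeros: "\<And>z. g z = 0 \<Longrightarrow> deriv g z \<noteq> 0" and hg: "\<And>z. h z * g z = 0"
  shows "h z = 0"
proof (cases "g z = 0")
  case True
  have "(g has_field_derivative deriv g z) (at z)"
    using g holomorphic_derivI by blast
  then have "((\<lambda>x. (g x - g z) / (x - z)) \<longlongrightarrow> deriv g z) (at z)"
    by (simp add: has_field_derivative_iff)
  then have "\<forall>\<^sub>F x in at z. (g x - g z) / (x - z) \<noteq> 0"
    using zeros[OF True] by (rule tendsto_imp_eventually_ne)
  then have "\<forall>\<^sub>F x in at z. h x = 0"
    by eventually_elim (use hg True in auto)
  then have "(h \<longlongrightarrow> 0) (at z)" by (rule tendsto_eventually)
  moreover have "(h \<longlongrightarrow> h z) (at z)"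
    using h by (simp add: continuous_on_eq_continuous_at continuous_at)
  ultimately show ?thesis using LIM_unique by blast
qed (use hg[of z] in auto)

lemma complex_in_basis:
  assumes "Im \<tau> > 0"
  obtains a b :: real where "z = of_real a + of_real b * \<tau>"
proof
  show "z = of_real (Re z - Im z / Im \<tau> * Re \<tau>) + of_real (Im z / Im \<tau>) * \<tau>"
    using assms by (simp add: complex_eq_iff)
qed

lemma entire_elliptic_imp_const:
  assumes \<tau>: "Im \<tau> > 0" and f: "f holomorphic_on UNIV"
    and per: "\<And>z \<omega>. \<omega> \<in> lat \<tau> \<Longrightarrow> f (z + \<omega>) = f z"
  shows "\<exists>c. \<forall>z. f z = c"
proof -
  define Q where "Q = (\<lambda>p. of_real (fst p) + of_real (snd p) * \<tau>) ` (cbox (0::real) 1 \<times> cbox (0::real) 1)"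
  have "compact Q"
    unfolding Q_def by (intro compact_continuous_image compact_Times compact_cbox continuous_intros)
  then have "bounded (f ` Q)"
    using f by (intro compact_imp_bounded compact_continuous_image)
               (auto intro: holomorphic_on_imp_continuous_on holomorphic_on_subset)
  moreover have "f z \<in> f ` Q" for z
  proof -
    obtain a b :: real where z: "z = of_real a + of_real b * \<tau>"
      using complex_in_basis[OF \<tau>] .
    define z' where "z' = of_real (frac a) + of_real (frac b) * \<tau>"
    have "z = z' + (of_int \<lfloor>a\<rfloor> + of_int \<lfloor>b\<rfloor> * \<tau>)"
      by (simp add: z z'_def frac_def algebra_simps)
    then have "f z = f z'" using per[of "of_int \<lfloor>a\<rfloor> + of_int \<lfloor>b\<rfloor> * \<tau>" z'] by (auto intro: latI)
    moreover have "z' \<in> Q"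
      unfolding Q_def z'_def
      by (intro image_eqI[of _ _ "(frac a, frac b)"]) (auto simp: frac_ge_0 less_imp_le[OF frac_lt_1])
    ultimately show ?thesis by auto
  qed
  ultimately have "bounded (range f)"
    by (metis bounded_subset image_subset_iff)
  then show ?thesis
    using Liouville_theorem[OF f] by (auto simp: constant_on_def)
qed

text \<open>The quotient \<open>E\<close> of the two theta functions is entire and zero-free, both
  having simple zeros at the same points. Its multipliers are exponentials of linear functions, so
  E'/E changes by constants under periods and its derivative is an entire elliptic function, hence
  constant. Thus log E is quadratic, and its linear term vanishes because \<open>E\<close> is
  even.\<close>

lemma kf_transform:
  assumes \<tau>: "Im \<tau> > 0" and \<tau>': "Im \<tau>' > 0" and c: "c \<noteq> 0"
    and lat: "(*) c ` lat \<tau> = lat \<tau>'"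
  shows "\<exists>\<alpha> \<gamma>. \<forall>z. kf \<tau>' (c * z) = exp (\<alpha> * z ^ 2 + \<gamma>) * kf \<tau> z"
proof -
  define f where "f = (\<lambda>z. kf \<tau>' (c * z))"
  define g where "g = kf \<tau>"
  define E where "E = (\<lambda>z. if g z = 0 then deriv f z / deriv g z else f z / g z)"
  have lat_iff: "c * z \<in> lat \<tau>' \<longleftrightarrow> z \<in> lat \<tau>" for z
    using c unfolding lat [symmetric] by auto
  have f: "f holomorphic_on UNIV"
    unfolding f_def
    by (rule holomorphic_on_compose_gen[OF _ kf_holomorphic[OF \<tau>', of UNIV], unfolded o_def])
       (auto intro!: holomorphic_intros)
  have g: "g holomorphic_on UNIV" unfolding g_def by (rule kf_holomorphic[OF \<tau>])
  have f0: "f z = 0 \<longleftrightarrow> z \<in> lat \<tau>" and g0: "g z = 0 \<longleftrightarrow> z \<in> lat \<tau>" for z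
    by (simp_all add: f_def g_def kf_eq_0_iff \<tau> \<tau>' lat_iff)
  have g': "deriv g z \<noteq> 0" if "g z = 0" for z
    using kf_simple_zeros[OF \<tau>] that g0 by (simp add: g_def)
  have f': "deriv f z \<noteq> 0" if "g z = 0" for z
  proof -
    have "(kf \<tau>' has_field_derivative deriv (kf \<tau>') (c * z)) (at (c * z))"
      using kf_holomorphic[OF \<tau>', of UNIV] holomorphic_derivI by blast
    then have "(f has_field_derivative (deriv (kf \<tau>') (c * z) * c)) (at z)"
      unfolding f_def
      by (rule DERIV_chain2[where f = "kf \<tau>'" and g = "\<lambda>z. c * z"]) (auto intro!: derivative_eq_intros)
    then show ?thesis
      using that c kf_simple_zeros[OF \<tau>', of "c * z"] lat_iff g0 by (simp add: DERIV_imp_deriv)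
  qed
  have E: "E holomorphic_on UNIV"
    unfolding E_def by (rule quotient_simple_zeros_holomorphic[OF f g]) (use f0 g0 g' in auto)
  have E0: "E z \<noteq> 0" for z
    using f' g' f0 g0 by (auto simp: E_def)
  have fE: "f z = E z * g z" for z
    using f0[of z] g0[of z] by (cases "g z = 0") (auto simp: E_def)
  have cE: "continuous_on UNIV E" using E by (rule holomorphic_on_imp_continuous_on)
  have Eq: "\<exists>A B. \<forall>z. E (z + \<omega>) = exp (A * z + B) * E z" if \<omega>: "\<omega> \<in> lat \<tau>" for \<omega>
  proof -
    obtain a b where ab: "\<And>z. g (z + \<omega>) = exp (a * z + b) * g z"
      using kf_quasi[OF \<tau> \<omega>] unfolding g_def by blast
    obtain a' b' where ab': "\<And>z. kf \<tau>' (z + c * \<omega>) = exp (a' * z + b') * kf \<tau>' z"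
      using kf_quasi[OF \<tau>', of "c * \<omega>"] \<omega> lat_iff by blast
    have f2: "f (z + \<omega>) = exp (a' * (c * z) + b') * f z" for z
      using ab'[of "c * z"] by (simp add: f_def distrib_left)
    have "E (z + \<omega>) * exp (a * z + b) - exp (a' * (c * z) + b') * E z = 0" for z
    proof (rule mult_simple_zeros_eq_0D[OF _ g g',
         where h = "\<lambda>z. E (z + \<omega>) * exp (a * z + b) - exp (a' * (c * z) + b') * E z"])
      show "continuous_on UNIV (\<lambda>z. E (z + \<omega>) * exp (a * z + b) - exp (a' * (c * z) + b') * E z)"
        by (intro continuous_intros cE continuous_on_compose2[OF cE]) auto
      show "(E (z + \<omega>) * exp (a * z + b) - exp (a' * (c * z) + b') * E z) * g z = 0" for z
        using f2[of z] fE[of "z + \<omega>"] fE[of z] ab[of z] by (auto simp: algebra_simps)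
    qed
    then have "E (z + \<omega>) = exp (a' * (c * z) + b') * E z / exp (a * z + b)" for z
      by (simp add: eq_divide_eq)
    then have "E (z + \<omega>) = exp ((a' * (c * z) + b') - (a * z + b)) * E z" for z
      by (simp add: exp_diff)
    moreover have "(a' * (c * z) + b') - (a * z + b) = (a' * c - a) * z + (b' - b)" for z
      by (simp add: algebra_simps)
    ultimately have "E (z + \<omega>) = exp ((a' * c - a) * z + (b' - b)) * E z" for z
      by (simp only:)
    then show ?thesis by blast
  qed
  have even: "E (- z) = E z" for z
  proof -
    have "E (- z) - E z = 0"
    proof (rule mult_simple_zeros_eq_0D[OF _ g g', where h = "\<lambda>z. E (- z) - E z"])
      show "continuous_on UNIV (\<lambda>z. E (- z) - E z)"
        by (intro continuous_intros cE continuous_on_compose2[OF cE]) auto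
      show "(E (- z) - E z) * g z = 0" for z
        using fE[of z] fE[of "- z"] kf_minus[OF \<tau>, of z] kf_minus[OF \<tau>', of "c * z"]
        by (auto simp: f_def g_def algebra_simps)
    qed
    then show ?thesis by simp
  qed
  define F where "F = (\<lambda>z. deriv E z / E z)"
  have E': "(E has_field_derivative deriv E z) (at z)" for z
    using E holomorphic_derivI by blast
  have F: "F holomorphic_on UNIV"
    unfolding F_def by (intro holomorphic_intros holomorphic_deriv E) (use E0 in auto)
  have F': "(F has_field_derivative deriv F z) (at z)" for z
    using F holomorphic_derivI by blast
  have Fq: "\<exists>A. \<forall>z. F (z + \<omega>) = F z + A" if \<omega>: "\<omega> \<in> lat \<tau>" for \<omega>
  proof -
    obtain A B where AB: "\<And>z. E (z + \<omega>) = exp (A * z + B) * E z" using Eq[OF \<omega>] by blast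
    have "F (z + \<omega>) = F z + A" for z
    proof -
      have "((\<lambda>z. E (z + \<omega>)) has_field_derivative (deriv E (z + \<omega>) * 1)) (at z)"
        by (rule DERIV_chain2[OF E']) (auto intro!: derivative_eq_intros)
      moreover have "((\<lambda>z. exp (A * z + B) * E z) has_field_derivative
           (exp (A * z + B) * A * E z + exp (A * z + B) * deriv E z)) (at z)"
        by (rule derivative_eq_intros E' refl)+ (simp add: algebra_simps)
      ultimately have "deriv E (z + \<omega>) = exp (A * z + B) * A * E z + exp (A * z + B) * deriv E z"
        unfolding AB using DERIV_unique by fastforce
      then show ?thesis
        using E0[of z] unfolding F_def AB by (simp add: divide_simps) (simp add: algebra_simps)
    qed
    then show ?thesis by blast
  qed
  have "\<exists>k. \<forall>z. deriv F z = k"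
  proof (rule entire_elliptic_imp_const[OF \<tau>])
    show "deriv F holomorphic_on UNIV" by (intro holomorphic_deriv F) auto
    fix z \<omega> assume "\<omega> \<in> lat \<tau>"
    then obtain A where A: "\<And>z. F (z + \<omega>) = F z + A" using Fq by blast
    have "((\<lambda>z. F (z + \<omega>)) has_field_derivative (deriv F (z + \<omega>) * 1)) (at z)"
      by (rule DERIV_chain2[OF F']) (auto intro!: derivative_eq_intros)
    moreover have "((\<lambda>z. F z + A) has_field_derivative deriv F z) (at z)"
      by (rule derivative_eq_intros F' refl)+ simp
    ultimately show "deriv F (z + \<omega>) = deriv F z"
      unfolding A using DERIV_unique by fastforce
  qed
  then obtain k where k: "\<And>z. deriv F z = k" by blast
  have F0: "F 0 = 0"
  proof -
    have "((\<lambda>z. E (- z)) has_field_derivative (deriv E (- 0) * (- 1))) (at 0)"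
      by (rule DERIV_chain2[OF E']) (auto intro!: derivative_eq_intros)
    then have "(E has_field_derivative (- deriv E 0)) (at 0)" by (simp add: even)
    then have "deriv E 0 = - deriv E 0" using DERIV_unique E' by blast
    then show ?thesis by (simp add: F_def)
  qed
  have "\<exists>c. \<forall>z\<in>UNIV. F z - k * z = c"
  proof (rule has_field_derivative_zero_constant)
    show "((\<lambda>z. F z - k * z) has_field_derivative 0) (at z within UNIV)" for z
      using F'[of z] by (auto intro!: derivative_eq_intros simp: k)
  qed auto
  then obtain c1 where c1: "\<And>z. F z - k * z = c1" by blast
  have Fz: "F z = k * z" for z
    using c1[of z] c1[of 0] F0 by simp
  have "\<exists>c. \<forall>z\<in>UNIV. E z * exp (- (k / 2 * z ^ 2)) = c"
  proof (rule has_field_derivative_zero_constant)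
    fix z
    have "deriv E z = k * z * E z" using Fz[of z] E0[of z] by (simp add: F_def field_simps)
    then show "((\<lambda>z. E z * exp (- (k / 2 * z ^ 2))) has_field_derivative 0) (at z within UNIV)"
      using E'[of z] by (auto intro!: derivative_eq_intros simp: algebra_simps)
  qed auto
  then obtain c0 where c0: "\<And>z. E z * exp (- (k / 2 * z ^ 2)) = c0" by blast
  have Ez: "E z = exp (k / 2 * z ^ 2) * E 0" for z
  proof -
    have "E z = E z * exp (- (k / 2 * z ^ 2)) * exp (k / 2 * z ^ 2)"
      by (simp add: mult.assoc flip: exp_add)
    also have "E z * exp (- (k / 2 * z ^ 2)) = E 0"
      using c0[of z] c0[of 0] by simp
    finally show ?thesis by (simp only: mult.commute)
  qed
  have "kf \<tau>' (c * z) = exp (k / 2 * z ^ 2 + Ln (E 0)) * kf \<tau> z" for z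
    using fE[of z] Ez[of z] E0[of 0] by (simp add: f_def g_def exp_add)
  then show ?thesis by blast
qed

text \<open>The exponents balance both parts of the multiplier in \<open>kf_transform\<close>: 16 +
  4 = 5 * 4 for the factor quadratic in z and 1 + 4 = 5 for the constant. The value at \<tau>/5
  turns out to be the fifth power of the continued fraction at \<tau>/5.\<close>

definition sfun :: "complex \<Rightarrow> complex \<Rightarrow> complex" where
  "sfun \<tau> z = kf \<tau> (4 * z) * kf \<tau> z ^ 4 / kf \<tau> (2 * z) ^ 5"

text \<open>The quadratic factors balance, 3 * 4 = 3 + 9, but the constants do not, 3 - 4 = -1. The
  square of \<open>qpoch\<close>, which is the derivative of \<open>kf\<close> at 0 up to a fixed
  constant, compensates for this and leaves the weight -1.\<close>

definition nfun :: "complex \<Rightarrow> complex \<Rightarrow> complex" where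
  "nfun \<tau> z = qpoch (ee \<tau>) (ee \<tau>) ^ 2 * kf \<tau> (2 * z) ^ 3 / (kf \<tau> z ^ 3 * kf \<tau> (3 * z))"

text \<open>Here \<open>A ^ (n ^ 2) * C\<close> stands for the multiplier of \<open>kf\<close> at n
  z; the exponents 16, 1 and 4 belong to n = 4, 1, 2. The same shape covers changes of basis and
  translations by periods.\<close>

lemma sfun_scaling:
  fixes A C x y w :: complex
  assumes "A \<noteq> 0" "C \<noteq> 0"
  shows "(A ^ 16 * C * x) * (A * C * y) ^ 4 / (A ^ 4 * C * w) ^ 5 = x * y ^ 4 / w ^ 5"
proof -
  have "(A ^ 16 * C * x) * (A * C * y) ^ 4 = (A ^ 20 * C ^ 5) * (x * y ^ 4)"
    by (simp add: power_numeral_reduce mult_ac)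
  moreover have "(A ^ 4 * C * w) ^ 5 = (A ^ 20 * C ^ 5) * w ^ 5"
    by (simp add: power_mult_distrib flip: power_mult)
  ultimately show ?thesis using assms by (metis mult_divide_mult_cancel_left mult_eq_0_iff power_not_zero)
qed

lemma nfun_scaling:
  fixes A C x y w p :: complex
  assumes "A \<noteq> 0" "C \<noteq> 0"
  shows "p * (A ^ 4 * C * y) ^ 3 / ((A * C * x) ^ 3 * (A ^ 9 * C * w)) = p / C * y ^ 3 / (x ^ 3 * w)"
proof -
  have "p * (A ^ 4 * C * y) ^ 3 = (A ^ 12 * C ^ 3) * (p * y ^ 3)"
    by (simp add: power_mult_distrib flip: power_mult)
  moreover have "(A * C * x) ^ 3 * (A ^ 9 * C * w) = (A ^ 12 * C ^ 3) * (C * (x ^ 3 * w))"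
    by (simp add: power_numeral_reduce mult_ac)
  ultimately have "p * (A ^ 4 * C * y) ^ 3 / ((A * C * x) ^ 3 * (A ^ 9 * C * w)) = (p * y ^ 3) / (C * (x ^ 3 * w))"
    using assms by (metis mult_divide_mult_cancel_left mult_eq_0_iff power_not_zero)
  then show ?thesis by simp
qed

lemma sfun_nfun_transform:
  assumes \<tau>: "Im \<tau> > 0" and \<tau>': "Im \<tau>' > 0" and c: "c \<noteq> 0"
    and lat: "(*) c ` lat \<tau> = lat \<tau>'"
  shows "sfun \<tau>' (c * z) = sfun \<tau> z" and "nfun \<tau>' (c * z) = nfun \<tau> z / c"
proof -
  obtain \<alpha> \<gamma> where k: "\<And>z. kf \<tau>' (c * z) = exp (\<alpha> * z ^ 2 + \<gamma>) * kf \<tau> z"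
    using kf_transform[OF assms] by blast
  define A where "A = exp (\<alpha> * z ^ 2)"
  define C where "C = exp \<gamma>"
  have A0: "A \<noteq> 0" "C \<noteq> 0" by (simp_all add: A_def C_def)
  have K: "kf \<tau>' (of_nat n * (c * z)) = A ^ (n ^ 2) * C * kf \<tau> (of_nat n * z)" for n
  proof -
    have "\<alpha> * (of_nat n * z) ^ 2 = of_nat (n ^ 2) * (\<alpha> * z ^ 2)" by (simp add: power_mult_distrib)
    then have "exp (\<alpha> * (of_nat n * z) ^ 2 + \<gamma>) = A ^ (n ^ 2) * C"
      by (simp only: A_def C_def exp_add exp_of_nat_mult)
    then show ?thesis using k[of "of_nat n * z"] by (simp add: mult_ac)
  qed
  have K1: "kf \<tau>' (c * z) = A * C * kf \<tau> z" and K2: "kf \<tau>' (2 * (c * z)) = A ^ 4 * C * kf \<tau> (2 * z)"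
    and K3: "kf \<tau>' (3 * (c * z)) = A ^ 9 * C * kf \<tau> (3 * z)"
    and K4: "kf \<tau>' (4 * (c * z)) = A ^ 16 * C * kf \<tau> (4 * z)"
    using K[of 1] K[of 2] K[of 3] K[of 4] by simp_all
  show "sfun \<tau>' (c * z) = sfun \<tau> z"
    unfolding sfun_def K1 K2 K4 by (rule sfun_scaling[OF A0])
  \<comment> \<open>Comparing derivatives at 0 on both sides of \<open>k\<close> expresses the
    constant exp \<gamma> through \<open>c\<close> and the two values of \<open>qpoch\<close>, which
    is what the transformation of \<open>nfun\<close> requires.\<close>
  have "((\<lambda>z. kf \<tau>' (c * z)) has_field_derivative
     ((- 2 * of_real pi * \<i> * qpoch (ee \<tau>') (ee \<tau>') ^ 2) * c)) (at 0)"
    by (rule DERIV_chain2[where f = "kf \<tau>'" and g = "\<lambda>z. c * z"])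
       (use kf_deriv_0[OF \<tau>'] in \<open>auto intro!: derivative_eq_intros\<close>)
  moreover have "((\<lambda>z. exp (\<alpha> * z ^ 2 + \<gamma>) * kf \<tau> z) has_field_derivative
     (exp \<gamma> * (- 2 * of_real pi * \<i> * qpoch (ee \<tau>) (ee \<tau>) ^ 2))) (at 0)"
    by (rule derivative_eq_intros kf_deriv_0[OF \<tau>] refl)+ simp
  ultimately have "(- 2 * of_real pi * \<i> * qpoch (ee \<tau>') (ee \<tau>') ^ 2) * c =
       exp \<gamma> * (- 2 * of_real pi * \<i> * qpoch (ee \<tau>) (ee \<tau>) ^ 2)"
    unfolding k by (rule DERIV_unique)
  then have "(2 * of_real pi * \<i>) * (qpoch (ee \<tau>') (ee \<tau>') ^ 2 * c) =
      (2 * of_real pi * \<i>) * (C * qpoch (ee \<tau>) (ee \<tau>) ^ 2)"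
    by (simp add: C_def algebra_simps)
  then have "qpoch (ee \<tau>') (ee \<tau>') ^ 2 = C * qpoch (ee \<tau>) (ee \<tau>) ^ 2 / c"
    using c by (simp add: field_simps)
  then show "nfun \<tau>' (c * z) = nfun \<tau> z / c"
    unfolding nfun_def K1 K2 K3 nfun_scaling[OF A0] using A0 c by simp
qed

lemma kf_add_nat_tau:
  assumes "Im \<tau> > 0"
  shows "kf \<tau> (z + of_nat n * \<tau>) =
     (- 1) ^ n * exp (- (of_nat (n ^ 2) * (of_real pi * \<i> * \<tau>)) - of_nat n * (2 * of_real pi * \<i> * z)) * kf \<tau> z"
proof (induction n)
  case (Suc n)
  have "kf \<tau> (z + of_nat (Suc n) * \<tau>) = kf \<tau> ((z + of_nat n * \<tau>) + \<tau>)"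
    by (simp add: algebra_simps)
  also have "\<dots> = - exp (- (of_real pi * \<i> * \<tau>) - 2 * of_real pi * \<i> * (z + of_nat n * \<tau>)) *
     ((- 1) ^ n * exp (- (of_nat (n ^ 2) * (of_real pi * \<i> * \<tau>)) - of_nat n * (2 * of_real pi * \<i> * z)) * kf \<tau> z)"
    by (simp only: kf_add_tau[OF assms] Suc)
  also have "\<dots> = (- 1) ^ Suc n * (exp (- (of_real pi * \<i> * \<tau>) - 2 * of_real pi * \<i> * (z + of_nat n * \<tau>)) *
      exp (- (of_nat (n ^ 2) * (of_real pi * \<i> * \<tau>)) - of_nat n * (2 * of_real pi * \<i> * z))) * kf \<tau> z"
    by simp
  also have "exp (- (of_real pi * \<i> * \<tau>) - 2 * of_real pi * \<i> * (z + of_nat n * \<tau>)) *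
      exp (- (of_nat (n ^ 2) * (of_real pi * \<i> * \<tau>)) - of_nat n * (2 * of_real pi * \<i> * z)) =
     exp (- (of_nat (Suc n ^ 2) * (of_real pi * \<i> * \<tau>)) - of_nat (Suc n) * (2 * of_real pi * \<i> * z))"
    unfolding exp_add [symmetric]
    by (rule arg_cong[where f = exp]) (simp add: algebra_simps power2_eq_square)
  finally show ?case .
qed simp

text \<open>The multiplier of \<open>kf\<close> at n z depends on n through the exponent n^2 and a
  sign, so the scaling lemmas for changes of basis also yield the period \<tau>.\<close>

lemma kf_nat_mult_add_tau:
  assumes "Im \<tau> > 0"
  defines "M \<equiv> \<lambda>z. exp (- (of_real pi * \<i> * \<tau>) - 2 * of_real pi * \<i> * z)"
  shows "kf \<tau> (of_nat n * (z + \<tau>)) = (- 1) ^ n * M z ^ (n ^ 2) * kf \<tau> (of_nat n * z)"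
proof -
  have "M z ^ (n ^ 2) = exp (- (of_nat (n ^ 2) * (of_real pi * \<i> * \<tau>)) - of_nat n * (2 * of_real pi * \<i> * (of_nat n * z)))"
    unfolding M_def exp_of_nat_mult [symmetric]
    by (rule arg_cong[where f = exp]) (simp add: algebra_simps power2_eq_square)
  then show ?thesis
    using kf_add_nat_tau[OF assms(1), of "of_nat n * z" n] by (simp add: distrib_left)
qed

lemma kf_nat_mult_add_1: "kf \<tau> (of_nat n * (z + 1)) = (- 1) ^ n * kf \<tau> (of_nat n * z)"
proof -
  have "kf \<tau> (z + of_nat n) = (- 1) ^ n * kf \<tau> z" for z
  proof (induction n)
    case (Suc n)
    have "kf \<tau> (z + of_nat (Suc n)) = kf \<tau> ((z + of_nat n) + 1)" by (simp add: algebra_simps)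
    then show ?case by (simp add: kf_add_1 Suc)
  qed simp
  from this[of "of_nat n * z"] show ?thesis by (simp add: distrib_left)
qed

lemma sfun_nfun_periodic_generators:
  assumes \<tau>: "Im \<tau> > 0"
  shows "sfun \<tau> (z + 1) = sfun \<tau> z" "sfun \<tau> (z + \<tau>) = sfun \<tau> z"
    "nfun \<tau> (z + 1) = nfun \<tau> z" "nfun \<tau> (z + \<tau>) = nfun \<tau> z"
proof -
  note k = kf_nat_mult_add_1[of \<tau> 1 z] kf_nat_mult_add_1[of \<tau> 2 z] kf_nat_mult_add_1[of \<tau> 3 z]
    kf_nat_mult_add_1[of \<tau> 4 z]
  show "sfun \<tau> (z + 1) = sfun \<tau> z" "nfun \<tau> (z + 1) = nfun \<tau> z"
    using k by (simp_all add: sfun_def nfun_def)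
  define M where "M = exp (- (of_real pi * \<i> * \<tau>) - 2 * of_real pi * \<i> * z)"
  have M: "M \<noteq> 0" by (simp add: M_def)
  note k = kf_nat_mult_add_tau[OF \<tau>, of 1 z, folded M_def] kf_nat_mult_add_tau[OF \<tau>, of 2 z, folded M_def]
    kf_nat_mult_add_tau[OF \<tau>, of 3 z, folded M_def] kf_nat_mult_add_tau[OF \<tau>, of 4 z, folded M_def]
  have K: "kf \<tau> (z + \<tau>) = - M * kf \<tau> z" "kf \<tau> (2 * (z + \<tau>)) = M ^ 4 * kf \<tau> (2 * z)"
     "kf \<tau> (3 * (z + \<tau>)) = - (M ^ 9) * kf \<tau> (3 * z)" "kf \<tau> (4 * (z + \<tau>)) = M ^ 16 * kf \<tau> (4 * z)"
    using k by simp_all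
  show "sfun \<tau> (z + \<tau>) = sfun \<tau> z"
    using sfun_scaling[OF M, of 1 "kf \<tau> (4 * z)" "- kf \<tau> z" "kf \<tau> (2 * z)"]
    unfolding sfun_def K by simp
  show "nfun \<tau> (z + \<tau>) = nfun \<tau> z"
    using nfun_scaling[OF M, of 1 "qpoch (ee \<tau>) (ee \<tau>) ^ 2" "kf \<tau> (2 * z)" "- kf \<tau> z" "- kf \<tau> (3 * z)"]
    unfolding nfun_def K by simp
qed

lemma lat_periodicI:
  fixes f :: "complex \<Rightarrow> complex"
  assumes "\<And>z. f (z + 1) = f z" "\<And>z. f (z + \<tau>) = f z" "\<omega> \<in> lat \<tau>"
  shows "f (z + \<omega>) = f z"
proof -
  have nat: "f (z + of_nat n * w) = f z" if "\<And>z. f (z + w) = f z" for n w z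
  proof (induction n)
    case (Suc n)
    then show ?case using that[of "z + of_nat n * w"] by (simp add: algebra_simps)
  qed simp
  have int: "f (z + of_int n * w) = f z" if "\<And>z. f (z + w) = f z" for n w z
  proof (cases "n \<ge> 0")
    case True
    then show ?thesis using nat[OF that, of z "nat n"] by simp
  next
    case False
    then show ?thesis using nat[OF that, of "z + of_int n * w" "nat (- n)"] by simp
  qed
  from assms(3) obtain m n where \<omega>: "\<omega> = of_int m * 1 + of_int n * \<tau>" by (auto simp: lat_def)
  show ?thesis
    unfolding \<omega> add.assoc [symmetric] using int[of \<tau>, OF assms(2)] int[of 1, OF assms(1)] by simp
qed

lemma sfun_periodic: "Im \<tau> > 0 \<Longrightarrow> \<omega> \<in> lat \<tau> \<Longrightarrow> sfun \<tau> (z + \<omega>) = sfun \<tau> z"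
  by (rule lat_periodicI) (auto simp: sfun_nfun_periodic_generators)

lemma nfun_periodic: "Im \<tau> > 0 \<Longrightarrow> \<omega> \<in> lat \<tau> \<Longrightarrow> nfun \<tau> (z + \<omega>) = nfun \<tau> z"
  by (rule lat_periodicI) (auto simp: sfun_nfun_periodic_generators)

lemma sfun_minus: "Im \<tau> > 0 \<Longrightarrow> sfun \<tau> (- z) = sfun \<tau> z"
  using kf_minus[of \<tau> z] kf_minus[of \<tau> "2 * z"] kf_minus[of \<tau> "4 * z"] by (simp add: sfun_def)

lemma nfun_minus: "Im \<tau> > 0 \<Longrightarrow> nfun \<tau> (- z) = - nfun \<tau> z"
  using kf_minus[of \<tau> z] kf_minus[of \<tau> "2 * z"] kf_minus[of \<tau> "3 * z"] by (simp add: nfun_def)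

section \<open>From bases to lattices\<close>

definition lattice_basis :: "complex set \<Rightarrow> complex \<Rightarrow> complex \<Rightarrow> bool" where
  "lattice_basis \<Lambda> c \<tau> \<longleftrightarrow> c \<noteq> 0 \<and> Im \<tau> > 0 \<and> \<Lambda> = (*) c ` lat \<tau>"

text \<open>The basis is picked arbitrarily; \<open>sfun_nfun_transform\<close> makes the value
  independent of it, which \<open>sL_eq\<close> and \<open>nL_eq\<close> record.\<close>

definition sL :: "complex set \<Rightarrow> complex \<Rightarrow> complex" where
  "sL \<Lambda> z = (case SOME p. lattice_basis \<Lambda> (fst p) (snd p) of (c, \<tau>) \<Rightarrow> sfun \<tau> (z / c))"

definition nL :: "complex set \<Rightarrow> complex \<Rightarrow> complex" where
  "nL \<Lambda> z = (case SOME p. lattice_basis \<Lambda> (fst p) (snd p) of (c, \<tau>) \<Rightarrow> nfun \<tau> (z / c) / c)"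

lemma
  assumes "lattice_basis \<Lambda> c \<tau>"
  shows sL_eq: "sL \<Lambda> z = sfun \<tau> (z / c)" and nL_eq: "nL \<Lambda> z = nfun \<tau> (z / c) / c"
proof -
  define p where "p = (SOME p. lattice_basis \<Lambda> (fst p) (snd p))"
  obtain c' \<tau>' where p: "p = (c', \<tau>')" by fastforce
  have "lattice_basis \<Lambda> (fst p) (snd p)"
    unfolding p_def by (rule someI[of _ "(c, \<tau>)"]) (use assms in simp)
  then have *: "lattice_basis \<Lambda> c' \<tau>'" by (simp add: p)
  have c: "c \<noteq> 0" "c' \<noteq> 0" and \<tau>: "Im \<tau> > 0" "Im \<tau>' > 0"
    and L: "(*) c ` lat \<tau> = (*) c' ` lat \<tau>'"
    using assms * by (auto simp: lattice_basis_def)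
  have "(*) (c / c') ` lat \<tau> = (*) (1 / c') ` (*) c ` lat \<tau>" by (auto simp: image_image)
  also have "\<dots> = lat \<tau>'" unfolding L using c by (auto simp: image_image)
  finally have L': "(*) (c / c') ` lat \<tau> = lat \<tau>'" .
  have z: "c / c' * (z / c) = z / c'" using c by simp
  have cc: "c / c' \<noteq> 0" using c by simp
  note * = sfun_nfun_transform[OF \<tau> cc L', of "z / c", unfolded z]
  show "sL \<Lambda> z = sfun \<tau> (z / c)" "nL \<Lambda> z = nfun \<tau> (z / c) / c"
    using * c unfolding sL_def nL_def p_def [symmetric] p by simp_all
qed

section \<open>Reduction of lattices with 5-torsion points\<close>

lemma lat_subsetI:
  assumes "c \<in> lat \<tau>" "c * \<tau>' \<in> lat \<tau>"
  shows "(*) c ` lat \<tau>' \<subseteq> lat \<tau>"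
proof clarify
  fix z assume "z \<in> lat \<tau>'"
  then obtain m n where "z = of_int m + of_int n * \<tau>'" by (auto simp: lat_def)
  then have "c * z = of_int m * c + of_int n * (c * \<tau>')" by (simp add: algebra_simps)
  then show "c * z \<in> lat \<tau>" using assms by (simp add: lat_add lat_mult_int)
qed

lemma lat_eq_scaledI:
  assumes "c \<noteq> 0" "c \<in> lat \<tau>" "c * \<tau>' \<in> lat \<tau>" "1 / c \<in> lat \<tau>'" "\<tau> / c \<in> lat \<tau>'"
  shows "lat \<tau> = (*) c ` lat \<tau>'"
proof
  have "(*) (1 / c) ` lat \<tau> \<subseteq> lat \<tau>'" by (rule lat_subsetI) (use assms in auto)
  then have "(*) c ` (*) (1 / c) ` lat \<tau> \<subseteq> (*) c ` lat \<tau>'" by blast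
  then show "lat \<tau> \<subseteq> (*) c ` lat \<tau>'" using assms(1) by (simp add: image_image)
qed (rule lat_subsetI[OF assms(2,3)])

lemma lat_shift: "lat (\<tau> + of_int k) = lat \<tau>"
proof -
  have "lat (\<tau> + of_int k) = (*) 1 ` lat \<tau>"
    by (rule lat_eq_scaledI)
       (auto intro: latI[of _ k 1] latI[of _ "- k" 1])
  then show ?thesis by (simp add: image_def)
qed

lemma lat_unimodular:
  assumes \<tau>: "Im \<tau> > 0" and det: "a * d - b * c = (1::int)"
  defines "j \<equiv> of_int c * \<tau> + of_int d" and "\<tau>' \<equiv> (of_int a * \<tau> + of_int b) / (of_int c * \<tau> + of_int d)"
  shows "j \<noteq> 0" "Im \<tau>' > 0" "lat \<tau> = (*) j ` lat \<tau>'"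
proof -
  show j: "j \<noteq> 0"
  proof
    assume *: "j = 0"
    then have "of_int c * Im \<tau> = 0" by (simp add: j_def complex_eq_iff)
    then have "c = 0" using \<tau> by simp
    moreover from this have "d = 0" using * by (simp add: j_def)
    ultimately show False using det by simp
  qed
  have detr: "real_of_int a * of_int d - of_int b * of_int c = 1"
    using det by (metis of_int_1 of_int_diff of_int_mult)
  have detc: "complex_of_int a * of_int d - of_int b * of_int c = 1"
    using det by (metis of_int_1 of_int_diff of_int_mult)
  have "Im \<tau>' = Im ((of_int a * \<tau> + of_int b) * cnj j) / (norm j)^2"
    unfolding \<tau>'_def j_def by (subst complex_div_cnj) (simp add: power_divide flip: of_real_power)
  also have "Im ((of_int a * \<tau> + of_int b) * cnj j) = (of_int a * of_int d - of_int b * of_int c) * Im \<tau>"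
    by (simp add: j_def algebra_simps)
  finally show "Im \<tau>' > 0" using \<tau> j by (simp add: detr)
  have jt: "j * \<tau>' = of_int a * \<tau> + of_int b" using j by (simp add: \<tau>'_def j_def)
  show "lat \<tau> = (*) j ` lat \<tau>'"
  proof (rule lat_eq_scaledI[OF j])
    show "j \<in> lat \<tau>" by (rule latI[of _ d c]) (simp add: j_def)
    show "j * \<tau>' \<in> lat \<tau>" by (rule latI[of _ b a]) (simp add: jt)
    have "j * (of_int a + of_int (- c) * \<tau>') = of_int a * j - of_int c * (j * \<tau>')" by (simp add: algebra_simps)
    also have "\<dots> = of_int a * of_int d - of_int b * of_int c" unfolding jt by (simp add: j_def algebra_simps)
    finally show "1 / j \<in> lat \<tau>'" using j detc by (intro latI[of _ a "- c"]) (simp add: field_simps)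
    have "j * (of_int (- b) + of_int d * \<tau>') = of_int d * (j * \<tau>') - of_int b * j" by (simp add: algebra_simps)
    also have "\<dots> = (of_int a * of_int d - of_int b * of_int c) * \<tau>" unfolding jt by (simp add: j_def algebra_simps)
    finally show "\<tau> / j \<in> lat \<tau>'" using j detc by (intro latI[of _ "- b" d]) (simp add: field_simps)
  qed
qed

text \<open>A shortest nonzero vector is primitive and extends to a basis. Scaled to 1, and with the
  real part of the other vector reduced to at most 1/2, that other vector has norm at least 1, which
  bounds its imaginary part from below.\<close>

lemma lat_reduced_basis:
  assumes \<tau>: "Im \<tau> > 0"
  obtains c \<tau>' where "c \<noteq> 0" "Im \<tau>' \<ge> 1/2" "lat \<tau> = (*) c ` lat \<tau>'"
proof -
  define f :: "int \<times> int \<Rightarrow> real" where "f = (\<lambda>p. norm (of_int (snd p) + of_int (fst p) * \<tau>))"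
  \<comment> \<open>Pairs are (coefficient of \<tau>, constant coefficient). The set of nonzero
    vectors of length at most 1 is finite and contains 1, so its minimum is a minimum over all
    nonzero vectors.\<close>
  define T where "T = {p. p \<noteq> (0, 0) \<and> f p \<le> 1}"
  define B where "B = \<lceil>1 / Im \<tau>\<rceil>"
  define B' where "B' = \<lceil>1 + of_int B * norm \<tau>\<rceil>"
  have "T \<subseteq> {-B..B} \<times> {-B'..B'}"
  proof
    fix p assume p: "p \<in> T"
    obtain n m where pe: "p = (n, m)" by fastforce
    have le: "norm (of_int m + of_int n * \<tau>) \<le> 1" using p by (simp add: T_def f_def pe)
    have "\<bar>of_int n\<bar> * Im \<tau> \<le> 1"
      using abs_Im_le_cmod[of "of_int m + of_int n * \<tau>"] le \<tau> by (simp add: abs_mult)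
    then have "\<bar>of_int n\<bar> \<le> 1 / Im \<tau>" using \<tau> by (simp add: field_simps)
    then have n: "\<bar>n\<bar> \<le> B" unfolding B_def by linarith
    have "norm (of_int m :: complex) \<le> norm (of_int m + of_int n * \<tau>) + norm (of_int n * \<tau>)"
      by (metis add_diff_cancel_right' norm_triangle_ineq4)
    also have "\<dots> \<le> 1 + of_int B * norm \<tau>"
      using le n by (intro add_mono) (auto simp: norm_mult intro!: mult_right_mono)
    finally have "\<bar>of_int m\<bar> \<le> 1 + of_int B * norm \<tau>" by simp
    then have "\<bar>m\<bar> \<le> B'" unfolding B'_def by linarith
    then show "p \<in> {-B..B} \<times> {-B'..B'}" using n by (auto simp: pe)
  qed
  then have fin: "finite T" by (rule finite_subset) auto
  have "(0, 1) \<in> T" by (simp add: T_def f_def)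
  then have "f ` T \<noteq> {}" "finite (f ` T)" using fin by auto
  then obtain p where p: "p \<in> T" "f p = Min (f ` T)" using Min_in by (metis imageE)
  have min: "f p \<le> f q" if "q \<noteq> (0, 0)" for q
  proof (cases "q \<in> T")
    case True
    then show ?thesis using p fin by simp
  next
    case False
    then show ?thesis using that p(1) by (auto simp: T_def)
  qed
  obtain c d where pe: "p = (c, d)" by fastforce
  define g where "g = gcd d c"
  have cd: "(c, d) \<noteq> (0, 0)" using p(1) by (auto simp: T_def pe)
  then have g0: "g > 0" by (auto simp: g_def)
  have f0: "f (c, d) > 0"
  proof -
    have "of_int d + of_int c * \<tau> \<noteq> 0"
    proof
      assume *: "of_int d + of_int c * \<tau> = 0"
      then have "of_int c * Im \<tau> = 0" by (simp add: complex_eq_iff)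
      then have "c = 0" using \<tau> by simp
      then show False using * cd by simp
    qed
    then show ?thesis by (simp add: f_def)
  qed
  \<comment> \<open>Dividing by a common factor of the coordinates would give a shorter
    vector.\<close>
  have "g = 1"
  proof (rule ccontr)
    assume "g \<noteq> 1"
    with g0 have g1: "g \<ge> 2" by simp
    obtain c' d' where c': "c = g * c'" and d': "d = g * d'"
      unfolding g_def by (meson dvdE gcd_dvd1 gcd_dvd2)
    have "f (c, d) = norm (of_int g * (of_int d' + of_int c' * \<tau>))"
      unfolding f_def c' d' by (simp add: algebra_simps)
    also have "\<dots> = of_int g * f (c', d')" using g0 by (simp add: norm_mult f_def)
    finally have eq: "f (c, d) = of_int g * f (c', d')" .
    have "(c', d') \<noteq> (0, 0)" using cd c' d' by auto
    then have "f (c, d) \<le> f (c', d')" using min pe by simp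
    moreover have "f (c', d') > 0" using f0 eq g0 by (simp add: zero_less_mult_iff)
    ultimately have "of_int g * f (c', d') \<le> 1 * f (c', d')" using eq by simp
    then have "real_of_int g \<le> 1" using \<open>f (c', d') > 0\<close> by (simp only: mult_le_cancel_right)
    then show False using g1 by simp
  qed
  then obtain u v where uv: "u * d + v * c = 1"
    unfolding g_def using bezout_int[of d c] by auto
  have det: "u * d - (- v) * c = 1" using uv by simp
  define j where "j = of_int c * \<tau> + of_int d"
  define \<tau>1 where "\<tau>1 = (of_int u * \<tau> + of_int (- v)) / (of_int c * \<tau> + of_int d)"
  note * = lat_unimodular[OF \<tau> det, folded j_def \<tau>1_def]
  define k where "k = round (Re \<tau>1)"
  define \<tau>2 where "\<tau>2 = \<tau>1 + of_int (- k)"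
  have l2: "lat \<tau> = (*) j ` lat \<tau>2" unfolding \<tau>2_def lat_shift by (rule *(3))
  have Re2: "\<bar>Re \<tau>2\<bar> \<le> 1/2"
    using of_int_round_abs_le[of "Re \<tau>1"] by (simp add: \<tau>2_def k_def abs_minus_commute)
  have im0: "Im \<tau>2 > 0" using *(2) by (simp add: \<tau>2_def)
  have "j * \<tau>2 \<in> lat \<tau>" unfolding l2 by auto
  then obtain m n where mn: "j * \<tau>2 = of_int m + of_int n * \<tau>" by (auto simp: lat_def)
  have "(n, m) \<noteq> (0, 0)" using mn *(1) im0 by auto
  then have "f (c, d) \<le> f (n, m)" using min pe by simp
  then have "norm j \<le> norm (j * \<tau>2)" unfolding mn by (simp add: f_def j_def add.commute)
  then have "1 \<le> norm \<tau>2" using *(1) by (simp add: norm_mult)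
  then have "1 \<le> (norm \<tau>2)^2" by simp
  also have "\<dots> = Re \<tau>2 ^ 2 + Im \<tau>2 ^ 2" by (rule cmod_power2)
  also have "Re \<tau>2 ^ 2 \<le> (1/2)^2" using Re2 by (metis abs_le_square_iff abs_of_nonneg zero_le_divide_1_iff zero_le_numeral)
  finally have "(1/2)^2 \<le> Im \<tau>2 ^ 2" by (simp add: power2_eq_square)
  then have "1/2 \<le> Im \<tau>2" by (rule power2_le_imp_le) (use im0 in simp)
  then show thesis using that[OF *(1) _ l2] by blast
qed

text \<open>Evaluated at points of order 5, these are the weight 0 functions invariant under
  \<open>\<Gamma>\<^sub>1(5)\<close> and -1, in lattice form and with no analytic condition
  yet.\<close>

definition lat_inv :: "(complex set \<Rightarrow> complex \<Rightarrow> complex) \<Rightarrow> bool" where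
  "lat_inv G \<longleftrightarrow> (\<forall>c \<tau> z. c \<noteq> 0 \<longrightarrow> Im \<tau> > 0 \<longrightarrow> G ((*) c ` lat \<tau>) (c * z) = G (lat \<tau>) z) \<and>
     (\<forall>\<tau> z \<omega>. Im \<tau> > 0 \<longrightarrow> \<omega> \<in> lat \<tau> \<longrightarrow> G (lat \<tau>) (z + \<omega>) = G (lat \<tau>) z) \<and>
     (\<forall>\<tau> z. Im \<tau> > 0 \<longrightarrow> G (lat \<tau>) (- z) = G (lat \<tau>) z)"

lemma lat_inv_scale:
  assumes "lat_inv G" "lat \<tau> = (*) c ` lat \<tau>'" "c \<noteq> 0" "Im \<tau>' > 0"
  shows "G (lat \<tau>) z = G (lat \<tau>') (z / c)"
proof -
  have "G ((*) c ` lat \<tau>') (c * (z / c)) = G (lat \<tau>') (z / c)"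
    using assms unfolding lat_inv_def by blast
  then show ?thesis using assms by simp
qed

lemma lat_inv_periodic:
  assumes "lat_inv G" "Im \<tau> > 0" "z' - z \<in> lat \<tau>"
  shows "G (lat \<tau>) z' = G (lat \<tau>) z"
proof -
  have "G (lat \<tau>) (z + (z' - z)) = G (lat \<tau>) z" using assms unfolding lat_inv_def by blast
  then show ?thesis by simp
qed

lemma lat_inv_even: "lat_inv G \<Longrightarrow> Im \<tau> > 0 \<Longrightarrow> G (lat \<tau>) (- z) = G (lat \<tau>) z"
  by (simp add: lat_inv_def)

text \<open>Representatives of the four cusps of the modular curve attached to \<open>\<Gamma>\<^sub>1(5)\<close>: the behaviour of a
  function of pairs (lattice, point of order 5) at the \<open>i\<close>-th cusp is that of
  \<open>(\<int> + \<int> \<tau>, cz i \<tau>)\<close> for \<open>\<tau> \<rightarrow> \<i>\<infinity>\<close>.\<close>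
definition cz :: "nat \<Rightarrow> complex \<Rightarrow> complex" where
  "cz i \<tau> = (if i = 1 then \<tau> / 5 else if i = 2 then 2 * \<tau> / 5 else if i = 3 then 1 / 5 else 2 / 5)"

text \<open>With a reduced basis, 5 y has coordinates (m, n) modulo 5. If 5 divides n, the sign
  leaves m = 1, 2. Otherwise the sign leaves n = 1, 2, and an integral translation of \<tau>'
  removes m without changing the lattice or the imaginary part.\<close>

lemma cz_cover:
  assumes G: "lat_inv G" and \<tau>: "Im \<tau> > 0" and z: "5 * z \<in> lat \<tau>" "z \<notin> lat \<tau>"
  obtains i \<tau>' where "i \<in> {1..4}" "Im \<tau>' \<ge> 1/2" "G (lat \<tau>) z = G (lat \<tau>') (cz i \<tau>')"
proof -
  obtain c \<tau>' where c: "c \<noteq> 0" and \<tau>': "Im \<tau>' \<ge> 1/2" and l: "lat \<tau> = (*) c ` lat \<tau>'"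
    using lat_reduced_basis[OF \<tau>] .
  have \<tau>'0: "Im \<tau>' > 0" using \<tau>' by linarith
  define y where "y = z / c"
  have Gz: "G (lat \<tau>) z = G (lat \<tau>') y" unfolding y_def by (rule lat_inv_scale[OF G l c \<tau>'0])
  have "5 * y \<in> lat \<tau>'" using z(1) c unfolding l y_def by auto
  then obtain m n where "5 * y = of_int m + of_int n * \<tau>'" by (auto simp: lat_def)
  then have y: "y = (of_int m + of_int n * \<tau>') / 5" by (simp add: eq_divide_eq mult.commute)
  have y0: "y \<notin> lat \<tau>'"
    using z(2) c unfolding l y_def by (metis image_eqI nonzero_mult_div_cancel_left times_divide_eq_right)
  have eqI: "G (lat \<tau>') y = G (lat \<tau>'') (cz i \<tau>'')"
    if "lat \<tau>'' = lat \<tau>'" "y - cz i \<tau>'' \<in> lat \<tau>' \<or> y + cz i \<tau>'' \<in> lat \<tau>'" for i \<tau>''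
    using that lat_inv_periodic[OF G \<tau>'0, of y "cz i \<tau>''"] lat_inv_periodic[OF G \<tau>'0, of y "- cz i \<tau>''"]
      lat_inv_even[OF G \<tau>'0, of "cz i \<tau>''"] by auto
  have sh: "lat (\<tau>' + of_int k) = lat \<tau>'" "Im (\<tau>' + of_int k) \<ge> 1/2" for k
    using \<tau>' by (simp_all add: lat_shift)
  have n5: "n = 5 * (n div 5) + n mod 5" and m5: "m = 5 * (m div 5) + m mod 5" by simp_all
  define k where "k = n div 5"
  have "n mod 5 \<in> {0..4}" by auto
  then consider "n = 5 * k" | "n = 5 * k + 1" | "n = 5 * k + 2" | "n = 5 * k + 3" | "n = 5 * k + 4"
    using n5 unfolding k_def by force
  then show thesis
  proof cases
    case 1
    define j where "j = m div 5"
    have "m mod 5 \<in> {0..4}" by auto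
    then consider "m = 5 * j" | "m = 5 * j + 1" | "m = 5 * j + 2" | "m = 5 * j + 3" | "m = 5 * j + 4"
      using m5 unfolding j_def by force
    then show thesis
    proof cases
      case a: 1
      have "y \<in> lat \<tau>'" by (rule latI[of _ j k]) (simp add: 1 a y add_divide_distrib)
      then show ?thesis using y0 by blast
    next
      case 2
      have "y - cz 3 \<tau>' \<in> lat \<tau>'"
        by (rule latI[of _ j k]) (simp add: 1 2 y cz_def field_simps)
      then show ?thesis using that[of 3 \<tau>'] eqI[of \<tau>' 3] \<tau>' Gz by auto
    next
      case 3
      have "y - cz 4 \<tau>' \<in> lat \<tau>'"
        by (rule latI[of _ j k]) (simp add: 1 3 y cz_def field_simps)
      then show ?thesis using that[of 4 \<tau>'] eqI[of \<tau>' 4] \<tau>' Gz by auto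
    next
      case 4
      have "y + cz 4 \<tau>' \<in> lat \<tau>'"
        by (rule latI[of _ "j + 1" k]) (simp add: 1 4 y cz_def field_simps)
      then show ?thesis using that[of 4 \<tau>'] eqI[of \<tau>' 4] \<tau>' Gz by auto
    next
      case 5
      have "y + cz 3 \<tau>' \<in> lat \<tau>'"
        by (rule latI[of _ "j + 1" k]) (simp add: 1 5 y cz_def field_simps)
      then show ?thesis using that[of 3 \<tau>'] eqI[of \<tau>' 3] \<tau>' Gz by auto
    qed
  next
    case 2
    have "y - cz 1 (\<tau>' + of_int m) \<in> lat \<tau>'"
      by (rule latI[of _ 0 k]) (simp add: 2 y cz_def field_simps)
    then show ?thesis using that[of 1 "\<tau>' + of_int m"] eqI[of "\<tau>' + of_int m" 1] sh[of m] Gz by auto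
  next
    case 3
    \<comment> \<open>The shift is 3 m because 2 * 3 = 1 modulo 5.\<close>
    have "y - cz 2 (\<tau>' + of_int (3 * m)) \<in> lat \<tau>'"
      by (rule latI[of _ "- m" k]) (simp add: 3 y cz_def field_simps)
    then show ?thesis using that[of 2 "\<tau>' + of_int (3 * m)"] eqI[of "\<tau>' + of_int (3 * m)" 2] sh[of "3 * m"] Gz by auto
  next
    case 4
    have "y + cz 2 (\<tau>' + of_int (- 3 * m)) \<in> lat \<tau>'"
      by (rule latI[of _ "- m" "k + 1"]) (simp add: 4 y cz_def field_simps)
    then show ?thesis using that[of 2 "\<tau>' + of_int (- 3 * m)"] eqI[of "\<tau>' + of_int (- 3 * m)" 2] sh[of "- 3 * m"] Gz by auto
  next
    case 5
    have "y + cz 1 (\<tau>' + of_int (- m)) \<in> lat \<tau>'"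
      by (rule latI[of _ 0 "k + 1"]) (simp add: 5 y cz_def field_simps)
    then show ?thesis using that[of 1 "\<tau>' + of_int (- m)"] eqI[of "\<tau>' + of_int (- m)" 1] sh[of "- m"] Gz by auto
  qed
qed

lemma cz_order_5:
  assumes "Im \<tau> > 0" "i \<in> {1..4}"
  shows "5 * cz i \<tau> \<in> lat \<tau>" "cz i \<tau> \<notin> lat \<tau>"
proof -
  have "i = 1 \<or> i = 2 \<or> i = 3 \<or> i = 4" using assms by auto
  then show "5 * cz i \<tau> \<in> lat \<tau>"
    by (elim disjE) (auto simp: cz_def intro: latI[of _ 0 1] latI[of _ 0 2] latI[of _ 1 0] latI[of _ 2 0])
  show "cz i \<tau> \<notin> lat \<tau>"
  proof
    assume "cz i \<tau> \<in> lat \<tau>"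
    then obtain m n where mn: "cz i \<tau> = of_int m + of_int n * \<tau>" by (auto simp: lat_def)
    have "Im (5 * cz i \<tau>) = 5 * of_int n * Im \<tau>" by (simp add: mn)
    moreover have "Re (5 * cz i \<tau>) = 5 * of_int m + 5 * of_int n * Re \<tau>" by (simp add: mn)
    ultimately have "(1::real) = 5 * of_int n \<or> (2::real) = 5 * of_int n
      \<or> (1::real) = 5 * of_int m \<or> (2::real) = 5 * of_int m"
      using \<open>i = 1 \<or> i = 2 \<or> i = 3 \<or> i = 4\<close> assms(1) by (auto simp: cz_def)
    then have "real_of_int 1 = of_int (5 * n) \<or> real_of_int 2 = of_int (5 * n)
      \<or> real_of_int 1 = of_int (5 * m) \<or> real_of_int 2 = of_int (5 * m)" by simp
    then have "1 = 5 * n \<or> 2 = 5 * n \<or> 1 = 5 * m \<or> 2 = 5 * m" by (simp only: of_int_eq_iff)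
    then show False by presburger
  qed
qed

text \<open>The substitution -1/\<tau> carries the points of cusps 1 and 2 to those of cusps 3 and
  4, and a further unimodular matrix links cusps 1 and 2, so constancy at one cusp spreads to the
  first.\<close>

lemma cz_transitive:
  assumes G: "lat_inv G" and i: "i \<in> {1..4}" and c: "\<And>\<tau>. Im \<tau> > 0 \<Longrightarrow> G (lat \<tau>) (cz i \<tau>) = c"
    and \<tau>: "Im \<tau> > 0"
  shows "G (lat \<tau>) (cz 1 \<tau>) = c"
proof -
  have S: "\<tau> \<noteq> 0" "Im (- 1 / \<tau>) > 0" "lat \<tau> = (*) \<tau> ` lat (- 1 / \<tau>)" if "Im \<tau> > 0" for \<tau>
    using lat_unimodular[OF that, of 0 0 "-1" 1] by auto
  have S': "G (lat \<tau>) (cz 1 \<tau>) = G (lat (- 1 / \<tau>)) (cz 3 (- 1 / \<tau>))"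
    "G (lat \<tau>) (cz 2 \<tau>) = G (lat (- 1 / \<tau>)) (cz 4 (- 1 / \<tau>))" if "Im \<tau> > 0" for \<tau>
    using lat_inv_scale[OF G S(3)[OF that] S(1)[OF that] S(2)[OF that]] S(1)[OF that]
    by (auto simp: cz_def)
  \<comment> \<open>The matrix with rows (3, -5) and (-1, 2) is diagonal modulo 5 and carries the
    point \<tau>/5 to 2\<sigma>/5 up to the lattice: a diamond operator.\<close>
  have T: "G (lat \<tau>) (cz 1 \<tau>) = G (lat \<sigma>) (cz 2 \<sigma>)" "Im \<sigma> > 0" if "\<sigma> = (3 * \<tau> - 5) / (2 - \<tau>)" for \<sigma>
  proof -
    have *: "2 - \<tau> \<noteq> 0" "Im \<sigma> > 0" "lat \<tau> = (*) (2 - \<tau>) ` lat \<sigma>"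
      using lat_unimodular[OF \<tau>, of 3 2 "-5" "-1"] that by auto
    show "Im \<sigma> > 0" by fact
    have "G (lat \<tau>) (cz 1 \<tau>) = G (lat \<sigma>) (cz 1 \<tau> / (2 - \<tau>))"
      by (rule lat_inv_scale[OF G *(3) *(1) *(2)])
    also have "\<dots> = G (lat \<sigma>) (cz 2 \<sigma>)"
    proof (rule lat_inv_periodic[OF G *(2)])
      have "\<tau> = (2 - \<tau>) * (5 + 2 * \<sigma>)" using *(1) by (simp add: that field_simps)
      then have "\<tau> / (2 - \<tau>) = 5 + 2 * \<sigma>" using *(1) by (simp add: field_simps)
      moreover have "cz 1 \<tau> / (2 - \<tau>) = (\<tau> / (2 - \<tau>)) / 5" by (simp add: cz_def)
      ultimately show "cz 1 \<tau> / (2 - \<tau>) - cz 2 \<sigma> \<in> lat \<sigma>"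
        by (intro latI[of _ 1 0]) (simp add: cz_def add_divide_distrib)
    qed
    finally show "G (lat \<tau>) (cz 1 \<tau>) = G (lat \<sigma>) (cz 2 \<sigma>)" .
  qed
  have "i = 1 \<or> i = 2 \<or> i = 3 \<or> i = 4" using i by auto
  then show ?thesis
    using c[OF \<tau>] S'(1)[OF \<tau>] c[OF S(2)[OF \<tau>]] T[OF refl] c[OF T(2)[OF refl]]
      S'(2)[OF T(2)[OF refl]] c[OF S(2)[OF T(2)[OF refl]]]
    by (elim disjE) auto
qed

text \<open>x = e(\<tau>/5) is the coordinate in which period 5 becomes single-valuedness on the
  punctured disc. The bound for Im \<tau> \<ge> 1/2 is a bound near x = 0, so the singularity there
  is removable.\<close>

lemma periodic_lift_disc:
  assumes hol: "g holomorphic_on {\<tau>. Im \<tau> > 0}" and per: "\<And>\<tau>. Im \<tau> > 0 \<Longrightarrow> g (\<tau> + 5) = g \<tau>"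
    and bd: "\<And>\<tau>. Im \<tau> \<ge> 1/2 \<Longrightarrow> norm (g \<tau>) \<le> C"
  obtains F where "F holomorphic_on ball 0 1" "\<And>\<tau>. Im \<tau> > 0 \<Longrightarrow> g \<tau> = F (ee (\<tau> / 5))"
proof -
  have pern: "g (\<tau> + 5 * of_nat n) = g \<tau>" if "Im \<tau> > 0" for \<tau> n
  proof (induction n)
    case (Suc n)
    have "g (\<tau> + 5 * of_nat n + 5) = g (\<tau> + 5 * of_nat n)" by (rule per) (use that in simp)
    then show ?case using Suc by (simp add: algebra_simps)
  qed simp
  have peri: "g (\<tau> + 5 * of_int n) = g \<tau>" if "Im \<tau> > 0" for \<tau> n
  proof (cases "n \<ge> 0")
    case True
    then show ?thesis using pern[OF that, of "nat n"] by simp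
  next
    case False
    then show ?thesis using pern[of "\<tau> + 5 * of_int n" "nat (- n)"] that by simp
  qed
  have eqg: "g \<tau> = g \<tau>'" if "Im \<tau> > 0" "Im \<tau>' > 0" "ee (\<tau> / 5) = ee (\<tau>' / 5)" for \<tau> \<tau>'
  proof -
    have "ee (\<tau> / 5 - \<tau>' / 5) = 1" using that by (simp add: ee_diff)
    then obtain n where "\<tau> / 5 - \<tau>' / 5 = of_int n" by (auto simp: ee_eq_1_iff Ints_def)
    then have "\<tau> = \<tau>' + 5 * of_int n" by (simp add: field_simps)
    then show ?thesis using peri[OF that(2)] by simp
  qed
  define T where "T = (\<lambda>a. 5 * a / (2 * of_real pi * \<i>))"
  have eeT: "ee (T a / 5) = exp a" for a by (simp add: T_def ee_def)
  have ImT: "Im (T a) = - 5 * Re a / (2 * pi)" for a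
  proof -
    have "T a = of_real (5 / (2 * pi)) * (- (\<i> * a))" by (simp add: T_def field_simps)
    then show ?thesis by simp
  qed
  define F0 where "F0 = (\<lambda>x. g (T (Ln x)))"
  have Im0: "Im (T a) > 0" if "exp a = x" "norm x < 1" for a x
  proof -
    have "exp (Re a) < 1" using that by (metis norm_exp_eq_Re)
    then have "Re a < 0" by simp
    then show ?thesis unfolding ImT by (simp add: divide_simps mult_less_0_iff)
  qed
  have F0: "F0 x = g (T a)" if "exp a = x" "norm x < 1" for a x
  proof -
    have x: "x \<noteq> 0" using that(1) by auto
    show ?thesis unfolding F0_def
      by (rule eqg) (use x that Im0[of "Ln x" x] Im0[of a x] in \<open>auto simp: eeT\<close>)
  qed
  have gF0: "g \<tau> = F0 (ee (\<tau> / 5))" if "Im \<tau> > 0" for \<tau>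
  proof -
    have "F0 (ee (\<tau> / 5)) = g (T (2 * of_real pi * \<i> * (\<tau> / 5)))"
      by (rule F0) (use that in \<open>auto simp: ee_def intro: norm_ee_less_1[unfolded ee_def]\<close>)
    then show ?thesis by (simp add: T_def)
  qed
  have holF0: "F0 holomorphic_on (ball 0 1 - {0})"
  proof -
    have "F0 field_differentiable at x0" if x0: "x0 \<in> ball 0 1 - {0}" for x0
    proof -
      \<comment> \<open>On \<open>U\<close> the function Ln (x / x0) + Ln x0 is a holomorphic branch
        of the logarithm; by \<open>F0\<close> the descended function does not depend on the
        branch.\<close>
      define U where "U = (\<lambda>x. x / x0) -` (- \<real>\<^sub>\<le>\<^sub>0) \<inter> (ball 0 1 :: complex set)"
      have "open U" unfolding U_def
        by (intro open_Int continuous_open_vimage) (use x0 in \<open>auto intro!: continuous_intros simp: open_Compl\<close>)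
      moreover have "x0 \<in> U" using x0 by (auto simp: U_def)
      moreover have "F0 holomorphic_on U"
      proof -
        have ex: "exp (Ln (x / x0) + Ln x0) = x" if "x \<in> U" for x
        proof -
          have "x \<noteq> 0" using that by (auto simp: U_def)
          then show ?thesis using x0 by (simp add: exp_add)
        qed
        have "(\<lambda>x. T (Ln (x / x0) + Ln x0)) holomorphic_on U"
          unfolding T_def using x0 by (intro holomorphic_intros) (auto simp: U_def)
        moreover have "(\<lambda>x. T (Ln (x / x0) + Ln x0)) ` U \<subseteq> {\<tau>. Im \<tau> > 0}"
          using Im0[OF ex] by (auto simp: U_def)
        ultimately have "(\<lambda>x. g (T (Ln (x / x0) + Ln x0))) holomorphic_on U"
          using holomorphic_on_compose_gen[OF _ hol, unfolded o_def] by blast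
        then show ?thesis
          by (rule holomorphic_transform) (use F0[OF ex] in \<open>auto simp: U_def\<close>)
      qed
      ultimately show ?thesis using holomorphic_on_imp_differentiable_at by blast
    qed
    then show ?thesis by (simp add: holomorphic_on_def field_differentiable_at_within)
  qed
  have "\<exists>B. \<forall>\<^sub>F x in at 0. norm (F0 x) \<le> B"
  proof
    have "\<forall>\<^sub>F x in at 0. x \<in> ball 0 (exp (- pi / 5)) - {0::complex}"
      by (rule eventually_at_in_open) auto
    then show "\<forall>\<^sub>F x in at 0. norm (F0 x) \<le> C"
    proof eventually_elim
      case (elim x)
      then have x: "x \<noteq> 0" "norm x < exp (- pi / 5)" by auto
      then have "ln (norm x) < - pi / 5" by (metis exp_less_mono exp_ln ln_less_cancel_iff ln_exp norm_eq_zero zero_less_norm_iff exp_gt_zero)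
      then have "Im (T (Ln x)) \<ge> 1/2"
        using x unfolding ImT by (simp add: field_simps)
      then show ?case unfolding F0_def by (rule bd)
    qed
  qed
  moreover have "0 \<in> interior (ball 0 (1::real) :: complex set)" by simp
  ultimately obtain F where F: "F holomorphic_on ball 0 1" "\<And>z. z \<in> ball 0 1 - {0} \<Longrightarrow> F z = F0 z"
    using holomorphic_on_extend_bounded[OF holF0] by blast
  show thesis
  proof (rule that[OF F(1)])
    fix \<tau> assume "Im \<tau> > 0"
    then show "g \<tau> = F (ee (\<tau> / 5))"
      using gF0[of \<tau>] F(2)[of "ee (\<tau> / 5)"] norm_ee_less_1[of "\<tau> / 5"] by simp
  qed
qed

lemma cz_periodic:
  assumes G: "lat_inv G" and \<tau>: "Im \<tau> > 0"
  shows "G (lat (\<tau> + 5)) (cz i (\<tau> + 5)) = G (lat \<tau>) (cz i \<tau>)"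
proof -
  have "lat (\<tau> + 5) = lat \<tau>" using lat_shift[of \<tau> 5] by simp
  moreover have "cz i (\<tau> + 5) - cz i \<tau> \<in> lat \<tau>"
    using lat_of_int[of 1 \<tau>] lat_of_int[of 2 \<tau>] by (auto simp: cz_def field_simps)
  ultimately show ?thesis using lat_inv_periodic[OF G \<tau>] by simp
qed

text \<open>Compactness of the modular curve, in the form of the maximum principle: the supremum over all cusp
  neighbourhoods is attained, and the cusp neighbourhoods cover everything.\<close>
lemma lat_inv_bounded_imp_const:
  assumes G: "lat_inv G"
    and hol: "\<And>i. i \<in> {1..4} \<Longrightarrow> (\<lambda>\<tau>. G (lat \<tau>) (cz i \<tau>)) holomorphic_on {\<tau>. Im \<tau> > 0}"
    and bd: "\<And>i. i \<in> {1..4} \<Longrightarrow> \<exists>C. \<forall>\<tau>. Im \<tau> \<ge> 1/2 \<longrightarrow> norm (G (lat \<tau>) (cz i \<tau>)) \<le> C"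
  shows "\<exists>c. \<forall>\<tau>. Im \<tau> > 0 \<longrightarrow> G (lat \<tau>) (cz 1 \<tau>) = c"
proof -
  have "\<exists>F. F holomorphic_on ball 0 1 \<and> (\<forall>\<tau>. Im \<tau> > 0 \<longrightarrow> G (lat \<tau>) (cz i \<tau>) = F (ee (\<tau> / 5)))"
    if i: "i \<in> {1..4}" for i
  proof -
    obtain C where C: "\<And>\<tau>. Im \<tau> \<ge> 1/2 \<Longrightarrow> norm (G (lat \<tau>) (cz i \<tau>)) \<le> C" using bd[OF i] by blast
    show ?thesis
      using periodic_lift_disc[OF hol[OF i] cz_periodic[OF G] C] by metis
  qed
  then obtain F where F: "\<And>i. i \<in> {1..4} \<Longrightarrow> F i holomorphic_on ball 0 1"
    and GF: "\<And>i \<tau>. i \<in> {1..4} \<Longrightarrow> Im \<tau> > 0 \<Longrightarrow> G (lat \<tau>) (cz i \<tau>) = F i (ee (\<tau> / 5))"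
    by metis
  \<comment> \<open>This is the norm of e(\<tau>/5) for Im \<tau> = 1/2, so the discs of radius
    \<rho> at the four cusps are the neighbourhoods reached by \<open>cz_cover\<close>.\<close>
  define \<rho> where "\<rho> = exp (- pi / 5)"
  have \<rho>: "0 < \<rho>" "\<rho> < 1" by (auto simp: \<rho>_def)
  have "\<exists>x\<in>cball 0 \<rho>. \<forall>y\<in>cball 0 \<rho>. norm (F i y) \<le> norm (F i x)" if i: "i \<in> {1..4}" for i
    using \<rho> F[OF i]
    by (intro continuous_attains_sup)
       (auto intro!: continuous_intros intro: continuous_on_subset holomorphic_on_imp_continuous_on)
  then obtain X where X: "\<And>i. i \<in> {1..4} \<Longrightarrow> X i \<in> cball 0 \<rho>"
    and Xmax: "\<And>i y. i \<in> {1..4} \<Longrightarrow> y \<in> cball 0 \<rho> \<Longrightarrow> norm (F i y) \<le> norm (F i (X i))"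
    by metis
  define M where "M = (\<lambda>i. norm (F i (X i)))"
  have "Max (M ` {1..4}) \<in> M ` {1..4::nat}" by (rule Max_in) auto
  then obtain i where i: "i \<in> {1..4}" "M i = Max (M ` {1..4})" by (metis imageE)
  have Mi: "M j \<le> M i" if "j \<in> {1..4}" for j unfolding i(2) using that by (intro Max_ge) auto
  have "F i constant_on ball 0 1"
  proof (rule maximum_modulus_principle[OF F[OF i(1)], of "ball 0 1" "X i"])
    show "X i \<in> ball 0 1" using X[OF i(1)] \<rho> by auto
    fix x :: complex assume x: "x \<in> ball 0 1"
    show "norm (F i x) \<le> norm (F i (X i))"
    proof (cases "x = 0")
      case True
      then show ?thesis using Xmax[OF i(1), of x] \<rho> by simp
    next
      case False
      define \<tau> where "\<tau> = 5 * Ln x / (2 * of_real pi * \<i>)"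
      have ee\<tau>: "ee (\<tau> / 5) = x" using False by (simp add: \<tau>_def ee_def)
      have "norm (ee (\<tau> / 5)) < 1" using x ee\<tau> by simp
      then have im: "Im \<tau> > 0" by (simp add: norm_ee zero_less_mult_iff)
      obtain j \<tau>' where j: "j \<in> {1..4}" "Im \<tau>' \<ge> 1/2" "G (lat \<tau>) (cz i \<tau>) = G (lat \<tau>') (cz j \<tau>')"
        using cz_cover[OF G im cz_order_5[OF im i(1)]] .
      have "norm (ee (\<tau>' / 5)) \<le> \<rho>" unfolding norm_ee \<rho>_def using j(2) by simp
      then have "norm (F j (ee (\<tau>' / 5))) \<le> M j" unfolding M_def by (intro Xmax j) auto
      also have "\<dots> \<le> M i" by (rule Mi) fact
      finally show ?thesis
        using GF[OF i(1) im] GF[OF j(1), of \<tau>'] j ee\<tau> by (simp add: M_def)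
    qed
  qed auto
  then obtain c where c: "\<And>x. x \<in> ball 0 1 \<Longrightarrow> F i x = c" by (auto simp: constant_on_def)
  have "G (lat \<tau>) (cz i \<tau>) = c" if "Im \<tau> > 0" for \<tau>
    using GF[OF i(1) that] c[of "ee (\<tau> / 5)"] norm_ee_less_1[of "\<tau> / 5"] that by simp
  then show ?thesis using cz_transitive[OF G i(1)] by blast
qed

section \<open>Power series with \<open>l\<close>-integral coefficients\<close>

definition csubring :: "'a::comm_ring_1 set \<Rightarrow> bool" where
  "csubring J \<longleftrightarrow> 1 \<in> J \<and> (\<forall>x\<in>J. \<forall>y\<in>J. x - y \<in> J \<and> x * y \<in> J)"

context
  fixes J :: "'a::comm_ring_1 set"
  assumes J: "csubring J"
begin

lemma csubring_1: "1 \<in> J" and csubring_diff: "x \<in> J \<Longrightarrow> y \<in> J \<Longrightarrow> x - y \<in> J"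
  and csubring_mult: "x \<in> J \<Longrightarrow> y \<in> J \<Longrightarrow> x * y \<in> J"
  using J by (auto simp: csubring_def)

lemma csubring_0: "0 \<in> J" using csubring_diff[OF csubring_1 csubring_1] by simp

lemma csubring_uminus: "x \<in> J \<Longrightarrow> - x \<in> J" using csubring_diff[OF csubring_0] by fastforce

lemma csubring_add: "x \<in> J \<Longrightarrow> y \<in> J \<Longrightarrow> x + y \<in> J"
  using csubring_diff[of x "- y"] csubring_uminus by fastforce

lemma csubring_power: "x \<in> J \<Longrightarrow> x ^ n \<in> J"
  by (induction n) (auto intro: csubring_1 csubring_mult)

lemma csubring_sum: "(\<And>i. i \<in> A \<Longrightarrow> f i \<in> J) \<Longrightarrow> sum f A \<in> J"
  by (induction A rule: infinite_finite_induct) (auto intro: csubring_0 csubring_add)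

lemma csubring_prod: "(\<And>i. i \<in> A \<Longrightarrow> f i \<in> J) \<Longrightarrow> prod f A \<in> J"
  by (induction A rule: infinite_finite_induct) (auto intro: csubring_1 csubring_mult)

lemma csubring_of_nat: "of_nat n \<in> J"
  by (induction n) (auto intro: csubring_0 csubring_1 csubring_add)

lemma csubring_of_int: "of_int n \<in> J"
  by (cases n rule: int_cases2) (auto intro: csubring_of_nat csubring_uminus)

lemmas csubring_intros = csubring_1 csubring_0 csubring_add csubring_diff csubring_mult csubring_uminus
  csubring_power csubring_sum csubring_prod csubring_of_nat csubring_of_int

lemma csubring_freshman:
  assumes "prime p" "a \<in> J" "b \<in> J"
  shows "\<exists>c\<in>J. (a + b) ^ p = a ^ p + b ^ p + of_nat p * c"
proof -
  have p: "p > 0" using assms(1) by (simp add: prime_gt_0_nat)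
  have dvd: "p dvd (p choose k)" if "k \<in> {1..<p}" for k
    using that assms(1) by (intro dvd_choose_prime) auto
  define c where "c = (\<Sum>k\<in>{1..<p}. of_nat ((p choose k) div p) * a ^ k * b ^ (p - k))"
  have "{..p} = insert 0 (insert p {1..<p})" using p by auto
  then have "(a + b) ^ p = a ^ p + b ^ p + (\<Sum>k\<in>{1..<p}. of_nat (p choose k) * a ^ k * b ^ (p - k))"
    using p by (simp add: binomial_ring)
  also have "(\<Sum>k\<in>{1..<p}. of_nat (p choose k) * a ^ k * b ^ (p - k)) = of_nat p * c"
    unfolding c_def sum_distrib_left
  proof (rule sum.cong[OF refl])
    fix k assume "k \<in> {1..<p}"
    then have "(p choose k) = p * ((p choose k) div p)" using dvd by simp
    then have "(of_nat (p choose k) :: 'a) = of_nat p * of_nat ((p choose k) div p)"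
      by (metis of_nat_mult)
    then show "of_nat (p choose k) * a ^ k * b ^ (p - k) = of_nat p * (of_nat ((p choose k) div p) * a ^ k * b ^ (p - k))"
      by (simp add: mult.assoc)
  qed
  finally show ?thesis
    using assms by (intro bexI[of _ c]) (auto simp: c_def intro!: csubring_sum csubring_mult csubring_power csubring_of_nat)
qed

end

locale lprime =
  fixes l :: nat
  assumes prime_l: "prime l"
begin

definition Zl :: "complex set" where
  "Zl = {x. \<exists>a b :: int. \<not> int l dvd b \<and> x = of_int a / of_int b}"

lemma ZlI: "\<not> int l dvd b \<Longrightarrow> x = of_int a / of_int b \<Longrightarrow> x \<in> Zl"
  by (auto simp: Zl_def)

lemma ZlE:
  assumes "x \<in> Zl"
  obtains b a :: int where "\<not> int l dvd b" "x = of_int a / of_int b"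
  using assms by (auto simp: Zl_def)

lemma prime_int_l: "prime (int l)" using prime_l by simp

lemma l_pos: "l > 0" using prime_l by (simp add: prime_gt_0_nat)

lemma Zl_subring: "csubring Zl"
proof -
  have "1 \<in> Zl" by (rule ZlI[of 1 _ 1]) (use prime_l in \<open>auto simp: not_prime_1\<close>)
  moreover have "x - y \<in> Zl \<and> x * y \<in> Zl" if xy: "x \<in> Zl" "y \<in> Zl" for x y
  proof -
    obtain b a where b: "\<not> int l dvd b" "x = of_int a / of_int b" using xy(1) by (rule ZlE)
    obtain d c where d: "\<not> int l dvd d" "y = of_int c / of_int d" using xy(2) by (rule ZlE)
    have bd: "\<not> int l dvd b * d" using b d prime_dvd_mult_iff[OF prime_int_l] by blast
    have "b \<noteq> 0" "d \<noteq> 0" using b d by auto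
    then have "x - y = of_int (a * d - c * b) / of_int (b * d)" "x * y = of_int (a * c) / of_int (b * d)"
      unfolding b(2) d(2) by (simp_all add: diff_frac_eq)
    then show ?thesis using ZlI[OF bd] by blast
  qed
  ultimately show ?thesis by (simp add: csubring_def)
qed

lemmas Zl_intros = csubring_intros[OF Zl_subring]

lemma Zl_inverse_of_nat: "0 < k \<Longrightarrow> k < l \<Longrightarrow> 1 / of_nat k \<in> Zl"
  by (rule ZlI[of "int k" _ 1]) (auto simp: zdvd_not_zless)

lemma Zl_fermat:
  assumes "x \<in> Zl"
  shows "\<exists>c\<in>Zl. x ^ l = x + of_nat l * c"
proof -
  obtain b a where b: "\<not> int l dvd b" "x = of_int a / of_int b" using assms by (rule ZlE)
  have b0: "b \<noteq> 0" using b by auto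
  have fer: "[a ^ l = a] (mod int l)" for a :: int
  proof -
    define b where "b = nat (a mod int l)"
    have b: "int b = a mod int l" using l_pos by (simp add: b_def)
    have ab: "[a = int b] (mod int l)" unfolding b by (simp add: cong_def)
    have "[b ^ l = b] (mod l)"
    proof (cases "l dvd b")
      case True
      then have "l dvd b ^ l" using l_pos by (meson dvd_power_same dvd_trans dvd_power)
      then show ?thesis using True by (meson cong_0_iff cong_sym cong_trans)
    next
      case False
      have "[b * b ^ (l - 1) = b * 1] (mod l)"
        by (intro cong_scalar_left fermat_theorem prime_l False)
      then show ?thesis using l_pos by (simp add: power_eq_if)
    qed
    then have "[int b ^ l = int b] (mod int l)" by (metis cong_int_iff of_nat_power)
    then show ?thesis using ab by (meson cong_pow cong_sym cong_trans)
  qed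
  have "[a ^ l * b = a * b ^ l] (mod int l)"
    using fer[of a] fer[of b] by (metis cong_mult cong_refl cong_sym cong_trans)
  then obtain k where k: "a ^ l * b - a * b ^ l = int l * k"
    by (auto simp: cong_iff_dvd_diff)
  have "of_int (a ^ l * b - a * b ^ l) = (of_int (int l * k) :: complex)" using k by simp
  then have "x ^ l - x = of_nat l * (of_int k / of_int (b ^ l * b))"
    using b0 by (simp add: b(2) field_simps)
  moreover have "\<not> int l dvd b ^ l * b"
    using b(1) prime_int_l by (metis prime_dvd_mult_iff prime_dvd_power)
  ultimately show ?thesis
    by (intro bexI[of _ "of_int k / of_int (b ^ l * b)"]) (auto simp: algebra_simps intro: ZlI)
qed

text \<open>Genuine functions on the unit disc, so that they can be compared with modular functions
  at x = e(\<tau>/5); \<open>Fl_fps_iff\<close> translates to formal power series for the arithmetic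
  of coefficients.\<close>

definition Fl :: "(complex \<Rightarrow> complex) \<Rightarrow> bool" where
  "Fl F \<longleftrightarrow> (\<exists>a. (\<forall>n. a n \<in> Zl) \<and> (\<forall>x. norm x < 1 \<longrightarrow> (\<lambda>n. a n * x ^ n) sums F x))"

lemma Fl_fps_iff:
  "Fl F \<longleftrightarrow> (\<exists>A. fps_conv_radius A \<ge> 1 \<and> (\<forall>n. fps_nth A n \<in> Zl) \<and> (\<forall>x. norm x < 1 \<longrightarrow> F x = eval_fps A x))"
proof
  assume "Fl F"
  then obtain a where a: "\<And>n. a n \<in> Zl" "\<And>x. norm x < 1 \<Longrightarrow> (\<lambda>n. a n * x ^ n) sums F x"
    unfolding Fl_def by blast
  define A where "A = Abs_fps a"
  have "fps_conv_radius A \<ge> 1"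
    unfolding fps_conv_radius_def A_def
  proof (rule conv_radius_geI_ex)
    fix r :: real assume "0 < r" "ereal r < 1"
    then show "\<exists>z. norm z = r \<and> summable (\<lambda>n. fps_nth (Abs_fps a) n * z ^ n)"
      using a(2)[of "of_real r"] by (intro exI[of _ "of_real r"]) (auto simp: sums_iff)
  qed
  moreover have "F x = eval_fps A x" if "norm x < 1" for x
    using a(2)[OF that] by (simp add: eval_fps_def A_def sums_iff)
  ultimately show "\<exists>A. fps_conv_radius A \<ge> 1 \<and> (\<forall>n. fps_nth A n \<in> Zl) \<and> (\<forall>x. norm x < 1 \<longrightarrow> F x = eval_fps A x)"
    using a(1) by (intro exI[of _ A]) (auto simp: A_def)
next
  assume "\<exists>A. fps_conv_radius A \<ge> 1 \<and> (\<forall>n. fps_nth A n \<in> Zl) \<and> (\<forall>x. norm x < 1 \<longrightarrow> F x = eval_fps A x)"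
  then obtain A where A: "fps_conv_radius A \<ge> 1" "\<And>n. fps_nth A n \<in> Zl" "\<And>x. norm x < 1 \<Longrightarrow> F x = eval_fps A x"
    by blast
  have "(\<lambda>n. fps_nth A n * x ^ n) sums F x" if "norm x < 1" for x
  proof -
    have "ereal (norm x) < fps_conv_radius A"
      using that A(1) by (metis ereal_less(3) less_le_trans one_ereal_def)
    then show ?thesis using A(3)[OF that] sums_eval_fps by metis
  qed
  then show "Fl F" unfolding Fl_def using A(2) by blast
qed

lemma norm_less_fps_conv_radius:
  assumes "fps_conv_radius (A :: complex fps) \<ge> 1" "norm x < 1"
  shows "ereal (norm x) < fps_conv_radius A"
  using assms by (metis ereal_less(3) less_le_trans one_ereal_def)

lemma Fl_holomorphic: "Fl F \<Longrightarrow> F holomorphic_on ball 0 1"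
proof -
  assume "Fl F"
  then obtain A where A: "fps_conv_radius A \<ge> 1" "\<And>x. norm x < 1 \<Longrightarrow> F x = eval_fps A x"
    unfolding Fl_fps_iff by blast
  have "eval_fps A holomorphic_on ball 0 1"
    by (rule holomorphic_on_eval_fps) (use norm_less_fps_conv_radius[OF A(1)] in auto)
  then show ?thesis by (rule holomorphic_transform) (use A(2) in auto)
qed

lemma FlI_deriv:
  assumes "F holomorphic_on ball 0 1" "\<And>n. (deriv ^^ n) F 0 / fact n \<in> Zl"
  shows "Fl F"
  unfolding Fl_def
  using holomorphic_power_series[OF assms(1)] assms(2)
  by (intro exI[of _ "\<lambda>n. (deriv ^^ n) F 0 / fact n"]) auto

lemma Fl_const: "c \<in> Zl \<Longrightarrow> Fl (\<lambda>x. c)"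
  unfolding Fl_fps_iff by (rule exI[of _ "fps_const c"]) (auto intro: Zl_intros)

lemma Fl_ident: "Fl (\<lambda>x. x)"
  unfolding Fl_fps_iff by (rule exI[of _ fps_X]) (auto simp: fps_X_nth intro: Zl_intros)

lemma fps_Zl_subring: "csubring {A :: complex fps. \<forall>n. fps_nth A n \<in> Zl}"
  unfolding csubring_def
  by (auto simp: fps_mult_nth intro!: csubring_sum[OF Zl_subring] csubring_mult[OF Zl_subring]
        csubring_diff[OF Zl_subring] csubring_1[OF Zl_subring] csubring_0[OF Zl_subring])

lemma
  assumes "Fl F" "Fl G"
  shows Fl_diff: "Fl (\<lambda>x. F x - G x)" and Fl_mult: "Fl (\<lambda>x. F x * G x)"
proof -
  obtain A where A: "fps_conv_radius A \<ge> 1" "\<And>n. fps_nth A n \<in> Zl" "\<And>x. norm x < 1 \<Longrightarrow> F x = eval_fps A x"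
    using assms(1) unfolding Fl_fps_iff by blast
  obtain B where B: "fps_conv_radius B \<ge> 1" "\<And>n. fps_nth B n \<in> Zl" "\<And>x. norm x < 1 \<Longrightarrow> G x = eval_fps B x"
    using assms(2) unfolding Fl_fps_iff by blast
  have r: "ereal (norm x) < fps_conv_radius A" "ereal (norm x) < fps_conv_radius B" if "norm x < 1" for x :: complex
    using norm_less_fps_conv_radius that A B by auto
  have AB: "A \<in> {A. \<forall>n. fps_nth A n \<in> Zl}" "B \<in> {A. \<forall>n. fps_nth A n \<in> Zl}" using A B by auto
  show "Fl (\<lambda>x. F x - G x)"
    unfolding Fl_fps_iff
    by (rule exI[of _ "A - B"])
       (use A B r csubring_diff[OF fps_Zl_subring AB] order_trans[OF _ fps_conv_radius_diff[of A B]]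
         in \<open>auto simp: eval_fps_diff\<close>)
  show "Fl (\<lambda>x. F x * G x)"
    unfolding Fl_fps_iff
    by (rule exI[of _ "A * B"])
       (use A B r csubring_mult[OF fps_Zl_subring AB] order_trans[OF _ fps_conv_radius_mult[of A B]]
         in \<open>auto simp: eval_fps_mult\<close>)
qed

lemma Fl_uminus: "Fl F \<Longrightarrow> Fl (\<lambda>x. - F x)"
  using Fl_diff[OF Fl_const[OF csubring_0[OF Zl_subring]]] by simp

lemma Fl_add: "Fl F \<Longrightarrow> Fl G \<Longrightarrow> Fl (\<lambda>x. F x + G x)"
  using Fl_diff[OF _ Fl_uminus] by simp

lemma Fl_power: "Fl F \<Longrightarrow> Fl (\<lambda>x. F x ^ n)"
  by (induction n) (auto intro: Fl_mult Fl_const csubring_1[OF Zl_subring])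

lemma Fl_sum: "(\<And>i. i \<in> I \<Longrightarrow> Fl (F i)) \<Longrightarrow> Fl (\<lambda>x. \<Sum>i\<in>I. F i x)"
  by (induction I rule: infinite_finite_induct) (auto intro: Fl_add Fl_const csubring_0[OF Zl_subring])

text \<open>Absence of zeros gives convergence of the reciprocal on the whole disc, and constant
  term 1 makes the recursion for its coefficients free of division.\<close>

lemma Fl_inverse:
  assumes F: "Fl F" and nz: "\<And>x. norm x < 1 \<Longrightarrow> F x \<noteq> 0" and F0: "F 0 = 1"
  shows "Fl (\<lambda>x. 1 / F x)"
proof -
  obtain A where A: "fps_conv_radius A \<ge> 1" "\<And>n. fps_nth A n \<in> Zl" "\<And>x. norm x < 1 \<Longrightarrow> F x = eval_fps A x"
    using F unfolding Fl_fps_iff by blast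
  have A0: "fps_nth A 0 = 1" using A(3)[of 0] F0 by (simp add: eval_fps_at_0)
  have hol: "(\<lambda>x. 1 / F x) holomorphic_on ball 0 1"
    by (intro holomorphic_intros Fl_holomorphic[OF F]) (use nz in auto)
  define b where "b = (\<lambda>n. (deriv ^^ n) (\<lambda>x. 1 / F x) 0 / fact n)"
  have b: "(\<lambda>n. b n * x ^ n) sums (1 / F x)" if "norm x < 1" for x
    using holomorphic_power_series[OF hol, of x] that by (simp add: b_def)
  define B where "B = Abs_fps b"
  have rB: "fps_conv_radius B \<ge> 1"
    unfolding fps_conv_radius_def B_def
  proof (rule conv_radius_geI_ex)
    fix r :: real assume "0 < r" "ereal r < 1"
    then show "\<exists>z. norm z = r \<and> summable (\<lambda>n. fps_nth (Abs_fps b) n * z ^ n)"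
      using b[of "of_real r"] by (intro exI[of _ "of_real r"]) (auto simp: sums_iff)
  qed
  have evB: "eval_fps B x = 1 / F x" if "norm x < 1" for x
    using b[OF that] by (simp add: eval_fps_def B_def sums_iff)
  have "A * B = 1"
  proof (rule eval_fps_eqD)
    have "(0::ereal) < 1" by simp
    also have "1 \<le> min (fps_conv_radius A) (fps_conv_radius B)" using A(1) rB by simp
    also have "\<dots> \<le> fps_conv_radius (A * B)" by (rule fps_conv_radius_mult)
    finally show "fps_conv_radius (A * B) > 0" .
    have "eventually (\<lambda>z::complex. z \<in> ball 0 1) (nhds 0)" by (rule eventually_nhds_in_open) auto
    then show "\<forall>\<^sub>F z in nhds 0. eval_fps (A * B) z = eval_fps 1 z"
    proof eventually_elim
      case (elim z)
      then have z: "norm z < 1" by simp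
      then show ?case
        using A(1,3) rB evB[OF z] nz[OF z] by (simp add: eval_fps_mult norm_less_fps_conv_radius)
    qed
  qed auto
  then have AB: "(\<Sum>i=0..n. fps_nth A i * fps_nth B (n - i)) = (if n = 0 then 1 else 0)" for n
    by (metis fps_mult_nth fps_one_nth)
  have "fps_nth B n \<in> Zl" for n
  proof (induction n rule: less_induct)
    case (less n)
    have "(\<Sum>i=0..n. fps_nth A i * fps_nth B (n - i)) = fps_nth B n + (\<Sum>i=1..n. fps_nth A i * fps_nth B (n - i))"
      by (simp add: sum.atLeast_Suc_atMost A0)
    then have "fps_nth B n = (if n = 0 then 1 else 0) - (\<Sum>i=1..n. fps_nth A i * fps_nth B (n - i))"
      using AB[of n] by (simp add: algebra_simps)
    also have "\<dots> \<in> Zl"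
      using less A(2) by (intro csubring_diff[OF Zl_subring] csubring_sum[OF Zl_subring] csubring_mult[OF Zl_subring])
         (auto intro: Zl_intros)
    finally show ?case .
  qed
  then show ?thesis
    unfolding Fl_fps_iff using rB evB by (intro exI[of _ B]) auto
qed

lemma Fl_compose_power:
  assumes "Fl F" "k > 0"
  shows "Fl (\<lambda>x. F (x ^ k))"
proof -
  obtain a where a: "\<And>n. a n \<in> Zl" "\<And>x. norm x < 1 \<Longrightarrow> (\<lambda>n. a n * x ^ n) sums F x"
    using assms unfolding Fl_def by blast
  define b where "b = (\<lambda>n. if k dvd n then a (n div k) else 0)"
  have "(\<lambda>n. b n * x ^ n) sums F (x ^ k)" if "norm x < 1" for x
  proof -
    have "norm (x ^ k) < 1" using that assms(2) by (simp add: norm_power power_less_one_iff)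
    then have "(\<lambda>n. a n * (x ^ k) ^ n) sums F (x ^ k)" by (rule a(2))
    moreover have "(\<lambda>n. a n * (x ^ k) ^ n) = (\<lambda>n. b (k * n) * x ^ (k * n))"
      using assms(2) by (auto simp: b_def power_mult)
    ultimately have "(\<lambda>n. b (k * n) * x ^ (k * n)) sums F (x ^ k)" by simp
    then show ?thesis
      by (subst (asm) sums_mono_reindex[of "\<lambda>n. k * n" "\<lambda>n. b n * x ^ n"])
         (use assms(2) in \<open>auto simp: strict_mono_def b_def\<close>)
  qed
  then show ?thesis
    unfolding Fl_def using a(1) by (intro exI[of _ b]) (auto simp: b_def intro: Zl_intros)
qed

lemma Fl_factor_x:
  assumes "Fl F" "F 0 = 0"
  obtains H where "Fl H" "\<And>x. norm x < 1 \<Longrightarrow> F x = x * H x"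
proof -
  obtain A where A: "fps_conv_radius A \<ge> 1" "\<And>n. fps_nth A n \<in> Zl" "\<And>x. norm x < 1 \<Longrightarrow> F x = eval_fps A x"
    using assms(1) unfolding Fl_fps_iff by blast
  have A0: "fps_nth A 0 = 0" using A(3)[of 0] assms(2) by (simp add: eval_fps_at_0)
  show thesis
  proof
    show "Fl (eval_fps (fps_shift 1 A))"
      unfolding Fl_fps_iff using A by (intro exI[of _ "fps_shift 1 A"]) auto
    fix x :: complex assume x: "norm x < 1"
    show "F x = x * eval_fps (fps_shift 1 A) x"
    proof (cases "x = 0")
      case False
      define S where "S = fps_shift 1 A"
      have AS: "A = fps_X * S"
        by (rule fps_ext) (auto simp: A0 S_def)
      have "eval_fps (fps_X * S) x = eval_fps fps_X x * eval_fps S x"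
        by (rule eval_fps_mult) (use norm_less_fps_conv_radius[OF A(1) x] in \<open>auto simp: S_def\<close>)
      then have "eval_fps A x = x * eval_fps (fps_shift 1 A) x"
        by (simp add: AS [symmetric]) (simp add: S_def)
      then show ?thesis using A(3)[OF x] by simp
    qed (use assms in simp)
  qed
qed

text \<open>Each Taylor coefficient of the limit is a limit of integers, and the integers are
  closed.\<close>

lemma Fl_uniform_limitI:
  assumes hol: "F holomorphic_on ball 0 1"
    and lim: "uniform_limit (cball 0 (1/2)) (\<lambda>N. poly (p N)) F sequentially"
    and int: "\<And>N n. Polynomial.coeff (p N) n \<in> \<int>"
  shows "Fl F"
proof (rule FlI_deriv[OF hol])
  fix n
  have "((\<lambda>N. (deriv ^^ n) (poly (p N)) 0) \<longlongrightarrow> (deriv ^^ n) F 0) sequentially"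
  proof (rule higher_deriv_complex_uniform_limit)
    show "uniform_limit (ball 0 (1/2)) (\<lambda>N. poly (p N)) F sequentially"
      by (rule uniform_limit_on_subset[OF lim]) auto
    show "\<forall>\<^sub>F N in sequentially. poly (p N) holomorphic_on ball 0 (1/2)"
      by (intro always_eventually allI poly_holomorphic_on holomorphic_on_ident)
  qed auto
  then have "((\<lambda>N. (deriv ^^ n) (poly (p N)) 0 / fact n) \<longlongrightarrow> (deriv ^^ n) F 0 / fact n) sequentially"
    by (intro tendsto_divide tendsto_const) auto
  moreover have "(deriv ^^ n) (poly (p N)) 0 / fact n \<in> \<int>" for N
  proof -
    have "eval_fps (fps_of_poly (p N)) = poly (p N)" by (rule ext) simp
    then show ?thesis
      using fps_nth_conv_deriv[of "fps_of_poly (p N)" n] int[of N n] by simp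
  qed
  ultimately have "(deriv ^^ n) F 0 / fact n \<in> \<int>"
    by (rule Lim_in_closed_set[OF closed_Ints always_eventually[OF allI], rotated -1]) auto
  then show "(deriv ^^ n) F 0 / fact n \<in> Zl" by (auto simp: Ints_def intro: Zl_intros)
qed

lemma Fl_qpoch:
  assumes "a > 0"
  shows "Fl (\<lambda>x. qpoch (x ^ a) (x ^ 5))"
proof (rule Fl_uniform_limitI)
  define p :: "nat \<Rightarrow> complex poly" where "p = (\<lambda>N. \<Prod>n<N. (1 - Polynomial.monom 1 (a + 5 * n)))"
  have "norm (x ^ 5) < 1" if "norm x < 1" for x :: complex
    using that by (simp add: norm_power power_less_one_iff)
  then show "(\<lambda>x. qpoch (x ^ a) (x ^ 5)) holomorphic_on ball 0 1"
    by (intro holomorphic_intros) auto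
  have "uniform_limit (cball 0 (1/2)) (\<lambda>N x. \<Prod>n<N. 1 - x ^ a * (x ^ 5) ^ n) (\<lambda>x. qpoch (x ^ a) (x ^ 5)) sequentially"
  proof (rule qpoch_uniform_limit)
    fix x :: complex assume "x \<in> cball 0 (1/2)"
    then have "norm x < 1" by simp
    then show "norm (x ^ 5) < 1" by (simp add: norm_power power_less_one_iff)
  qed (auto intro!: continuous_intros)
  moreover have "poly (p N) x = (\<Prod>n<N. 1 - x ^ a * (x ^ 5) ^ n)" for N x
    by (simp add: p_def poly_prod poly_monom power_add power_mult)
  then have "(\<lambda>N. poly (p N)) = (\<lambda>N x. \<Prod>n<N. 1 - x ^ a * (x ^ 5) ^ n)" by (intro ext)
  ultimately show "uniform_limit (cball 0 (1/2)) (\<lambda>N. poly (p N)) (\<lambda>x. qpoch (x ^ a) (x ^ 5)) sequentially"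
    by simp
  show "Polynomial.coeff (p N) n \<in> \<int>" for N n
  proof (induction N arbitrary: n)
    case (Suc N)
    have "Polynomial.coeff (p (Suc N)) n = (\<Sum>i\<le>n. Polynomial.coeff (p N) i * Polynomial.coeff (1 - Polynomial.monom 1 (a + 5 * N)) (n - i))"
      by (simp add: p_def coeff_mult)
    also have "\<dots> \<in> \<int>" by (intro Ints_sum Ints_mult Suc) auto
    finally show ?case .
  qed (auto simp: p_def)
qed

text \<open>Summing over the l-th roots of unity keeps the coefficients whose index is divisible by
  l and multiplies them by l; \<open>H\<close> is the image under the operator \<open>U_l\<close>.
  This is the source of all divisibility by l in sums over the superlattices
  \<open>lat (sup_pt l \<tau> j)\<close>.\<close>

lemma Fl_sum_roots_of_unity:
  assumes "Fl F"
  obtains H where "Fl H" "\<And>y. norm y < 1 \<Longrightarrow> (\<Sum>j<l. F (ee (of_nat j / of_nat l) * y)) = of_nat l * H (y ^ l)"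
proof -
  obtain a where a: "\<And>n. a n \<in> Zl" "\<And>x. norm x < 1 \<Longrightarrow> (\<lambda>n. a n * x ^ n) sums F x"
    using assms unfolding Fl_def by blast
  define H where "H = (\<lambda>x. (\<Sum>n. a (l * n) * x ^ n))"
  have root: "(\<Sum>j<l. ee (of_nat j / of_nat l) ^ n) = (if l dvd n then of_nat l else 0)" for n
  proof -
    have eq: "ee (of_nat j / of_nat l) ^ n = ee (of_nat n / of_nat l) ^ j" for j
      by (simp add: mult.commute flip: ee_of_nat_mult)
    show ?thesis
    proof (cases "l dvd n")
      case True
      then obtain m where "n = l * m" by blast
      then have "ee (of_nat n / of_nat l) = 1" using l_pos ee_of_int[of "int m"] by simp
      then show ?thesis using True by (simp add: eq)
    next
      case False
      have "ee (of_nat n / of_nat l) \<noteq> 1"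
      proof
        assume "ee (of_nat n / of_nat l) = 1"
        then obtain m where "of_nat n / of_nat l = (of_int m :: complex)" by (auto simp: ee_eq_1_iff Ints_def)
        then have "(of_int (int n) :: complex) = of_int (m * int l)" using l_pos by (simp add: field_simps)
        then have "int n = m * int l" by (simp only: of_int_eq_iff)
        then show False using False by (metis dvd_triv_right int_dvd_int_iff)
      qed
      moreover have "ee (of_nat n / of_nat l) ^ l = 1"
        using l_pos ee_of_int[of "int n"] by (simp flip: ee_of_nat_mult)
      ultimately show ?thesis using False by (simp add: eq geometric_sum)
    qed
  qed
  have key: "(\<lambda>n. a (l * n) * (y ^ l) ^ n) sums ((\<Sum>j<l. F (ee (of_nat j / of_nat l) * y)) / of_nat l)"
    if y: "norm y < 1" for y
  proof -
    have "norm (ee (of_nat j / of_nat l) * y) < 1" for j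
      using y by (simp add: norm_mult norm_ee)
    then have "(\<lambda>n. \<Sum>j<l. a n * (ee (of_nat j / of_nat l) * y) ^ n) sums (\<Sum>j<l. F (ee (of_nat j / of_nat l) * y))"
      by (intro sums_sum a(2))
    moreover have "(\<Sum>j<l. a n * (ee (of_nat j / of_nat l) * y) ^ n) =
        (if l dvd n then of_nat l * (a n * y ^ n) else 0)" for n
    proof -
      have "(\<Sum>j<l. a n * (ee (of_nat j / of_nat l) * y) ^ n) = a n * y ^ n * (\<Sum>j<l. ee (of_nat j / of_nat l) ^ n)"
        by (simp add: power_mult_distrib sum_distrib_left mult_ac)
      then show ?thesis by (simp add: root)
    qed
    ultimately have "(\<lambda>n. if l dvd n then of_nat l * (a n * y ^ n) else 0) sums (\<Sum>j<l. F (ee (of_nat j / of_nat l) * y))"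
      by simp
    then have "(\<lambda>n. (if l dvd n then of_nat l * (a n * y ^ n) else 0) / of_nat l) sums
        ((\<Sum>j<l. F (ee (of_nat j / of_nat l) * y)) / of_nat l)" by (rule sums_divide)
    moreover have "(\<lambda>n. (if l dvd n then of_nat l * (a n * y ^ n) else 0) / of_nat l) =
        (\<lambda>n. if l dvd n then a n * y ^ n else 0)" using l_pos by auto
    ultimately have *: "(\<lambda>n. if l dvd n then a n * y ^ n else 0) sums
        ((\<Sum>j<l. F (ee (of_nat j / of_nat l) * y)) / of_nat l)" by simp
    have sm: "strict_mono (\<lambda>n. l * n)" using l_pos by (simp add: strict_mono_def)
    have z: "(if l dvd n then a n * y ^ n else 0) = 0" if "n \<notin> range (\<lambda>n. l * n)" for n
      using that by (auto simp: image_iff elim!: dvdE)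
    from sums_mono_reindex[of "\<lambda>n. l * n" "\<lambda>n. if l dvd n then a n * y ^ n else 0", OF sm z] *
    have "(\<lambda>n. if l dvd l * n then a (l * n) * y ^ (l * n) else 0) sums
        ((\<Sum>j<l. F (ee (of_nat j / of_nat l) * y)) / of_nat l)" by blast
    then show ?thesis by (simp add: power_mult)
  qed
  have "(\<lambda>n. a (l * n) * x ^ n) sums H x" if "norm x < 1" for x
  proof -
    have "\<exists>y. y ^ l = x"
    proof (cases "x = 0")
      case False
      then have "exp (Ln x / of_nat l) ^ l = x" using l_pos by (simp flip: exp_of_nat_mult)
      then show ?thesis by blast
    qed (use l_pos in auto)
    then obtain y where y: "y ^ l = x" by blast
    then have "norm y ^ l < 1" using that by (metis norm_power)
    then have "norm y < 1" using l_pos by (simp add: power_less_one_iff)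
    then show ?thesis using key[of y] y by (simp add: H_def sums_iff)
  qed
  then have "Fl H" unfolding Fl_def using a(1) by (intro exI[of _ "\<lambda>n. a (l * n)"]) auto
  moreover have "(\<Sum>j<l. F (ee (of_nat j / of_nat l) * y)) = of_nat l * H (y ^ l)" if "norm y < 1" for y
    using key[OF that] l_pos by (simp add: H_def sums_iff field_simps)
  ultimately show thesis using that by blast
qed

text \<open>Modulo l the l-th power is additive on power series and fixes coefficients by Fermat, so
  A(x)^l agrees with A(x^l). The argument runs on truncations, since coefficient n of the power
  depends only on coefficients up to n.\<close>

lemma fps_frobenius:
  fixes A :: "complex fps"
  assumes A: "\<And>n. fps_nth A n \<in> Zl"
  shows "\<exists>c\<in>Zl. fps_nth (A ^ l) n = (if l dvd n then fps_nth A (n div l) else 0) + of_nat l * c"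
proof -
  define J where "J = {A :: complex fps. \<forall>n. fps_nth A n \<in> Zl}"
  have J: "csubring J" unfolding J_def by (rule fps_Zl_subring)
  define T where "T = (\<lambda>N. \<Sum>i<N. fps_const (fps_nth A i) * fps_X ^ i)"
  have cJ: "fps_const c \<in> J" if "c \<in> Zl" for c
    using that by (auto simp: J_def intro: Zl_intros)
  have XJ: "fps_X \<in> J" by (auto simp: J_def fps_X_nth intro: Zl_intros)
  have T: "\<exists>B\<in>J. T N ^ l = (\<Sum>i<N. fps_const (fps_nth A i) * fps_X ^ (l * i)) + of_nat l * B" for N
  proof (induction N)
    case 0
    then show ?case using l_pos csubring_0[OF J] by (intro bexI[of _ 0]) (auto simp: T_def)
  next
    case (Suc N)
    then obtain B where B: "B \<in> J" "T N ^ l = (\<Sum>i<N. fps_const (fps_nth A i) * fps_X ^ (l * i)) + of_nat l * B" by blast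
    define t where "t = fps_const (fps_nth A N) * fps_X ^ N"
    have tJ: "t \<in> J" "T N \<in> J"
      unfolding t_def T_def
      by (auto intro!: csubring_mult[OF J] csubring_power[OF J] csubring_sum[OF J] cJ XJ A)
    obtain C where C: "C \<in> J" "(T N + t) ^ l = T N ^ l + t ^ l + of_nat l * C"
      using csubring_freshman[OF J prime_l tJ(2,1)] by blast
    obtain c where c: "c \<in> Zl" "fps_nth A N ^ l = fps_nth A N + of_nat l * c" using Zl_fermat[OF A] by blast
    have "t ^ l = fps_const (fps_nth A N ^ l) * fps_X ^ (l * N)"
      by (simp add: t_def power_mult_distrib fps_const_power mult.commute flip: power_mult)
    also have "fps_const (fps_nth A N ^ l) = fps_const (fps_nth A N) + of_nat l * fps_const c"
      unfolding c(2) by (simp add: fps_of_nat [symmetric])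
    finally have "t ^ l = fps_const (fps_nth A N) * fps_X ^ (l * N) + of_nat l * (fps_const c * fps_X ^ (l * N))"
      by (simp add: algebra_simps)
    then have "T (Suc N) ^ l = (\<Sum>i<Suc N. fps_const (fps_nth A i) * fps_X ^ (l * i)) +
        of_nat l * (B + fps_const c * fps_X ^ (l * N) + C)"
      using C(2) B(2) by (simp add: T_def t_def algebra_simps)
    moreover have "B + fps_const c * fps_X ^ (l * N) + C \<in> J"
      using B C c by (intro csubring_add[OF J] csubring_mult[OF J] csubring_power[OF J] cJ XJ)
    ultimately show ?case by blast
  qed
  define N where "N = Suc n"
  obtain B where B: "B \<in> J" "T N ^ l = (\<Sum>i<N. fps_const (fps_nth A i) * fps_X ^ (l * i)) + of_nat l * B"
    using T[of N] by blast
  have "fps_cutoff N A = fps_cutoff N (T N)"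
  proof (rule fps_ext)
    fix k
    have "fps_nth (T N) k = (\<Sum>i<N. if k = i then fps_nth A i else 0)"
      by (simp add: T_def fps_sum_nth fps_X_power_iff if_distrib cong: if_cong)
    also have "\<dots> = (if k < N then fps_nth A k else 0)" by (simp add: sum.delta)
    finally show "fps_nth (fps_cutoff N A) k = fps_nth (fps_cutoff N (T N)) k" by simp
  qed
  \<comment> \<open>Below degree \<open>N\<close> the series and its truncation have the same
    powers.\<close>
  have pw: "fps_nth (A ^ m) k = fps_nth (T N ^ m) k" if "k < N" for m k
    using that
  proof (induction m arbitrary: k)
    case (Suc m)
    have "fps_nth A i = fps_nth (T N) i" if "i < N" for i
      using \<open>fps_cutoff N A = fps_cutoff N (T N)\<close> that by (metis fps_cutoff_nth)
    then show ?case using Suc by (auto simp: fps_mult_nth intro!: sum.cong)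
  qed simp
  have "fps_nth (A ^ l) n = fps_nth (T N ^ l) n" by (rule pw) (simp add: N_def)
  also have "\<dots> = (\<Sum>i<N. if n = l * i then fps_nth A i else 0) + of_nat l * fps_nth B n"
    unfolding B(2) by (simp add: fps_sum_nth fps_X_power_iff if_distrib fps_of_nat [symmetric] cong: if_cong)
  also have "(\<Sum>i<N. if n = l * i then fps_nth A i else 0) = (if l dvd n then fps_nth A (n div l) else 0)"
  proof (cases "l dvd n")
    case True
    then obtain m where m: "n = l * m" by blast
    have "m < N" using l_pos by (cases l) (auto simp: N_def m)
    have "(\<Sum>i<N. if n = l * i then fps_nth A i else 0) = (\<Sum>i<N. if i = m then fps_nth A i else 0)"
      using l_pos by (intro sum.cong) (auto simp: m)
    also have "\<dots> = fps_nth A m" using \<open>m < N\<close> by (simp add: sum.delta)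
    finally show ?thesis using True l_pos m by simp
  qed (auto intro!: sum.neutral)
  finally show ?thesis using B(1) by (auto simp: J_def)
qed

lemma Fl_frobenius:
  assumes "Fl F"
  obtains H where "Fl H" "\<And>x. norm x < 1 \<Longrightarrow> F x ^ l = F (x ^ l) + of_nat l * H x"
proof -
  obtain A where A: "fps_conv_radius A \<ge> 1" "\<And>n. fps_nth A n \<in> Zl" "\<And>x. norm x < 1 \<Longrightarrow> F x = eval_fps A x"
    using assms unfolding Fl_fps_iff by blast
  obtain c where c: "\<And>n. c n \<in> Zl"
    "\<And>n. fps_nth (A ^ l) n = (if l dvd n then fps_nth A (n div l) else 0) + of_nat l * c n"
    using fps_frobenius[OF A(2)] by metis
  define H where "H = (\<lambda>x. (F x ^ l - F (x ^ l)) / of_nat l)"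
  have "(\<lambda>n. c n * x ^ n) sums H x" if x: "norm x < 1" for x
  proof -
    have r: "ereal (norm x) < fps_conv_radius A" by (rule norm_less_fps_conv_radius[OF A(1) x])
    have "(\<lambda>n. fps_nth (A ^ l) n * x ^ n) sums eval_fps (A ^ l) x"
      by (rule sums_eval_fps) (use r fps_conv_radius_power[of A l] in auto)
    also have "eval_fps (A ^ l) x = F x ^ l" using A(3)[OF x] eval_fps_power[OF r] by simp
    finally have 1: "(\<lambda>n. fps_nth (A ^ l) n * x ^ n) sums (F x ^ l)" .
    have xl: "norm (x ^ l) < 1" using x l_pos by (simp add: norm_power power_less_one_iff)
    have "(\<lambda>n. fps_nth A n * (x ^ l) ^ n) sums F (x ^ l)"
      using sums_eval_fps[OF norm_less_fps_conv_radius[OF A(1) xl]] A(3)[OF xl] by simp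
    then have "(\<lambda>n. (if l dvd l * n then fps_nth A (l * n div l) else 0) * x ^ (l * n)) sums F (x ^ l)"
      using l_pos by (simp add: power_mult)
    then have 2: "(\<lambda>n. (if l dvd n then fps_nth A (n div l) else 0) * x ^ n) sums F (x ^ l)"
      using l_pos
      by (subst (asm) sums_mono_reindex[of "\<lambda>n. l * n" "\<lambda>n. (if l dvd n then fps_nth A (n div l) else 0) * x ^ n"])
         (auto simp: strict_mono_def image_iff elim!: dvdE)
    have "(\<lambda>n. (fps_nth (A ^ l) n * x ^ n - (if l dvd n then fps_nth A (n div l) else 0) * x ^ n) / of_nat l) sums H x"
      unfolding H_def by (intro sums_divide sums_diff 1 2)
    moreover have "(fps_nth (A ^ l) n * x ^ n - (if l dvd n then fps_nth A (n div l) else 0) * x ^ n) / of_nat l = c n * x ^ n" for n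
      using l_pos unfolding c(2) by (simp add: field_simps)
    ultimately show ?thesis by simp
  qed
  then have "Fl H" unfolding Fl_def using c(1) by blast
  moreover have "F x ^ l = F (x ^ l) + of_nat l * H x" for x
    using l_pos by (simp add: H_def)
  ultimately show thesis using that by blast
qed

end

section \<open>Expansions at the cusps\<close>

text \<open>Boundedness is required on every half plane Im \<tau> \<ge> \<epsilon> and not just near
  infinity, which makes the notion stable under \<tau> -> a \<tau> + b with small a > 0, as in
  passing to \<open>sup_pt\<close>.\<close>

definition BH :: "(complex \<Rightarrow> complex) \<Rightarrow> bool" where
  "BH g \<longleftrightarrow> g holomorphic_on {\<tau>. Im \<tau> > 0} \<and> (\<forall>\<epsilon>>0. \<exists>C. \<forall>\<tau>. Im \<tau> \<ge> \<epsilon> \<longrightarrow> norm (g \<tau>) \<le> C)"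

lemma BH_holomorphic: "BH g \<Longrightarrow> g holomorphic_on {\<tau>. Im \<tau> > 0}"
  by (simp add: BH_def)

lemma BH_bound:
  assumes "BH g" "\<epsilon> > 0"
  obtains C where "\<And>\<tau>. Im \<tau> \<ge> \<epsilon> \<Longrightarrow> norm (g \<tau>) \<le> C"
  using assms unfolding BH_def by blast

lemma BH_cong: "BH g \<Longrightarrow> (\<And>\<tau>. Im \<tau> > 0 \<Longrightarrow> g \<tau> = h \<tau>) \<Longrightarrow> BH h"
  unfolding BH_def by (auto elim: holomorphic_transform)

lemma BH_const: "BH (\<lambda>\<tau>. c)"
  by (auto simp: BH_def)

lemma
  assumes g: "BH g" and h: "BH h"
  shows BH_diff: "BH (\<lambda>\<tau>. g \<tau> - h \<tau>)" and BH_add: "BH (\<lambda>\<tau>. g \<tau> + h \<tau>)"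
    and BH_mult: "BH (\<lambda>\<tau>. g \<tau> * h \<tau>)"
proof -
  have "\<exists>C. \<forall>\<tau>. Im \<tau> \<ge> \<epsilon> \<longrightarrow> norm (g \<tau> - h \<tau>) \<le> C \<and> norm (g \<tau> + h \<tau>) \<le> C"
    "\<exists>C. \<forall>\<tau>. Im \<tau> \<ge> \<epsilon> \<longrightarrow> norm (g \<tau> * h \<tau>) \<le> C" if e: "\<epsilon> > 0" for \<epsilon>
  proof -
    obtain C1 where C1: "\<And>\<tau>. Im \<tau> \<ge> \<epsilon> \<Longrightarrow> norm (g \<tau>) \<le> C1" using BH_bound[OF g e] by blast
    obtain C2 where C2: "\<And>\<tau>. Im \<tau> \<ge> \<epsilon> \<Longrightarrow> norm (h \<tau>) \<le> C2" using BH_bound[OF h e] by blast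
    show "\<exists>C. \<forall>\<tau>. Im \<tau> \<ge> \<epsilon> \<longrightarrow> norm (g \<tau> - h \<tau>) \<le> C \<and> norm (g \<tau> + h \<tau>) \<le> C"
    proof (intro exI[of _ "C1 + C2"] allI impI conjI)
      fix \<tau> assume t: "Im \<tau> \<ge> \<epsilon>"
      show "norm (g \<tau> - h \<tau>) \<le> C1 + C2"
        using norm_triangle_ineq4[of "g \<tau>" "h \<tau>"] C1[OF t] C2[OF t] by linarith
      show "norm (g \<tau> + h \<tau>) \<le> C1 + C2"
        using norm_triangle_ineq[of "g \<tau>" "h \<tau>"] C1[OF t] C2[OF t] by linarith
    qed
    show "\<exists>C. \<forall>\<tau>. Im \<tau> \<ge> \<epsilon> \<longrightarrow> norm (g \<tau> * h \<tau>) \<le> C"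
    proof (intro exI[of _ "C1 * C2"] allI impI)
      fix \<tau> assume t: "Im \<tau> \<ge> \<epsilon>"
      show "norm (g \<tau> * h \<tau>) \<le> C1 * C2"
        using C1[OF t] C2[OF t] order_trans[OF norm_ge_zero C1[OF t]] unfolding norm_mult
        by (intro mult_mono) auto
    qed
  qed
  then show "BH (\<lambda>\<tau>. g \<tau> - h \<tau>)" "BH (\<lambda>\<tau>. g \<tau> + h \<tau>)" "BH (\<lambda>\<tau>. g \<tau> * h \<tau>)"
    using g h unfolding BH_def by (auto intro!: holomorphic_intros) blast+
qed

lemma BH_power: "BH g \<Longrightarrow> BH (\<lambda>\<tau>. g \<tau> ^ n)"
  by (induction n) (auto intro: BH_const BH_mult)

lemma BH_sum: "(\<And>i. i \<in> I \<Longrightarrow> BH (g i)) \<Longrightarrow> BH (\<lambda>\<tau>. \<Sum>i\<in>I. g i \<tau>)"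
  by (induction I rule: infinite_finite_induct) (auto intro: BH_const BH_add)

lemma BH_prod: "(\<And>i. i \<in> I \<Longrightarrow> BH (g i)) \<Longrightarrow> BH (\<lambda>\<tau>. \<Prod>i\<in>I. g i \<tau>)"
  by (induction I rule: infinite_finite_induct) (auto intro: BH_const BH_mult)

lemma BH_compose_ee:
  assumes "F holomorphic_on ball 0 1"
  shows "BH (\<lambda>\<tau>. F (ee (\<tau> / 5)))"
proof -
  have "(\<lambda>\<tau>. F (ee (\<tau> / 5))) holomorphic_on {\<tau>. Im \<tau> > 0}"
    by (rule holomorphic_on_compose_gen[OF _ assms, unfolded o_def])
       (auto intro!: holomorphic_intros norm_ee_less_1)
  moreover have "\<exists>C. \<forall>\<tau>. Im \<tau> \<ge> \<epsilon> \<longrightarrow> norm (F (ee (\<tau> / 5))) \<le> C" if e: "\<epsilon> > 0" for \<epsilon>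
  proof -
    define r where "r = exp (- 2 * pi * (\<epsilon> / 5))"
    have "r < 1" using e by (simp add: r_def)
    then have "continuous_on (cball 0 r) F"
      using assms by (intro holomorphic_on_imp_continuous_on) (auto intro: holomorphic_on_subset)
    then have "bounded (F ` cball 0 r)"
      by (intro compact_imp_bounded compact_continuous_image compact_cball)
    then obtain C where "\<forall>y\<in>F ` cball 0 r. norm y \<le> C" unfolding bounded_iff by blast
    then have C: "\<And>x. x \<in> cball 0 r \<Longrightarrow> norm (F x) \<le> C" by blast
    have "norm (ee (\<tau> / 5)) \<le> r" if "Im \<tau> \<ge> \<epsilon>" for \<tau>
      using that by (simp add: norm_ee r_def)
    then show ?thesis using C by (intro exI[of _ C]) auto
  qed
  ultimately show ?thesis by (auto simp: BH_def)
qed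

lemma BH_subst:
  assumes g: "BH g" and a: "a > 0" and b: "Im b \<ge> 0"
  shows "BH (\<lambda>\<tau>. g (of_real a * \<tau> + b))"
proof -
  have "(\<lambda>\<tau>. g (of_real a * \<tau> + b)) holomorphic_on {\<tau>. Im \<tau> > 0}"
    by (rule holomorphic_on_compose_gen[OF _ BH_holomorphic[OF g], unfolded o_def])
       (use a b in \<open>auto intro!: holomorphic_intros add_pos_nonneg\<close>)
  moreover have "\<exists>C. \<forall>\<tau>. Im \<tau> \<ge> \<epsilon> \<longrightarrow> norm (g (of_real a * \<tau> + b)) \<le> C" if e: "\<epsilon> > 0" for \<epsilon>
  proof -
    have "a * \<epsilon> > 0" using a e by simp
    then obtain C where C: "\<And>\<tau>. Im \<tau> \<ge> a * \<epsilon> \<Longrightarrow> norm (g \<tau>) \<le> C"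
      using BH_bound[OF g] by blast
    have "Im (of_real a * \<tau> + b) \<ge> a * \<epsilon>" if "Im \<tau> \<ge> \<epsilon>" for \<tau>
    proof -
      have "a * \<epsilon> \<le> a * Im \<tau>" using that a by (intro mult_left_mono) auto
      then show ?thesis using b by simp
    qed
    then show ?thesis using C by (intro exI[of _ C]) auto
  qed
  ultimately show ?thesis by (auto simp: BH_def)
qed

text \<open>The two Rogers-Ramanujan products. At x = e(\<tau>/5) they are \<open>kf\<close> at
  \<tau>/5 and 2\<tau>/5 up to powers of exp(\<pi> i \<tau>/5).\<close>

definition thA :: "complex \<Rightarrow> complex" where
  "thA x = qpoch x (x ^ 5) * qpoch (x ^ 4) (x ^ 5)"

definition thB :: "complex \<Rightarrow> complex" where
  "thB x = qpoch (x ^ 2) (x ^ 5) * qpoch (x ^ 3) (x ^ 5)"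

text \<open>The value of \<open>kf\<close> at n/5, with q in place of e(\<tau>).\<close>

definition kc :: "nat \<Rightarrow> complex \<Rightarrow> complex" where
  "kc n q = exp (- (of_real pi * \<i> * (of_nat n / 5))) * qpoch (ee (of_nat n / 5)) q * qpoch (q / ee (of_nat n / 5)) q"

text \<open>\<open>Sc i\<close> and \<open>Nc i\<close> are the zero-free holomorphic parts of the
  two functions at the i-th cusp; \<open>es\<close> and \<open>en\<close> are the monomial parts.
  Thus \<open>sL\<close> has a simple zero at the first cusp, a simple pole at the second, and
  neither at the other two.\<close>

definition Sc :: "nat \<Rightarrow> complex \<Rightarrow> complex" where
  "Sc i x = (if i = 1 then thA x ^ 5 / thB x ^ 5 else if i = 2 then - (thB x ^ 5 / thA x ^ 5)
     else if i = 3 then kc 4 (x ^ 5) * kc 1 (x ^ 5) ^ 4 / kc 2 (x ^ 5) ^ 5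
     else kc 8 (x ^ 5) * kc 2 (x ^ 5) ^ 4 / kc 4 (x ^ 5) ^ 5)"

definition Nc :: "nat \<Rightarrow> complex \<Rightarrow> complex" where
  "Nc i x = qpoch (x ^ 5) (x ^ 5) ^ 2 *
     (if i = 1 then thB x ^ 2 / thA x ^ 3 else if i = 2 then - (thA x ^ 2 / thB x ^ 3)
     else if i = 3 then kc 2 (x ^ 5) ^ 3 / (kc 1 (x ^ 5) ^ 3 * kc 3 (x ^ 5))
     else kc 4 (x ^ 5) ^ 3 / (kc 2 (x ^ 5) ^ 3 * kc 6 (x ^ 5)))"

definition es :: "nat \<Rightarrow> complex \<Rightarrow> complex" where
  "es i x = (if i = 1 then x else if i = 2 then 1 / x else 1)"

definition en :: "nat \<Rightarrow> complex \<Rightarrow> complex" where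
  "en i x = (if i = 2 then x else 1)"

lemma norm_power_less_1: "norm (x::complex) < 1 \<Longrightarrow> k > 0 \<Longrightarrow> norm (x ^ k) < 1"
  by (simp add: norm_power power_less_one_iff)

lemma thA_thB_nonzero:
  assumes "norm x < 1"
  shows "thA x \<noteq> 0" "thB x \<noteq> 0" "qpoch (x ^ 5) (x ^ 5) \<noteq> 0"
proof -
  have "qpoch (x ^ k) (x ^ 5) \<noteq> 0" if "k > 0" for k
    using assms that by (intro qpoch_nonzero norm_power_less_1) auto
  from this[of 1] this[of 2] this[of 3] this[of 4] this[of 5]
  show "thA x \<noteq> 0" "thB x \<noteq> 0" "qpoch (x ^ 5) (x ^ 5) \<noteq> 0"
    by (simp_all add: thA_def thB_def)
qed

lemma kc_nonzero:
  assumes q: "norm q < 1" and n: "\<not> 5 dvd n"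
  shows "kc n q \<noteq> 0"
proof -
  have u: "norm (ee (of_nat n / 5)) = 1" by (simp add: norm_ee)
  have "ee (of_nat n / 5) * q ^ k \<noteq> 1" for k
  proof (cases "k = 0")
    case True
    have "ee (of_nat n / 5) \<noteq> 1"
    proof
      assume "ee (of_nat n / 5) = 1"
      then obtain m where "(of_nat n / 5 :: complex) = of_int m" by (auto simp: ee_eq_1_iff Ints_def)
      then have "(of_int (int n) :: complex) = of_int (5 * m)" by (simp add: field_simps)
      then have "int n = 5 * m" by (simp only: of_int_eq_iff)
      then show False using n by presburger
    qed
    then show ?thesis using True by simp
  next
    case False
    then have "norm (ee (of_nat n / 5) * q ^ k) < 1"
      using norm_power_less_1[OF q, of k] by (simp add: norm_mult u)
    then show ?thesis by auto
  qed
  then have "qpoch (ee (of_nat n / 5)) q \<noteq> 0" using qpoch_eq_0_iff[OF q] by blast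
  moreover have "qpoch (q / ee (of_nat n / 5)) q \<noteq> 0"
    by (rule qpoch_nonzero) (use q in \<open>auto simp: norm_divide u\<close>)
  ultimately show ?thesis by (simp add: kc_def)
qed

lemma Sc_Nc_nonzero:
  assumes "norm x < 1"
  shows "Sc i x \<noteq> 0" "Nc i x \<noteq> 0"
  using thA_thB_nonzero[OF assms] kc_nonzero[OF norm_power_less_1[OF assms]]
  by (auto simp: Sc_def Nc_def)

lemma qpoch_power_holomorphic: "(\<lambda>x. qpoch (x ^ a) (x ^ 5)) holomorphic_on ball 0 1"
  by (intro holomorphic_intros) (auto intro!: norm_power_less_1)

lemma kc_holomorphic: "(\<lambda>x. kc n (x ^ 5)) holomorphic_on ball 0 1"
  unfolding kc_def by (intro holomorphic_intros) (auto intro!: norm_power_less_1)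

lemma Sc_Nc_holomorphic: "Sc i holomorphic_on ball 0 1" "Nc i holomorphic_on ball 0 1"
proof -
  have A: "thA holomorphic_on ball 0 1"
    using holomorphic_on_mult[OF qpoch_power_holomorphic[of 1] qpoch_power_holomorphic[of 4]]
    by (simp add: thA_def [abs_def])
  have B: "thB holomorphic_on ball 0 1"
    using holomorphic_on_mult[OF qpoch_power_holomorphic[of 2] qpoch_power_holomorphic[of 3]]
    by (simp add: thB_def [abs_def])
  have nz: "x \<in> ball 0 1 \<Longrightarrow> thA x \<noteq> 0" "x \<in> ball 0 1 \<Longrightarrow> thB x \<noteq> 0"
    "x \<in> ball 0 1 \<Longrightarrow> \<not> 5 dvd n \<Longrightarrow> kc n (x ^ 5) \<noteq> 0" for x n
    using thA_thB_nonzero kc_nonzero norm_power_less_1 by auto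
  consider "i = 1" | "i = 2" | "i = 3" | "i \<notin> {1,2,3}" by blast
  then show "Sc i holomorphic_on ball 0 1" "Nc i holomorphic_on ball 0 1"
    using nz unfolding Sc_def [abs_def] Nc_def [abs_def]
    by (cases; auto intro!: holomorphic_intros A B kc_holomorphic qpoch_power_holomorphic)+
qed

lemma kf_at_5_torsion:
  fixes \<tau> :: complex
  assumes n: "n \<in> {1..4}"
  defines "x \<equiv> ee (\<tau> / 5)" and "h \<equiv> exp (of_real pi * \<i> * (\<tau> / 5))"
  shows "kf \<tau> (of_nat n * (\<tau> / 5)) = inverse h ^ n * (qpoch (x ^ n) (x ^ 5) * qpoch (x ^ (5 - n)) (x ^ 5))"
proof -
  have 1: "ee (of_nat n * (\<tau> / 5)) = x ^ n" unfolding x_def by (rule ee_of_nat_mult)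
  have 2: "ee \<tau> = x ^ 5" using ee_of_nat_mult[of 5 "\<tau> / 5"] by (simp add: x_def)
  have "x ^ 5 = x ^ n * x ^ (5 - n)" using n by (simp flip: power_add)
  moreover have "x \<noteq> 0" by (simp add: x_def)
  ultimately have 3: "ee \<tau> / ee (of_nat n * (\<tau> / 5)) = x ^ (5 - n)" unfolding 1 2 by simp
  have "exp (- (of_real pi * \<i> * (of_nat n * (\<tau> / 5)))) = exp (of_nat n * (- (of_real pi * \<i> * (\<tau> / 5))))"
    by (simp add: mult_ac)
  also have "\<dots> = inverse h ^ n" unfolding exp_of_nat_mult by (simp add: h_def exp_minus)
  finally show ?thesis unfolding kf_def 3 unfolding 1 2 by (simp only: mult.assoc)
qed

lemma sfun_nfun_cusp_1_2:
  assumes \<tau>: "Im \<tau> > 0"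
  defines "x \<equiv> ee (\<tau> / 5)"
  shows "sfun \<tau> (\<tau> / 5) = x * Sc 1 x" "nfun \<tau> (\<tau> / 5) = Nc 1 x"
    "sfun \<tau> (2 * \<tau> / 5) = Sc 2 x / x" "nfun \<tau> (2 * \<tau> / 5) = x * Nc 2 x"
proof -
  define h where "h = exp (of_real pi * \<i> * (\<tau> / 5))"
  define H where "H = inverse h"
  define A where "A = thA x"
  define B where "B = thB x"
  have h0: "h \<noteq> 0" "H \<noteq> 0" by (simp_all add: h_def H_def)
  have x: "x = h ^ 2" unfolding x_def h_def power2_eq_square by (rule exp_half_ee[symmetric])
  have hH: "h = inverse H" by (simp add: H_def)
  have "norm x < 1" unfolding x_def by (rule norm_ee_less_1) (use \<tau> in simp)
  then have AB: "A \<noteq> 0" "B \<noteq> 0" unfolding A_def B_def by (simp_all add: thA_thB_nonzero)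
  note T = kf_at_5_torsion[of _ \<tau>, folded x_def h_def H_def]
  have K1: "kf \<tau> (\<tau> / 5) = H * A"
    using T[of 1] by (simp add: A_def thA_def)
  have K2: "kf \<tau> (2 * \<tau> / 5) = H ^ 2 * B"
    using T[of 2] by (simp add: B_def thB_def)
  have K3: "kf \<tau> (3 * \<tau> / 5) = H ^ 3 * B"
    using T[of 3] by (simp add: B_def thB_def mult.commute)
  have K4: "kf \<tau> (4 * \<tau> / 5) = H ^ 4 * A"
    using T[of 4] by (simp add: A_def thA_def mult.commute)
  \<comment> \<open>Quasi-periodicity brings 6\<tau>/5 and 8\<tau>/5 back to \<tau>/5 and 3\<tau>/5.
    \<open>H\<close> is exp(-\<pi> i \<tau>/5), so that x = 1 / H^2 and no choice of a square root
    of x intervenes.\<close>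
  have shift: "kf \<tau> (of_nat n * \<tau> / 5 + \<tau>) = - (H ^ (5 + 2 * n)) * kf \<tau> (of_nat n * \<tau> / 5)" for n
  proof -
    have "exp (- (of_real pi * \<i> * \<tau>) - 2 * of_real pi * \<i> * (of_nat n * \<tau> / 5)) =
        exp (of_nat (5 + 2 * n) * (- (of_real pi * \<i> * (\<tau> / 5))))"
      by (rule arg_cong[where f = exp]) (simp add: field_simps)
    also have "\<dots> = H ^ (5 + 2 * n)"
      unfolding exp_of_nat_mult by (simp add: H_def h_def exp_minus)
    finally show ?thesis using kf_add_tau[OF \<tau>, of "of_nat n * \<tau> / 5"] by simp
  qed
  have K6: "kf \<tau> (6 * \<tau> / 5) = - (H ^ 8) * A"
    using shift[of 1] K1 by (simp add: add_divide_distrib [symmetric] flip: power_Suc2 mult.assoc)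
  have K8: "kf \<tau> (8 * \<tau> / 5) = - (H ^ 14) * B"
  proof -
    have "8 * \<tau> / 5 = of_nat 3 * \<tau> / 5 + \<tau>" by simp
    then have "kf \<tau> (8 * \<tau> / 5) = - (H ^ 11) * (H ^ 3 * B)" using shift[of 3] K3 by simp
    also have "\<dots> = - (H ^ (11 + 3)) * B" unfolding power_add by simp
    finally show ?thesis by simp
  qed
  have qq: "ee \<tau> = x ^ 5" using ee_of_nat_mult[of 5 "\<tau> / 5"] by (simp add: x_def)
  define p where "p = qpoch (x ^ 5) (x ^ 5) ^ 2"
  have xH: "x = 1 / H ^ 2" by (simp add: x hH power_inverse divide_inverse)
  have SN: "Sc 1 x = A ^ 5 / B ^ 5" "Sc 2 x = - (B ^ 5 / A ^ 5)" "Nc 1 x = p * B ^ 2 / A ^ 3"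
    "Nc 2 x = - (p * A ^ 2 / B ^ 3)"
    by (simp_all add: Sc_def Nc_def A_def B_def p_def)
  have "sfun \<tau> (\<tau> / 5) = (H ^ 4 * A) * (H * A) ^ 4 / (H ^ 2 * B) ^ 5"
    unfolding sfun_def using K1 K2 K4 by simp
  also have "\<dots> = (H ^ 8 * A ^ 5) / (H ^ 8 * (H ^ 2 * B ^ 5))"
    by (simp add: power_mult_distrib power_numeral_reduce mult_ac)
  also have "\<dots> = A ^ 5 / (H ^ 2 * B ^ 5)"
    by (rule mult_divide_mult_cancel_left) (use h0 in simp)
  finally show "sfun \<tau> (\<tau> / 5) = x * Sc 1 x"
    unfolding SN unfolding xH by simp
  have "nfun \<tau> (\<tau> / 5) = p * (H ^ 2 * B) ^ 3 / ((H * A) ^ 3 * (H ^ 3 * B))"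
    unfolding nfun_def using K1 K2 K3 by (simp add: qq p_def)
  also have "\<dots> = (H ^ 6 * B) * (p * B ^ 2) / ((H ^ 6 * B) * A ^ 3)"
    by (simp add: power_mult_distrib power_numeral_reduce mult_ac)
  also have "\<dots> = p * B ^ 2 / A ^ 3"
    by (rule mult_divide_mult_cancel_left) (use h0 AB in simp)
  finally show "nfun \<tau> (\<tau> / 5) = Nc 1 x"
    unfolding SN .
  have "sfun \<tau> (2 * \<tau> / 5) = (- (H ^ 14) * B) * (H ^ 2 * B) ^ 4 / (H ^ 4 * A) ^ 5"
    unfolding sfun_def using K2 K4 K8 by simp
  also have "\<dots> = H ^ 20 * (H ^ 2 * - (B ^ 5)) / (H ^ 20 * A ^ 5)"
    by (simp add: power_mult_distrib power_numeral_reduce mult_ac)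
  also have "\<dots> = H ^ 2 * - (B ^ 5) / A ^ 5"
    by (rule mult_divide_mult_cancel_left) (use h0 in simp)
  finally show "sfun \<tau> (2 * \<tau> / 5) = Sc 2 x / x"
    unfolding SN unfolding xH by simp
  have "nfun \<tau> (2 * \<tau> / 5) = p * (H ^ 4 * A) ^ 3 / ((H ^ 2 * B) ^ 3 * (- (H ^ 8) * A))"
    unfolding nfun_def using K2 K4 K6 by (simp add: qq p_def)
  also have "\<dots> = (H ^ 12 * A) * - (p * A ^ 2) / ((H ^ 12 * A) * (H ^ 2 * B ^ 3))"
    by (simp add: power_mult_distrib power_numeral_reduce mult_ac)
  also have "\<dots> = - (p * A ^ 2) / (H ^ 2 * B ^ 3)"
    by (rule mult_divide_mult_cancel_left) (use h0 AB in simp)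
  finally show "nfun \<tau> (2 * \<tau> / 5) = x * Nc 2 x"
    unfolding SN unfolding xH by simp
qed

lemma sfun_nfun_cusp:
  assumes \<tau>: "Im \<tau> > 0" and i: "i \<in> {1..4}"
  defines "x \<equiv> ee (\<tau> / 5)"
  shows "sfun \<tau> (cz i \<tau>) = es i x * Sc i x" "nfun \<tau> (cz i \<tau>) = en i x * Nc i x"
proof -
  have q: "ee \<tau> = x ^ 5" using ee_of_nat_mult[of 5 "\<tau> / 5"] by (simp add: x_def)
  have K: "kf \<tau> (of_nat n / 5) = kc n (x ^ 5)" for n
    by (simp add: kf_def kc_def q)
  note K = K[of 1, simplified] K[of 2, simplified] K[of 3, simplified] K[of 4, simplified]
    K[of 6, simplified] K[of 8, simplified]
  have "i = 1 \<or> i = 2 \<or> i = 3 \<or> i = 4" using i by auto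
  then have "sfun \<tau> (cz i \<tau>) = es i x * Sc i x \<and> nfun \<tau> (cz i \<tau>) = en i x * Nc i x"
  proof (elim disjE)
    assume "i = 1"
    then show ?thesis using sfun_nfun_cusp_1_2[OF \<tau>] by (simp add: cz_def es_def en_def x_def)
  next
    assume "i = 2"
    then show ?thesis using sfun_nfun_cusp_1_2[OF \<tau>] by (simp add: cz_def es_def en_def x_def)
  next
    assume "i = 3"
    then show ?thesis by (simp add: cz_def es_def en_def sfun_def nfun_def K Sc_def Nc_def q)
  next
    assume "i = 4"
    then show ?thesis by (simp add: cz_def es_def en_def sfun_def nfun_def K Sc_def Nc_def q)
  qed
  then show "sfun \<tau> (cz i \<tau>) = es i x * Sc i x" "nfun \<tau> (cz i \<tau>) = en i x * Nc i x" by auto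
qed

section \<open>The expansion principle and superlattices of index \<open>l\<close>\<close>

lemma lattice_basis_lat: "Im \<tau> > 0 \<Longrightarrow> lattice_basis (lat \<tau>) 1 \<tau>"
  by (simp add: lattice_basis_def image_def)

lemma sL_lat: "Im \<tau> > 0 \<Longrightarrow> sL (lat \<tau>) z = sfun \<tau> z"
  using sL_eq[OF lattice_basis_lat] by simp

lemma nL_lat: "Im \<tau> > 0 \<Longrightarrow> nL (lat \<tau>) z = nfun \<tau> z"
  using nL_eq[OF lattice_basis_lat] by simp

lemma lattice_basis_scale: "lattice_basis \<Lambda> c \<tau> \<Longrightarrow> a \<noteq> 0 \<Longrightarrow> lattice_basis ((*) a ` \<Lambda>) (a * c) \<tau>"
  by (auto simp: lattice_basis_def image_image mult.assoc)

lemma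
  assumes "lattice_basis \<Lambda> c \<tau>" "a \<noteq> 0"
  shows sL_scale: "sL ((*) a ` \<Lambda>) (a * z) = sL \<Lambda> z" and nL_scale: "nL ((*) a ` \<Lambda>) (a * z) = nL \<Lambda> z / a"
  using assms sL_eq[OF lattice_basis_scale[OF assms]] sL_eq[OF assms(1)]
    nL_eq[OF lattice_basis_scale[OF assms]] nL_eq[OF assms(1)]
  by (auto simp: lattice_basis_def)

lemma
  assumes "lattice_basis \<Lambda> c \<tau>" "\<omega> \<in> \<Lambda>"
  shows sL_periodic: "sL \<Lambda> (z + \<omega>) = sL \<Lambda> z" and nL_periodic: "nL \<Lambda> (z + \<omega>) = nL \<Lambda> z"
proof -
  obtain v where v: "v \<in> lat \<tau>" "\<omega> = c * v" using assms by (auto simp: lattice_basis_def)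
  have c: "c \<noteq> 0" "Im \<tau> > 0" using assms by (auto simp: lattice_basis_def)
  then have "(z + \<omega>) / c = z / c + v" by (simp add: v(2) add_divide_distrib)
  then show "sL \<Lambda> (z + \<omega>) = sL \<Lambda> z" "nL \<Lambda> (z + \<omega>) = nL \<Lambda> z"
    using sfun_periodic[OF c(2) v(1)] nfun_periodic[OF c(2) v(1)]
    by (simp_all add: sL_eq[OF assms(1)] nL_eq[OF assms(1)])
qed

lemma
  assumes "lattice_basis \<Lambda> c \<tau>"
  shows sL_minus: "sL \<Lambda> (- z) = sL \<Lambda> z" and nL_minus: "nL \<Lambda> (- z) = - nL \<Lambda> z"
  using sfun_minus[of \<tau> "z / c"] nfun_minus[of \<tau> "z / c"] conjunct1[OF conjunct2[OF assms[unfolded lattice_basis_def]]]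
  by (simp_all add: sL_eq[OF assms] nL_eq[OF assms])

lemma lat_inv_sL: "lat_inv sL"
  unfolding lat_inv_def
  using sL_scale[OF lattice_basis_lat] sL_periodic[OF lattice_basis_lat] sL_minus[OF lattice_basis_lat] by auto

lemma ee_surj:
  assumes "x \<noteq> 0" "norm x < 1"
  obtains \<tau> where "Im \<tau> > 0" "ee (\<tau> / 5) = x"
proof -
  define \<tau> where "\<tau> = 5 * Ln x / (2 * of_real pi * \<i>)"
  have e: "ee (\<tau> / 5) = x" using assms by (simp add: \<tau>_def ee_def)
  then have "norm (ee (\<tau> / 5)) < 1" using assms by simp
  then have "Im \<tau> > 0" by (simp add: norm_ee zero_less_mult_iff)
  then show thesis using that e by blast
qed

lemma Sc_1_0: "Sc 1 0 = 1" and Nc_1_0: "Nc 1 0 = 1"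
  by (simp_all add: Sc_def Nc_def thA_def thB_def)

context lprime
begin

lemma Fl_0_in_Zl: "Fl F \<Longrightarrow> F 0 \<in> Zl"
proof -
  assume "Fl F"
  then obtain a where a: "\<And>n. a n \<in> Zl" "\<And>x. norm x < 1 \<Longrightarrow> (\<lambda>n. a n * x ^ n) sums F x"
    unfolding Fl_def by blast
  have "(\<lambda>n. a n * 0 ^ n) sums F 0" using a(2)[of 0] by simp
  then have "F 0 = a 0" using sums_unique2 powser_sums_zero by blast
  then show ?thesis using a by simp
qed

lemma Fl_thA: "Fl thA" and Fl_thB: "Fl thB"
  using Fl_mult[OF Fl_qpoch[of 1] Fl_qpoch[of 4]] Fl_mult[OF Fl_qpoch[of 2] Fl_qpoch[of 3]]
  by (simp_all add: thA_def [abs_def] thB_def [abs_def])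

lemma Fl_Sc_1: "Fl (Sc 1)"
proof -
  have "Fl (\<lambda>x. 1 / thB x ^ 5)"
    by (rule Fl_inverse[OF Fl_power[OF Fl_thB]]) (use thA_thB_nonzero in \<open>auto simp: thB_def\<close>)
  from Fl_mult[OF Fl_power[OF Fl_thA, of 5] this] show ?thesis
    by (simp add: Sc_def [abs_def])
qed

lemma Fl_Nc_1: "Fl (Nc 1)"
proof -
  have "Fl (\<lambda>x. 1 / thA x ^ 3)"
    by (rule Fl_inverse[OF Fl_power[OF Fl_thA]]) (use thA_thB_nonzero in \<open>auto simp: thA_def\<close>)
  from Fl_mult[OF Fl_mult[OF Fl_power[OF Fl_qpoch[of 5], of 2] Fl_power[OF Fl_thB, of 2]] this]
  show ?thesis by (simp add: Nc_def [abs_def])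
qed

lemma Fl_inverse_Sc_1: "Fl (\<lambda>x. 1 / Sc 1 x)" and Fl_inverse_Nc_1: "Fl (\<lambda>x. 1 / Nc 1 x)"
  by (rule Fl_inverse; use Fl_Sc_1 Fl_Nc_1 Sc_Nc_nonzero Sc_1_0 Nc_1_0 in auto)+

text \<open>The function \<open>sL\<close> is a Hauptmodul whose only pole is at the second cusp, and it vanishes to first
  order at the first cusp; peeling off the value at the first cusp and dividing by \<open>sL\<close> lowers the
  order of the pole and keeps the expansion at the first cusp integral.\<close>
lemma lat_inv_polynomial:
  assumes "lat_inv G" "Fl F"
    and "\<And>\<tau>. Im \<tau> > 0 \<Longrightarrow> G (lat \<tau>) (cz 1 \<tau>) = F (ee (\<tau> / 5))"
    and "BH (\<lambda>\<tau>. ee (\<tau> / 5) ^ n * G (lat \<tau>) (cz 2 \<tau>))"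
    and "BH (\<lambda>\<tau>. G (lat \<tau>) (cz 3 \<tau>))" "BH (\<lambda>\<tau>. G (lat \<tau>) (cz 4 \<tau>))"
  shows "\<exists>p. degree p \<le> n \<and> (\<forall>k. Polynomial.coeff p k \<in> Zl) \<and> Polynomial.coeff p 0 = F 0 \<and>
           (\<forall>\<tau>. Im \<tau> > 0 \<longrightarrow> G (lat \<tau>) (cz 1 \<tau>) = poly p (sL (lat \<tau>) (cz 1 \<tau>)))"
  using assms
proof (induction n arbitrary: G F)
  case (0 G F)
  have bh: "BH (\<lambda>\<tau>. G (lat \<tau>) (cz i \<tau>))" if "i \<in> {1..4}" for i
  proof -
    have "i = 1 \<or> i = 2 \<or> i = 3 \<or> i = 4" using that by auto
    moreover have "BH (\<lambda>\<tau>. G (lat \<tau>) (cz 1 \<tau>))"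
      by (rule BH_cong[OF BH_compose_ee[OF Fl_holomorphic[OF 0(2)]]]) (use 0(3) in auto)
    ultimately show ?thesis using 0(4,5,6) by auto
  qed
  have "\<exists>c. \<forall>\<tau>. Im \<tau> > 0 \<longrightarrow> G (lat \<tau>) (cz 1 \<tau>) = c"
  proof (rule lat_inv_bounded_imp_const[OF 0(1)])
    show "(\<lambda>\<tau>. G (lat \<tau>) (cz i \<tau>)) holomorphic_on {\<tau>. Im \<tau> > 0}" if "i \<in> {1..4}" for i
      using bh[OF that] by (rule BH_holomorphic)
    show "\<exists>C. \<forall>\<tau>. Im \<tau> \<ge> 1/2 \<longrightarrow> norm (G (lat \<tau>) (cz i \<tau>)) \<le> C" if "i \<in> {1..4}" for i
      using bh[OF that] unfolding BH_def by (elim conjE allE[of _ "1/2"]) simp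
  qed
  then obtain c where c: "\<And>\<tau>. Im \<tau> > 0 \<Longrightarrow> G (lat \<tau>) (cz 1 \<tau>) = c" by blast
  have Fc: "F x = c" if "x \<noteq> 0" "norm x < 1" for x
    using ee_surj[OF that] 0(3) c by metis
  have "F 0 = c"
  proof -
    have "isCont F 0"
      using holomorphic_on_imp_differentiable_at[OF Fl_holomorphic[OF 0(2)]]
      by (intro field_differentiable_imp_continuous_at) auto
    then have "(F \<longlongrightarrow> F 0) (at 0)" by (simp add: isCont_def)
    moreover have "\<forall>\<^sub>F x in at 0. F x = c"
    proof -
      have "\<forall>\<^sub>F x in at 0. x \<in> ball 0 1 - {0::complex}" by (rule eventually_at_in_open) auto
      then show ?thesis by eventually_elim (use Fc in auto)
    qed
    then have "(F \<longlongrightarrow> c) (at 0)" by (rule tendsto_eventually)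
    ultimately show ?thesis using LIM_unique by blast
  qed
  then show ?case
    using c Fl_0_in_Zl[OF 0(2)] by (intro exI[of _ "[:F 0:]"]) (auto simp: coeff_pCons split: nat.splits intro: Zl_intros)
next
  case (Suc n G F)
  define c where "c = F 0"
  have cZ: "c \<in> Zl" unfolding c_def by (rule Fl_0_in_Zl[OF Suc(3)])
  have "Fl (\<lambda>x. F x - c)" by (intro Fl_diff Suc(3) Fl_const cZ)
  then obtain H where H: "Fl H" "\<And>x. norm x < 1 \<Longrightarrow> F x - c = x * H x"
    by (rule Fl_factor_x) (auto simp: c_def)
  define G' where "G' = (\<lambda>\<Lambda> z. (G \<Lambda> z - c) / sL \<Lambda> z)"
  define F' where "F' = (\<lambda>x. H x * (1 / Sc 1 x))"
  have s: "sL (lat \<tau>) (cz i \<tau>) = es i (ee (\<tau> / 5)) * Sc i (ee (\<tau> / 5))" if "Im \<tau> > 0" "i \<in> {1..4}" for i \<tau>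
    using sfun_nfun_cusp(1)[OF that] sL_lat[OF that(1)] by simp
  have x1: "norm (ee (\<tau> / 5)) < 1" if "Im \<tau> > 0" for \<tau>
    using that by (intro norm_ee_less_1) simp
  have invS: "BH (\<lambda>\<tau>. 1 / Sc i (ee (\<tau> / 5)))" for i
  proof (rule BH_compose_ee)
    show "(\<lambda>x. 1 / Sc i x) holomorphic_on ball 0 1"
      using Sc_Nc_nonzero by (intro holomorphic_intros Sc_Nc_holomorphic) auto
  qed
  have "\<exists>p. degree p \<le> n \<and> (\<forall>k. Polynomial.coeff p k \<in> Zl) \<and> Polynomial.coeff p 0 = F' 0 \<and>
           (\<forall>\<tau>. Im \<tau> > 0 \<longrightarrow> G' (lat \<tau>) (cz 1 \<tau>) = poly p (sL (lat \<tau>) (cz 1 \<tau>)))"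
  proof (rule Suc.IH)
    show "lat_inv G'"
      using Suc(2) lat_inv_sL unfolding lat_inv_def G'_def by auto
    show "Fl F'" unfolding F'_def by (intro Fl_mult H(1) Fl_inverse_Sc_1)
    show "G' (lat \<tau>) (cz 1 \<tau>) = F' (ee (\<tau> / 5))" if "Im \<tau> > 0" for \<tau>
    proof -
      have "G' (lat \<tau>) (cz 1 \<tau>) = (ee (\<tau> / 5) * H (ee (\<tau> / 5))) / (ee (\<tau> / 5) * Sc 1 (ee (\<tau> / 5)))"
        using s[OF that, of 1] H(2)[OF x1[OF that]] unfolding G'_def Suc(4)[OF that] by (simp add: es_def)
      then show ?thesis by (simp add: F'_def)
    qed
    \<comment> \<open>Dividing by \<open>sL\<close>, which has a simple pole at the second cusp,
      contributes a factor x and so lowers the pole order by one.\<close>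
    have "BH (\<lambda>\<tau>. (ee (\<tau> / 5) ^ Suc n * G (lat \<tau>) (cz 2 \<tau>) - ee (\<tau> / 5) ^ Suc n * c) * (1 / Sc 2 (ee (\<tau> / 5))))"
      by (intro BH_mult BH_diff Suc(5) invS BH_compose_ee holomorphic_intros)
    then show "BH (\<lambda>\<tau>. ee (\<tau> / 5) ^ n * G' (lat \<tau>) (cz 2 \<tau>))"
      by (rule BH_cong) (simp add: G'_def s es_def field_simps)
    have B0: "BH (\<lambda>\<tau>. (G (lat \<tau>) (cz i \<tau>) - c) * (1 / Sc i (ee (\<tau> / 5))))" if "i = 3 \<or> i = 4" for i
      using that Suc(6,7) by (intro BH_mult BH_diff invS BH_const) auto
    have "BH (\<lambda>\<tau>. G' (lat \<tau>) (cz i \<tau>))" if "i = 3 \<or> i = 4" for i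
      by (rule BH_cong[OF B0[OF that]]) (use that in \<open>auto simp: G'_def s es_def\<close>)
    then show "BH (\<lambda>\<tau>. G' (lat \<tau>) (cz 3 \<tau>))" "BH (\<lambda>\<tau>. G' (lat \<tau>) (cz 4 \<tau>))" by auto
  qed
  then obtain p where p: "degree p \<le> n" "\<And>k. Polynomial.coeff p k \<in> Zl"
    "\<And>\<tau>. Im \<tau> > 0 \<Longrightarrow> G' (lat \<tau>) (cz 1 \<tau>) = poly p (sL (lat \<tau>) (cz 1 \<tau>))" by blast
  show ?case
  proof (intro exI[of _ "pCons c p"] conjI allI impI)
    show "degree (pCons c p) \<le> Suc n" using p(1) degree_pCons_le[of c p] by linarith
    show "Polynomial.coeff (pCons c p) k \<in> Zl" for k using p(2) cZ by (simp add: coeff_pCons split: nat.splits)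
    show "Polynomial.coeff (pCons c p) 0 = F 0" by (simp add: c_def)
    fix \<tau> assume t: "Im \<tau> > 0"
    have "sL (lat \<tau>) (cz 1 \<tau>) \<noteq> 0"
      using s[OF t, of 1] Sc_Nc_nonzero[OF x1[OF t]] by (simp add: es_def)
    then show "G (lat \<tau>) (cz 1 \<tau>) = poly (pCons c p) (sL (lat \<tau>) (cz 1 \<tau>))"
      using p(3)[OF t] by (simp add: G'_def field_simps)
  qed
qed

end

subsection \<open>Superlattices of prime index\<close>

definition ext :: "nat \<Rightarrow> complex set \<Rightarrow> complex \<Rightarrow> complex set" where
  "ext l \<Lambda> v = {w + of_int k * v / of_nat l | w k. w \<in> \<Lambda>}"

text \<open>A vector outside l \<Lambda> generates a superlattice of index l over \<Lambda>. Taking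
  the set of lattices makes the many generators of one superlattice count once.\<close>

definition sups :: "nat \<Rightarrow> complex set \<Rightarrow> complex set set" where
  "sups l \<Lambda> = {ext l \<Lambda> v | v. v \<in> \<Lambda> \<and> v / of_nat l \<notin> \<Lambda>}"

lemma ext_scale: "ext l ((*) c ` \<Lambda>) (c * v) = (*) c ` ext l \<Lambda> v"
proof -
  have "c * w + of_int k * (c * v) / of_nat l = c * (w + of_int k * v / of_nat l)" for w k
    by (simp add: algebra_simps)
  then show ?thesis unfolding ext_def by (auto simp: image_iff) metis+
qed

lemma sups_scale:
  assumes "c \<noteq> 0"
  shows "sups l ((*) c ` \<Lambda>) = (`) ((*) c) ` sups l \<Lambda>"
proof -
  have "c * v / of_nat l \<in> (*) c ` \<Lambda> \<longleftrightarrow> v / of_nat l \<in> \<Lambda>" for v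
  proof -
    have "c * v / of_nat l = c * (v / of_nat l)" by simp
    then show ?thesis using assms by (auto simp: image_iff simp del: times_divide_eq_right)
  qed
  then show ?thesis
    unfolding sups_def by (auto simp: image_iff ext_scale [symmetric]) (metis ext_scale)+
qed

definition sup_inf :: "nat \<Rightarrow> complex \<Rightarrow> complex set" where
  "sup_inf l \<tau> = (*) (1 / of_nat l) ` lat (of_nat l * \<tau>)"

text \<open>The factor 5 turns the shifts into multiplication of e(\<tau>/(5l)) by l-th roots of
  unity; 5 j still meets all residues modulo l when l is a prime other than 5.\<close>

definition sup_pt :: "nat \<Rightarrow> complex \<Rightarrow> nat \<Rightarrow> complex" where
  "sup_pt l \<tau> j = (\<tau> + 5 * of_nat j) / of_nat l"

lemma of_int_div_of_nat_in_lat_iff: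
  assumes \<tau>: "Im \<tau> > 0" and l: "l > 0"
  shows "(of_int m + of_int n * \<tau>) / of_nat l \<in> lat \<tau> \<longleftrightarrow> int l dvd m \<and> int l dvd n"
proof
  assume "(of_int m + of_int n * \<tau>) / of_nat l \<in> lat \<tau>"
  then obtain a b where "(of_int m + of_int n * \<tau>) / of_nat l = of_int a + of_int b * \<tau>" by (auto simp: lat_def)
  then have eq: "of_int m + of_int n * \<tau> = of_nat l * (of_int a + of_int b * \<tau>)" using l by (simp add: field_simps)
  have "of_int n * Im \<tau> = of_nat l * (of_int b * Im \<tau>)" using arg_cong[OF eq, of Im] by simp
  then have n: "real_of_int n = of_int (int l * b)" using \<tau> by simp
  then have n': "n = int l * b" by (simp only: of_int_eq_iff)
  have "(of_int m :: complex) = of_int (int l * a)" using eq by (simp add: n' algebra_simps)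
  then have "m = int l * a" by (simp only: of_int_eq_iff)
  with n' show "int l dvd m \<and> int l dvd n" by simp
next
  assume "int l dvd m \<and> int l dvd n"
  then obtain a b where "m = int l * a" "n = int l * b" by (auto elim!: dvdE)
  then show "(of_int m + of_int n * \<tau>) / of_nat l \<in> lat \<tau>" using l by (intro latI[of _ a b]) (simp add: field_simps)
qed

lemma cong_solve_prime:
  fixes l :: nat and n :: int
  assumes "prime l" "\<not> int l dvd n"
  obtains k a where "k * n = 1 + int l * a"
proof -
  have "coprime n (int l)" using assms by (metis coprime_commute prime_imp_coprime prime_nat_int_transfer)
  then obtain u v where "u * n + v * int l = 1" by (metis bezout_int coprime_imp_gcd_eq_1)
  then show thesis using that[of u "- v"] by (simp add: algebra_simps)
qed

lemma ext_div:
  assumes l: "prime l" and \<tau>: "Im \<tau> > 0" and n: "int l dvd n" and m: "\<not> int l dvd m"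
  shows "ext l (lat \<tau>) (of_int m + of_int n * \<tau>) = sup_inf l \<tau>"
proof -
  have l0: "l > 0" using l by (simp add: prime_gt_0_nat)
  obtain n' where n': "n = int l * n'" using n by blast
  obtain k0 a where k0: "k0 * m = 1 + int l * a" using cong_solve_prime[OF l m] .
  show ?thesis
  proof
    show "ext l (lat \<tau>) (of_int m + of_int n * \<tau>) \<subseteq> sup_inf l \<tau>"
    proof
      fix z assume "z \<in> ext l (lat \<tau>) (of_int m + of_int n * \<tau>)"
      then obtain w k where z: "z = w + of_int k * (of_int m + of_int n * \<tau>) / of_nat l" and "w \<in> lat \<tau>"
        unfolding ext_def by blast
      then obtain p q where w: "w = of_int p + of_int q * \<tau>" by (auto simp: lat_def)
      have "of_nat l * z \<in> lat (of_nat l * \<tau>)"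
        by (rule latI[of _ "int l * p + k * m" "q + k * n'"]) (use l0 in \<open>simp add: z w n' field_simps\<close>)
      then show "z \<in> sup_inf l \<tau>"
        unfolding sup_inf_def using l0 by (intro image_eqI[of _ _ "of_nat l * z"]) auto
    qed
    show "sup_inf l \<tau> \<subseteq> ext l (lat \<tau>) (of_int m + of_int n * \<tau>)"
    proof
      fix z assume "z \<in> sup_inf l \<tau>"
      then obtain p q where z: "z = 1 / of_nat l * (of_int p + of_int q * (of_nat l * \<tau>))"
        unfolding sup_inf_def lat_def by blast
      define k where "k = p * k0"
      have km: "k * m = p + int l * (p * a)" 
      using arg_cong[OF k0, of "\<lambda>t. p * t"] by (simp add: k_def algebra_simps)
      have "z = (of_int (- (p * a)) + of_int (q - k * n') * \<tau>) + of_int k * (of_int m + of_int n * \<tau>) / of_nat l"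
      proof -
        have "of_int (k * m) = (of_int (p + int l * (p * a)) :: complex)" using km by simp
        then have km': "of_int k * of_int m = of_int p + of_nat l * (of_int p * of_int a :: complex)" by simp
        have "of_int k * (of_int m + of_int n * \<tau>) = of_int k * of_int m + of_nat l * (of_int k * of_int n' * \<tau>)"
          by (simp add: n' algebra_simps)
        then show ?thesis using l0 unfolding z km' by (simp add: field_simps)
      qed
      moreover have "of_int (- (p * a)) + of_int (q - k * n') * \<tau> \<in> lat \<tau>" by (rule latI[OF refl])
      ultimately show "z \<in> ext l (lat \<tau>) (of_int m + of_int n * \<tau>)" unfolding ext_def by blast
    qed
  qed
qed

text \<open>Multiplying the generator by an inverse of n modulo l changes nothing in the
  superlattice and makes the coefficient of \<tau> equal to 1; the other coefficient then only
  matters modulo l.\<close>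

lemma ext_not_div:
  assumes l: "prime l" and \<tau>: "Im \<tau> > 0" and n: "\<not> int l dvd n" and j: "int l dvd m - 5 * int j * n"
  shows "ext l (lat \<tau>) (of_int m + of_int n * \<tau>) = lat (sup_pt l \<tau> j)"
proof -
  have l0: "l > 0" using l by (simp add: prime_gt_0_nat)
  obtain b where b: "m - 5 * int j * n = int l * b" using j by blast
  then have m: "m = 5 * int j * n + int l * b" by simp
  obtain k0 a where k0: "k0 * n = 1 + int l * a" using cong_solve_prime[OF l n] .
  have k0': "of_int k0 * of_int n = 1 + of_nat l * (of_int a :: complex)"
    using arg_cong[OF k0, of "of_int :: int \<Rightarrow> complex"] by simp
  define t where "t = sup_pt l \<tau> j"
  have \<tau>t: "\<tau> = of_nat l * t - 5 * of_nat j" using l0 by (simp add: t_def sup_pt_def)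
  have v: "(of_int m + of_int n * \<tau>) = of_nat l * (of_int b + of_int n * t)"
    by (simp add: m \<tau>t algebra_simps)
  show ?thesis unfolding t_def [symmetric]
  proof
    show "ext l (lat \<tau>) (of_int m + of_int n * \<tau>) \<subseteq> lat t"
    proof
      fix z assume "z \<in> ext l (lat \<tau>) (of_int m + of_int n * \<tau>)"
      then obtain w k where z: "z = w + of_int k * (of_int m + of_int n * \<tau>) / of_nat l" and "w \<in> lat \<tau>"
        unfolding ext_def by blast
      then obtain p q where w: "w = of_int p + of_int q * \<tau>" by (auto simp: lat_def)
      have "z = of_int p + of_int q * \<tau> + of_int k * (of_int b + of_int n * t)"
        using l0 by (simp add: z w v)
      then show "z \<in> lat t"
        by (intro latI[of _ "p - 5 * int j * q + k * b" "int l * q + k * n"]) (simp add: \<tau>t algebra_simps)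
    qed
    show "lat t \<subseteq> ext l (lat \<tau>) (of_int m + of_int n * \<tau>)"
    proof
      fix z assume "z \<in> lat t"
      then obtain p q where z: "z = of_int p + of_int q * t" by (auto simp: lat_def)
      define k where "k = q * k0"
      have kn: "of_int k * of_int n = of_int q + of_nat l * (of_int q * of_int a :: complex)"
        using arg_cong[OF k0', of "\<lambda>t. of_int q * t"] by (simp add: k_def algebra_simps)
      have lt: "of_nat l * t = \<tau> + 5 * of_nat j" using l0 by (simp add: t_def sup_pt_def)
      have "of_int k * (of_int m + of_int n * \<tau>) / of_nat l = of_int k * (of_int b + of_int n * t)"
        using l0 by (simp add: v)
      also have "\<dots> = of_int k * of_int b + (of_int k * of_int n) * t" by (simp add: algebra_simps)
      also have "\<dots> = of_int k * of_int b + of_int q * t + of_int q * of_int a * (of_nat l * t)"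
        unfolding kn by (simp add: algebra_simps)
      finally have "z = (of_int (p - k * b - q * a * 5 * int j) + of_int (- (q * a)) * \<tau>) +
          of_int k * (of_int m + of_int n * \<tau>) / of_nat l"
        unfolding lt by (simp add: z algebra_simps)
      moreover have "of_int (p - k * b - q * a * 5 * int j) + of_int (- (q * a)) * \<tau> \<in> lat \<tau>" by (rule latI[OF refl])
      ultimately show "z \<in> ext l (lat \<tau>) (of_int m + of_int n * \<tau>)" unfolding ext_def by blast
    qed
  qed
qed

lemma sups_lat:
  assumes l: "prime l" "l \<noteq> 5" and \<tau>: "Im \<tau> > 0"
  shows "sups l (lat \<tau>) = insert (sup_inf l \<tau>) ((\<lambda>j. lat (sup_pt l \<tau> j)) ` {..<l})"
proof
  have l0: "l > 0" using l by (simp add: prime_gt_0_nat)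
  have l5: "\<not> int l dvd 5"
  proof
    assume "int l dvd 5"
    then have "l dvd 5" by (metis int_dvd_int_iff of_nat_numeral)
    moreover have "prime (5::nat)" by simp
    ultimately show False using l by (metis not_prime_1 prime_nat_iff)
  qed
  show "sups l (lat \<tau>) \<subseteq> insert (sup_inf l \<tau>) ((\<lambda>j. lat (sup_pt l \<tau> j)) ` {..<l})"
  proof
    fix M assume "M \<in> sups l (lat \<tau>)"
    then obtain m n where M: "M = ext l (lat \<tau>) (of_int m + of_int n * \<tau>)"
      and nd: "\<not> (int l dvd m \<and> int l dvd n)"
    proof -
      obtain v where v: "M = ext l (lat \<tau>) v" "v \<in> lat \<tau>" "v / of_nat l \<notin> lat \<tau>"
        using \<open>M \<in> sups l (lat \<tau>)\<close> unfolding sups_def by blast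
      then obtain m n where "v = of_int m + of_int n * \<tau>" by (auto simp: lat_def)
      then show thesis using that[of m n] v of_int_div_of_nat_in_lat_iff[OF \<tau> l0] by blast
    qed
    show "M \<in> insert (sup_inf l \<tau>) ((\<lambda>j. lat (sup_pt l \<tau> j)) ` {..<l})"
    proof (cases "int l dvd n")
      case True
      then show ?thesis using ext_div[OF l(1) \<tau> True] nd M by auto
    next
      case False
      have "\<not> int l dvd 5 * n" using False l5 l(1) by (simp add: prime_dvd_mult_iff)
      then obtain k a where k: "k * (5 * n) = 1 + int l * a" using cong_solve_prime[OF l(1)] by blast
      \<comment> \<open>\<open>k\<close> inverts 5 n modulo l, so this is the solution of 5 j n = m
        modulo l.\<close>
      define j where "j = nat ((k * m) mod int l)"
      have jl: "j < l" using l0 by (simp add: j_def nat_less_iff)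
      have jm: "int j = k * m - int l * ((k * m) div int l)"
        using l0 by (simp add: j_def minus_mult_div_eq_mod)
      have "m - 5 * int j * n = m - (k * (5 * n)) * m + int l * ((k * m) div int l) * 5 * n"
        unfolding jm by (simp add: algebra_simps)
      also have "\<dots> = int l * (((k * m) div int l) * 5 * n - a * m)" unfolding k by (simp add: algebra_simps)
      finally have "int l dvd m - 5 * int j * n" by simp
      from ext_not_div[OF l(1) \<tau> False this] show ?thesis using M jl by auto
    qed
  qed
  show "insert (sup_inf l \<tau>) ((\<lambda>j. lat (sup_pt l \<tau> j)) ` {..<l}) \<subseteq> sups l (lat \<tau>)"
  proof -
    have nd1: "\<not> int l dvd 1" using l(1) by (metis int_dvd_int_iff not_prime_1 of_nat_1 nat_dvd_1_iff_1)
    have "sup_inf l \<tau> = ext l (lat \<tau>) (of_int 1 + of_int 0 * \<tau>)"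
      by (rule ext_div[OF l(1) \<tau>, symmetric]) (use nd1 in auto)
    moreover have "of_int 1 + of_int 0 * \<tau> \<in> lat \<tau>" by (rule latI[OF refl])
    moreover have "(of_int 1 + of_int 0 * \<tau>) / of_nat l \<notin> lat \<tau>"
      unfolding of_int_div_of_nat_in_lat_iff[OF \<tau> l0] using nd1 by auto
    ultimately have 1: "sup_inf l \<tau> \<in> sups l (lat \<tau>)" unfolding sups_def by blast
    have "lat (sup_pt l \<tau> j) \<in> sups l (lat \<tau>)" for j
    proof -
      have "lat (sup_pt l \<tau> j) = ext l (lat \<tau>) (of_int (5 * int j) + of_int 1 * \<tau>)"
        by (rule ext_not_div[OF l(1) \<tau>, symmetric]) (use nd1 in auto)
      moreover have "of_int (5 * int j) + of_int 1 * \<tau> \<in> lat \<tau>" by (rule latI[OF refl])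
      moreover have "(of_int (5 * int j) + of_int 1 * \<tau>) / of_nat l \<notin> lat \<tau>"
        unfolding of_int_div_of_nat_in_lat_iff[OF \<tau> l0] using nd1 by auto
      ultimately show ?thesis unfolding sups_def by blast
    qed
    with 1 show ?thesis by auto
  qed
qed

lemma sup_pt_Im: "Im \<tau> > 0 \<Longrightarrow> l > 0 \<Longrightarrow> Im (sup_pt l \<tau> j) > 0"
  by (simp add: sup_pt_def)

lemma sups_lat_distinct:
  assumes l: "prime l" "l \<noteq> 5" and \<tau>: "Im \<tau> > 0"
  shows "inj_on (\<lambda>j. lat (sup_pt l \<tau> j)) {..<l}" "sup_inf l \<tau> \<notin> (\<lambda>j. lat (sup_pt l \<tau> j)) ` {..<l}"
proof -
  have l0: "l > 0" using l by (simp add: prime_gt_0_nat)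
  have l5: "\<not> l dvd 5"
  proof
    assume "l dvd 5"
    moreover have "prime (5::nat)" by simp
    ultimately show False using l by (metis not_prime_1 prime_nat_iff)
  qed
  have key: "int l dvd c" if "of_int c / of_nat l \<in> lat \<sigma>" "Im \<sigma> > 0" for c \<sigma>
    using of_int_div_of_nat_in_lat_iff[OF that(2) l0, of c 0] that(1) by simp
  show "inj_on (\<lambda>j. lat (sup_pt l \<tau> j)) {..<l}"
  proof (rule inj_onI)
    fix i j assume ij: "i \<in> {..<l}" "j \<in> {..<l}" and eq: "lat (sup_pt l \<tau> i) = lat (sup_pt l \<tau> j)"
    have "sup_pt l \<tau> i \<in> lat (sup_pt l \<tau> j)" using lat_tau[of "sup_pt l \<tau> i"] unfolding eq .
    from lat_diff[OF this lat_tau] have "of_int (5 * (int i - int j)) / of_nat l \<in> lat (sup_pt l \<tau> j)"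
      by (simp add: sup_pt_def diff_divide_distrib [symmetric] algebra_simps)
    then have "int l dvd 5 * (int i - int j)" by (rule key) (rule sup_pt_Im[OF \<tau> l0])
    then have "int l dvd int i - int j"
      using l(1) l5 by (metis int_dvd_int_iff of_nat_numeral prime_dvd_mult_iff prime_nat_int_transfer)
    then show "i = j"
      using ij by (metis cong_iff_dvd_diff cong_int_iff cong_less_modulus_unique_nat lessThan_iff)
  qed
  show "sup_inf l \<tau> \<notin> (\<lambda>j. lat (sup_pt l \<tau> j)) ` {..<l}"
  proof
    assume "sup_inf l \<tau> \<in> (\<lambda>j. lat (sup_pt l \<tau> j)) ` {..<l}"
    then obtain j where j: "sup_inf l \<tau> = lat (sup_pt l \<tau> j)" by auto
    have "1 / of_nat l \<in> sup_inf l \<tau>" unfolding sup_inf_def by (intro image_eqI[of _ _ 1]) auto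
    then have "of_int 1 / of_nat l \<in> lat (sup_pt l \<tau> j)" using j by simp
    then have "int l dvd 1" by (rule key) (rule sup_pt_Im[OF \<tau> l0])
    then show False using l(1) by (metis int_dvd_int_iff not_prime_1 of_nat_1 nat_dvd_1_iff_1)
  qed
qed

section \<open>Sums over superlattices\<close>

text \<open>Each product omits one factor, so when \<open>s0\<close> equals \<open>s M0\<close> only
  the term of \<open>M0\<close> can survive. For constant weights 1 this is the derivative at
  \<open>s0\<close> of the polynomial with roots \<open>s M\<close>. Division by \<open>n0\<close>
  makes the sum invariant under scaling of all weights, hence of weight 0.\<close>

definition gT :: "'i set \<Rightarrow> ('i \<Rightarrow> complex) \<Rightarrow> ('i \<Rightarrow> complex) \<Rightarrow> complex \<Rightarrow> complex \<Rightarrow> complex" where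
  "gT A n s n0 s0 = (\<Sum>M\<in>A. n M / n0 * (\<Prod>M'\<in>A - {M}. s0 - s M'))"

lemma gT_reindex:
  assumes f: "bij_betw f A B" and a: "a \<noteq> 0"
    and n: "\<And>M. M \<in> A \<Longrightarrow> n' M = a * n (f M)" and s: "\<And>M. M \<in> A \<Longrightarrow> s' M = s (f M)"
  shows "gT A n' s' (a * n0) s0 = gT B n s n0 s0"
proof -
  have "gT B n s n0 s0 = (\<Sum>M\<in>A. n (f M) / n0 * (\<Prod>M'\<in>B - {f M}. s0 - s M'))"
    unfolding gT_def by (rule sum.reindex_bij_betw[OF f, symmetric])
  also have "\<dots> = gT A n' s' (a * n0) s0"
    unfolding gT_def
  proof (rule sum.cong[OF refl])
    fix M assume M: "M \<in> A"
    have "bij_betw f (A - {M}) (B - {f M})"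
      using f M by (auto simp: bij_betw_def inj_on_def)
    then have "(\<Prod>M'\<in>B - {f M}. s0 - s M') = (\<Prod>M'\<in>A - {M}. s0 - s (f M'))"
      by (rule prod.reindex_bij_betw[symmetric])
    also have "\<dots> = (\<Prod>M'\<in>A - {M}. s0 - s' M')" by (rule prod.cong) (use s in auto)
    finally show "n (f M) / n0 * (\<Prod>M'\<in>B - {f M}. s0 - s M') = n' M / (a * n0) * (\<Prod>M'\<in>A - {M}. s0 - s' M')"
      using n[OF M] a by simp
  qed
  finally show ?thesis by simp
qed

text \<open>Separates index l, which will stand for \<open>sup_inf\<close>, from the l superlattices
  that are permuted by roots of unity.\<close>

lemma gT_atMost:
  "gT {..l::nat} n s n0 s0 = n l / n0 * (\<Prod>j<l. s0 - s j) + (s0 - s l) * gT {..<l} n s n0 s0"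
proof -
  have s: "{..l} = insert l {..<l}" by auto
  have "gT {..l} n s n0 s0 = n l / n0 * (\<Prod>M'\<in>{..l} - {l}. s0 - s M') +
      (\<Sum>M<l. n M / n0 * (\<Prod>M'\<in>{..l} - {M}. s0 - s M'))"
    unfolding gT_def by (subst s) simp
  also have "{..l} - {l} = {..<l}" by auto
  also have "(\<Sum>M<l. n M / n0 * (\<Prod>M'\<in>{..l} - {M}. s0 - s M')) = (s0 - s l) * gT {..<l} n s n0 s0"
    unfolding gT_def sum_distrib_left
  proof (rule sum.cong[OF refl])
    fix M assume "M \<in> {..<l}"
    then have "{..l} - {M} = insert l ({..<l} - {M})" by auto
    then show "n M / n0 * (\<Prod>M'\<in>{..l} - {M}. s0 - s M') =
        (s0 - s l) * (n M / n0 * (\<Prod>M'\<in>{..<l} - {M}. s0 - s M'))" by simp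
  qed
  finally show ?thesis .
qed

definition root_poly :: "nat \<Rightarrow> (nat \<Rightarrow> complex) \<Rightarrow> complex poly" where
  "root_poly l s = (\<Prod>j<l. [:- s j, 1:])"

lemma root_poly_degree: "degree (root_poly l s) = l" "lead_coeff (root_poly l s) = 1"
proof -
  show "degree (root_poly l s) = l" unfolding root_poly_def by (simp add: degree_prod_eq_sum_degree)
  show "lead_coeff (root_poly l s) = 1" unfolding root_poly_def lead_coeff_prod by simp
qed

lemma poly_root_poly: "poly (root_poly l s) x = (\<Prod>j<l. x - s j)"
  by (simp add: root_poly_def poly_prod)

text \<open>Synthetic division of the root polynomial by X - s_j, read from the top coefficient
  downwards.\<close>

lemma coeff_cofactor:
  assumes j: "j < l" and i: "i \<le> l"
  shows "Polynomial.coeff (\<Prod>m\<in>{..<l} - {j}. [:- s m, 1:]) i =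
    (\<Sum>k\<in>{i+1..l}. Polynomial.coeff (root_poly l s) k * s j ^ (k - (i + 1)))"
proof -
  define Q where "Q = (\<Prod>m\<in>{..<l} - {j}. [:- s m, 1:])"
  have P: "root_poly l s = [:- s j, 1:] * Q"
    unfolding root_poly_def Q_def using j by (subst prod.remove[of _ j]) auto
  have "degree Q = (\<Sum>m\<in>{..<l} - {j}. degree [:- s m, 1:])"
    unfolding Q_def by (rule degree_prod_eq_sum_degree) auto
  then have dQ: "degree Q < l" using j by simp
  have rec: "Polynomial.coeff Q i = Polynomial.coeff (root_poly l s) (Suc i) + s j * Polynomial.coeff Q (Suc i)" for i
    unfolding P by simp
  show ?thesis unfolding Q_def [symmetric] using i
  proof (induction i rule: inc_induct)
    case base
    then show ?case using dQ by (simp add: coeff_eq_0)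
  next
    case (step i)
    have "(\<Sum>k\<in>{i+1..l}. Polynomial.coeff (root_poly l s) k * s j ^ (k - (i + 1))) =
      Polynomial.coeff (root_poly l s) (Suc i) + (\<Sum>k\<in>{Suc i+1..l}. Polynomial.coeff (root_poly l s) k * s j ^ (k - (i + 1)))"
      using step(2) by (subst sum.atLeast_Suc_atMost) auto
    also have "(\<Sum>k\<in>{Suc i+1..l}. Polynomial.coeff (root_poly l s) k * s j ^ (k - (i + 1))) =
      s j * (\<Sum>k\<in>{Suc i+1..l}. Polynomial.coeff (root_poly l s) k * s j ^ (k - (Suc i + 1)))"
      unfolding sum_distrib_left
    proof (rule sum.cong[OF refl])
      fix k assume "k \<in> {Suc i+1..l}"
      then have "k - (i + 1) = Suc (k - (Suc i + 1))" by auto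
      then show "Polynomial.coeff (root_poly l s) k * s j ^ (k - (i + 1)) =
        s j * (Polynomial.coeff (root_poly l s) k * s j ^ (k - (Suc i + 1)))" by simp
    qed
    finally show ?case using rec[of i] step by simp
  qed
qed

text \<open>The derivative of the root polynomial is the sum of its cofactors; comparing
  coefficients yields Newton's identity with the power sums. The factor l - m has to be inverted
  later.\<close>

lemma newton_identity:
  assumes m: "1 \<le> m" "m < l"
  shows "of_nat (l - m) * Polynomial.coeff (root_poly l s) m =
     - (\<Sum>k\<in>{m+1..l}. Polynomial.coeff (root_poly l s) k * (\<Sum>j<l. s j ^ (k - m)))"
proof -
  obtain i where i: "m = Suc i" using m by (cases m) auto
  have "pderiv (root_poly l s) = (\<Sum>j<l. (\<Prod>m\<in>{..<l} - {j}. [:- s m, 1:]))"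
    unfolding root_poly_def by (simp add: pderiv_prod pderiv_pCons)
  then have "of_nat m * Polynomial.coeff (root_poly l s) m =
      (\<Sum>j<l. Polynomial.coeff (\<Prod>m\<in>{..<l} - {j}. [:- s m, 1:]) i)"
    by (metis coeff_pderiv coeff_sum i)
  also have "\<dots> = (\<Sum>j<l. \<Sum>k\<in>{m..l}. Polynomial.coeff (root_poly l s) k * s j ^ (k - m))"
    by (rule sum.cong[OF refl], subst coeff_cofactor) (use m i in auto)
  also have "\<dots> = (\<Sum>k\<in>{m..l}. Polynomial.coeff (root_poly l s) k * (\<Sum>j<l. s j ^ (k - m)))"
    unfolding sum_distrib_left by (rule sum.swap)
  also have "\<dots> = Polynomial.coeff (root_poly l s) m * of_nat l +
      (\<Sum>k\<in>{m+1..l}. Polynomial.coeff (root_poly l s) k * (\<Sum>j<l. s j ^ (k - m)))"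
    using m by (subst sum.atLeast_Suc_atMost) auto
  finally show ?thesis using m by (simp add: of_nat_diff algebra_simps)
qed

text \<open>Expanding the cofactors turns the sum into a polynomial in \<open>s0\<close> whose
  coefficients involve the weighted power sums of the roots, to which averaging over roots of unity
  applies.\<close>

lemma gT_lessThan_coeffs:
  "gT {..<l} n s n0 s0 = (\<Sum>i<l. s0 ^ i * (\<Sum>k\<in>{i+1..l}. Polynomial.coeff (root_poly l s) k *
       (\<Sum>j<l. n j * s j ^ (k - (i + 1))))) / n0"
proof -
  have Q: "(\<Prod>m\<in>{..<l} - {j}. s0 - s m) =
      (\<Sum>i<l. s0 ^ i * (\<Sum>k\<in>{i+1..l}. Polynomial.coeff (root_poly l s) k * s j ^ (k - (i + 1))))"
    if j: "j < l" for j
  proof -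
    define Q where "Q = (\<Prod>m\<in>{..<l} - {j}. [:- s m, 1:])"
    have "degree Q = (\<Sum>m\<in>{..<l} - {j}. degree [:- s m, 1:])"
      unfolding Q_def by (rule degree_prod_eq_sum_degree) auto
    then have dQ: "degree Q = l - 1" using j by simp
    have "(\<Prod>m\<in>{..<l} - {j}. s0 - s m) = poly Q s0" by (simp add: Q_def poly_prod)
    also have "\<dots> = (\<Sum>i<l. Polynomial.coeff Q i * s0 ^ i)"
      unfolding poly_altdef dQ using j by (intro sum.cong) auto
    also have "\<dots> = (\<Sum>i<l. s0 ^ i * (\<Sum>k\<in>{i+1..l}. Polynomial.coeff (root_poly l s) k * s j ^ (k - (i + 1))))"
      unfolding Q_def by (rule sum.cong[OF refl], subst coeff_cofactor[OF j]) (auto simp: mult.commute)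
    finally show ?thesis .
  qed
  have "gT {..<l} n s n0 s0 = (\<Sum>j<l. n j * (\<Prod>m\<in>{..<l} - {j}. s0 - s m)) / n0"
    by (simp add: gT_def sum_divide_distrib)
  also have "(\<Sum>j<l. n j * (\<Prod>m\<in>{..<l} - {j}. s0 - s m)) =
      (\<Sum>j<l. \<Sum>i<l. \<Sum>k\<in>{i+1..l}. s0 ^ i * (Polynomial.coeff (root_poly l s) k * (n j * s j ^ (k - (i + 1)))))"
    by (rule sum.cong[OF refl], subst Q) (auto simp: sum_distrib_left mult_ac)
  also have "\<dots> = (\<Sum>i<l. \<Sum>j<l. \<Sum>k\<in>{i+1..l}. s0 ^ i * (Polynomial.coeff (root_poly l s) k * (n j * s j ^ (k - (i + 1)))))"
    by (rule sum.swap)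
  also have "\<dots> = (\<Sum>i<l. \<Sum>k\<in>{i+1..l}. \<Sum>j<l. s0 ^ i * (Polynomial.coeff (root_poly l s) k * (n j * s j ^ (k - (i + 1)))))"
    by (intro sum.cong refl sum.swap)
  also have "\<dots> = (\<Sum>i<l. s0 ^ i * (\<Sum>k\<in>{i+1..l}. Polynomial.coeff (root_poly l s) k *
       (\<Sum>j<l. n j * s j ^ (k - (i + 1)))))"
    by (simp add: sum_distrib_left)
  finally show ?thesis .
qed

section \<open>Symmetric expressions over superlattices as weight 0 functions\<close>

definition sidx :: "nat \<Rightarrow> complex \<Rightarrow> nat \<Rightarrow> complex set" where
  "sidx l \<tau> j = (if j = l then sup_inf l \<tau> else lat (sup_pt l \<tau> j))"

lemma bij_betw_sidx:
  assumes "prime l" "l \<noteq> 5" "Im \<tau> > 0"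
  shows "bij_betw (sidx l \<tau>) {..l} (sups l (lat \<tau>))"
proof -
  note d = sups_lat_distinct[OF assms]
  have "{..l} = insert l {..<l}" by auto
  then show ?thesis
    unfolding bij_betw_def sups_lat[OF assms]
    using d by (auto simp: inj_on_def sidx_def image_iff)
qed

lemma lattice_basis_sup_inf: "Im \<tau> > 0 \<Longrightarrow> l > 0 \<Longrightarrow> lattice_basis (sup_inf l \<tau>) (1 / of_nat l) (of_nat l * \<tau>)"
  by (simp add: lattice_basis_def sup_inf_def)

lemma sups_lat_basis:
  assumes "prime l" "l \<noteq> 5" "Im \<tau> > 0" "M \<in> sups l (lat \<tau>)"
  obtains c \<sigma> where "lattice_basis M c \<sigma>"
proof -
  have l0: "l > 0" using assms(1) by (simp add: prime_gt_0_nat)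
  have "M = sup_inf l \<tau> \<or> (\<exists>j. M = lat (sup_pt l \<tau> j))"
    using assms(4) unfolding sups_lat[OF assms(1-3)] by auto
  then show thesis
    using that lattice_basis_sup_inf[OF assms(3) l0] lattice_basis_lat[OF sup_pt_Im[OF assms(3) l0]] by blast
qed

lemma lat_subset_sups: "M \<in> sups l \<Lambda> \<Longrightarrow> \<Lambda> \<subseteq> M"
proof
  fix w assume "M \<in> sups l \<Lambda>" "w \<in> \<Lambda>"
  then obtain v where M: "M = ext l \<Lambda> v" unfolding sups_def by blast
  have "w = w + of_int 0 * v / of_nat l" by simp
  then show "w \<in> M" unfolding M ext_def using \<open>w \<in> \<Lambda>\<close> by blast
qed

text \<open>The hypothesis on \<Psi> says: symmetric in the superlattices and homogeneous of degree
  0 in the weight -1 values. The scaling factor is c for a homothety by c, 1 for a period and -1 for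
  z -> -z.\<close>

lemma lat_inv_sups:
  fixes \<Psi> :: "complex set set \<Rightarrow> (complex set \<Rightarrow> complex) \<Rightarrow> (complex set \<Rightarrow> complex) \<Rightarrow> complex \<Rightarrow> complex \<Rightarrow> complex"
  assumes l: "prime l" "l \<noteq> 5"
    and \<Psi>: "\<And>f A B a n s n' s' n0 s0. bij_betw f A B \<Longrightarrow> a \<noteq> 0 \<Longrightarrow> (\<And>M. M \<in> A \<Longrightarrow> n' M = a * n (f M)) \<Longrightarrow>
       (\<And>M. M \<in> A \<Longrightarrow> s' M = s (f M)) \<Longrightarrow> \<Psi> A n' s' (a * n0) s0 = \<Psi> B n s n0 s0"
  shows "lat_inv (\<lambda>\<Lambda> z. \<Psi> (sups l \<Lambda>) (\<lambda>M. nL M z) (\<lambda>M. sL M z) (nL \<Lambda> z) (sL \<Lambda> z))"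
  unfolding lat_inv_def
proof (intro conjI allI impI)
  fix c \<tau> z assume c: "c \<noteq> (0::complex)" and \<tau>: "Im \<tau> > 0"
  note b = lattice_basis_lat[OF \<tau>]
  have "inj ((*) c)" by (rule injI) (use c in simp)
  then have "inj ((`) ((*) c))" by (auto intro: injI simp: inj_image_eq_iff)
  then have bij: "bij_betw ((`) ((*) c)) (sups l (lat \<tau>)) (sups l ((*) c ` lat \<tau>))"
    unfolding sups_scale[OF c] by (meson bij_betw_imageI inj_on_subset subset_UNIV)
  have n0: "nL (lat \<tau>) z = c * nL ((*) c ` lat \<tau>) (c * z)" using nL_scale[OF b c] c by simp
  show "\<Psi> (sups l ((*) c ` lat \<tau>)) (\<lambda>M. nL M (c * z)) (\<lambda>M. sL M (c * z)) (nL ((*) c ` lat \<tau>) (c * z))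
         (sL ((*) c ` lat \<tau>) (c * z)) =
        \<Psi> (sups l (lat \<tau>)) (\<lambda>M. nL M z) (\<lambda>M. sL M z) (nL (lat \<tau>) z) (sL (lat \<tau>) z)"
    unfolding n0 sL_scale[OF b c]
  proof (rule \<Psi>[OF bij c, symmetric])
    fix M assume "M \<in> sups l (lat \<tau>)"
    then obtain c' \<sigma> where "lattice_basis M c' \<sigma>" by (rule sups_lat_basis[OF l \<tau>])
    then show "nL M z = c * nL ((*) c ` M) (c * z)" "sL M z = sL ((*) c ` M) (c * z)"
      using nL_scale sL_scale c by auto
  qed
next
  fix \<tau> z \<omega> assume \<tau>: "Im \<tau> > 0" and \<omega>: "\<omega> \<in> lat \<tau>"
  note b = lattice_basis_lat[OF \<tau>]
  have "\<Psi> (sups l (lat \<tau>)) (\<lambda>M. nL M (z + \<omega>)) (\<lambda>M. sL M (z + \<omega>)) (1 * nL (lat \<tau>) z) (sL (lat \<tau>) z) =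
        \<Psi> (sups l (lat \<tau>)) (\<lambda>M. nL M z) (\<lambda>M. sL M z) (nL (lat \<tau>) z) (sL (lat \<tau>) z)"
  proof (rule \<Psi>[where f = "\<lambda>M. M"])
    fix M assume M: "M \<in> sups l (lat \<tau>)"
    then obtain c' \<sigma> where "lattice_basis M c' \<sigma>" by (rule sups_lat_basis[OF l \<tau>])
    moreover have "\<omega> \<in> M" using lat_subset_sups[OF M] \<omega> by blast
    ultimately show "nL M (z + \<omega>) = 1 * nL M z" "sL M (z + \<omega>) = sL M z"
      using nL_periodic sL_periodic by auto
  qed (auto simp: bij_betw_def)
  then show "\<Psi> (sups l (lat \<tau>)) (\<lambda>M. nL M (z + \<omega>)) (\<lambda>M. sL M (z + \<omega>)) (nL (lat \<tau>) (z + \<omega>)) (sL (lat \<tau>) (z + \<omega>)) =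
        \<Psi> (sups l (lat \<tau>)) (\<lambda>M. nL M z) (\<lambda>M. sL M z) (nL (lat \<tau>) z) (sL (lat \<tau>) z)"
    by (simp add: nL_periodic[OF b \<omega>] sL_periodic[OF b \<omega>])
next
  fix \<tau> z assume \<tau>: "Im \<tau> > 0"
  note b = lattice_basis_lat[OF \<tau>]
  have "\<Psi> (sups l (lat \<tau>)) (\<lambda>M. nL M (- z)) (\<lambda>M. sL M (- z)) ((- 1) * nL (lat \<tau>) z) (sL (lat \<tau>) z) =
        \<Psi> (sups l (lat \<tau>)) (\<lambda>M. nL M z) (\<lambda>M. sL M z) (nL (lat \<tau>) z) (sL (lat \<tau>) z)"
  proof (rule \<Psi>[where f = "\<lambda>M. M"])
    fix M assume M: "M \<in> sups l (lat \<tau>)"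
    then obtain c' \<sigma> where "lattice_basis M c' \<sigma>" by (rule sups_lat_basis[OF l \<tau>])
    then show "nL M (- z) = (- 1) * nL M z" "sL M (- z) = sL M z"
      using nL_minus sL_minus by auto
  qed (auto simp: bij_betw_def)
  then show "\<Psi> (sups l (lat \<tau>)) (\<lambda>M. nL M (- z)) (\<lambda>M. sL M (- z)) (nL (lat \<tau>) (- z)) (sL (lat \<tau>) (- z)) =
        \<Psi> (sups l (lat \<tau>)) (\<lambda>M. nL M z) (\<lambda>M. sL M z) (nL (lat \<tau>) z) (sL (lat \<tau>) z)"
    by (simp add: nL_minus[OF b] sL_minus[OF b])
qed

section \<open>Values at the cusps and pole orders\<close>

definition sc :: "nat \<Rightarrow> complex \<Rightarrow> complex" where
  "sc i \<tau> = es i (ee (\<tau> / 5)) * Sc i (ee (\<tau> / 5))"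

definition nc :: "nat \<Rightarrow> complex \<Rightarrow> complex" where
  "nc i \<tau> = en i (ee (\<tau> / 5)) * Nc i (ee (\<tau> / 5))"

lemma sL_nL_cusp:
  assumes "Im \<tau> > 0" "i \<in> {1..4}"
  shows "sL (lat \<tau>) (cz i \<tau>) = sc i \<tau>" "nL (lat \<tau>) (cz i \<tau>) = nc i \<tau>"
  using sfun_nfun_cusp[OF assms] by (simp_all add: sL_lat nL_lat assms sc_def nc_def)

definition sgi :: "nat \<Rightarrow> complex" where "sgi i = (if i \<le> 2 then 1 else - 1)"

text \<open>Multiplication by l is -1 on 5-torsion. For \<open>sup_inf\<close>, rescaling by l sends
  the point to \<open>cz i\<close> of l \<tau> at cusps 1, 2 and to its negative at cusps 3, 4; for
  \<open>lat \<sigma>\<close> with \<tau> = l \<sigma> - 5 j the roles are exchanged. Since s is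
  even and n is odd, only n sees the sign; the factor l is the weight of n.\<close>

lemma sL_nL_sups:
  assumes l: "l mod 5 = 4" and \<tau>: "Im \<tau> > 0" and i: "i \<in> {1..4}"
  shows "sL (sidx l \<tau> j) (cz i \<tau>) = (if j = l then sc i (of_nat l * \<tau>) else sc i (sup_pt l \<tau> j))"
    and "nL (sidx l \<tau> j) (cz i \<tau>) =
      sgi i * (if j = l then of_nat l * nc i (of_nat l * \<tau>) else - nc i (sup_pt l \<tau> j))"
proof -
  have l0: "l > 0" using l by (cases l) auto
  define k where "k = (l + 1) div 5"
  have lk: "l + 1 = 5 * k" using l unfolding k_def by presburger
  then have lk': "(of_nat l :: complex) = 5 * of_nat k - 1"
    by (metis add_diff_cancel_right' of_nat_1 of_nat_add of_nat_mult of_nat_numeral)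
  have cases_i: "i = 1 \<or> i = 2 \<or> i = 3 \<or> i = 4" using i by auto
  have *: "sL (sidx l \<tau> j) (cz i \<tau>) = (if j = l then sc i (of_nat l * \<tau>) else sc i (sup_pt l \<tau> j)) \<and>
     nL (sidx l \<tau> j) (cz i \<tau>) =
      sgi i * (if j = l then of_nat l * nc i (of_nat l * \<tau>) else - nc i (sup_pt l \<tau> j))"
  proof (cases "j = l")
    case True
    define \<sigma> where "\<sigma> = of_nat l * \<tau>"
    have \<sigma>: "Im \<sigma> > 0" using \<tau> l0 by (simp add: \<sigma>_def)
    have b: "lattice_basis (sidx l \<tau> j) (1 / of_nat l) \<sigma>"
      using lattice_basis_sup_inf[OF \<tau> l0] True by (simp add: sidx_def \<sigma>_def)
    have z: "cz i \<tau> / (1 / of_nat l) = of_nat l * cz i \<tau>" by simp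
    have "sfun \<sigma> (of_nat l * cz i \<tau>) = sfun \<sigma> (cz i \<sigma>) \<and> nfun \<sigma> (of_nat l * cz i \<tau>) = sgi i * nfun \<sigma> (cz i \<sigma>)"
    proof (cases "i \<le> 2")
      case True
      then have "of_nat l * cz i \<tau> = cz i \<sigma>" using i by (auto simp: cz_def \<sigma>_def)
      then show ?thesis using True by (simp add: sgi_def)
    next
      case False
      have "of_nat l * cz i \<tau> = - cz i \<sigma> + of_int (if i = 3 then int k else 2 * int k)"
        unfolding lk' using False by (auto simp: cz_def field_simps)
      then have "sfun \<sigma> (of_nat l * cz i \<tau>) = sfun \<sigma> (- cz i \<sigma>)" "nfun \<sigma> (of_nat l * cz i \<tau>) = nfun \<sigma> (- cz i \<sigma>)"
        by (simp_all only: sfun_periodic[OF \<sigma> lat_of_int] nfun_periodic[OF \<sigma> lat_of_int])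
      then show ?thesis using False by (simp add: sgi_def sfun_minus[OF \<sigma>] nfun_minus[OF \<sigma>])
    qed
    then show ?thesis
      using sL_eq[OF b, of "cz i \<tau>"] nL_eq[OF b, of "cz i \<tau>"] sfun_nfun_cusp[OF \<sigma> i] True
      unfolding z by (simp add: sc_def nc_def \<sigma>_def)
  next
    case False
    define \<sigma> where "\<sigma> = sup_pt l \<tau> j"
    have \<sigma>: "Im \<sigma> > 0" unfolding \<sigma>_def by (rule sup_pt_Im[OF \<tau> l0])
    have s: "sidx l \<tau> j = lat \<sigma>" using False by (simp add: sidx_def \<sigma>_def)
    have \<tau>\<sigma>: "\<tau> = of_nat l * \<sigma> - 5 * of_nat j" using l0 by (simp add: \<sigma>_def sup_pt_def)
    have "sfun \<sigma> (cz i \<tau>) = sfun \<sigma> (cz i \<sigma>) \<and> nfun \<sigma> (cz i \<tau>) = - sgi i * nfun \<sigma> (cz i \<sigma>)"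
    proof (cases "i \<le> 2")
      case False
      then have "cz i \<tau> = cz i \<sigma>" by (auto simp: cz_def)
      then show ?thesis using False by (simp add: sgi_def)
    next
      case True
      define \<omega> where "\<omega> = of_nat i * (of_int (- int j) + of_int (int k) * \<sigma>)"
      have "\<omega> \<in> lat \<sigma>"
      proof -
        have "of_int (int i) * (of_int (- int j) + of_int (int k) * \<sigma>) \<in> lat \<sigma>"
          by (intro lat_mult_int latI[OF refl])
        then show ?thesis unfolding \<omega>_def by simp
      qed
      moreover have "cz i \<tau> = - cz i \<sigma> + \<omega>"
        unfolding \<tau>\<sigma> lk' \<omega>_def using True i cases_i by (auto simp: cz_def field_simps)
      ultimately have "sfun \<sigma> (cz i \<tau>) = sfun \<sigma> (- cz i \<sigma>)" "nfun \<sigma> (cz i \<tau>) = nfun \<sigma> (- cz i \<sigma>)"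
        by (simp_all only: sfun_periodic[OF \<sigma>] nfun_periodic[OF \<sigma>])
      then show ?thesis using True by (simp add: sgi_def sfun_minus[OF \<sigma>] nfun_minus[OF \<sigma>])
    qed
    then show ?thesis
      using sfun_nfun_cusp[OF \<sigma> i] False unfolding s sL_lat[OF \<sigma>] nL_lat[OF \<sigma>]
      by (simp add: sc_def nc_def \<sigma>_def [symmetric])
  qed
  from * show "sL (sidx l \<tau> j) (cz i \<tau>) = (if j = l then sc i (of_nat l * \<tau>) else sc i (sup_pt l \<tau> j))" by blast
  from * show "nL (sidx l \<tau> j) (cz i \<tau>) =
      sgi i * (if j = l then of_nat l * nc i (of_nat l * \<tau>) else - nc i (sup_pt l \<tau> j))" by blast
qed

text \<open>A pole of order at most k in x = e(\<tau>/5) towards infinity, and boundedness on every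
  half plane after clearing it.\<close>

definition XB :: "nat \<Rightarrow> (complex \<Rightarrow> complex) \<Rightarrow> bool" where
  "XB k g \<longleftrightarrow> BH (\<lambda>\<tau>. ee (\<tau> / 5) ^ k * g \<tau>)"

lemma BH_ee: "BH (\<lambda>\<tau>. ee (\<tau> / 5))"
  by (rule BH_compose_ee) (rule holomorphic_on_ident)

lemma XB_mono: "XB k g \<Longrightarrow> k \<le> k' \<Longrightarrow> XB k' g"
proof -
  assume g: "XB k g" and k: "k \<le> k'"
  have "BH (\<lambda>\<tau>. ee (\<tau> / 5) ^ (k' - k) * (ee (\<tau> / 5) ^ k * g \<tau>))"
    by (rule BH_mult[OF BH_power[OF BH_ee] g[unfolded XB_def]])
  moreover have "x ^ (k' - k) * (x ^ k * z) = x ^ k' * z" for x z :: complex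
    using k by (simp add: mult.assoc [symmetric] flip: power_add)
  ultimately show ?thesis unfolding XB_def by simp
qed

lemma XB_diff: "XB k g \<Longrightarrow> XB k h \<Longrightarrow> XB k (\<lambda>\<tau>. g \<tau> - h \<tau>)"
  unfolding XB_def by (simp add: right_diff_distrib BH_diff)

lemma XB_add: "XB k g \<Longrightarrow> XB k h \<Longrightarrow> XB k (\<lambda>\<tau>. g \<tau> + h \<tau>)"
  unfolding XB_def by (simp add: distrib_left BH_add)

lemma XB_sum: "(\<And>i. i \<in> I \<Longrightarrow> XB k (g i)) \<Longrightarrow> XB k (\<lambda>\<tau>. \<Sum>i\<in>I. g i \<tau>)"
  unfolding XB_def by (simp add: sum_distrib_left BH_sum)

lemma XB_mult: "XB k g \<Longrightarrow> XB k' h \<Longrightarrow> XB (k + k') (\<lambda>\<tau>. g \<tau> * h \<tau>)"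
proof -
  assume "XB k g" "XB k' h"
  then have "BH (\<lambda>\<tau>. (ee (\<tau> / 5) ^ k * g \<tau>) * (ee (\<tau> / 5) ^ k' * h \<tau>))"
    unfolding XB_def by (rule BH_mult)
  then show ?thesis unfolding XB_def by (simp add: power_add mult_ac)
qed

lemma XB_const: "XB 0 (\<lambda>\<tau>. c)"
  by (simp add: XB_def BH_const)

lemma XB_power: "XB k g \<Longrightarrow> XB (n * k) (\<lambda>\<tau>. g \<tau> ^ n)"
  by (induction n) (use XB_const[of 1] XB_mult in \<open>auto\<close>)

lemma XB_prod:
  assumes "finite I" "\<And>i. i \<in> I \<Longrightarrow> XB k (g i)"
  shows "XB (card I * k) (\<lambda>\<tau>. \<Prod>i\<in>I. g i \<tau>)"
  using assms by (induction I rule: finite_induct) (use XB_const[of 1] XB_mult in \<open>auto\<close>)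

lemma XB_cong: "XB k g \<Longrightarrow> (\<And>\<tau>. Im \<tau> > 0 \<Longrightarrow> g \<tau> = h \<tau>) \<Longrightarrow> XB k h"
  unfolding XB_def by (elim BH_cong) simp

lemma XB_cmult: "XB k g \<Longrightarrow> XB k (\<lambda>\<tau>. c * g \<tau>)"
  using XB_mult[OF XB_const] by simp

lemma XB_gT:
  assumes n: "\<And>j. j \<le> l \<Longrightarrow> XB kn (\<lambda>\<tau>. n \<tau> j / n0 \<tau>)" and s: "\<And>j. j \<le> l \<Longrightarrow> XB k (\<lambda>\<tau>. s \<tau> j)"
    and s0: "XB k s0"
  shows "XB (kn + l * k) (\<lambda>\<tau>. gT {..l} (n \<tau>) (s \<tau>) (n0 \<tau>) (s0 \<tau>))"
  unfolding gT_def
proof (rule XB_sum)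
  fix M assume M: "M \<in> {..l}"
  have "XB (card ({..l} - {M}) * k) (\<lambda>\<tau>. \<Prod>M'\<in>{..l} - {M}. s0 \<tau> - s \<tau> M')"
    by (rule XB_prod) (auto intro!: XB_diff s s0)
  then have "XB (l * k) (\<lambda>\<tau>. \<Prod>M'\<in>{..l} - {M}. s0 \<tau> - s \<tau> M')" using M by simp
  then show "XB (kn + l * k) (\<lambda>\<tau>. n \<tau> M / n0 \<tau> * (\<Prod>M'\<in>{..l} - {M}. s0 \<tau> - s \<tau> M'))"
    using n M by (intro XB_mult) auto
qed

definition s1 :: "complex \<Rightarrow> complex" where "s1 x = x * Sc 1 x"

lemma ee_sup_pt:
  assumes "l > 0"
  shows "ee (sup_pt l \<tau> j / 5) = ee (of_nat j / of_nat l) * ee (\<tau> / (5 * of_nat l))"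
    "ee (\<tau> / (5 * of_nat l)) ^ l = ee (\<tau> / 5)" "ee (of_nat l * \<tau> / 5) = ee (\<tau> / 5) ^ l"
    "ee (sup_pt l \<tau> j / 5) ^ l = ee (\<tau> / 5)"
proof -
  have "sup_pt l \<tau> j / 5 = of_nat j / of_nat l + \<tau> / (5 * of_nat l)"
    using assms by (simp add: sup_pt_def field_simps)
  then show 1: "ee (sup_pt l \<tau> j / 5) = ee (of_nat j / of_nat l) * ee (\<tau> / (5 * of_nat l))"
    by (simp only: ee_add)
  show 2: "ee (\<tau> / (5 * of_nat l)) ^ l = ee (\<tau> / 5)"
    using assms by (simp flip: ee_of_nat_mult)
  show "ee (of_nat l * \<tau> / 5) = ee (\<tau> / 5) ^ l"
    by (simp flip: ee_of_nat_mult)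
  have "ee (of_nat j / of_nat l) ^ l = 1"
    using assms ee_of_int[of "int j"] by (simp flip: ee_of_nat_mult)
  then show "ee (sup_pt l \<tau> j / 5) ^ l = ee (\<tau> / 5)"
    unfolding 1 power_mult_distrib 2 by simp
qed

text \<open>The pole order of s at a cusp, and at cusps 2, 3, 4 also that of 1/n.\<close>

definition kap :: "nat \<Rightarrow> nat" where "kap i = (if i = 2 then 1 else 0)"

lemma XB_sc_nc:
  assumes i: "i \<in> {2..4}" and l: "l > 0"
  shows "XB (kap i) (sc i)" "XB (kap i) (\<lambda>\<tau>. sc i (sup_pt l \<tau> j))"
    "XB (l * kap i) (\<lambda>\<tau>. sc i (of_nat l * \<tau>))" "XB (kap i) (\<lambda>\<tau>. 1 / nc i \<tau>)"
    "XB 0 (\<lambda>\<tau>. nc i (of_nat l * \<tau>))" "XB 0 (\<lambda>\<tau>. nc i (sup_pt l \<tau> j))"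
proof -
  have cases_i: "i = 2 \<or> i = 3 \<or> i = 4" using i by auto
  have sub1: "BH (\<lambda>\<tau>. g (of_nat l * \<tau>))" if "BH g" for g
    using BH_subst[OF that, of "real l" 0] l by simp
  have sub2: "BH (\<lambda>\<tau>. g (sup_pt l \<tau> j))" if "BH g" for g
    using BH_subst[OF that, of "1 / real l" "5 * of_nat j / of_nat l"] l
    by (simp add: sup_pt_def add_divide_distrib)
  have S: "BH (\<lambda>\<tau>. Sc i (ee (\<tau> / 5)))" "BH (\<lambda>\<tau>. Nc i (ee (\<tau> / 5)))"
    by (intro BH_compose_ee Sc_Nc_holomorphic)+
  have N': "BH (\<lambda>\<tau>. 1 / Nc i (ee (\<tau> / 5)))"
  proof (rule BH_compose_ee)
    show "(\<lambda>x. 1 / Nc i x) holomorphic_on ball 0 1"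
      using Sc_Nc_nonzero by (intro holomorphic_intros Sc_Nc_holomorphic) auto
  qed
  have scB: "BH (\<lambda>\<tau>. ee (\<tau> / 5) ^ kap i * sc i \<tau>)"
    using S(1) cases_i by (auto simp: kap_def sc_def es_def)
  then show "XB (kap i) (sc i)" by (simp add: XB_def)
  have ncB: "BH (nc i)"
    using BH_mult[OF BH_ee S(2)] S(2) cases_i by (auto simp: nc_def [abs_def] en_def)
  show "XB 0 (\<lambda>\<tau>. nc i (of_nat l * \<tau>))" "XB 0 (\<lambda>\<tau>. nc i (sup_pt l \<tau> j))"
    using sub1[OF ncB] sub2[OF ncB] by (simp_all add: XB_def)
  show "XB (kap i) (\<lambda>\<tau>. 1 / nc i \<tau>)"
    using N' cases_i by (auto simp: XB_def kap_def nc_def en_def)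
  have "BH (\<lambda>\<tau>. (ee (\<tau> / 5) ^ l) ^ kap i * sc i (of_nat l * \<tau>))"
    using sub1[OF scB] ee_sup_pt(3)[OF l] by simp
  then show "XB (l * kap i) (\<lambda>\<tau>. sc i (of_nat l * \<tau>))" by (simp add: XB_def power_mult)
  \<comment> \<open>With x' = e(\<open>sup_pt l \<tau> j\<close>/5) one has x = x'^l: one factor x'
    absorbs the pole and the other l - 1 are bounded.\<close>
  have "BH (\<lambda>\<tau>. (ee (sup_pt l \<tau> j / 5) ^ (l - 1)) ^ kap i * (ee (sup_pt l \<tau> j / 5) ^ kap i * sc i (sup_pt l \<tau> j)))"
    by (intro BH_mult BH_power sub2[OF BH_ee] sub2[OF scB])
  moreover have "(ee (sup_pt l \<tau> j / 5) ^ (l - 1)) ^ kap i * (ee (sup_pt l \<tau> j / 5) ^ kap i * z) = ee (\<tau> / 5) ^ kap i * z" for \<tau> z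
  proof -
    have "ee (sup_pt l \<tau> j / 5) ^ (l - 1) * ee (sup_pt l \<tau> j / 5) = ee (\<tau> / 5)"
      using l ee_sup_pt(4)[OF l] by (metis power_minus_mult)
    then show ?thesis by (metis mult.assoc power_mult_distrib)
  qed
  ultimately show "XB (kap i) (\<lambda>\<tau>. sc i (sup_pt l \<tau> j))" by (simp only: XB_def)
qed

section \<open>Expansions at the first cusp modulo l\<close>

context lprime
begin

definition zs :: "complex \<Rightarrow> nat \<Rightarrow> complex" where
  "zs y j = s1 (ee (of_nat j / of_nat l) * y)"

lemma Fl_s1: "Fl s1"
  using Fl_mult[OF Fl_ident Fl_Sc_1] by (simp add: s1_def [abs_def])

lemma norm_power_l: "norm y < 1 \<Longrightarrow> norm (y ^ l) < (1::real)"
  for y :: complex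
  by (rule norm_power_less_1[OF _ l_pos])

lemma norm_rot: "norm (ee (of_nat j / of_nat l) * y) = norm y"
  by (simp add: norm_mult norm_ee)

text \<open>Power sums of the rotated values are l times series in y^l, and Newton's identities pass
  this to the coefficients, since l - m is a unit of \<open>Zl\<close> for 0 < m < l. The constant
  coefficient, where one would divide by l, is obtained from \<open>prod_zs\<close> instead.\<close>

lemma root_coeffs:
  "1 \<le> m \<Longrightarrow> m < l \<Longrightarrow> \<exists>C. Fl C \<and> (\<forall>y. norm y < 1 \<longrightarrow>
     Polynomial.coeff (root_poly l (zs y)) m = of_nat l * C (y ^ l))"
proof (induction "l - m" arbitrary: m rule: less_induct)
  case less
  have "\<exists>W. Fl W \<and> (\<forall>y. norm y < 1 \<longrightarrow> (\<Sum>j<l. zs y j ^ k) = of_nat l * W (y ^ l))" for k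
  proof -
    obtain H where "Fl H" "\<And>y. norm y < 1 \<Longrightarrow> (\<Sum>j<l. s1 (ee (of_nat j / of_nat l) * y) ^ k) = of_nat l * H (y ^ l)"
      using Fl_sum_roots_of_unity[OF Fl_power[OF Fl_s1, of k]] by blast
    then show ?thesis unfolding zs_def by blast
  qed
  then obtain W where W: "\<And>k. Fl (W k)" "\<And>k y. norm y < 1 \<Longrightarrow> (\<Sum>j<l. zs y j ^ k) = of_nat l * W k (y ^ l)"
    by metis
  have "\<exists>C. Fl C \<and> (\<forall>y. norm y < 1 \<longrightarrow> Polynomial.coeff (root_poly l (zs y)) k = of_nat l * C (y ^ l))"
    if "k \<in> {m<..<l}" for k
    using that less(2,3) by (intro less(1)) auto
  then obtain C where C: "\<And>k. k \<in> {m<..<l} \<Longrightarrow> Fl (C k)"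
    "\<And>k y. k \<in> {m<..<l} \<Longrightarrow> norm y < 1 \<Longrightarrow> Polynomial.coeff (root_poly l (zs y)) k = of_nat l * C k (y ^ l)"
    by metis
  define D where "D = (\<lambda>x. - (1 / of_nat (l - m)) * (W (l - m) x + (\<Sum>k\<in>{m<..<l}. of_nat l * C k x * W (k - m) x)))"
  have "1 / of_nat (l - m) \<in> Zl" using less(2,3) by (intro Zl_inverse_of_nat) auto
  then have "Fl D" unfolding D_def
    by (intro Fl_mult Fl_const Fl_add Fl_sum W C csubring_uminus[OF Zl_subring] csubring_of_nat[OF Zl_subring])
  moreover have "Polynomial.coeff (root_poly l (zs y)) m = of_nat l * D (y ^ l)" if y: "norm y < 1" for y
  proof -
    have "{m+1..l} = insert l {m<..<l}" using less(3) by auto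
    then have "of_nat (l - m) * Polynomial.coeff (root_poly l (zs y)) m =
      - (Polynomial.coeff (root_poly l (zs y)) l * (of_nat l * W (l - m) (y ^ l)) +
        (\<Sum>k\<in>{m<..<l}. Polynomial.coeff (root_poly l (zs y)) k * (of_nat l * W (k - m) (y ^ l))))"
      unfolding newton_identity[OF less(2,3)] W(2)[OF y] by simp
    also have "Polynomial.coeff (root_poly l (zs y)) l = 1" using root_poly_degree by metis
    also have "(\<Sum>k\<in>{m<..<l}. Polynomial.coeff (root_poly l (zs y)) k * (of_nat l * W (k - m) (y ^ l))) =
       of_nat l * (\<Sum>k\<in>{m<..<l}. of_nat l * C k (y ^ l) * W (k - m) (y ^ l))"
      unfolding sum_distrib_left by (rule sum.cong[OF refl]) (simp add: C(2)[OF _ y])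
    finally show ?thesis
      using less(3) by (simp add: D_def field_simps)
  qed
  ultimately show ?case by blast
qed

text \<open>Combines the expansion in weighted power sums with averaging over roots of unity; every
  term then carries a factor l.\<close>

lemma gT_eval:
  assumes N: "Fl N"
  shows "\<exists>H. Fl H \<and> (\<forall>y. norm y < 1 \<longrightarrow>
    gT {..<l} (\<lambda>j. N (ee (of_nat j / of_nat l) * y)) (zs y) 1 (s1 (y ^ l)) = of_nat l * H (y ^ l))"
proof -
  have "\<exists>W. Fl W \<and> (\<forall>y. norm y < 1 \<longrightarrow> (\<Sum>j<l. N (ee (of_nat j / of_nat l) * y) * zs y j ^ k) = of_nat l * W (y ^ l))" for k
  proof -
    obtain H where "Fl H" "\<And>y. norm y < 1 \<Longrightarrow> (\<Sum>j<l. N (ee (of_nat j / of_nat l) * y) *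
        s1 (ee (of_nat j / of_nat l) * y) ^ k) = of_nat l * H (y ^ l)"
      using Fl_sum_roots_of_unity[OF Fl_mult[OF N Fl_power[OF Fl_s1, of k]]] by blast
    then show ?thesis unfolding zs_def by blast
  qed
  then obtain W where W: "\<And>k. Fl (W k)"
    "\<And>k y. norm y < 1 \<Longrightarrow> (\<Sum>j<l. N (ee (of_nat j / of_nat l) * y) * zs y j ^ k) = of_nat l * W k (y ^ l)"
    by metis
  have "\<exists>C. Fl C \<and> (\<forall>y. norm y < 1 \<longrightarrow> Polynomial.coeff (root_poly l (zs y)) k = C (y ^ l))"
    if k: "k \<in> {1..l}" for k
  proof (cases "k = l")
    case True
    then show ?thesis
      using root_poly_degree[of l] by (intro exI[of _ "\<lambda>x. 1"]) (auto intro!: Fl_const csubring_1[OF Zl_subring])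
  next
    case False
    then obtain C where "Fl C" "\<And>y. norm y < 1 \<Longrightarrow> Polynomial.coeff (root_poly l (zs y)) k = of_nat l * C (y ^ l)"
      using root_coeffs[of k] k by auto
    then show ?thesis
      by (intro exI[of _ "\<lambda>x. of_nat l * C x"]) (auto intro!: Fl_mult Fl_const csubring_of_nat[OF Zl_subring])
  qed
  then obtain C where C: "\<And>k. k \<in> {1..l} \<Longrightarrow> Fl (C k)"
    "\<And>k y. k \<in> {1..l} \<Longrightarrow> norm y < 1 \<Longrightarrow> Polynomial.coeff (root_poly l (zs y)) k = C k (y ^ l)"
    by metis
  define H where "H = (\<lambda>x. \<Sum>i<l. s1 x ^ i * (\<Sum>k\<in>{i+1..l}. C k x * W (k - (i + 1)) x))"
  have "Fl H" unfolding H_def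
    by (intro Fl_sum Fl_mult Fl_power Fl_s1 C W) auto
  moreover have "gT {..<l} (\<lambda>j. N (ee (of_nat j / of_nat l) * y)) (zs y) 1 (s1 (y ^ l)) = of_nat l * H (y ^ l)"
    if y: "norm y < 1" for y
  proof -
    have "gT {..<l} (\<lambda>j. N (ee (of_nat j / of_nat l) * y)) (zs y) 1 (s1 (y ^ l)) =
        (\<Sum>i<l. s1 (y ^ l) ^ i * (\<Sum>k\<in>{i+1..l}. C k (y ^ l) * (of_nat l * W (k - (i + 1)) (y ^ l))))"
      unfolding gT_lessThan_coeffs div_by_1 W(2)[OF y]
      by (intro sum.cong refl arg_cong2[where f = "(*)"]) (simp add: C(2)[OF _ y])
    then show ?thesis by (simp add: H_def sum_distrib_left mult_ac)
  qed
  ultimately show ?thesis by blast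
qed

end

section \<open>The modular relations\<close>

lemma ee_sum: "(\<Prod>i\<in>I. ee (f i)) = ee (\<Sum>i\<in>I. f i)"
  by (induction I rule: infinite_finite_induct) (auto simp: ee_add)

lemma gT_cong:
  assumes "\<And>M. M \<in> A \<Longrightarrow> n M = n' M" "\<And>M. M \<in> A \<Longrightarrow> s M = s' M"
  shows "gT A n s n0 s0 = gT A n' s' n0 s0"
  unfolding gT_def using assms by (intro sum.cong prod.cong arg_cong2[where f = "(*)"]) auto

lemma gT_denominator: "gT A n s n0 s0 = gT A n s 1 s0 / n0"
  by (simp add: gT_def sum_divide_distrib)

locale lprime4 = lprime +
  assumes l_mod: "l mod 5 = 4"
begin

lemma l_not_5: "l \<noteq> 5" using l_mod by auto

lemma l_odd: "odd l"
proof -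
  have "l > 2" using l_mod by (cases l; cases "l - 1"; cases "l - 2") auto
  then show ?thesis using prime_l prime_odd_nat by blast
qed

lemma gT_sups:
  assumes \<tau>: "Im \<tau> > 0" and i: "i \<in> {1..4}"
  shows "gT (sups l (lat \<tau>)) (\<lambda>M. nL M (cz i \<tau>)) (\<lambda>M. sL M (cz i \<tau>)) (nL (lat \<tau>) (cz i \<tau>)) (sL (lat \<tau>) (cz i \<tau>)) =
    gT {..l} (\<lambda>j. sgi i * (if j = l then of_nat l * nc i (of_nat l * \<tau>) else - nc i (sup_pt l \<tau> j)))
      (\<lambda>j. if j = l then sc i (of_nat l * \<tau>) else sc i (sup_pt l \<tau> j)) (nc i \<tau>) (sc i \<tau>)"
    and "gT (sups l (lat \<tau>)) (\<lambda>M. 1) (\<lambda>M. sL M (cz i \<tau>)) 1 (sL (lat \<tau>) (cz i \<tau>)) =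
    gT {..l} (\<lambda>j. 1) (\<lambda>j. if j = l then sc i (of_nat l * \<tau>) else sc i (sup_pt l \<tau> j)) 1 (sc i \<tau>)"
    and "(\<Prod>M\<in>sups l (lat \<tau>). g (sL M (cz i \<tau>))) = g (sc i (of_nat l * \<tau>)) * (\<Prod>j<l. g (sc i (sup_pt l \<tau> j)))"
proof -
  note bij = bij_betw_sidx[OF prime_l l_not_5 \<tau>]
  show "gT (sups l (lat \<tau>)) (\<lambda>M. nL M (cz i \<tau>)) (\<lambda>M. sL M (cz i \<tau>)) (nL (lat \<tau>) (cz i \<tau>)) (sL (lat \<tau>) (cz i \<tau>)) =
    gT {..l} (\<lambda>j. sgi i * (if j = l then of_nat l * nc i (of_nat l * \<tau>) else - nc i (sup_pt l \<tau> j)))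
      (\<lambda>j. if j = l then sc i (of_nat l * \<tau>) else sc i (sup_pt l \<tau> j)) (nc i \<tau>) (sc i \<tau>)"
    unfolding sL_nL_cusp[OF \<tau> i]
    by (subst gT_reindex[OF bij, of 1, symmetric])
       (use sL_nL_sups[OF l_mod \<tau> i] in auto)
  show "gT (sups l (lat \<tau>)) (\<lambda>M. 1) (\<lambda>M. sL M (cz i \<tau>)) 1 (sL (lat \<tau>) (cz i \<tau>)) =
    gT {..l} (\<lambda>j. 1) (\<lambda>j. if j = l then sc i (of_nat l * \<tau>) else sc i (sup_pt l \<tau> j)) 1 (sc i \<tau>)"
    unfolding sL_nL_cusp[OF \<tau> i]
    by (subst gT_reindex[OF bij, of 1, symmetric])
       (use sL_nL_sups[OF l_mod \<tau> i] in auto)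
  have "(\<Prod>M\<in>sups l (lat \<tau>). g (sL M (cz i \<tau>))) = (\<Prod>j\<le>l. g (sL (sidx l \<tau> j) (cz i \<tau>)))"
    by (rule prod.reindex_bij_betw[OF bij, symmetric])
  also have "{..l} = insert l {..<l}" by auto
  also have "(\<Prod>j\<in>insert l {..<l}. g (sL (sidx l \<tau> j) (cz i \<tau>))) =
      g (sc i (of_nat l * \<tau>)) * (\<Prod>j<l. g (sc i (sup_pt l \<tau> j)))"
    unfolding sL_nL_sups[OF l_mod \<tau> i] by simp
  finally show "(\<Prod>M\<in>sups l (lat \<tau>). g (sL M (cz i \<tau>))) = g (sc i (of_nat l * \<tau>)) * (\<Prod>j<l. g (sc i (sup_pt l \<tau> j)))" .
qed

text \<open>In the variable y, an l-th root of e(\<tau>/5), the values at all l + 1 superlattices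
  become power series at once.\<close>

lemma cusp_1_values:
  fixes \<tau> :: complex
  defines "y \<equiv> ee (\<tau> / (5 * of_nat l))"
  shows "ee (\<tau> / 5) = y ^ l" "sc 1 \<tau> = s1 (y ^ l)" "sc 1 (of_nat l * \<tau>) = s1 ((y ^ l) ^ l)" "sc 1 (sup_pt l \<tau> j) = zs y j"
    "nc 1 \<tau> = Nc 1 (y ^ l)" "nc 1 (of_nat l * \<tau>) = Nc 1 ((y ^ l) ^ l)"
    "nc 1 (sup_pt l \<tau> j) = Nc 1 (ee (of_nat j / of_nat l) * y)"
  using ee_sup_pt[OF l_pos, of \<tau>]
  by (simp_all add: sc_def nc_def es_def en_def s1_def zs_def y_def)

text \<open>The exponents j/l sum to (l - 1)/2, an integer because l is odd.\<close>

lemma prod_rotations: "(\<Prod>j<l. ee (of_nat j / of_nat l) * y) = y ^ l"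
proof -
  obtain h where h: "l = 2 * h + 1" using l_odd by (auto elim: oddE)
  have "(\<Sum>j<n. of_nat j :: complex) = of_nat n * (of_nat n - 1) / 2" for n
    by (induction n) (auto simp: field_simps)
  from this[of l] have "(\<Sum>j<l. of_nat j :: complex) = of_nat l * of_nat h"
    unfolding h by simp
  then have "(\<Sum>j<l. of_nat j / of_nat l :: complex) = of_nat h"
    using l_pos by (simp add: sum_divide_distrib [symmetric])
  then have "(\<Prod>j<l. ee (of_nat j / of_nat l)) = 1"
    unfolding ee_sum using ee_of_int[of "int h"] by simp
  then show ?thesis by (simp add: prod.distrib)
qed

text \<open>The quotient \<open>\<Prod> sL M / sL\<^sup>l\<^sup>+\<^sup>1\<close> over the superlattices \<open>M\<close> of index \<open>l\<close> has neither zeros nor poles,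
  not even at the cusps.\<close>
lemma prod_zs:
  assumes y: "norm y < 1"
  shows "(\<Prod>j<l. zs y j) = s1 (y ^ l) * Sc 1 (y ^ l) ^ l / Sc 1 ((y ^ l) ^ l)"
proof -
  define \<Psi> where "\<Psi> = (\<lambda>(A :: complex set set) (n :: complex set \<Rightarrow> complex) (s :: complex set \<Rightarrow> complex) (n0 :: complex) s0.
     (\<Prod>M\<in>A. s M) / s0 ^ Suc l)"
  define G where "G = (\<lambda>\<Lambda> z. \<Psi> (sups l \<Lambda>) (\<lambda>M. nL M z) (\<lambda>M. sL M z) (nL \<Lambda> z) (sL \<Lambda> z))"
  define Q where "Q = (\<lambda>i \<tau>. Sc i (ee (of_nat l * \<tau> / 5)) * (\<Prod>j<l. Sc i (ee (sup_pt l \<tau> j / 5))) * (1 / Sc i (ee (\<tau> / 5))) ^ Suc l)"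
  have inv: "lat_inv G"
    unfolding G_def
  proof (rule lat_inv_sups[OF prime_l l_not_5])
    fix f and A B :: "complex set set" and a n0 s0 :: complex and n s n' s' :: "complex set \<Rightarrow> complex"
    assume "bij_betw f A B" "\<And>M. M \<in> A \<Longrightarrow> s' M = s (f M)"
    then show "\<Psi> A n' s' (a * n0) s0 = \<Psi> B n s n0 s0"
      by (simp add: \<Psi>_def prod.reindex_bij_betw[symmetric])
  qed
  have prod_ee: "(\<Prod>j<l. ee (sup_pt l \<tau> j / 5)) = ee (\<tau> / 5)" for \<tau>
    unfolding ee_sup_pt(1)[OF l_pos] prod_rotations by (rule ee_sup_pt(2)[OF l_pos])
  have GQ: "G (lat \<tau>) (cz i \<tau>) = Q i \<tau>" if \<tau>: "Im \<tau> > 0" and i: "i \<in> {1..4}" for i \<tau>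
  proof -
    have "G (lat \<tau>) (cz i \<tau>) = sc i (of_nat l * \<tau>) * (\<Prod>j<l. sc i (sup_pt l \<tau> j)) / sc i \<tau> ^ Suc l"
      unfolding G_def \<Psi>_def gT_sups(3)[OF \<tau> i, of "\<lambda>x. x"] sL_nL_cusp[OF \<tau> i] ..
    also have "(\<Prod>j<l. sc i (sup_pt l \<tau> j)) = es i (ee (\<tau> / 5)) * (\<Prod>j<l. Sc i (ee (sup_pt l \<tau> j / 5)))"
      unfolding sc_def prod.distrib
      by (auto simp: es_def prod_ee prod_dividef)
    finally show ?thesis
      unfolding Q_def sc_def using ee_sup_pt(3)[OF l_pos, of \<tau>]
      by (auto simp: es_def power_mult_distrib power_divide field_simps)
  qed
  have BHQ: "BH (Q i)" for i
  proof -
    have S: "BH (\<lambda>\<tau>. Sc i (ee (\<tau> / 5)))" by (intro BH_compose_ee Sc_Nc_holomorphic)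
    have S': "BH (\<lambda>\<tau>. 1 / Sc i (ee (\<tau> / 5)))"
    proof (rule BH_compose_ee)
      show "(\<lambda>x. 1 / Sc i x) holomorphic_on ball 0 1"
        using Sc_Nc_nonzero by (intro holomorphic_intros Sc_Nc_holomorphic) auto
    qed
    have sub1: "BH (\<lambda>\<tau>. Sc i (ee (of_nat l * \<tau> / 5)))"
      using BH_subst[OF S, of "real l" 0] l_pos by simp
    have sub2: "BH (\<lambda>\<tau>. Sc i (ee (sup_pt l \<tau> j / 5)))" for j
      using BH_subst[OF S, of "1 / real l" "5 * of_nat j / of_nat l"] l_pos
      by (simp add: sup_pt_def add_divide_distrib)
    show ?thesis
      unfolding Q_def by (rule BH_mult[OF BH_mult[OF sub1 BH_prod[OF sub2]] BH_power[OF S']])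
  qed
  have "\<exists>c. \<forall>\<tau>. Im \<tau> > 0 \<longrightarrow> G (lat \<tau>) (cz 1 \<tau>) = c"
  proof (rule lat_inv_bounded_imp_const[OF inv])
    fix i :: nat assume i: "i \<in> {1..4}"
    have bh: "BH (\<lambda>\<tau>. G (lat \<tau>) (cz i \<tau>))"
      by (rule BH_cong[OF BHQ[of i]]) (use GQ i in auto)
    show "(\<lambda>\<tau>. G (lat \<tau>) (cz i \<tau>)) holomorphic_on {\<tau>. Im \<tau> > 0}" by (rule BH_holomorphic[OF bh])
    show "\<exists>C. \<forall>\<tau>. Im \<tau> \<ge> 1/2 \<longrightarrow> norm (G (lat \<tau>) (cz i \<tau>)) \<le> C"
      using bh unfolding BH_def by (elim conjE allE[of _ "1/2"]) simp
  qed
  then obtain c where c: "\<And>\<tau>. Im \<tau> > 0 \<Longrightarrow> G (lat \<tau>) (cz 1 \<tau>) = c" by blast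
  \<comment> \<open>The expansion of the constant function at the first cusp in the variable y. At y
    = 0 every value of \<open>Sc 1\<close> is 1, so the constant is 1.\<close>
  define R where "R = (\<lambda>y. Sc 1 ((y ^ l) ^ l) * (\<Prod>j<l. Sc 1 (ee (of_nat j / of_nat l) * y)) * (1 / Sc 1 (y ^ l)) ^ Suc l)"
  have Rc: "R y = c" if y0: "y \<noteq> 0" "norm y < 1" for y
  proof -
    obtain \<tau>0 where \<tau>0: "Im \<tau>0 > 0" "ee (\<tau>0 / 5) = y" using ee_surj[OF y0] .
    define \<tau> where "\<tau> = of_nat l * \<tau>0"
    have \<tau>: "Im \<tau> > 0" using \<tau>0 l_pos by (simp add: \<tau>_def)
    have "\<tau> / (5 * of_nat l) = \<tau>0 / 5" using l_pos by (simp add: \<tau>_def)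
    then have yt: "ee (\<tau> / (5 * of_nat l)) = y" by (simp only: \<tau>0(2))
    have x: "ee (\<tau> / 5) = y ^ l" using ee_sup_pt(2)[OF l_pos, of \<tau>] by (simp only: yt)
    have "Q 1 \<tau> = R y"
      unfolding Q_def R_def ee_sup_pt(3)[OF l_pos] ee_sup_pt(1)[OF l_pos] x yt ..
    then show ?thesis using c[OF \<tau>] GQ[OF \<tau>, of 1] by simp
  qed
  have "R holomorphic_on ball 0 1"
  proof -
    have comp: "(\<lambda>y. Sc 1 (g y)) holomorphic_on ball 0 1"
      if "g holomorphic_on ball 0 1" "\<And>y. norm y < 1 \<Longrightarrow> norm (g y) < 1" for g
      by (rule holomorphic_on_compose_gen[OF that(1) Sc_Nc_holomorphic(1), unfolded o_def]) (use that(2) in auto)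
    have nzl: "Sc 1 (z ^ l) \<noteq> 0" if "norm z < 1" for z
      by (rule Sc_Nc_nonzero) (rule norm_power_l[OF that])
    show ?thesis
      unfolding R_def
      by (intro holomorphic_intros comp) (use nzl in \<open>auto intro!: norm_power_l simp: norm_rot\<close>)
  qed
  then have "isCont R 0"
    using holomorphic_on_imp_differentiable_at[of R "ball 0 1" 0]
    by (intro field_differentiable_imp_continuous_at) auto
  then have "(R \<longlongrightarrow> R 0) (at 0)" by (simp add: isCont_def)
  moreover have "\<forall>\<^sub>F x in at 0. R x = c"
  proof -
    have "\<forall>\<^sub>F x in at 0. x \<in> ball 0 1 - {0::complex}" by (rule eventually_at_in_open) auto
    then show ?thesis by eventually_elim (use Rc in auto)
  qed
  then have "(R \<longlongrightarrow> c) (at 0)" by (rule tendsto_eventually)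
  ultimately have R0: "R 0 = c" using LIM_unique by blast
  have "(0::complex) ^ l = 0" using l_pos by simp
  then have "R 0 = 1" unfolding R_def by (simp only: mult_zero_right Sc_1_0) simp
  then have R1: "R y = 1" using R0 Rc[of y] y by (cases "y = 0") auto
  have nz: "Sc 1 ((y ^ l) ^ l) \<noteq> 0" "Sc 1 (y ^ l) \<noteq> 0"
    by (rule Sc_Nc_nonzero, intro norm_power_l y)+
  have "(\<Prod>j<l. zs y j) = y ^ l * (\<Prod>j<l. Sc 1 (ee (of_nat j / of_nat l) * y))"
    unfolding zs_def s1_def prod.distrib[of "\<lambda>j. ee (of_nat j / of_nat l) * y"] prod_rotations ..
  also have "(\<Prod>j<l. Sc 1 (ee (of_nat j / of_nat l) * y)) = Sc 1 (y ^ l) ^ Suc l / Sc 1 ((y ^ l) ^ l)"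
    using R1 nz unfolding R_def by (simp add: power_divide field_simps)
  finally show ?thesis by (simp add: s1_def)
qed

text \<open>The middle coefficients of the root polynomial vanish modulo l. The constant one is
  minus the product in \<open>prod_zs\<close>, as l is odd, and Sc 1 (x)^l = Sc 1 (x^l) modulo l
  reduces it to - s1.\<close>

lemma root_poly_eval:
  "\<exists>H. Fl H \<and> (\<forall>y. norm y < 1 \<longrightarrow>
     (\<Prod>j<l. s1 (y ^ l) - zs y j) = s1 (y ^ l) ^ l - s1 (y ^ l) + of_nat l * H (y ^ l))"
proof -
  obtain C where C: "\<And>k. k \<in> {1..<l} \<Longrightarrow> Fl (C k)"
    "\<And>k y. k \<in> {1..<l} \<Longrightarrow> norm y < 1 \<Longrightarrow> Polynomial.coeff (root_poly l (zs y)) k = of_nat l * C k (y ^ l)"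
    using root_coeffs by (metis atLeastLessThan_iff)
  obtain H where H: "Fl H" "\<And>x. norm x < 1 \<Longrightarrow> Sc 1 x ^ l = Sc 1 (x ^ l) + of_nat l * H x"
    using Fl_frobenius[OF Fl_Sc_1] by blast
  define K where "K = (\<lambda>x. (\<Sum>k\<in>{1..<l}. C k x * s1 x ^ k) - s1 x * H x * (1 / Sc 1 (x ^ l)))"
  have "Fl K"
    unfolding K_def using Fl_compose_power[OF Fl_inverse_Sc_1 l_pos]
    by (intro Fl_diff Fl_sum Fl_mult Fl_power Fl_s1 C H) auto
  moreover have "(\<Prod>j<l. s1 (y ^ l) - zs y j) = s1 (y ^ l) ^ l - s1 (y ^ l) + of_nat l * K (y ^ l)"
    if y: "norm y < 1" for y
  proof -
    define x where "x = y ^ l"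
    have x: "norm x < 1" "norm (x ^ l) < 1" unfolding x_def by (intro norm_power_l y)+
    have nz: "Sc 1 (x ^ l) \<noteq> 0" by (rule Sc_Nc_nonzero) (rule x)
    have "Polynomial.coeff (root_poly l (zs y)) 0 = (\<Prod>j<l. - zs y j)"
      using poly_root_poly[of l "zs y" 0] by (simp add: poly_0_coeff_0)
    also have "\<dots> = - (\<Prod>j<l. zs y j)" using l_odd by (simp add: prod_uminus)
    also have "\<dots> = - (s1 x * (Sc 1 (x ^ l) + of_nat l * H x) / Sc 1 (x ^ l))"
      unfolding prod_zs[OF y] x_def [symmetric] H(2)[OF x(1)] ..
    also have "\<dots> = - s1 x - of_nat l * (s1 x * H x * (1 / Sc 1 (x ^ l)))"
      using nz by (simp add: field_simps)
    finally have c0: "Polynomial.coeff (root_poly l (zs y)) 0 = - s1 x - of_nat l * (s1 x * H x * (1 / Sc 1 (x ^ l)))" .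
    have cl: "Polynomial.coeff (root_poly l (zs y)) l = 1" using root_poly_degree by metis
    have "(\<Prod>j<l. s1 x - zs y j) = (\<Sum>k\<le>l. Polynomial.coeff (root_poly l (zs y)) k * s1 x ^ k)"
      unfolding poly_root_poly[symmetric] poly_altdef root_poly_degree ..
    also have "{..l} = insert 0 (insert l {1..<l})" using l_pos by auto
    also have "(\<Sum>k\<in>insert 0 (insert l {1..<l}). Polynomial.coeff (root_poly l (zs y)) k * s1 x ^ k) =
        Polynomial.coeff (root_poly l (zs y)) 0 + s1 x ^ l +
        (\<Sum>k\<in>{1..<l}. Polynomial.coeff (root_poly l (zs y)) k * s1 x ^ k)"
      using l_pos cl by simp
    also have "(\<Sum>k\<in>{1..<l}. Polynomial.coeff (root_poly l (zs y)) k * s1 x ^ k) =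
        of_nat l * (\<Sum>k\<in>{1..<l}. C k x * s1 x ^ k)"
      unfolding sum_distrib_left by (rule sum.cong[OF refl]) (simp add: C(2)[OF _ y] x_def)
    finally show ?thesis unfolding c0 x_def [symmetric] by (simp add: K_def algebra_simps)
  qed
  ultimately show ?thesis by blast
qed

end

section \<open>The three polynomial relations between s and the superlattice sums\<close>

context lprime4
begin

definition svals :: "nat \<Rightarrow> complex \<Rightarrow> nat \<Rightarrow> complex" where
  "svals i \<tau> j = (if j = l then sc i (of_nat l * \<tau>) else sc i (sup_pt l \<tau> j))"

definition nvals :: "nat \<Rightarrow> complex \<Rightarrow> nat \<Rightarrow> complex" where
  "nvals i \<tau> j = sgi i * (if j = l then of_nat l * nc i (of_nat l * \<tau>) else - nc i (sup_pt l \<tau> j))"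

lemma XB_svals:
  assumes i: "i \<in> {2..4}"
  shows "XB (l * kap i) (\<lambda>\<tau>. svals i \<tau> j)" "XB (l * kap i) (sc i)"
proof -
  have le: "kap i \<le> l * kap i" using l_pos by simp
  show "XB (l * kap i) (\<lambda>\<tau>. svals i \<tau> j)"
    unfolding svals_def using XB_sc_nc[OF i l_pos] XB_mono[OF _ le] by (cases "j = l") auto
  show "XB (l * kap i) (sc i)" using XB_sc_nc[OF i l_pos] XB_mono[OF _ le] by auto
qed

lemma XB_nvals:
  assumes i: "i \<in> {2..4}"
  shows "XB (kap i) (\<lambda>\<tau>. nvals i \<tau> j / nc i \<tau>)"
proof -
  have "XB 0 (\<lambda>\<tau>. nvals i \<tau> j)"
    unfolding nvals_def using XB_sc_nc[OF i l_pos]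
    by (cases "j = l") (auto simp del: mult_minus_right intro!: XB_cmult intro: XB_cmult[of 0 _ "- 1", simplified])
  from XB_mult[OF this XB_sc_nc(4)[OF i l_pos]] show ?thesis by simp
qed

lemma lat_inv_polynomial_cusps:
  assumes inv: "lat_inv G" and F: "Fl F" and F0: "F 0 = 0"
    and 1: "\<And>y \<tau>. Im \<tau> > 0 \<Longrightarrow> y = ee (\<tau> / (5 * of_nat l)) \<Longrightarrow> norm y < 1 \<Longrightarrow> G (lat \<tau>) (cz 1 \<tau>) = F (y ^ l)"
    and 2: "\<And>i. i \<in> {2..4} \<Longrightarrow> XB (n * kap i) (\<lambda>\<tau>. G (lat \<tau>) (cz i \<tau>))"
  shows "\<exists>p. degree p \<le> n \<and> (\<forall>k. Polynomial.coeff p k \<in> Zl) \<and> Polynomial.coeff p 0 = 0 \<and>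
           (\<forall>\<tau>. Im \<tau> > 0 \<longrightarrow> G (lat \<tau>) (\<tau> / 5) = poly p (sL (lat \<tau>) (\<tau> / 5)))"
proof -
  have "\<exists>p. degree p \<le> n \<and> (\<forall>k. Polynomial.coeff p k \<in> Zl) \<and> Polynomial.coeff p 0 = F 0 \<and>
           (\<forall>\<tau>. Im \<tau> > 0 \<longrightarrow> G (lat \<tau>) (cz 1 \<tau>) = poly p (sL (lat \<tau>) (cz 1 \<tau>)))"
  proof (rule lat_inv_polynomial[OF inv F])
    fix \<tau> assume \<tau>: "Im \<tau> > 0"
    have "norm (ee (\<tau> / (5 * of_nat l))) < 1"
      using \<tau> l_pos by (intro norm_ee_less_1) (simp add: Im_divide_of_nat [symmetric] flip: divide_divide_eq_left)
    then have "G (lat \<tau>) (cz 1 \<tau>) = F (ee (\<tau> / (5 * of_nat l)) ^ l)" by (rule 1[OF \<tau> refl])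
    then show "G (lat \<tau>) (cz 1 \<tau>) = F (ee (\<tau> / 5))" unfolding ee_sup_pt(2)[OF l_pos] .
  next
    show "BH (\<lambda>\<tau>. ee (\<tau> / 5) ^ n * G (lat \<tau>) (cz 2 \<tau>))" using 2[of 2] by (simp add: XB_def kap_def)
    show "BH (\<lambda>\<tau>. G (lat \<tau>) (cz 3 \<tau>))" "BH (\<lambda>\<tau>. G (lat \<tau>) (cz 4 \<tau>))"
      using 2[of 3] 2[of 4] by (simp_all add: XB_def kap_def)
  qed
  then show ?thesis by (simp add: F0 cz_def)
qed

text \<open>Let s = s1 x be the value at the first cusp; the value at \<open>sup_inf\<close> is s1
  (x^l) = s^l modulo l. In the first sum the term of \<open>sup_inf\<close> is s^l - s modulo l by
  \<open>root_poly_eval\<close>, and the others form a sum divisible by l. In the second sum the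
  term of \<open>sup_inf\<close> is divisible by l as well, because of the weight. The product is (s
  - s^l)(s^l - s) modulo l. All three remainders vanish at x = 0, hence the missing constant
  terms.\<close>

lemma modular_relations:
  "\<exists>p1 p2 p3. (\<forall>k. Polynomial.coeff p1 k \<in> Zl) \<and> (\<forall>k. Polynomial.coeff p2 k \<in> Zl) \<and> (\<forall>k. Polynomial.coeff p3 k \<in> Zl) \<and>
     Polynomial.coeff p1 0 = 0 \<and> Polynomial.coeff p2 0 = 0 \<and> degree p3 \<le> 2 * l \<and>
     (\<forall>\<tau>. Im \<tau> > 0 \<longrightarrow> (let z = \<tau> / 5; s = sL (lat \<tau>) z; A = sups l (lat \<tau>) in
        gT A (\<lambda>M. 1) (\<lambda>M. sL M z) 1 s = s ^ l - s + of_nat l * poly p1 s \<and>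
        gT A (\<lambda>M. nL M z) (\<lambda>M. sL M z) (nL (lat \<tau>) z) s = of_nat l * poly p2 s \<and>
        (\<Prod>M\<in>A. s - sL M z) = - ((s ^ l - s) ^ 2) + of_nat l * poly p3 s))"
proof -
  obtain H1 where H1: "Fl H1" "\<And>y. norm y < 1 \<Longrightarrow>
     (\<Prod>j<l. s1 (y ^ l) - zs y j) = s1 (y ^ l) ^ l - s1 (y ^ l) + of_nat l * H1 (y ^ l)"
    using root_poly_eval by blast
  have s10: "s1 0 = 0" by (simp add: s1_def)
  have zl: "(0::complex) ^ l = 0" using l_pos by simp
  have P0: "(\<Prod>j<l. s1 (0 ^ l) - zs 0 j) = 0"
    unfolding zl zs_def mult_zero_right s10 using l_pos by simp
  have "(\<Prod>j<l. s1 (0 ^ l) - zs 0 j) = s1 (0 ^ l) ^ l - s1 (0 ^ l) + of_nat l * H1 (0 ^ l)"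
    by (rule H1(2)) simp
  then have H10: "H1 0 = 0" unfolding P0 unfolding zl s10 using l_pos by simp
  obtain H2 where H2: "Fl H2" "\<And>y. norm y < 1 \<Longrightarrow> gT {..<l} (\<lambda>j. 1) (zs y) 1 (s1 (y ^ l)) = of_nat l * H2 (y ^ l)"
    using gT_eval[OF Fl_const[OF csubring_1[OF Zl_subring]]] by blast
  obtain H3 where H3: "Fl H3" "\<And>y. norm y < 1 \<Longrightarrow>
     gT {..<l} (\<lambda>j. - Nc 1 (ee (of_nat j / of_nat l) * y)) (zs y) 1 (s1 (y ^ l)) = of_nat l * H3 (y ^ l)"
    using gT_eval[OF Fl_uminus[OF Fl_Nc_1]] by blast
  obtain H4 where H4: "Fl H4" "\<And>x. norm x < 1 \<Longrightarrow> s1 x ^ l = s1 (x ^ l) + of_nat l * H4 x"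
    using Fl_frobenius[OF Fl_s1] by blast
  have Fs1l: "Fl (\<lambda>x. s1 (x ^ l))" by (rule Fl_compose_power[OF Fl_s1 l_pos])
  have lZ: "of_nat l \<in> Zl" by (rule csubring_of_nat[OF Zl_subring])
  have sgi1: "sgi 1 = 1" by (simp add: sgi_def)
  define \<Psi>1 where "\<Psi>1 = (\<lambda>(A :: complex set set) (n :: complex set \<Rightarrow> complex) s (n0 :: complex) s0.
     (gT A (\<lambda>M. 1) s 1 s0 - s0 ^ l + s0) / of_nat l)"
  define \<Psi>2 where "\<Psi>2 = (\<lambda>(A :: complex set set) n s n0 s0. gT A n s n0 s0 / of_nat l)"
  define \<Psi>3 where "\<Psi>3 = (\<lambda>(A :: complex set set) (n :: complex set \<Rightarrow> complex) (s :: complex set \<Rightarrow> complex) (n0 :: complex) s0.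
     ((\<Prod>M\<in>A. s0 - s M) + (s0 ^ l - s0) ^ 2) / of_nat l)"
  define G where "G = (\<lambda>\<Psi> \<Lambda> z. \<Psi> (sups l \<Lambda>) (\<lambda>M. nL M z) (\<lambda>M. sL M z) (nL \<Lambda> z) (sL \<Lambda> z) :: complex)"
  have inv1: "lat_inv (G \<Psi>1)" unfolding G_def
  proof (rule lat_inv_sups[OF prime_l l_not_5])
    fix f and A B :: "complex set set" and a n0 s0 :: complex and n s n' s' :: "complex set \<Rightarrow> complex"
    assume "bij_betw f A B" "\<And>M. M \<in> A \<Longrightarrow> s' M = s (f M)"
    then have "gT A (\<lambda>M. 1) s' (1 * 1) s0 = gT B (\<lambda>M. 1) s 1 s0" by (intro gT_reindex) auto
    then show "\<Psi>1 A n' s' (a * n0) s0 = \<Psi>1 B n s n0 s0" by (simp add: \<Psi>1_def)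
  qed
  have inv2: "lat_inv (G \<Psi>2)" unfolding G_def
  proof (rule lat_inv_sups[OF prime_l l_not_5])
    fix f and A B :: "complex set set" and a n0 s0 :: complex and n s n' s' :: "complex set \<Rightarrow> complex"
    assume h: "bij_betw f A B" "a \<noteq> 0" "\<And>M. M \<in> A \<Longrightarrow> n' M = a * n (f M)" "\<And>M. M \<in> A \<Longrightarrow> s' M = s (f M)"
    show "\<Psi>2 A n' s' (a * n0) s0 = \<Psi>2 B n s n0 s0"
      unfolding \<Psi>2_def
      by (rule arg_cong2[where f = "(/)", OF gT_reindex[where f = f and a = a] refl]) (use h in auto)
  qed
  have inv3: "lat_inv (G \<Psi>3)" unfolding G_def
  proof (rule lat_inv_sups[OF prime_l l_not_5])
    fix f and A B :: "complex set set" and a n0 s0 :: complex and n s n' s' :: "complex set \<Rightarrow> complex"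
    assume *: "bij_betw f A B" "\<And>M. M \<in> A \<Longrightarrow> s' M = s (f M)"
    have "(\<Prod>M\<in>B. s0 - s M) = (\<Prod>M\<in>A. s0 - s (f M))" by (rule prod.reindex_bij_betw[OF *(1), symmetric])
    also have "\<dots> = (\<Prod>M\<in>A. s0 - s' M)" by (rule prod.cong) (use * in auto)
    finally show "\<Psi>3 A n' s' (a * n0) s0 = \<Psi>3 B n s n0 s0" by (simp add: \<Psi>3_def)
  qed
  have G1: "G \<Psi>1 (lat \<tau>) (cz i \<tau>) = (gT {..l} (\<lambda>j. 1) (svals i \<tau>) 1 (sc i \<tau>) - sc i \<tau> ^ l + sc i \<tau>) / of_nat l"
    and G2: "G \<Psi>2 (lat \<tau>) (cz i \<tau>) = gT {..l} (nvals i \<tau>) (svals i \<tau>) (nc i \<tau>) (sc i \<tau>) / of_nat l"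
    and G3: "G \<Psi>3 (lat \<tau>) (cz i \<tau>) = ((sc i \<tau> - sc i (of_nat l * \<tau>)) * (\<Prod>j<l. sc i \<tau> - sc i (sup_pt l \<tau> j)) +
        (sc i \<tau> ^ l - sc i \<tau>) ^ 2) / of_nat l"
    if \<tau>: "Im \<tau> > 0" and i: "i \<in> {1..4}" for \<tau> i
    using gT_sups(2)[OF \<tau> i] gT_sups(1)[OF \<tau> i] gT_sups(3)[OF \<tau> i, of "\<lambda>x. sc i \<tau> - x"]
    unfolding G_def \<Psi>1_def \<Psi>2_def \<Psi>3_def svals_def nvals_def sL_nL_cusp[OF \<tau> i] by simp_all
  have sv: "svals 1 \<tau> l = s1 ((y ^ l) ^ l)" "\<And>j. j < l \<Longrightarrow> svals 1 \<tau> j = zs y j" "sc 1 \<tau> = s1 (y ^ l)" "nc 1 \<tau> = Nc 1 (y ^ l)"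
     "nvals 1 \<tau> l = of_nat l * Nc 1 ((y ^ l) ^ l)" "\<And>j. j < l \<Longrightarrow> nvals 1 \<tau> j = - Nc 1 (ee (of_nat j / of_nat l) * y)"
    if "y = ee (\<tau> / (5 * of_nat l))" for y \<tau>
  proof -
    note cv = cusp_1_values[of \<tau>, folded that]
    show "svals 1 \<tau> l = s1 ((y ^ l) ^ l)" unfolding svals_def using cv(3) by simp
    show "svals 1 \<tau> j = zs y j" if "j < l" for j unfolding svals_def using cv(4) that by simp
    show "sc 1 \<tau> = s1 (y ^ l)" "nc 1 \<tau> = Nc 1 (y ^ l)" by (rule cv(2), rule cv(5))
    show "nvals 1 \<tau> l = of_nat l * Nc 1 ((y ^ l) ^ l)" unfolding nvals_def sgi1 using cv(6) by simp
    show "nvals 1 \<tau> j = - Nc 1 (ee (of_nat j / of_nat l) * y)" if "j < l" for j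
      unfolding nvals_def sgi1 using cv(7) that by simp
  qed
  have zprod: "(\<Prod>j<l. s1 (y ^ l) - svals 1 \<tau> j) = s1 (y ^ l) ^ l - s1 (y ^ l) + of_nat l * H1 (y ^ l)"
    if y: "y = ee (\<tau> / (5 * of_nat l))" "norm y < 1" for y \<tau>
  proof -
    have "(\<Prod>j<l. s1 (y ^ l) - svals 1 \<tau> j) = (\<Prod>j<l. s1 (y ^ l) - zs y j)"
      by (rule prod.cong) (auto simp: sv(2)[OF y(1), unfolded One_nat_def])
    then show ?thesis using H1(2)[OF y(2)] by simp
  qed
  have XBpow: "XB (2 * l * kap i) (\<lambda>\<tau>. (sc i \<tau> ^ l - sc i \<tau>) ^ 2)" "XB (l * kap i) (\<lambda>\<tau>. sc i \<tau> ^ l - sc i \<tau>)"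
    if i: "i \<in> {2..4}" for i
  proof -
    show "XB (l * kap i) (\<lambda>\<tau>. sc i \<tau> ^ l - sc i \<tau>)"
      by (intro XB_diff XB_power XB_sc_nc(1)[OF i l_pos] XB_svals(2)[OF i])
    from XB_power[OF this, of 2] show "XB (2 * l * kap i) (\<lambda>\<tau>. (sc i \<tau> ^ l - sc i \<tau>) ^ 2)" by (simp add: mult.assoc)
  qed
  have cong14: "i \<in> {2..4} \<Longrightarrow> i \<in> {1..4}" for i :: nat by auto

  \<comment> \<open>Each product has l factors whose poles at the second cusp have order at most l,
    which gives the degree bound.\<close>
  have "\<exists>p. degree p \<le> l * l \<and> (\<forall>k. Polynomial.coeff p k \<in> Zl) \<and> Polynomial.coeff p 0 = 0 \<and>
           (\<forall>\<tau>. Im \<tau> > 0 \<longrightarrow> G \<Psi>1 (lat \<tau>) (\<tau> / 5) = poly p (sL (lat \<tau>) (\<tau> / 5)))"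
  proof (rule lat_inv_polynomial_cusps[OF inv1, where F = "\<lambda>x. H1 x + (s1 x - s1 (x ^ l)) * H2 x"])
    show "Fl (\<lambda>x. H1 x + (s1 x - s1 (x ^ l)) * H2 x)"
      by (intro Fl_add Fl_mult Fl_diff H1 H2 Fl_s1 Fs1l)
    show "H1 0 + (s1 0 - s1 (0 ^ l)) * H2 0 = 0" unfolding zl s10 H10 by simp
    fix y \<tau> assume \<tau>: "Im \<tau> > 0" and y: "y = ee (\<tau> / (5 * of_nat l))" "norm y < 1"
    have "gT {..<l} (\<lambda>j. 1) (svals 1 \<tau>) 1 (s1 (y ^ l)) = gT {..<l} (\<lambda>j. 1) (zs y) 1 (s1 (y ^ l))"
      by (rule gT_cong) (auto simp: sv(2)[OF y(1), unfolded One_nat_def])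
    note gc = this
    have "G \<Psi>1 (lat \<tau>) (cz 1 \<tau>) = (gT {..l} (\<lambda>j. 1) (svals 1 \<tau>) 1 (sc 1 \<tau>) - sc 1 \<tau> ^ l + sc 1 \<tau>) / of_nat l"
      by (rule G1[OF \<tau>]) simp
    also have "gT {..l} (\<lambda>j. 1) (svals 1 \<tau>) 1 (sc 1 \<tau>) = 1 / 1 * (s1 (y ^ l) ^ l - s1 (y ^ l) + of_nat l * H1 (y ^ l)) +
        (s1 (y ^ l) - s1 ((y ^ l) ^ l)) * (of_nat l * H2 (y ^ l))"
      unfolding gT_atMost sv(1,3)[OF y(1)] gc zprod[OF y] H2(2)[OF y(2)] ..
    also have "sc 1 \<tau> = s1 (y ^ l)" by (rule sv(3)[OF y(1)])
    also have "1 / 1 * (s1 (y ^ l) ^ l - s1 (y ^ l) + of_nat l * H1 (y ^ l)) +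
        (s1 (y ^ l) - s1 ((y ^ l) ^ l)) * (of_nat l * H2 (y ^ l)) - s1 (y ^ l) ^ l + s1 (y ^ l) =
        of_nat l * (H1 (y ^ l) + (s1 (y ^ l) - s1 ((y ^ l) ^ l)) * H2 (y ^ l))"
      by (simp add: algebra_simps)
    finally show "G \<Psi>1 (lat \<tau>) (cz 1 \<tau>) = H1 (y ^ l) + (s1 (y ^ l) - s1 ((y ^ l) ^ l)) * H2 (y ^ l)"
      using l_pos by simp
  next
    fix i :: nat assume i: "i \<in> {2..4}"
    have "XB (0 + l * (l * kap i)) (\<lambda>\<tau>. gT {..l} (\<lambda>j. 1) (svals i \<tau>) 1 (sc i \<tau>))"
      by (rule XB_gT) (auto intro: XB_svals[OF i] XB_const)
    then have 1: "XB (l * l * kap i) (\<lambda>\<tau>. gT {..l} (\<lambda>j. 1) (svals i \<tau>) 1 (sc i \<tau>))" by (simp add: mult.assoc)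
    have 2: "XB (l * l * kap i) (\<lambda>\<tau>. sc i \<tau> ^ l - sc i \<tau>)"
      by (rule XB_mono[OF XBpow(2)[OF i]]) simp
    show "XB (l * l * kap i) (\<lambda>\<tau>. G \<Psi>1 (lat \<tau>) (cz i \<tau>))"
      by (rule XB_cong[OF XB_cmult[OF XB_diff[OF 1 2], of "1 / of_nat l"]])
         (simp add: G1[OF _ cong14[OF i]] diff_divide_distrib add_divide_distrib)
  qed
  then obtain p1 where p1: "\<And>k. Polynomial.coeff p1 k \<in> Zl" "Polynomial.coeff p1 0 = 0"
    "\<And>\<tau>. Im \<tau> > 0 \<Longrightarrow> G \<Psi>1 (lat \<tau>) (\<tau> / 5) = poly p1 (sL (lat \<tau>) (\<tau> / 5))" by blast

  define A where "A = (\<lambda>x. s1 x ^ l - s1 x + of_nat l * H1 x)"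
  have FA: "Fl A" "A 0 = 0"
    unfolding A_def by (intro Fl_add Fl_diff Fl_power Fl_mult Fl_const Fl_s1 H1 lZ) (simp add: s10 H10 zl)
  \<comment> \<open>One more than for the unweighted sum, because 1/n has a simple pole at the
    second cusp.\<close>
  have "\<exists>p. degree p \<le> l * l + 1 \<and> (\<forall>k. Polynomial.coeff p k \<in> Zl) \<and> Polynomial.coeff p 0 = 0 \<and>
           (\<forall>\<tau>. Im \<tau> > 0 \<longrightarrow> G \<Psi>2 (lat \<tau>) (\<tau> / 5) = poly p (sL (lat \<tau>) (\<tau> / 5)))"
  proof (rule lat_inv_polynomial_cusps[OF inv2, where
        F = "\<lambda>x. (Nc 1 (x ^ l) * A x + (s1 x - s1 (x ^ l)) * H3 x) * (1 / Nc 1 x)"])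
    show "Fl (\<lambda>x. (Nc 1 (x ^ l) * A x + (s1 x - s1 (x ^ l)) * H3 x) * (1 / Nc 1 x))"
      by (intro Fl_add Fl_mult Fl_diff FA H3 Fl_s1 Fs1l Fl_inverse_Nc_1 Fl_compose_power[OF Fl_Nc_1 l_pos])
    show "(Nc 1 (0 ^ l) * A 0 + (s1 0 - s1 (0 ^ l)) * H3 0) * (1 / Nc 1 0) = 0" unfolding zl s10 FA(2) by simp
    fix y \<tau> assume \<tau>: "Im \<tau> > 0" and y: "y = ee (\<tau> / (5 * of_nat l))" "norm y < 1"
    have nz: "Nc 1 (y ^ l) \<noteq> 0" by (rule Sc_Nc_nonzero) (rule norm_power_l[OF y(2)])
    have *: "gT {..<l} (nvals 1 \<tau>) (svals 1 \<tau>) n0 (s1 (y ^ l)) = of_nat l * H3 (y ^ l) / n0" for n0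
    proof -
      have "gT {..<l} (nvals 1 \<tau>) (svals 1 \<tau>) 1 (s1 (y ^ l)) =
          gT {..<l} (\<lambda>j. - Nc 1 (ee (of_nat j / of_nat l) * y)) (zs y) 1 (s1 (y ^ l))"
        by (rule gT_cong) (auto simp: sv(2,6)[OF y(1), unfolded One_nat_def])
      then show ?thesis using H3(2)[OF y(2)] by (subst gT_denominator) simp
    qed
    have "G \<Psi>2 (lat \<tau>) (cz 1 \<tau>) = gT {..l} (nvals 1 \<tau>) (svals 1 \<tau>) (nc 1 \<tau>) (sc 1 \<tau>) / of_nat l"
      by (rule G2[OF \<tau>]) simp
    also have "gT {..l} (nvals 1 \<tau>) (svals 1 \<tau>) (nc 1 \<tau>) (sc 1 \<tau>) =
       of_nat l * Nc 1 ((y ^ l) ^ l) / Nc 1 (y ^ l) * A (y ^ l) +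
       (s1 (y ^ l) - s1 ((y ^ l) ^ l)) * (of_nat l * H3 (y ^ l) / Nc 1 (y ^ l))"
      unfolding gT_atMost sv(1,3,4,5)[OF y(1)] * zprod[OF y] A_def ..
    also have "\<dots> / of_nat l = (Nc 1 ((y ^ l) ^ l) * A (y ^ l) + (s1 (y ^ l) - s1 ((y ^ l) ^ l)) * H3 (y ^ l)) * (1 / Nc 1 (y ^ l))"
      using l_pos nz by (simp add: field_simps)
    finally show "G \<Psi>2 (lat \<tau>) (cz 1 \<tau>) =
        (Nc 1 ((y ^ l) ^ l) * A (y ^ l) + (s1 (y ^ l) - s1 ((y ^ l) ^ l)) * H3 (y ^ l)) * (1 / Nc 1 (y ^ l))" .
  next
    fix i :: nat assume i: "i \<in> {2..4}"
    have "XB (kap i + l * (l * kap i)) (\<lambda>\<tau>. gT {..l} (nvals i \<tau>) (svals i \<tau>) (nc i \<tau>) (sc i \<tau>))"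
      by (rule XB_gT) (auto intro: XB_svals[OF i] XB_nvals[OF i])
    then have 1: "XB ((l * l + 1) * kap i) (\<lambda>\<tau>. gT {..l} (nvals i \<tau>) (svals i \<tau>) (nc i \<tau>) (sc i \<tau>))"
      by (simp add: algebra_simps)
    show "XB ((l * l + 1) * kap i) (\<lambda>\<tau>. G \<Psi>2 (lat \<tau>) (cz i \<tau>))"
      by (rule XB_cong[OF XB_cmult[OF 1, of "1 / of_nat l"]]) (simp add: G2[OF _ cong14[OF i]])
  qed
  then obtain p2 where p2: "\<And>k. Polynomial.coeff p2 k \<in> Zl" "Polynomial.coeff p2 0 = 0"
    "\<And>\<tau>. Im \<tau> > 0 \<Longrightarrow> G \<Psi>2 (lat \<tau>) (\<tau> / 5) = poly p2 (sL (lat \<tau>) (\<tau> / 5))" by blast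

  \<comment> \<open>Pole order l from \<open>sup_inf\<close> and 1 from each of the l other
    superlattices. This sharp bound is what makes the leading coefficient in the integrality
    argument for \<beta> a unit at l.\<close>
  have "\<exists>p. degree p \<le> 2 * l \<and> (\<forall>k. Polynomial.coeff p k \<in> Zl) \<and> Polynomial.coeff p 0 = 0 \<and>
           (\<forall>\<tau>. Im \<tau> > 0 \<longrightarrow> G \<Psi>3 (lat \<tau>) (\<tau> / 5) = poly p (sL (lat \<tau>) (\<tau> / 5)))"
  proof (rule lat_inv_polynomial_cusps[OF inv3, where
        F = "\<lambda>x. H1 x * (s1 x - s1 x ^ l) + H4 x * A x"])
    show "Fl (\<lambda>x. H1 x * (s1 x - s1 x ^ l) + H4 x * A x)"
      by (intro Fl_add Fl_mult Fl_diff Fl_power FA H4 H1 Fl_s1)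
    show "H1 0 * (s1 0 - s1 0 ^ l) + H4 0 * A 0 = 0" unfolding s10 FA(2) zl by simp
    fix y \<tau> assume \<tau>: "Im \<tau> > 0" and y: "y = ee (\<tau> / (5 * of_nat l))" "norm y < 1"
    define x where "x = y ^ l"
    have s1xl: "s1 (x ^ l) = s1 x ^ l - of_nat l * H4 x"
      using H4(2)[OF norm_power_l[OF y(2)]] by (simp add: x_def)
    have "G \<Psi>3 (lat \<tau>) (cz 1 \<tau>) = ((sc 1 \<tau> - sc 1 (of_nat l * \<tau>)) * (\<Prod>j<l. sc 1 \<tau> - sc 1 (sup_pt l \<tau> j)) +
        (sc 1 \<tau> ^ l - sc 1 \<tau>) ^ 2) / of_nat l" by (rule G3[OF \<tau>]) simp
    also have "(\<Prod>j<l. sc 1 \<tau> - sc 1 (sup_pt l \<tau> j)) = (\<Prod>j<l. s1 (y ^ l) - svals 1 \<tau> j)"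
      by (rule prod.cong) (auto simp: svals_def sv(3)[OF y(1), unfolded One_nat_def])
    also have "\<dots> = A x" unfolding zprod[OF y] A_def x_def ..
    also have "sc 1 \<tau> = s1 x" using sv(3)[OF y(1)] by (simp add: x_def)
    also have "sc 1 (of_nat l * \<tau>) = s1 x ^ l - of_nat l * H4 x"
      using sv(1)[OF y(1)] unfolding svals_def x_def [symmetric] s1xl by simp
    also have "(s1 x - (s1 x ^ l - of_nat l * H4 x)) * A x + (s1 x ^ l - s1 x) ^ 2 =
       of_nat l * (H1 x * (s1 x - s1 x ^ l) + H4 x * A x)"
      by (simp add: A_def power2_eq_square algebra_simps)
    finally show "G \<Psi>3 (lat \<tau>) (cz 1 \<tau>) = H1 (y ^ l) * (s1 (y ^ l) - s1 (y ^ l) ^ l) + H4 (y ^ l) * A (y ^ l)"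
      using l_pos by (simp add: x_def)
  next
    fix i :: nat assume i: "i \<in> {2..4}"
    note b = XB_sc_nc[OF i l_pos]
    have "XB (l * kap i + card {..<l} * kap i)
      (\<lambda>\<tau>. (sc i \<tau> - sc i (of_nat l * \<tau>)) * (\<Prod>j<l. sc i \<tau> - sc i (sup_pt l \<tau> j)))"
      by (intro XB_mult XB_diff XB_prod b XB_svals(2)[OF i]) auto
    moreover have "l * kap i + card {..<l} * kap i = 2 * l * kap i" by simp
    ultimately have 1: "XB (2 * l * kap i) (\<lambda>\<tau>. (sc i \<tau> - sc i (of_nat l * \<tau>)) * (\<Prod>j<l. sc i \<tau> - sc i (sup_pt l \<tau> j)))"
      by (simp only:)
    show "XB (2 * l * kap i) (\<lambda>\<tau>. G \<Psi>3 (lat \<tau>) (cz i \<tau>))"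
      by (rule XB_cong[OF XB_cmult[OF XB_add[OF 1 XBpow(1)[OF i]], of "1 / of_nat l"]])
         (simp add: G3[OF _ cong14[OF i]])
  qed
  then obtain p3 where p3: "degree p3 \<le> 2 * l" "\<And>k. Polynomial.coeff p3 k \<in> Zl"
    "\<And>\<tau>. Im \<tau> > 0 \<Longrightarrow> G \<Psi>3 (lat \<tau>) (\<tau> / 5) = poly p3 (sL (lat \<tau>) (\<tau> / 5))" by blast

  show ?thesis
    using p1 p2 p3 l_pos
    by (intro exI[of _ p1] exI[of _ p2] exI[of _ p3])
       (auto simp: Let_def G_def \<Psi>1_def \<Psi>2_def \<Psi>3_def divide_eq_eq algebra_simps)
qed

end

section \<open>Integral elements\<close>

definition integral_over :: "complex set \<Rightarrow> complex \<Rightarrow> bool" where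
  "integral_over J x \<longleftrightarrow> (\<exists>p. lead_coeff p = 1 \<and> (\<forall>k. Polynomial.coeff p k \<in> J) \<and> poly p x = 0)"

lemma csubring_polys:
  assumes "csubring J"
  shows "csubring {p :: 'a :: comm_ring_1 poly. \<forall>k. Polynomial.coeff p k \<in> J}"
  unfolding csubring_def
  by (auto simp: coeff_mult intro!: csubring_sum[OF assms] csubring_mult[OF assms]
        csubring_diff[OF assms] csubring_1[OF assms] csubring_0[OF assms])

text \<open>\<alpha> is an eigenvalue of a matrix over \<open>J\<close>, hence a root of its
  characteristic polynomial, which is monic with coefficients in \<open>J\<close>.\<close>

lemma integral_over_matrix:
  fixes v :: "nat \<Rightarrow> complex"
  assumes J: "csubring J" and eq: "\<And>i. i < n \<Longrightarrow> \<alpha> * v i = (\<Sum>j<n. a i j * v j)"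
    and a: "\<And>i j. i < n \<Longrightarrow> j < n \<Longrightarrow> a i j \<in> J" and v: "\<exists>i<n. v i \<noteq> 0"
  shows "integral_over J \<alpha>"
proof -
  define A where "A = Matrix.mat n n (\<lambda>(i, j). a i j)"
  define V where "V = Matrix.vec n v"
  have A: "A \<in> carrier_mat n n" by (simp add: A_def)
  have "A *\<^sub>v V = \<alpha> \<cdot>\<^sub>v V"
  proof (rule eq_vecI)
    fix i assume "i < dim_vec (\<alpha> \<cdot>\<^sub>v V)"
    then have i: "i < n" by (simp add: V_def)
    then show "Matrix.vec_index (A *\<^sub>v V) i = Matrix.vec_index (\<alpha> \<cdot>\<^sub>v V) i"
      by (simp add: A_def V_def scalar_prod_def eq[OF i] lessThan_atLeast0)
  qed (simp add: A_def V_def)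
  moreover have "V \<noteq> 0\<^sub>v n"
  proof
    assume V0: "V = 0\<^sub>v n"
    from v obtain i where "i < n" "v i \<noteq> 0" by blast
    moreover from this have "Matrix.vec_index V i = v i" by (simp add: V_def)
    ultimately show False by (simp add: V0)
  qed
  ultimately have "eigenvector A V \<alpha>" by (simp add: eigenvector_def A_def V_def)
  then have root: "poly (char_poly A) \<alpha> = 0"
    using eigenvalue_root_char_poly[OF A] unfolding eigenvalue_def by blast
  have PJ: "csubring {p :: complex poly. \<forall>k. Polynomial.coeff p k \<in> J}" by (rule csubring_polys[OF J])
  have entry: "char_poly_matrix A $$ (i, j) \<in> {p. \<forall>k. Polynomial.coeff p k \<in> J}" if "i < n" "j < n" for i j
    using that a csubring_0[OF J] csubring_1[OF J] csubring_uminus[OF J] csubring_diff[OF J]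
    by (auto simp: char_poly_matrix_def A_def coeff_pCons split: nat.splits)
  have "char_poly A \<in> {p. \<forall>k. Polynomial.coeff p k \<in> J}"
    unfolding char_poly_def det_def'[OF char_poly_matrix_closed[OF A]]
    by (intro csubring_sum[OF PJ] csubring_mult[OF PJ] csubring_of_int[OF PJ] csubring_prod[OF PJ] entry)
       (use permutes_in_image[of _ "{0..<n}"] in auto)
  then show ?thesis
    unfolding integral_over_def using degree_monic_char_poly[OF A] root by (intro exI[of _ "char_poly A"]) auto
qed

definition jspan :: "complex set \<Rightarrow> 'i set \<Rightarrow> ('i \<Rightarrow> complex) \<Rightarrow> complex set" where
  "jspan J I g = {\<Sum>i\<in>I. c i * g i | c. \<forall>i\<in>I. c i \<in> J}"

lemma jspanI: "(\<And>i. i \<in> I \<Longrightarrow> c i \<in> J) \<Longrightarrow> z = (\<Sum>i\<in>I. c i * g i) \<Longrightarrow> z \<in> jspan J I g"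
  unfolding jspan_def by blast

context
  fixes J :: "complex set"
  assumes J: "csubring J"
begin

lemma jspan_diff: "x \<in> jspan J I g \<Longrightarrow> y \<in> jspan J I g \<Longrightarrow> x - y \<in> jspan J I g"
proof -
  assume x: "x \<in> jspan J I g" and y: "y \<in> jspan J I g"
  obtain c where "\<And>i. i \<in> I \<Longrightarrow> c i \<in> J" "x = (\<Sum>i\<in>I. c i * g i)" using x unfolding jspan_def by auto
  moreover obtain d where "\<And>i. i \<in> I \<Longrightarrow> d i \<in> J" "y = (\<Sum>i\<in>I. d i * g i)" using y unfolding jspan_def by auto
  ultimately show ?thesis
    by (intro jspanI[of I "\<lambda>i. c i - d i"]) (auto simp: left_diff_distrib sum_subtractf intro: csubring_diff[OF J])
qed

lemma jspan_0: "0 \<in> jspan J I g"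
  by (rule jspanI[of I "\<lambda>i. 0"]) (auto intro: csubring_0[OF J])

lemma jspan_add: "x \<in> jspan J I g \<Longrightarrow> y \<in> jspan J I g \<Longrightarrow> x + y \<in> jspan J I g"
  using jspan_diff[of x I g "0 - y"] jspan_diff[OF jspan_0, of y I g] by simp

lemma jspan_smult: "x \<in> jspan J I g \<Longrightarrow> a \<in> J \<Longrightarrow> a * x \<in> jspan J I g"
proof -
  assume x: "x \<in> jspan J I g" and a: "a \<in> J"
  obtain c where "\<And>i. i \<in> I \<Longrightarrow> c i \<in> J" "x = (\<Sum>i\<in>I. c i * g i)" using x unfolding jspan_def by auto
  then show ?thesis
    by (intro jspanI[of I "\<lambda>i. a * c i"]) (auto simp: sum_distrib_left mult.assoc intro: csubring_mult[OF J] a)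
qed

lemma jspan_sum: "(\<And>k. k \<in> K \<Longrightarrow> f k \<in> jspan J I g) \<Longrightarrow> sum f K \<in> jspan J I g"
  by (induction K rule: infinite_finite_induct) (auto intro: jspan_0 jspan_add)

lemma jspan_generator: "finite I \<Longrightarrow> i \<in> I \<Longrightarrow> g i \<in> jspan J I g"
  by (rule jspanI[of I "\<lambda>k. if k = i then 1 else 0"])
     (auto intro: csubring_0[OF J] csubring_1[OF J] simp: if_distrib[of "\<lambda>x. x * _"] cong: if_cong)

lemma jspan_stable:
  assumes "\<And>i. i \<in> I \<Longrightarrow> x * g i \<in> jspan J I g" "z \<in> jspan J I g"
  shows "x * z \<in> jspan J I g"
proof -
  obtain c where c: "\<And>i. i \<in> I \<Longrightarrow> c i \<in> J" "z = (\<Sum>i\<in>I. c i * g i)" using assms(2) unfolding jspan_def by auto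
  have "(\<Sum>i\<in>I. c i * (x * g i)) \<in> jspan J I g"
    by (rule jspan_sum, rule jspan_smult) (use assms(1) c(1) in auto)
  then show ?thesis unfolding c(2) by (simp add: sum_distrib_left mult_ac)
qed

text \<open>The determinant trick: multiplication by \<alpha> preserves a nonzero finitely generated
  \<open>J\<close>-module.\<close>

lemma integral_over_stable:
  assumes fin: "finite I" and st: "\<And>i. i \<in> I \<Longrightarrow> \<alpha> * g i \<in> jspan J I g" and nz: "\<exists>i\<in>I. g i \<noteq> 0"
  shows "integral_over J \<alpha>"
proof -
  obtain h where h: "bij_betw h {..<card I} I"
    using ex_bij_betw_nat_finite[OF fin] by (auto simp: lessThan_atLeast0)
  have "\<forall>i\<in>I. \<exists>c. (\<forall>j\<in>I. c j \<in> J) \<and> \<alpha> * g i = (\<Sum>j\<in>I. c j * g j)"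
    using st unfolding jspan_def by blast
  then obtain c where c: "\<And>i j. i \<in> I \<Longrightarrow> j \<in> I \<Longrightarrow> c i j \<in> J"
    "\<And>i. i \<in> I \<Longrightarrow> \<alpha> * g i = (\<Sum>j\<in>I. c i j * g j)" by metis
  have hI: "h k \<in> I" if "k < card I" for k using h that by (auto simp: bij_betw_def)
  show ?thesis
  proof (rule integral_over_matrix[OF J, of "card I" \<alpha> "g \<circ> h" "\<lambda>i j. c (h i) (h j)"])
    fix i assume i: "i < card I"
    show "\<alpha> * (g \<circ> h) i = (\<Sum>j<card I. c (h i) (h j) * (g \<circ> h) j)"
      unfolding o_def c(2)[OF hI[OF i]] by (rule sum.reindex_bij_betw[OF h, symmetric])
  next
    show "\<exists>i<card I. (g \<circ> h) i \<noteq> 0" using nz h unfolding bij_betw_def o_def by (metis imageE lessThan_iff)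
  qed (use c(1) hI in auto)
qed

lemma integral_over_power:
  assumes "integral_over J x"
  obtains n where "n > 0" "x ^ n \<in> jspan J {..<n} (\<lambda>k. x ^ k)"
proof -
  obtain p where p: "lead_coeff p = 1" "\<And>k. Polynomial.coeff p k \<in> J" "poly p x = 0"
    using assms unfolding integral_over_def by blast
  define n where "n = degree p"
  have "n > 0"
  proof (rule ccontr)
    assume "\<not> n > 0"
    then obtain a where "p = [:a:]" using degree_0_id[of p] by (metis n_def gr0I)
    then show False using p by auto
  qed
  moreover have "x ^ n \<in> jspan J {..<n} (\<lambda>k. x ^ k)"
  proof (rule jspanI[of _ "\<lambda>k. - Polynomial.coeff p k"])
    have "0 = (\<Sum>k\<le>n. Polynomial.coeff p k * x ^ k)" using p(3) by (simp add: poly_altdef n_def)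
    also have "\<dots> = x ^ n + (\<Sum>k<n. Polynomial.coeff p k * x ^ k)"
      using p(1) by (simp add: lessThan_Suc_atMost [symmetric] n_def)
    finally show "x ^ n = (\<Sum>k<n. - Polynomial.coeff p k * x ^ k)"
      by (simp add: sum_negf eq_neg_iff_add_eq_0)
  qed (use p(2) in \<open>auto intro: csubring_uminus[OF J]\<close>)
  ultimately show thesis using that by blast
qed

text \<open>The monomials x^i y^j below the degrees of two integral equations span one module stable
  under both elements, so differences and products are integral too.\<close>

lemma integral_over_both:
  assumes x: "integral_over J x" and y: "integral_over J y"
  obtains I :: "(nat \<times> nat) set" and g :: "nat \<times> nat \<Rightarrow> complex" where "finite I" "\<exists>i\<in>I. g i \<noteq> 0"
    "\<And>i. i \<in> I \<Longrightarrow> x * g i \<in> jspan J I g" "\<And>i. i \<in> I \<Longrightarrow> y * g i \<in> jspan J I g"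
proof -
  obtain m where m: "m > 0" "x ^ m \<in> jspan J {..<m} (\<lambda>k. x ^ k)" by (rule integral_over_power[OF x])
  obtain n where n: "n > 0" "y ^ n \<in> jspan J {..<n} (\<lambda>k. y ^ k)" by (rule integral_over_power[OF y])
  define I where "I = {..<m} \<times> {..<n}"
  define g where "g = (\<lambda>(i, j). x ^ i * y ^ j)"
  have fin: "finite I" by (simp add: I_def)
  have gI: "x ^ i * y ^ j \<in> jspan J I g" if "i < m" "j < n" for i j
    using jspan_generator[OF fin, of "(i, j)" g] that by (simp add: I_def g_def)
  have "x ^ m * y ^ j \<in> jspan J I g" if j: "j < n" for j
  proof -
    obtain c where c: "\<And>i. i \<in> {..<m} \<Longrightarrow> c i \<in> J" "x ^ m = (\<Sum>i<m. c i * x ^ i)" using m(2) unfolding jspan_def by auto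
    have "(\<Sum>i<m. c i * (x ^ i * y ^ j)) \<in> jspan J I g"
      by (rule jspan_sum, rule jspan_smult) (use c(1) gI j in auto)
    then show ?thesis unfolding c(2) by (simp add: sum_distrib_right mult.assoc)
  qed
  moreover have "x ^ i * y ^ n \<in> jspan J I g" if i: "i < m" for i
  proof -
    obtain c where c: "\<And>j. j \<in> {..<n} \<Longrightarrow> c j \<in> J" "y ^ n = (\<Sum>j<n. c j * y ^ j)" using n(2) unfolding jspan_def by auto
    have "(\<Sum>j<n. c j * (x ^ i * y ^ j)) \<in> jspan J I g"
      by (rule jspan_sum, rule jspan_smult) (use c(1) gI i in auto)
    then show ?thesis unfolding c(2) by (simp add: sum_distrib_left mult_ac)
  qed
  ultimately have x': "x ^ Suc i * y ^ j \<in> jspan J I g" and y': "x ^ i * y ^ Suc j \<in> jspan J I g"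
    if "i < m" "j < n" for i j
    using that gI by (metis Suc_lessI)+
  show thesis
  proof (rule that[OF fin])
    show "\<exists>i\<in>I. g i \<noteq> 0" using m(1) n(1) by (intro bexI[of _ "(0, 0)"]) (auto simp: I_def g_def)
    show "x * g i \<in> jspan J I g" if "i \<in> I" for i
      using x'[of "fst i" "snd i"] that by (cases i) (auto simp: I_def g_def mult_ac)
    show "y * g i \<in> jspan J I g" if "i \<in> I" for i
      using y'[of "fst i" "snd i"] that by (cases i) (auto simp: I_def g_def mult_ac)
  qed
qed

lemma integral_over_csubring: "csubring {x. integral_over J x}"
  unfolding csubring_def
proof (intro conjI ballI)
  have "integral_over J 1"
    unfolding integral_over_def
    by (intro exI[of _ "[:- 1, 1:]"])
       (auto simp: coeff_pCons intro: csubring_1[OF J] csubring_0[OF J] csubring_uminus[OF J] split: nat.splits)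
  then show "1 \<in> {x. integral_over J x}" by simp
  fix x y assume "x \<in> {x. integral_over J x}" "y \<in> {x. integral_over J x}"
  then obtain I :: "(nat \<times> nat) set" and g :: "nat \<times> nat \<Rightarrow> complex" where I: "finite I" "\<exists>i\<in>I. g i \<noteq> 0"
    "\<And>i. i \<in> I \<Longrightarrow> x * g i \<in> jspan J I g" "\<And>i. i \<in> I \<Longrightarrow> y * g i \<in> jspan J I g"
    using integral_over_both[of x y] by auto
  have "integral_over J (x - y)"
    by (rule integral_over_stable[OF I(1) _ I(2)]) (use I(3,4) in \<open>auto simp: left_diff_distrib intro: jspan_diff\<close>)
  then show "x - y \<in> {x. integral_over J x}" by simp
  have "integral_over J (x * y)"
    by (rule integral_over_stable[OF I(1) _ I(2)])
       (use I(3,4) in \<open>auto simp: mult.assoc intro: jspan_stable\<close>)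
  then show "x * y \<in> {x. integral_over J x}" by simp
qed

text \<open>The products u^i z^j with i < 2 and j below the degree span a \<open>J\<close>-module
  stable under z. Used to descend from \<int>[\<open>lam\<close>] localised at l to
  \<open>Zl\<close>.\<close>

lemma integral_over_quadratic:
  assumes u: "u * u \<in> J" and z: "integral_over {a + b * u | a b. a \<in> J \<and> b \<in> J} z"
  shows "integral_over J z"
proof -
  define A where "A = {a + b * u | a b. a \<in> J \<and> b \<in> J}"
  obtain p where p: "lead_coeff p = 1" "\<And>k. Polynomial.coeff p k \<in> A" "poly p z = 0"
    using z unfolding integral_over_def A_def by blast
  have "\<exists>a b. a \<in> J \<and> b \<in> J \<and> Polynomial.coeff p k = a + b * u" for k using p(2)[of k] unfolding A_def by blast
  then obtain a b where ab: "\<And>k. a k \<in> J" "\<And>k. b k \<in> J" "\<And>k. Polynomial.coeff p k = a k + b k * u" by metis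
  define n where "n = degree p"
  have n0: "n > 0"
  proof (rule ccontr)
    assume "\<not> n > 0"
    then obtain a where "p = [:a:]" using degree_0_id[of p] by (metis n_def gr0I)
    then show False using p by auto
  qed
  define I where "I = {..<2::nat} \<times> {..<n}"
  define g where "g = (\<lambda>(i, j). u ^ i * z ^ j)"
  have fin: "finite I" by (simp add: I_def)
  have gI: "z ^ j \<in> jspan J I g" "u * z ^ j \<in> jspan J I g" if "j < n" for j
    using jspan_generator[OF fin, of "(0, j)" g] jspan_generator[OF fin, of "(1, j)" g] that by (simp_all add: I_def g_def)
  have uu: "u * (u * z ^ j) \<in> jspan J I g" if "j < n" for j
    using jspan_smult[OF gI(1)[OF that] u] by (simp add: mult.assoc)
  have "0 = (\<Sum>k\<le>n. Polynomial.coeff p k * z ^ k)" using p(3) by (simp add: poly_altdef n_def)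
  also have "\<dots> = z ^ n + (\<Sum>k<n. Polynomial.coeff p k * z ^ k)"
    using p(1) by (simp add: lessThan_Suc_atMost [symmetric] n_def)
  finally have "z ^ n = - (\<Sum>k<n. Polynomial.coeff p k * z ^ k)" by (simp add: eq_neg_iff_add_eq_0)
  then have zn: "z ^ n = (\<Sum>k<n. (- a k) * z ^ k + (- b k) * (u * z ^ k))"
    by (simp add: ab(3) sum_negf [symmetric] algebra_simps sum_subtractf)
  have zn1: "z ^ n \<in> jspan J I g"
    unfolding zn by (rule jspan_sum, rule jspan_add; rule jspan_smult) (use gI ab csubring_uminus[OF J] in auto)
  have zn2: "u * z ^ n \<in> jspan J I g"
  proof -
    have "(\<Sum>k<n. (- a k) * (u * z ^ k) + (- b k) * (u * (u * z ^ k))) \<in> jspan J I g"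
      by (rule jspan_sum, rule jspan_add; rule jspan_smult) (use gI uu ab csubring_uminus[OF J] in auto)
    then show ?thesis unfolding zn by (simp add: sum_distrib_left algebra_simps)
  qed
  show ?thesis
  proof (rule integral_over_stable[OF fin])
    show "\<exists>i\<in>I. g i \<noteq> 0" using n0 by (intro bexI[of _ "(0, 0)"]) (auto simp: I_def g_def)
    fix i assume i: "i \<in> I"
    obtain e j where ej: "i = (e, j)" by fastforce
    have j: "j < n" and e: "e = 0 \<or> e = 1" using i by (auto simp: ej I_def)
    have 1: "z ^ Suc j \<in> jspan J I g" "u * z ^ Suc j \<in> jspan J I g"
      using j gI zn1 zn2 by (metis Suc_lessI)+
    then show "z * g i \<in> jspan J I g" using e by (auto simp: ej g_def mult_ac)
  qed
qed

end

lemma csubring_Ints: "csubring (\<int> :: complex set)"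
  by (auto simp: csubring_def)

lemma alg_int_iff_algebraic_int: "alg_int x \<longleftrightarrow> algebraic_int x"
  unfolding alg_int_def algebraic_int_altdef_ipoly by blast

lemma alg_int_iff_integral_over: "alg_int x \<longleftrightarrow> integral_over \<int> x"
  unfolding alg_int_iff_algebraic_int integral_over_def by (auto elim: algebraic_int.cases intro: algebraic_int.intros)

lemma alg_int_csubring: "csubring {x. alg_int x}"
  unfolding alg_int_iff_integral_over by (rule integral_over_csubring[OF csubring_Ints])

lemma alg_int_rational_imp_int: "alg_int x \<Longrightarrow> x \<in> \<rat> \<Longrightarrow> x \<in> \<int>"
  unfolding alg_int_iff_algebraic_int by (rule rational_algebraic_int_is_int)

context lprime
begin

text \<open>With \<open>N\<close> the product of all denominators of the equation p of degree n, the
  polynomial N^n p(X/N) is monic, integral and vanishes at N z.\<close>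

lemma integral_over_Zl_imp_alg_int:
  assumes "integral_over Zl z"
  obtains N :: int where "\<not> int l dvd N" "alg_int (of_int N * z)"
proof -
  obtain p where p: "lead_coeff p = 1" "\<And>k. Polynomial.coeff p k \<in> Zl" "poly p z = 0"
    using assms unfolding integral_over_def by blast
  have "\<exists>b a :: int. \<not> int l dvd b \<and> Polynomial.coeff p k = of_int a / of_int b" for k
    using p(2)[of k] unfolding Zl_def by blast
  then obtain b a where ba: "\<And>k. \<not> int l dvd b k" "\<And>k. Polynomial.coeff p k = of_int (a k) / of_int (b k)" by metis
  define n where "n = degree p"
  define N where "N = (\<Prod>k\<le>n. b k)"
  have N: "\<not> int l dvd N"
    unfolding N_def using ba(1) prime_int_l by (simp add: prime_dvd_prod_iff)
  then have N0: "N \<noteq> 0" by auto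
  have Nc: "of_int N * Polynomial.coeff p k \<in> \<int>" if "k \<le> n" for k
  proof -
    have "b k \<noteq> 0" using ba(1)[of k] by auto
    moreover have "N = b k * (\<Prod>j\<in>{..n} - {k}. b j)" unfolding N_def using that by (subst prod.remove[of _ k]) auto
    ultimately have "of_int N * Polynomial.coeff p k = of_int ((\<Prod>j\<in>{..n} - {k}. b j) * a k)"
      by (simp add: ba(2))
    then show ?thesis by (metis Ints_of_int)
  qed
  define q where "q = (\<Sum>k\<le>n. Polynomial.monom (of_int N ^ (n - k) * Polynomial.coeff p k) k)"
  have cq: "Polynomial.coeff q k = (if k \<le> n then of_int N ^ (n - k) * Polynomial.coeff p k else 0)" for k
    by (simp add: q_def coeff_sum)
  have qn: "Polynomial.coeff q n = 1" using p(1) by (simp add: cq n_def)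
  have "n \<le> degree q" by (rule le_degree) (simp only: qn, simp)
  then have "degree q = n" by (intro antisym degree_le) (auto simp: cq)
  then have lq: "lead_coeff q = 1" using qn by simp
  have "Polynomial.coeff q k \<in> \<int>" for k
  proof (cases "k < n")
    case True
    then have "n - k = Suc (n - k - 1)" by simp
    then have "of_int N ^ (n - k) * Polynomial.coeff p k = of_int N ^ (n - k - 1) * (of_int N * Polynomial.coeff p k)"
      by (metis mult.assoc power_Suc2)
    moreover have "\<dots> \<in> \<int>" by (intro Ints_mult Ints_power Nc) (use True in auto)
    ultimately show ?thesis using True by (simp only: cq) simp
  next
    case False
    then show ?thesis using qn cq[of k] by (cases "k = n") auto
  qed
  moreover have "poly q (of_int N * z) = 0"
  proof -
    have "poly q (of_int N * z) = (\<Sum>k\<le>n. of_int N ^ (n - k) * Polynomial.coeff p k * (of_int N * z) ^ k)"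
      by (simp add: q_def poly_sum poly_monom)
    also have "\<dots> = (\<Sum>k\<le>n. of_int N ^ n * (Polynomial.coeff p k * z ^ k))"
    proof (rule sum.cong[OF refl])
      fix k assume "k \<in> {..n}"
      then have "(of_int N :: complex) ^ n = of_int N ^ (n - k) * of_int N ^ k" by (simp flip: power_add)
      then show "of_int N ^ (n - k) * Polynomial.coeff p k * (of_int N * z) ^ k = of_int N ^ n * (Polynomial.coeff p k * z ^ k)"
        by (simp add: power_mult_distrib)
    qed
    also have "\<dots> = of_int N ^ n * poly p z" by (simp add: poly_altdef n_def sum_distrib_left)
    finally show ?thesis using p(3) by simp
  qed
  ultimately have "alg_int (of_int N * z)"
    unfolding alg_int_iff_integral_over integral_over_def using lq by blast
  then show thesis using that N by blast
qed

end

section \<open>The CM point\<close>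

lemma square_mod_5: "(y :: int) ^ 2 mod 5 \<in> {0, 1, 4}"
proof -
  have "y mod 5 \<in> {0..4}" by auto
  then have "y mod 5 \<in> {0, 1, 2, 3, 4}" by (simp add: atLeastAtMost_def) presburger
  moreover have "y ^ 2 mod 5 = (y mod 5) ^ 2 mod 5" by (simp add: power_mod)
  ultimately show ?thesis by auto
qed

lemma Legendre_5:
  "Legendre n 5 = (if n mod 5 = 0 then 0 else if n mod 5 = 1 \<or> n mod 5 = 4 then 1 else - 1)"
proof -
  have "QuadRes 5 n" if "n mod 5 = 1" using that unfolding QuadRes_def cong_def by (intro exI[of _ 1]) simp
  moreover have "QuadRes 5 n" if "n mod 5 = 4" using that unfolding QuadRes_def cong_def by (intro exI[of _ 2]) simp
  moreover have "n mod 5 \<in> {0, 1, 4}" if "QuadRes 5 n"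
    using that square_mod_5 unfolding QuadRes_def cong_def by metis
  ultimately show ?thesis unfolding Legendre_def cong_def by auto
qed

text \<open>The symbol (n/5) runs through 1, -1, -1, 1, 0, so each block of five consecutive factors
  is one factor of \<open>thA\<close> over one factor of \<open>thB\<close>. At \<tau> = w/5 this
  identifies \<eta>^5 with the value of \<open>sL\<close> at the point w/5.\<close>

lemma rr_cf_power_5:
  assumes \<tau>: "Im \<tau> > 0"
  shows "rr_cf \<tau> ^ 5 = s1 (ee \<tau>)"
proof -
  define q where "q = ee \<tau>"
  have q: "norm q < 1" unfolding q_def by (rule norm_ee_less_1[OF \<tau>])
  define f where "f = (\<lambda>n. (1 - q ^ Suc n) powi Legendre (int (Suc n)) 5)"
  have yb: "norm (q ^ Suc n) \<le> norm q" for n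
    using q mult_left_mono[OF power_le_one[of "norm q" n], of "norm q"] by (simp add: norm_power norm_mult)
  have bound: "norm (f n - 1) \<le> norm q ^ Suc n / (1 - norm q)" for n
  proof -
    define y where "y = q ^ Suc n"
    have y: "norm y \<le> norm q" "norm y = norm q ^ Suc n" using yb[of n] by (simp_all add: y_def norm_power norm_mult)
    have d: "norm (1 - y) \<ge> 1 - norm q" using norm_triangle_ineq2[of 1 y] y(1) by simp
    have y1: "y \<noteq> 1" using y(1) q by auto
    have "norm (inverse (1 - y) - 1) = norm (y / (1 - y))" using y1 by (simp add: field_simps)
    also have "\<dots> \<le> norm y / (1 - norm q)"
      unfolding norm_divide using d q by (intro divide_left_mono mult_pos_pos) auto
    finally have 1: "norm (inverse (1 - y) - 1) \<le> norm y / (1 - norm q)" .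
    have "norm y * (1 - norm q) \<le> norm y * 1" by (intro mult_left_mono) auto
    then have 2: "norm y \<le> norm y / (1 - norm q)" using q by (simp add: field_simps)
    have "f n = 1 \<or> f n = 1 - y \<or> f n = inverse (1 - y)"
      unfolding f_def Legendre_5 y_def [symmetric] by (auto simp: power_int_minus)
    then show ?thesis using 1 2 q unfolding y(2) [symmetric] by auto
  qed
  have "summable (\<lambda>n. norm (f n - 1))"
  proof (rule summable_comparison_test'[of "\<lambda>n. norm q ^ Suc n / (1 - norm q)" 0])
    show "summable (\<lambda>n. norm q ^ Suc n / (1 - norm q))"
      using q by (intro summable_divide) (simp add: summable_Suc_iff summable_geometric del: power_Suc)
  qed (use bound in auto)
  then have "convergent_prod f"
    by (intro abs_convergent_prod_imp_convergent_prod) (simp add: abs_convergent_prod_conv_summable)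
  then have "(\<lambda>n. \<Prod>i<n. f i) \<longlonglongrightarrow> prodinf f"
    by (intro has_prod_imp_tendsto' convergent_prod_has_prod)
  then have L1: "(\<lambda>n. \<Prod>i<n * 5. f i) \<longlonglongrightarrow> prodinf f"
    by (rule filterlim_compose) (simp add: mult_nat_right_at_top)
  have q5: "norm (q ^ 5) < 1" by (rule norm_power_less_1[OF q]) simp
  have block: "(\<Prod>i<n * 5. f i) =
      (\<Prod>m<n. 1 - q * (q ^ 5) ^ m) * (\<Prod>m<n. 1 - q ^ 4 * (q ^ 5) ^ m) /
      ((\<Prod>m<n. 1 - q ^ 2 * (q ^ 5) ^ m) * (\<Prod>m<n. 1 - q ^ 3 * (q ^ 5) ^ m))" for n
  proof -
    have "prod f {m * 5..<m * 5 + 5} = (1 - q * (q ^ 5) ^ m) * (1 - q ^ 4 * (q ^ 5) ^ m) /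
      ((1 - q ^ 2 * (q ^ 5) ^ m) * (1 - q ^ 3 * (q ^ 5) ^ m))" for m
    proof -
      have s: "{m * 5..<m * 5 + 5} = {m * 5, m * 5 + 1, m * 5 + 2, m * 5 + 3, m * 5 + 4}" by auto
      have p: "prod f {m * 5..<m * 5 + 5} = f (m * 5) * f (m * 5 + 1) * f (m * 5 + 2) * f (m * 5 + 3) * f (m * 5 + 4)"
        unfolding s by (simp add: mult.assoc)
      have e: "q ^ Suc (m * 5 + k) = q ^ Suc k * (q ^ 5) ^ m" for k
        by (simp add: power_mult [symmetric] power_add [symmetric] mult.commute add.commute)
      have m: "int (Suc (m * 5 + k)) mod 5 = int (Suc k) mod 5" for k by presburger
      have f0: "f (m * 5 + k) = (1 - q ^ Suc k * (q ^ 5) ^ m) powi Legendre (int (Suc k)) 5" for k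
        unfolding f_def e Legendre_5 m by simp
      show ?thesis
        unfolding p f0 f0[of 0, simplified add_0_right]
        by (simp add: Legendre_5 power_int_minus field_simps eval_nat_numeral)
    qed
    then show ?thesis
      by (simp only: prod.nat_group[of f 5 n, symmetric] prod.distrib prod_dividef)
  qed
  have "(\<lambda>n. \<Prod>i<n * 5. f i) \<longlonglongrightarrow> qpoch q (q ^ 5) * qpoch (q ^ 4) (q ^ 5) / (qpoch (q ^ 2) (q ^ 5) * qpoch (q ^ 3) (q ^ 5))"
    unfolding block using thA_thB_nonzero(2)[OF q] unfolding thB_def
    by (intro tendsto_intros qpoch_tendsto q5) auto
  then have "prodinf f = thA q / thB q" using LIMSEQ_unique[OF L1] by (simp add: thA_def thB_def)
  moreover have "rr_cf \<tau> = exp (2 * pi * \<i> * \<tau> / 5) * prodinf f"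
    by (simp add: rr_cf_def f_def q_def ee_def mult_ac)
  moreover have "exp (2 * pi * \<i> * \<tau> / 5) ^ 5 = q"
    unfolding q_def ee_def exp_of_nat_mult [symmetric] by (simp add: mult_ac)
  ultimately show ?thesis by (simp add: q_def [symmetric] s1_def Sc_def power_mult_distrib power_divide)
qed

lemma i_sqrt_square: "(\<i> * complex_of_real (sqrt (real n))) * (\<i> * complex_of_real (sqrt (real n))) = - of_nat n"
proof -
  have "complex_of_real (sqrt (real n)) * complex_of_real (sqrt (real n)) = of_nat n"
    unfolding of_real_mult [symmetric] by simp
  moreover have "(\<i> * c) * (\<i> * c) = - (c * c)" for c by (simp add: algebra_simps)
  ultimately show ?thesis by metis
qed

section \<open>Multiplication by \<open>lam\<close> on the lattice of the CM point\<close>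

context lprime4
begin

definition lam :: complex where "lam = \<i> * of_real (sqrt (real l))"

lemma lam_square: "lam * lam = - of_nat l"
  unfolding lam_def by (rule i_sqrt_square)

lemma lam_nonzero: "lam \<noteq> 0"
  using l_pos by (simp add: lam_def)

text \<open>As lam^2 = - l, the lattice lam^-1 L is lam L / l. On L / l L the image of lam L is a
  line spanned by lam: w acts on lam as a scalar c modulo l L, so adjoining lam / l to L gives
  everything.\<close>

lemma sups_lam_multiple:
  fixes k u N :: int
  assumes w: "Im w > 0" and k: "\<not> int l dvd k" and lam: "lam = of_int k * w - of_int u"
    and lw: "lam * w = of_int u * w - of_int (k * N)" and N: "k ^ 2 * N = u ^ 2 + int l"
  shows "(*) (1 / lam) ` lat w \<in> sups l (lat w)"
proof -
  have l0: "(of_nat l :: complex) \<noteq> 0" using l_pos by simp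
  have inv: "1 / lam = - lam / of_nat l" using lam_square lam_nonzero l0 by (simp add: field_simps)
  have lamL: "lam * a \<in> lat w" if "a \<in> lat w" for a
  proof -
    obtain m n where a: "a = of_int m + of_int n * w" using \<open>a \<in> lat w\<close> by (auto simp: lat_def)
    have "lam * a = of_int m * lam + of_int n * (lam * w)" by (simp add: a algebra_simps)
    also have "\<dots> = of_int (- m * u - n * k * N) + of_int (m * k + n * u) * w"
      unfolding lw by (subst lam) (simp add: algebra_simps)
    finally show ?thesis by (rule latI)
  qed
  have lam_lat: "lam \<in> lat w" using lamL[of 1] by simp
  have not: "lam / of_nat l \<notin> lat w"
  proof -
    have "lam = of_int (- u) + of_int k * w" using lam by simp
    then show ?thesis using of_int_div_of_nat_in_lat_iff[OF w l_pos, of "- u" k] k by auto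
  qed
  have "coprime k (int l)" using prime_int_l k by (metis coprime_commute prime_imp_coprime)
  then obtain k' where k': "[k * k' = 1] (mod int l)" using cong_solve_coprime_int by blast
  \<comment> \<open>The scalar of w on lam. Comparing coordinates of w lam = u w - k N and c lam = c
    k w - c u requires c k = u, which defines c, and c u = k N, which follows from the norm equation
    modulo l.\<close>
  define c where "c = u * k'"
  have "[k * c = u] (mod int l)"
    using cong_mult[OF cong_refl[of u] k'] by (simp add: c_def mult_ac)
  then have c1: "int l dvd u - c * k" by (simp add: cong_iff_dvd_diff mult.commute dvd_diff_commute)
  have "k * (k * N - c * u) = u * (u - c * k) + int l"
    using N by (simp add: algebra_simps power2_eq_square)
  then have "int l dvd k * (k * N - c * u)" using c1 by simp
  then have c2: "int l dvd k * N - c * u" using k prime_int_l by (metis prime_dvd_mult_iff)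
  obtain s t where st: "u - c * k = int l * s" "k * N - c * u = int l * t" using c1 c2 by (metis dvdE)
  have wl: "w * lam / of_nat l = of_int (- t) + of_int s * w + of_int c * lam / of_nat l"
  proof -
    have "w * lam = of_int (u - c * k) * w - of_int (k * N - c * u) + of_int c * (of_int k * w - of_int u)"
      using lw by (simp add: algebra_simps)
    then show ?thesis unfolding st lam [symmetric] using l0 by (simp add: field_simps)
  qed
  have "(*) (1 / lam) ` lat w = ext l (lat w) lam"
  proof (intro antisym subsetI)
    fix z assume "z \<in> (*) (1 / lam) ` lat w"
    then obtain m n where z: "z = 1 / lam * (of_int m + of_int n * w)" by (auto simp: lat_def)
    have "z = - of_int m * (lam / of_nat l) - of_int n * (w * lam / of_nat l)"
      unfolding z inv using l0 by (simp add: field_simps)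
    also have "\<dots> = (of_int (n * t) + of_int (- n * s) * w) + of_int (- m - n * c) * lam / of_nat l"
      unfolding wl using l0 by (simp add: field_simps)
    finally show "z \<in> ext l (lat w) lam" unfolding ext_def by (blast intro: latI)
  next
    fix z assume "z \<in> ext l (lat w) lam"
    then obtain a j where a: "a \<in> lat w" "z = a + of_int j * lam / of_nat l" by (auto simp: ext_def)
    have "of_int j * lam / of_nat l = 1 / lam * of_int (- j)" unfolding inv by simp
    then have "z = 1 / lam * (lam * a + of_int (- j))"
      using a(2) lam_nonzero by (simp add: field_simps)
    moreover have "lam * a + of_int (- j) \<in> lat w" by (intro lat_add lamL a lat_of_int)
    ultimately show "z \<in> (*) (1 / lam) ` lat w" by blast
  qed
  then show ?thesis unfolding sups_def using lam_lat not by blast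
qed

text \<open>Specialises \<open>modular_relations\<close> to \<tau> = w, where lam^-1 L has the same
  value of s as L. Its factor makes the full product vanish and leaves one common product
  \<open>X\<close> in both sums.\<close>

lemma cm_relations:
  fixes k u N :: int
  assumes w: "Im w > 0" and k: "\<not> int l dvd k" and lam: "lam = of_int k * w - of_int u"
    and lw: "lam * w = of_int u * w - of_int (k * N)" and N: "k ^ 2 * N = u ^ 2 + int l" "5 dvd N"
  defines "\<beta> \<equiv> rr_cf (w / 5) ^ 5"
  obtains p p2 p3 :: "complex poly" and e :: complex where
    "\<And>k. Polynomial.coeff p k \<in> Zl" "\<And>k. Polynomial.coeff p2 k \<in> Zl" "\<And>k. Polynomial.coeff p3 k \<in> Zl"
    "Polynomial.coeff p 0 = 0" "Polynomial.coeff p2 0 = 0" "degree p3 \<le> 2 * l" "e = 1 \<or> e = - 1" "\<beta> \<noteq> 0"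
    "\<beta> ^ l - \<beta> + of_nat l * poly p \<beta> = - e * lam * poly p2 \<beta>"
    "(\<beta> ^ l - \<beta>) ^ 2 = of_nat l * poly p3 \<beta>"
proof -
  define z where "z = w / 5"
  define A where "A = sups l (lat w)"
  define s where "s = (\<lambda>M. sL M z)"
  define n where "n = (\<lambda>M. nL M z)"
  define s0 where "s0 = sL (lat w) z"
  define n0 where "n0 = nL (lat w) z"
  define M0 where "M0 = (*) (1 / lam) ` lat w"
  note basis = lattice_basis_lat[OF w]
  have x: "norm (ee (w / 5)) < 1" by (rule norm_ee_less_1) (use w in simp)
  have s0: "s0 = \<beta>"
    using sL_nL_cusp(1)[OF w, of 1] rr_cf_power_5[of "w / 5"] w
    by (simp add: s0_def z_def cz_def sc_def es_def \<beta>_def s1_def)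
  have "n0 = nc 1 w" using sL_nL_cusp(2)[OF w, of 1] by (simp add: n0_def z_def cz_def)
  then have n0: "n0 \<noteq> 0" using Sc_Nc_nonzero(2)[OF x, of 1] by (simp add: nc_def en_def)
  have b0: "\<beta> \<noteq> 0" using rr_cf_power_5[of "w / 5"] w Sc_Nc_nonzero(1)[OF x, of 1] by (simp add: \<beta>_def s1_def)
  \<comment> \<open>u^2 = k^2 N - l with 5 dividing N and l = -1 modulo 5.\<close>
  have "u ^ 2 mod 5 = 1"
  proof -
    have "int l mod 5 = 4" using l_mod by (metis of_nat_mod of_nat_numeral)
    moreover have "(u ^ 2 + int l) mod 5 = 0" using N by (metis dvd_eq_mod_eq_0 dvd_mult)
    ultimately show ?thesis by presburger
  qed
  then have "u mod 5 = 1 \<or> u mod 5 = 4"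
  proof -
    have "u mod 5 \<in> {0..4}" by auto
    then have "u mod 5 = 0 \<or> u mod 5 = 1 \<or> u mod 5 = 2 \<or> u mod 5 = 3 \<or> u mod 5 = 4" by (simp add: atLeastAtMost_def) presburger
    moreover have "u ^ 2 mod 5 = (u mod 5) ^ 2 mod 5" by (simp add: power_mod)
    ultimately show ?thesis using \<open>u ^ 2 mod 5 = 1\<close> by auto
  qed
  then obtain e t :: int where e: "e = 1 \<or> e = - 1" and u: "u = 5 * t + e"
  proof
    assume "u mod 5 = 1"
    then have "u = 5 * (u div 5) + 1" by presburger
    then show thesis using that[of 1 "u div 5"] by simp
  next
    assume "u mod 5 = 4"
    then have "u = 5 * (u div 5 + 1) + - 1" by presburger
    then show thesis using that[of "- 1" "u div 5 + 1"] by simp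
  qed
  obtain N' where N': "N = 5 * N'" using N(2) by blast
  \<comment> \<open>So lam acts on the 5-torsion point z modulo L as the sign e; both u = e modulo 5
    and 5 dividing N are used.\<close>
  have lz: "lam * z = of_int e * z + (of_int (- k * N') + of_int t * w)"
  proof -
    have "lam * z = lam * w / 5" by (simp add: z_def)
    also have "\<dots> = of_int e * z + (of_int (- k * N') + of_int t * w)"
      unfolding lw N' u by (simp add: z_def field_simps)
    finally show ?thesis .
  qed
  have per: "of_int (- k * N') + of_int t * w \<in> lat w" by (rule latI) (rule refl)
  \<comment> \<open>The homothety by lam carries (lam^-1 L, z) to (L, lam z), and lam z is e z
    modulo L; the weight of n leaves the factor lam.\<close>
  have sM0: "s M0 = s0" and nM0: "n M0 = of_int e * lam * n0"
  proof -
    have z': "z = 1 / lam * (lam * z)" using lam_nonzero by simp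
    have i0: "1 / lam \<noteq> 0" using lam_nonzero by simp
    have "s M0 = sL (lat w) (lam * z)" unfolding s_def M0_def by (subst z') (rule sL_scale[OF basis i0])
    also have "\<dots> = sL (lat w) (of_int e * z)" unfolding lz by (rule sL_periodic[OF basis per])
    also have "\<dots> = s0" using e sL_minus[OF basis] by (auto simp: s0_def)
    finally show "s M0 = s0" .
    have "n M0 = nL (lat w) (lam * z) / (1 / lam)" unfolding n_def M0_def by (subst z') (rule nL_scale[OF basis i0])
    also have "nL (lat w) (lam * z) = nL (lat w) (of_int e * z)" unfolding lz by (rule nL_periodic[OF basis per])
    also have "\<dots> = of_int e * n0" using e nL_minus[OF basis] by (auto simp: n0_def)
    finally show "n M0 = of_int e * lam * n0" by simp
  qed
  have M0: "M0 \<in> A" unfolding M0_def A_def by (rule sups_lam_multiple[OF w k lam lw N(1)])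
  have fin: "finite A" unfolding A_def using bij_betw_finite[OF bij_betw_sidx[OF prime_l l_not_5 w]] by simp
  define X where "X = (\<Prod>M\<in>A - {M0}. s0 - s M)"
  have gT: "gT A f s a s0 = f M0 / a * X" for f a
  proof -
    have "(\<Prod>M'\<in>A - {M}. s0 - s M') = 0" if "M \<in> A - {M0}" for M
      using fin M0 that sM0 by (intro prod_zero) auto
    then show ?thesis unfolding gT_def X_def by (subst sum.remove[OF fin M0]) simp
  qed
  obtain p1 p2 p3 where p: "\<And>k. Polynomial.coeff p1 k \<in> Zl" "\<And>k. Polynomial.coeff p2 k \<in> Zl"
    "\<And>k. Polynomial.coeff p3 k \<in> Zl" "Polynomial.coeff p1 0 = 0" "Polynomial.coeff p2 0 = 0" "degree p3 \<le> 2 * l"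
    "gT A (\<lambda>M. 1) s 1 s0 = s0 ^ l - s0 + of_nat l * poly p1 s0"
    "gT A n s n0 s0 = of_nat l * poly p2 s0"
    "(\<Prod>M\<in>A. s0 - s M) = - ((s0 ^ l - s0) ^ 2) + of_nat l * poly p3 s0"
    using modular_relations w unfolding Let_def A_def s_def s0_def n_def n0_def z_def by blast
  have "(\<Prod>M\<in>A. s0 - s M) = 0" using fin M0 sM0 by (intro prod_zero) auto
  then have 3: "(\<beta> ^ l - \<beta>) ^ 2 = of_nat l * poly p3 \<beta>" using p(9) unfolding s0 by simp
  have X1: "X = \<beta> ^ l - \<beta> + of_nat l * poly p1 \<beta>" using p(7) unfolding gT[unfolded s0] s0 by simp
  have "of_int e * lam * X = of_nat l * poly p2 \<beta>" using p(8) n0 unfolding gT[unfolded s0] nM0 s0 by simp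
  \<comment> \<open>Multiplying by e lam turns lam^2 into - l, which cancels the l on the right and
    trades it for a single lam.\<close>
  moreover have "(of_int e * lam) * (of_int e * lam * X) = lam * lam * X" using e by auto
  ultimately have "lam * lam * X = (of_int e * lam) * (of_nat l * poly p2 \<beta>)" by metis
  then have "of_nat l * X = of_nat l * (- of_int e * lam * poly p2 \<beta>)"
    unfolding lam_square by (simp add: mult_ac) (metis minus_minus)
  then have "X = - of_int e * lam * poly p2 \<beta>" using l_pos by (metis mult_left_cancel of_nat_eq_0_iff not_less_zero)
  with X1 have 2: "\<beta> ^ l - \<beta> + of_nat l * poly p1 \<beta> = - of_int e * lam * poly p2 \<beta>" by simp
  show thesis by (rule that[OF p(1-6) _ b0 2 3]) (use e in auto)
qed

text \<open>With \<open>N\<close> the norm of w one has w^2 = v w - N. For d = l, lam = 2 w - v, so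
  k = 2 and u = v; for d = 4 l, v is even and lam = w - v/2, so k = 1 and u = v/2. In both cases k
  is prime to l.\<close>

lemma cm_point:
  fixes d :: nat and v :: int and P :: "complex set"
  defines "K \<equiv> quad_field l"
  defines "R \<equiv> ring_of_integers K"
  defines "w \<equiv> (of_int v + \<i> * of_real (sqrt (real d))) / 2"
  assumes d: "d = l \<or> d = 4 * l" and w: "alg_int w"
    and P: "is_prime_ideal R P" "5 \<in> P" "w \<in> ideal_mult R P P"
  obtains k u N :: int where "Im w > 0" "\<not> int l dvd k" "lam = of_int k * w - of_int u"
    "lam * w = of_int u * w - of_int (k * N)" "k ^ 2 * N = u ^ 2 + int l" "5 dvd N"
proof -
  have Pid: "is_ideal R P" "P \<noteq> R" using P(1) by (auto simp: is_prime_ideal_def)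
  have PR: "P \<subseteq> R" using Pid by (simp add: is_ideal_def)
  have int_mem: "of_int n \<in> R" for n
  proof -
    have "alg_int (of_int n)" using csubring_of_int[OF alg_int_csubring] by auto
    moreover have "(of_int n :: complex) = of_rat (of_int n) + of_rat 0 * lam" by simp
    ultimately show ?thesis unfolding R_def K_def ring_of_integers_def quad_field_def lam_def by blast
  qed
  have mulP: "r * x \<in> P" if "r \<in> R" "x \<in> P" for r x using Pid(1) that by (simp add: is_ideal_def)
  have addP: "x + y \<in> P" if "x \<in> P" "y \<in> P" for x y using Pid(1) that by (simp add: is_ideal_def)
  have "{a * b | a b. a \<in> P \<and> b \<in> P} \<subseteq> P" using mulP PR by auto
  then have "ideal_mult R P P \<subseteq> P" unfolding ideal_mult_def using Pid(1) by (intro Inter_lower) simp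
  then have wP: "w \<in> P" using P(3) by blast
  define y where "y = \<i> * complex_of_real (sqrt (real d))"
  have y2: "y * y = - of_nat d" unfolding y_def by (rule i_sqrt_square)
  have wy: "w = (of_int v + y) / 2" by (simp add: w_def y_def)
  have wc: "w * (of_int v - w) = (of_int v ^ 2 + of_nat d) / 4"
    unfolding wy using y2 by (simp add: field_simps power2_eq_square)
  have vw: "alg_int (of_int v - w)"
    using csubring_diff[OF alg_int_csubring] csubring_of_int[OF alg_int_csubring] w by blast
  have "alg_int (w * (of_int v - w))" using csubring_mult[OF alg_int_csubring] w vw by blast
  moreover have "w * (of_int v - w) \<in> \<rat>"
    unfolding wc by (intro Rats_divide Rats_add Rats_power) auto
  ultimately obtain N :: int where N: "w * (of_int v - w) = of_int N"
    using alg_int_rational_imp_int by (metis Ints_cases)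
  have "of_int (4 * N) = (of_int (v ^ 2 + int d) :: complex)" using N unfolding wc by (simp add: field_simps)
  then have N4: "4 * N = v ^ 2 + int d" by (simp only: of_int_eq_iff)
  \<comment> \<open>\<open>N\<close> is the product of w and its conjugate, hence lies in
    \<open>P\<close> together with 5; if it were prime to 5, then 1 would lie in
    \<open>P\<close>.\<close>
  have "5 dvd N"
  proof (rule ccontr)
    assume "\<not> 5 dvd N"
    then have "coprime 5 N" by (intro prime_imp_coprime) (simp_all add: prime_int_numeral_eq)
    then obtain a b where ab: "a * 5 + b * N = 1" by (metis bezout_int coprime_iff_gcd_eq_1)
    have wK: "w \<in> K" using wP PR unfolding R_def ring_of_integers_def by blast
    obtain r s where rs: "w = of_rat r + of_rat s * lam"
      using wK unfolding K_def quad_field_def lam_def by blast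
    have "of_int v - w = of_rat (of_int v - r) + of_rat (- s) * lam"
      unfolding rs by (simp add: of_rat_diff of_rat_minus)
    then have "of_int v - w \<in> R"
      using vw unfolding R_def K_def ring_of_integers_def quad_field_def lam_def by blast
    then have "(of_int v - w) * w \<in> P" using wP by (rule mulP)
    then have "of_int N \<in> P" using N by (simp add: mult.commute)
    then have "of_int a * 5 + of_int b * of_int N \<in> P"
      using P(2) by (intro addP mulP int_mem)
    moreover have "of_int a * 5 + of_int b * of_int N = (1 :: complex)"
      using arg_cong[OF ab, of "of_int :: int \<Rightarrow> complex"] by simp
    ultimately have "1 \<in> P" by simp
    then have "x \<in> P" if "x \<in> R" for x using mulP[OF that] by fastforce
    then show False using Pid(2) PR by blast
  qed
  have d0: "d > 0" using d l_pos by auto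
  have "Im w > 0" using d0 by (simp add: w_def)
  have ww: "w * w = of_int v * w - of_int N" using N by (simp add: algebra_simps)
  from d show thesis
  proof
    assume d: "d = l"
    have lam: "lam = of_int 2 * w - of_int v" unfolding wy y_def lam_def d by (simp add: field_simps)
    have "lam * w = 2 * (w * w) - of_int v * w" unfolding lam by (simp add: algebra_simps)
    then have "lam * w = of_int v * w - of_int (2 * N)" unfolding ww by (simp add: algebra_simps)
    moreover have "\<not> int l dvd 2"
      using l_mod mod_less_eq_dividend[of l 5] by (intro zdvd_not_zless) auto
    ultimately show thesis using that[of 2 v N] \<open>Im w > 0\<close> lam \<open>5 dvd N\<close> N4 d by simp
  next
    assume d: "d = 4 * l"
    have "v ^ 2 = 2 * (2 * (N - int l))" using N4 unfolding d by simp
    then have "even (v ^ 2)" by (metis dvd_triv_left)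
    then obtain u where u: "v = 2 * u" by auto
    have lam: "lam = of_int 1 * w - of_int u" unfolding wy y_def lam_def d u by (simp add: real_sqrt_mult field_simps)
    have "lam * w = w * w - of_int u * w" unfolding lam by (simp add: algebra_simps)
    then have "lam * w = of_int u * w - of_int (1 * N)" unfolding ww u by (simp add: algebra_simps)
    moreover have "\<not> int l dvd 1" using prime_int_l by (metis not_prime_unit)
    moreover have "1 ^ 2 * N = u ^ 2 + int l" using N4 unfolding d u by simp
    ultimately show thesis using that[of 1 u N] \<open>Im w > 0\<close> lam \<open>5 dvd N\<close> by simp
  qed
qed

end

section \<open>Division and resultants over a subring\<close>

definition polys :: "'a::comm_ring_1 set \<Rightarrow> 'a poly set" where
  "polys J = {p. \<forall>k. Polynomial.coeff p k \<in> J}"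

lemma polysD: "p \<in> polys J \<Longrightarrow> Polynomial.coeff p k \<in> J"
  by (simp add: polys_def)

lemma polys_mono: "J \<subseteq> J' \<Longrightarrow> p \<in> polys J \<Longrightarrow> p \<in> polys J'"
  by (auto simp: polys_def)

context
  fixes J :: "'a::comm_ring_1 set"
  assumes J: "csubring J"
begin

lemma polys_csubring: "csubring (polys J)"
  unfolding polys_def by (rule csubring_polys[OF J])

lemma polys_monom: "c \<in> J \<Longrightarrow> Polynomial.monom c n \<in> polys J"
  by (auto simp: polys_def csubring_0[OF J])

lemma polys_pCons: "c \<in> J \<Longrightarrow> p \<in> polys J \<Longrightarrow> pCons c p \<in> polys J"
  by (auto simp: polys_def coeff_pCons split: nat.splits)

lemma polys_smult: "c \<in> J \<Longrightarrow> p \<in> polys J \<Longrightarrow> Polynomial.smult c p \<in> polys J"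
  by (auto simp: polys_def csubring_mult[OF J])

lemma poly_in_csubring: "p \<in> polys J \<Longrightarrow> x \<in> J \<Longrightarrow> poly p x \<in> J"
  unfolding poly_altdef by (intro csubring_sum[OF J] csubring_mult[OF J] csubring_power[OF J]) (auto simp: polys_def)

lemma polys_monic_division:
  assumes m: "m \<in> polys J" "lead_coeff m = 1" "degree m > 0" and F: "F \<in> polys J"
  obtains q r where "q \<in> polys J" "r \<in> polys J" "F = q * m + r" "degree r < degree m"
proof -
  have "\<exists>q r. q \<in> polys J \<and> r \<in> polys J \<and> F = q * m + r \<and> degree r < degree m"
    using F
  proof (induction "degree F" arbitrary: F rule: less_induct)
    case less
    show ?case
    proof (cases "degree F < degree m")
      case True
      then show ?thesis
        using less.prems csubring_0[OF polys_csubring] by (intro exI[of _ 0] exI[of _ F]) auto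
    next
      case False
      define h where "h = Polynomial.monom (lead_coeff F) (degree F - degree m)"
      have h: "h \<in> polys J" unfolding h_def by (rule polys_monom) (use less.prems in \<open>simp add: polys_def\<close>)
      define F' where "F' = F - h * m"
      have F': "F' \<in> polys J" unfolding F'_def
        by (intro csubring_diff[OF polys_csubring] csubring_mult[OF polys_csubring] less.prems h m)
      have top: "Polynomial.coeff F' k = 0" if "k \<ge> degree F" for k
      proof -
        have "Polynomial.coeff (h * m) k = lead_coeff F * Polynomial.coeff m (k - (degree F - degree m))"
          using that unfolding h_def coeff_monom_mult by auto
        moreover have "Polynomial.coeff m (k - (degree F - degree m)) = (if k = degree F then 1 else 0)"
          using that False m(2) by (auto intro!: coeff_eq_0)
        moreover have "Polynomial.coeff F k = (if k = degree F then lead_coeff F else 0)"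
          using that by (auto intro!: coeff_eq_0)
        ultimately show ?thesis by (simp add: F'_def)
      qed
      have "degree F' < degree F"
      proof (rule ccontr)
        assume n: "\<not> degree F' < degree F"
        then have "lead_coeff F' = 0" using top by simp
        then have "degree F' = 0" by simp
        then show False using n False m(3) by simp
      qed
      then obtain q r where qr: "q \<in> polys J" "r \<in> polys J" "F' = q * m + r" "degree r < degree m"
        using less.hyps[OF _ F'] by blast
      have "F = (q + h) * m + r" using qr(3) by (simp add: F'_def algebra_simps)
      then show ?thesis using qr h csubring_add[OF polys_csubring] by blast
    qed
  qed
  then show thesis using that by blast
qed

text \<open>Descending induction from the top coefficient of \<open>a\<close>: because
  \<open>m\<close> is monic, each high coefficient of \<open>a\<close> is one of
  \<open>a * m\<close> minus multiples of higher ones of \<open>a\<close>.\<close>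

lemma coeff_mult_monic_high:
  assumes m: "m \<in> polys J" "lead_coeff m = 1" and a: "a \<in> polys J"
    and hi: "\<And>j. j \<ge> N + degree m \<Longrightarrow> Polynomial.coeff (a * m) j \<in> (*) \<pi> ` J"
  shows "j \<ge> N \<Longrightarrow> Polynomial.coeff a j \<in> (*) \<pi> ` J"
proof (induction "degree a - j" arbitrary: j rule: less_induct)
  case less
  have add: "x - y \<in> (*) \<pi> ` J" if "x \<in> (*) \<pi> ` J" "y \<in> (*) \<pi> ` J" for x y
    using that csubring_diff[OF J] by (auto simp: image_iff right_diff_distrib [symmetric])
  have zero: "0 \<in> (*) \<pi> ` J" using csubring_0[OF J] by force
  have sum: "sum f S \<in> (*) \<pi> ` J" if "\<And>i. i \<in> S \<Longrightarrow> f i \<in> (*) \<pi> ` J" for f and S :: "nat set"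
    using that
  proof (induction S rule: infinite_finite_induct)
    case (insert x S)
    then have "f x - (0 - sum f S) \<in> (*) \<pi> ` J" by (intro add zero) auto
    then show ?case using insert by simp
  qed (use zero in auto)
  define n where "n = degree m"
  have hd: "Polynomial.coeff (a * m) (j + n) = (\<Sum>i\<le>j + n. Polynomial.coeff a i * Polynomial.coeff m (j + n - i))"
    by (simp add: coeff_mult)
  also have "\<dots> = (\<Sum>i\<in>{j..j + n}. Polynomial.coeff a i * Polynomial.coeff m (j + n - i))"
    by (rule sum.mono_neutral_right) (auto simp: coeff_eq_0 n_def)
  also have "{j..j + n} = insert j {j<..j + n}" by auto
  also have "(\<Sum>i\<in>insert j {j<..j + n}. Polynomial.coeff a i * Polynomial.coeff m (j + n - i)) =
      Polynomial.coeff a j + (\<Sum>i\<in>{j<..j + n}. Polynomial.coeff a i * Polynomial.coeff m (j + n - i))"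
    using m(2) by (simp add: n_def)
  finally have eq: "Polynomial.coeff a j = Polynomial.coeff (a * m) (j + n) -
      (\<Sum>i\<in>{j<..j + n}. Polynomial.coeff a i * Polynomial.coeff m (j + n - i))" by simp
  have "Polynomial.coeff a i * Polynomial.coeff m (j + n - i) \<in> (*) \<pi> ` J" if i: "i \<in> {j<..j + n}" for i
  proof (cases "i > degree a")
    case True
    then show ?thesis using zero by (simp add: coeff_eq_0)
  next
    case False
    then have "Polynomial.coeff a i \<in> (*) \<pi> ` J" using i less.prems by (intro less.hyps) auto
    moreover have "Polynomial.coeff m (j + n - i) \<in> J" using m(1) by (rule polysD)
    ultimately show ?thesis using csubring_mult[OF J] by (auto simp: image_iff mult.assoc)
  qed
  then show ?case unfolding eq using hi[of "j + n"] less.prems by (intro add sum) (auto simp: n_def)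
qed

section \<open>Determinants and resultants modulo an element of the subring\<close>

lemma det_csubring:
  assumes A: "A \<in> carrier_mat n n" and e: "\<And>i j. i < n \<Longrightarrow> j < n \<Longrightarrow> A $$ (i, j) \<in> J"
  shows "det A \<in> J"
  unfolding det_def'[OF A]
  by (intro csubring_sum[OF J] csubring_mult[OF J] csubring_of_int[OF J] csubring_prod[OF J] e)
     (use permutes_in_image[of _ "{0..<n}"] in auto)

lemma det_cong_1:
  assumes \<pi>: "\<pi> \<in> J" and A: "A \<in> carrier_mat n n"
    and e: "\<And>i j. i < n \<Longrightarrow> j < n \<Longrightarrow> \<exists>y\<in>J. A $$ (i, j) = (if i = j then 1 else 0) + \<pi> * y"
  shows "\<exists>y\<in>J. det A = 1 + \<pi> * y"
proof -
  define C where "C = (\<lambda>x y. x \<in> J \<and> y \<in> J \<and> (\<exists>z\<in>J. x = y + \<pi> * z))"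
  have CI: "C x y" if "y \<in> J" "z \<in> J" "x = y + \<pi> * z" for x y z
    using that \<pi> unfolding C_def by (auto intro!: csubring_add[OF J] csubring_mult[OF J])
  have Crefl: "C x x" if "x \<in> J" for x using that csubring_0[OF J] by (intro CI[of x 0]) auto
  have Cadd: "C (x + x') (y + y')" if xy: "C x y" "C x' y'" for x y x' y'
  proof -
    obtain z z' where z: "z \<in> J" "x = y + \<pi> * z" "z' \<in> J" "x' = y' + \<pi> * z'" using xy unfolding C_def by blast
    show ?thesis
      by (rule CI[of _ "z + z'"]) (use xy z in \<open>auto simp: C_def algebra_simps intro!: csubring_add[OF J]\<close>)
  qed
  have Cmult: "C (x * x') (y * y')" if xy: "C x y" "C x' y'" for x y x' y'
  proof -
    obtain z z' where z: "z \<in> J" "x = y + \<pi> * z" "z' \<in> J" "x' = y' + \<pi> * z'" using xy unfolding C_def by blast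
    have y: "y \<in> J" "y' \<in> J" using xy by (auto simp: C_def)
    show ?thesis
      by (rule CI[of _ "y * z' + z * y' + \<pi> * z * z'"])
         (use y z \<pi> in \<open>auto simp: algebra_simps intro!: csubring_add[OF J] csubring_mult[OF J]\<close>)
  qed
  have Csum: "C (sum f S) (sum g S)" if fg: "\<And>i. i \<in> S \<Longrightarrow> C (f i) (g i)" for f g and S :: "(nat \<Rightarrow> nat) set"
    using fg by (induction S rule: infinite_finite_induct) (auto intro!: Cadd Crefl csubring_0[OF J])
  have Cprod: "C (prod f S) (prod g S)" if fg: "\<And>i. i \<in> S \<Longrightarrow> C (f i) (g i)" for f g and S :: "nat set"
    using fg by (induction S rule: infinite_finite_induct) (auto intro!: Cmult Crefl csubring_1[OF J])
  have Ce: "C (A $$ (i, j)) ((1\<^sub>m n) $$ (i, j))" if ij: "i < n" "j < n" for i j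
  proof -
    obtain y where "y \<in> J" "A $$ (i, j) = (if i = j then 1 else 0) + \<pi> * y" using e[OF ij] by blast
    then show ?thesis using ij csubring_0[OF J] csubring_1[OF J] by (intro CI[of _ y]) auto
  qed
  have "C (det A) (det (1\<^sub>m n))"
    unfolding det_def'[OF A] det_def'[OF one_carrier_mat]
    by (intro Csum Cmult Cprod Crefl csubring_of_int[OF J] Ce)
       (use permutes_in_image[of _ "{0..<n}"] in auto)
  then show ?thesis by (auto simp: C_def)
qed

end

lemma polys_pderiv: "csubring J \<Longrightarrow> p \<in> polys J \<Longrightarrow> pderiv p \<in> polys J" for p :: "complex poly"
  by (auto simp: polys_def coeff_pderiv intro!: csubring_mult csubring_of_nat simp del: of_nat_Suc)

text \<open>A Bezout relation modulo \<open>\<pi>\<close> inverts the Sylvester matrix modulo \<open>\<pi>\<close>.\<close>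
lemma resultant_cong_unit:
  fixes m q :: "complex poly"
  assumes J: "csubring J" and \<pi>: "\<pi> \<in> J"
    and m: "m \<in> polys J" "lead_coeff m = 1" "degree m > 0" and q: "q \<in> polys J"
    and uvr: "u \<in> polys J" "v \<in> polys J" "r \<in> polys J" "u * m + v * q = 1 + Polynomial.smult \<pi> r"
  shows "\<exists>y\<in>J. \<exists>z\<in>J. y * resultant m q = 1 + \<pi> * z"
proof -
  note P = polys_csubring[OF J]
  define n d where "n = degree m" and "d = degree q"
  define D where "D = d + n"
  \<comment> \<open>Every X^k below the size of the Sylvester matrix is a combination of m and q
    modulo \<pi> with cofactors of the degrees the matrix allows. The cofactor of q is reduced
    modulo the monic m; the excess coefficients of the other one are then multiples of \<pi> and
    move into the error term.\<close>
  have bez: "\<exists>a b R. a \<in> polys J \<and> b \<in> polys J \<and> R \<in> polys J \<and> (\<forall>j\<ge>d. Polynomial.coeff a j = 0) \<and>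
      (\<forall>j\<ge>n. Polynomial.coeff b j = 0) \<and> a * m + b * q = Polynomial.monom 1 k + Polynomial.smult \<pi> R" if k: "k < D" for k
  proof -
    define X where "X = (Polynomial.monom 1 k :: complex poly)"
    have XJ: "X \<in> polys J" unfolding X_def by (rule polys_monom[OF J csubring_1[OF J]])
    obtain Q b where b: "Q \<in> polys J" "b \<in> polys J" "X * v = Q * m + b" "degree b < degree m"
      by (rule polys_monic_division[OF J m csubring_mult[OF P XJ uvr(2)]])
    define a where "a = X * u + Q * q"
    have aJ: "a \<in> polys J" unfolding a_def by (intro csubring_add[OF P] csubring_mult[OF P] XJ uvr b q)
    have "a * m + b * q = X * (u * m + v * q) + (Q * m + b - X * v) * q" by (simp add: a_def algebra_simps)
    then have ab: "a * m + b * q = X + Polynomial.smult \<pi> (X * r)" unfolding uvr(4) b(3) by (simp add: algebra_simps)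
    have hi: "Polynomial.coeff a j \<in> (*) \<pi> ` J" if "j \<ge> d" for j
    proof (rule coeff_mult_monic_high[OF J m(1,2) aJ _ that])
      fix i assume i: "i \<ge> d + degree m"
      have "degree (b * q) < d + degree m" using degree_mult_le[of b q] b(4) by (simp add: d_def)
      then have "Polynomial.coeff (b * q) i = 0" using i by (intro coeff_eq_0) simp
      moreover have "Polynomial.coeff X i = 0" using i k by (simp add: X_def D_def n_def)
      moreover have "Polynomial.coeff (a * m + b * q) i = Polynomial.coeff X i + \<pi> * Polynomial.coeff (X * r) i"
        unfolding ab by simp
      ultimately have "Polynomial.coeff (a * m) i = \<pi> * Polynomial.coeff (X * r) i" by simp
      moreover have "Polynomial.coeff (X * r) i \<in> J" by (rule polysD[OF csubring_mult[OF P XJ uvr(3)]])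
      ultimately show "Polynomial.coeff (a * m) i \<in> (*) \<pi> ` J" by (metis imageI)
    qed
    then obtain h where h: "\<And>j. j \<ge> d \<Longrightarrow> h j \<in> J \<and> Polynomial.coeff a j = \<pi> * h j"
      unfolding image_iff by metis
    define H where "H = (\<Sum>j\<in>{d..degree a}. Polynomial.monom (h j) j)"
    define a' where "a' = (\<Sum>j<d. Polynomial.monom (Polynomial.coeff a j) j)"
    have HJ: "H \<in> polys J" unfolding H_def by (rule csubring_sum[OF P], rule polys_monom[OF J]) (use h in auto)
    have a'J: "a' \<in> polys J" unfolding a'_def
      by (rule csubring_sum[OF P], rule polys_monom[OF J]) (rule polysD[OF aJ])
    have ca': "Polynomial.coeff a' j = (if j < d then Polynomial.coeff a j else 0)" for j
      by (simp add: a'_def coeff_sum)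
    have cH: "Polynomial.coeff H j = (if j \<in> {d..degree a} then h j else 0)" for j
      by (simp add: H_def coeff_sum del: atLeastAtMost_iff)
    have "a = a' + Polynomial.smult \<pi> H"
    proof (rule poly_eqI)
      fix k
      show "Polynomial.coeff a k = Polynomial.coeff (a' + Polynomial.smult \<pi> H) k"
        using h[of k] coeff_eq_0[of a k] by (cases "k < d"; cases "k \<le> degree a") (auto simp: ca' cH)
    qed
    then have "a' * m + b * q = X + Polynomial.smult \<pi> (X * r - H * m)"
      using ab by (simp add: algebra_simps smult_diff_right)
    moreover have "X * r - H * m \<in> polys J" by (intro csubring_diff[OF P] csubring_mult[OF P] XJ uvr HJ m)
    moreover have "\<forall>j\<ge>n. Polynomial.coeff b j = 0" using b(4) by (auto simp: n_def intro!: coeff_eq_0)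
    moreover have "\<forall>j\<ge>d. Polynomial.coeff a' j = 0" using ca' by simp
    ultimately show ?thesis using a'J b(2) unfolding X_def by blast
  qed
  then obtain a b R where abR: "\<And>k. k < D \<Longrightarrow> a k \<in> polys J \<and> b k \<in> polys J \<and> R k \<in> polys J \<and>
      (\<forall>j\<ge>d. Polynomial.coeff (a k) j = 0) \<and> (\<forall>j\<ge>n. Polynomial.coeff (b k) j = 0) \<and>
      a k * m + b k * q = Polynomial.monom 1 k + Polynomial.smult \<pi> (R k)"
    by metis
  define S where "S = sylvester_mat m q"
  \<comment> \<open>Row k holds the cofactors for X^(D-1-k). Indices are reversed because the
    Sylvester matrix lists descending powers, first deg q shifts of m and then deg m shifts of
    q.\<close>
  define f where "f = (\<lambda>k i. if i < d then Polynomial.coeff (a (D - 1 - k)) (d - 1 - i)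
      else Polynomial.coeff (b (D - 1 - k)) (D - 1 - i))"
  define B where "B = Matrix.mat D D (\<lambda>(k, i). f k i)"
  have S: "S \<in> carrier_mat D D" using sylvester_carrier_mat[of m q] by (simp add: S_def D_def n_def d_def add.commute)
  have B: "B \<in> carrier_mat D D" by (simp add: B_def)
  have D0: "D > 0" using m(3) by (simp add: D_def n_def)
  have Sij: "S $$ (i, j) = (if i < d then Polynomial.coeff (Polynomial.monom 1 (d - 1 - i) * m) (D - 1 - j)
      else Polynomial.coeff (Polynomial.monom 1 (D - 1 - i) * q) (D - 1 - j))" if ij: "i < D" "j < D" for i j
  proof -
    have "Polynomial.coeff (Polynomial.monom 1 (Suc e) * g) (Suc h) = Polynomial.coeff (Polynomial.monom 1 e * g) h"
      for e h and g :: "complex poly" by (simp add: coeff_monom_mult)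
    from this[of "d - 1 - i" m "D - 1 - j"] this[of "D - 1 - i" q "D - 1 - j"]
    show ?thesis using ij unfolding S_def D_def n_def d_def
      by (subst sylvester_index_mat2) (auto simp: Suc_diff_Suc add.commute)
  qed
  have BS: "(B * S) $$ (k, j) = (if k = j then 1 else 0) + \<pi> * Polynomial.coeff (R (D - 1 - k)) (D - 1 - j)"
    if kj: "k < D" "j < D" for k j
  proof -
    define K where "K = D - 1 - k"
    have KD: "K < D" using D0 by (simp add: K_def)
    define s where "s = D - 1 - j"
    have low: "(\<Sum>i<N. Polynomial.coeff g (N - 1 - i) * Polynomial.coeff (Polynomial.monom 1 (N - 1 - i) * p) s) =
       Polynomial.coeff (g * p) s" if g: "\<forall>j\<ge>N. Polynomial.coeff g j = 0" for N and g p :: "complex poly"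
    proof -
      have "g = (\<Sum>i<N. Polynomial.monom (Polynomial.coeff g i) i)"
        using g by (intro poly_eqI) (auto simp: coeff_sum)
      then have "Polynomial.coeff (g * p) s = Polynomial.coeff ((\<Sum>i<N. Polynomial.monom (Polynomial.coeff g i) i) * p) s"
        by simp
      also have "\<dots> = (\<Sum>i<N. Polynomial.coeff g i * Polynomial.coeff (Polynomial.monom 1 i * p) s)"
        by (auto simp: sum_distrib_right coeff_sum coeff_monom_mult intro!: sum.cong)
      also have "\<dots> = (\<Sum>i<N. Polynomial.coeff g (N - Suc i) * Polynomial.coeff (Polynomial.monom 1 (N - Suc i) * p) s)"
        by (rule sum.nat_diff_reindex[symmetric])
      finally show ?thesis by simp
    qed
    have split: "(\<Sum>i<d + N. g i) = (\<Sum>i<d. g i) + (\<Sum>i<N. g (d + i))" for N and g :: "nat \<Rightarrow> complex"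
      by (induction N) (simp_all add: add.assoc)
    have "(B * S) $$ (k, j) = (\<Sum>i<D. f k i * S $$ (i, j))"
      using kj B S by (simp add: B_def scalar_prod_def lessThan_atLeast0)
    also have "\<dots> = (\<Sum>i<d. f k i * S $$ (i, j)) + (\<Sum>i<n. f k (d + i) * S $$ (d + i, j))"
      unfolding D_def by (rule split)
    also have "(\<Sum>i<d. f k i * S $$ (i, j)) = Polynomial.coeff (a K * m) s"
      using abR[OF KD] kj by (subst low[symmetric, of d]) (auto intro!: sum.cong simp: Sij f_def K_def s_def D_def)
    also have "(\<Sum>i<n. f k (d + i) * S $$ (d + i, j)) = Polynomial.coeff (b K * q) s"
      using abR[OF KD] kj by (subst low[symmetric, of n]) (auto intro!: sum.cong simp: Sij f_def K_def s_def D_def)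
    also have "Polynomial.coeff (a K * m) s + Polynomial.coeff (b K * q) s = Polynomial.coeff (a K * m + b K * q) s" by simp
    also have "\<dots> = Polynomial.coeff (Polynomial.monom 1 K + Polynomial.smult \<pi> (R K)) s" using abR[OF KD] by simp
    also have "\<dots> = (if k = j then 1 else 0) + \<pi> * Polynomial.coeff (R K) s"
      using kj by (auto simp: K_def s_def)
    finally show ?thesis by (simp only: K_def s_def)
  qed
  have aJ: "a (D - 1 - k) \<in> polys J" "b (D - 1 - k) \<in> polys J" "R (D - 1 - k) \<in> polys J" for k
    using abR[of "D - 1 - k"] D0 by auto
  have "det B \<in> J"
    by (rule det_csubring[OF J B]) (auto simp: B_def f_def intro!: polysD[OF aJ(1)[unfolded diff_diff_left plus_1_eq_Suc]] polysD[OF aJ(2)[unfolded diff_diff_left plus_1_eq_Suc]])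
  moreover have "\<exists>z\<in>J. det (B * S) = 1 + \<pi> * z"
    by (rule det_cong_1[OF J \<pi>]) (use B S BS polysD[OF aJ(3)] in auto)
  then have "\<exists>z\<in>J. det B * resultant m q = 1 + \<pi> * z"
    unfolding resultant_def S_def [symmetric] by (simp add: det_mult[OF B S])
  ultimately show ?thesis by blast
qed

section \<open>The localisation of the quadratic field at \<open>l\<close>\<close>

lemma integral_over_mono: "J \<subseteq> J' \<Longrightarrow> integral_over J x \<Longrightarrow> integral_over J' x"
  unfolding integral_over_def by blast

lemma integral_overI: "csubring J \<Longrightarrow> x \<in> J \<Longrightarrow> integral_over J x"
  unfolding integral_over_def
  by (intro exI[of _ "[:- x, 1:]"])
     (auto simp: coeff_pCons intro: csubring_1 csubring_0 csubring_uminus split: nat.splits)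

lemma integral_over_sqrt: "csubring J \<Longrightarrow> x * x \<in> J \<Longrightarrow> integral_over J x"
  unfolding integral_over_def
  by (intro exI[of _ "[:- (x * x), 0, 1:]"])
     (auto simp: coeff_pCons intro: csubring_1 csubring_0 csubring_uminus split: nat.splits)

context lprime4
begin

abbreviation "Kl \<equiv> quad_field l"

lemma KlE:
  assumes "x \<in> Kl"
  obtains a b :: int and N :: nat where "N > 0" "of_nat N * x = of_int a + of_int b * lam"
proof -
  obtain r s where x: "x = of_rat r + of_rat s * lam" using assms unfolding quad_field_def lam_def by blast
  obtain p q where r: "quotient_of r = (p, q)" by fastforce
  obtain p' q' where s: "quotient_of s = (p', q')" by fastforce
  have q: "q > 0" "q' > 0" using r s quotient_of_denom_pos by blast+
  have rr: "of_rat r = (of_int p / of_int q :: complex)" "of_rat s = (of_int p' / of_int q' :: complex)"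
    unfolding quotient_of_div[OF r] quotient_of_div[OF s] by (simp_all add: of_rat_divide)
  have N: "(of_nat (nat (q * q')) :: complex) = of_int q * of_int q'" using q by simp
  show thesis
  proof (rule that[of "nat (q * q')" "p * q'" "p' * q"])
    show "of_nat (nat (q * q')) * x = of_int (p * q') + of_int (p' * q) * lam"
      unfolding N x rr using q by (simp add: field_simps)
  qed (use q in simp)
qed

lemma Kl_rat: "of_rat r + of_rat s * lam \<in> Kl"
  unfolding quad_field_def lam_def by blast

lemma Kl_csubring: "csubring Kl"
proof -
  have "x - y \<in> Kl \<and> x * y \<in> Kl" if "x \<in> Kl" "y \<in> Kl" for x y
  proof -
    obtain r s where x: "x = of_rat r + of_rat s * lam" using \<open>x \<in> Kl\<close> unfolding quad_field_def lam_def by blast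
    obtain r' s' where y: "y = of_rat r' + of_rat s' * lam" using \<open>y \<in> Kl\<close> unfolding quad_field_def lam_def by blast
    have "x - y = of_rat (r - r') + of_rat (s - s') * lam" by (simp add: x y of_rat_diff algebra_simps)
    moreover have "x * y = of_rat r * of_rat r' + of_rat s * of_rat s' * (lam * lam) + (of_rat r * of_rat s' + of_rat s * of_rat r') * lam"
      by (simp add: x y algebra_simps)
    then have "x * y = of_rat (r * r' - of_nat l * s * s') + of_rat (r * s' + s * r') * lam"
      unfolding lam_square by (simp add: of_rat_diff of_rat_add of_rat_mult algebra_simps)
    ultimately show ?thesis using Kl_rat by metis
  qed
  then show ?thesis using Kl_rat[of 1 0] by (simp add: csubring_def)
qed

lemma Kl_inverse:
  assumes x: "x \<in> Kl"
  shows "inverse x \<in> Kl"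
proof (cases "x = 0")
  case False
  obtain a b :: int and N :: nat where N: "N > 0" "of_nat N * x = of_int a + of_int b * lam" by (rule KlE[OF x])
  define M where "M = a ^ 2 + int l * b ^ 2"
  have yy: "(of_int a + of_int b * lam) * (of_int a - of_int b * lam) = of_int M"
    using lam_square by (simp add: M_def algebra_simps power2_eq_square)
  have "M \<noteq> 0"
  proof
    assume "M = 0"
    moreover have "a ^ 2 \<ge> 0" "int l * b ^ 2 \<ge> 0" by simp_all
    ultimately have "a ^ 2 = 0" "int l * b ^ 2 = 0" unfolding M_def by linarith+
    then have "a = 0" "b = 0" using l_pos by auto
    then show False using N False by simp
  qed
  have "x * (of_nat N * (of_int a - of_int b * lam) / of_int M) = of_nat N * x * (of_int a - of_int b * lam) / of_int M"
    by simp
  then have "x * (of_nat N * (of_int a - of_int b * lam) / of_int M) = 1"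
    unfolding N(2) yy using \<open>M \<noteq> 0\<close> by simp
  then have "inverse x = of_nat N * (of_int a - of_int b * lam) / of_int M" by (rule inverse_unique)
  also have "\<dots> = of_rat (of_int (int N * a) / of_int M) + of_rat (of_int (- int N * b) / of_int M) * lam"
    by (simp add: of_rat_divide of_rat_mult of_rat_minus diff_divide_distrib algebra_simps)
  also have "\<dots> \<in> Kl" by (rule Kl_rat)
  finally show ?thesis .
qed (use csubring_0[OF Kl_csubring] in simp)

text \<open>The local ring of K at lam. The ring of integers may exceed \<int>[lam], but only by
  denominators 2, which are units here since l is odd.\<close>

definition Al :: "complex set" where
  "Al = {a + b * lam | a b. a \<in> Zl \<and> b \<in> Zl}"

lemma AlI: "a \<in> Zl \<Longrightarrow> b \<in> Zl \<Longrightarrow> x = a + b * lam \<Longrightarrow> x \<in> Al"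
  unfolding Al_def by blast

lemma Zl_subset_Al: "Zl \<subseteq> Al"
  using AlI[of _ 0] Zl_intros(2) by force

lemma lam_in_Al: "lam \<in> Al"
  by (rule AlI[of 0 1]) (auto intro: Zl_intros)

lemma Al_csubring: "csubring Al"
proof -
  have "x - y \<in> Al \<and> x * y \<in> Al" if "x \<in> Al" "y \<in> Al" for x y
  proof -
    obtain a b where x: "a \<in> Zl" "b \<in> Zl" "x = a + b * lam" using \<open>x \<in> Al\<close> unfolding Al_def by blast
    obtain c d where y: "c \<in> Zl" "d \<in> Zl" "y = c + d * lam" using \<open>y \<in> Al\<close> unfolding Al_def by blast
    have "x - y = (a - c) + (b - d) * lam" by (simp add: x y algebra_simps)
    then have "x - y \<in> Al" by (rule AlI[rotated 2]) (intro Zl_intros x y)+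
    moreover have "x * y = a * c + b * d * (lam * lam) + (a * d + b * c) * lam" by (simp add: x y algebra_simps)
    then have "x * y = (a * c - of_nat l * b * d) + (a * d + b * c) * lam" unfolding lam_square by (simp add: algebra_simps)
    then have "x * y \<in> Al" by (rule AlI[rotated 2]) (intro Zl_intros x y)+
    ultimately show ?thesis ..
  qed
  then show ?thesis using Zl_subset_Al Zl_intros(1) by (auto simp: csubring_def)
qed

lemmas Al_intros = csubring_intros[OF Al_csubring] lam_in_Al

lemma Zl_int_div: "\<not> int l dvd N \<Longrightarrow> of_int a / of_int N \<in> Zl"
  by (rule ZlI) auto

lemma Al_subset_Kl: "Al \<subseteq> Kl"
proof
  fix x assume "x \<in> Al"
  then obtain a b where ab: "a \<in> Zl" "b \<in> Zl" "x = a + b * lam" unfolding Al_def by blast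
  have "\<exists>r. c = of_rat r" if c: "c \<in> Zl" for c :: complex
  proof -
    obtain q p :: int where "c = of_int p / of_int q" using c by (rule ZlE)
    then have "c = of_rat (of_int p / of_int q)" by (simp add: of_rat_divide)
    then show ?thesis ..
  qed
  then show "x \<in> Kl" using ab Kl_rat by metis
qed

text \<open>Integers prime to l are units of \<open>Al\<close>, and l = - lam^2, so powers of lam
  clear every denominator.\<close>

lemma Al_denominator:
  assumes "x \<in> Kl"
  shows "\<exists>k. lam ^ k * x \<in> Al"
proof -
  have "\<exists>k. lam ^ k * x \<in> Al" if "N > 0" "of_nat N * x \<in> Al" for N :: nat and x
    using that
  proof (induction N arbitrary: x rule: less_induct)
    case (less N)
    show ?case
    proof (cases "l dvd N")
      case True
      then obtain N' where N': "N = l * N'" by blast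
      have "l > 1" using prime_l by (rule prime_gt_1_nat)
      then have "N' < N" "N' > 0" using less.prems(1) by (auto simp: N')
      moreover have "of_nat N' * (of_nat l * x) \<in> Al" using less.prems(2) by (simp add: N' mult_ac)
      ultimately obtain k where "lam ^ k * (of_nat l * x) \<in> Al" using less.IH by blast
      then have "- (lam ^ k * (of_nat l * x)) \<in> Al" by (rule Al_intros)
      moreover have "- (lam ^ k * (of_nat l * x)) = lam ^ k * (lam * lam) * x" unfolding lam_square by simp
      ultimately have "lam ^ Suc (Suc k) * x \<in> Al" by (simp add: mult_ac)
      then show ?thesis ..
    next
      case False
      then have "of_int 1 / of_int (int N) \<in> Al" by (intro subsetD[OF Zl_subset_Al] Zl_int_div) simp
      then have "of_int 1 / of_int (int N) * (of_nat N * x) \<in> Al" using less.prems(2) by (rule csubring_mult[OF Al_csubring])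
      then have "lam ^ 0 * x \<in> Al" using less.prems(1) by simp
      then show ?thesis ..
    qed
  qed
  moreover obtain a b :: int and N :: nat where N: "N > 0" "of_nat N * x = of_int a + of_int b * lam" by (rule KlE[OF assms])
  moreover have "of_nat N * x \<in> Al" unfolding N(2) by (intro Al_intros)
  ultimately show ?thesis by blast
qed

text \<open>The valuation ring property of \<open>Al\<close>: the inverse of an element of K outside
  it lies in lam \<open>Al\<close>. A common denominator N is reduced by descent as long as l
  divides everything.\<close>

lemma Al_valuation:
  assumes "x \<in> Kl" "x \<notin> Al"
  shows "\<exists>c\<in>Al. lam * c * x = 1"
proof -
  have AlI': "(of_int p + of_int q * lam) / of_int M \<in> Al" if "\<not> int l dvd M" for p q M
    using that by (intro AlI[OF Zl_int_div[of M p] Zl_int_div[of M q]]) (auto simp: add_divide_distrib)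
  have "x \<in> Al \<or> (\<exists>c\<in>Al. lam * c * x = 1)"
    if "N > 0" "of_nat N * x = of_int a + of_int b * lam" for N :: nat and a b :: int
    using that
  proof (induction N arbitrary: a b rule: less_induct)
    case (less N)
    have N0: "(of_nat N :: complex) \<noteq> 0" using less.prems(1) by simp
    show ?case
    proof (cases "l dvd N")
      case False
      have "x = (of_int a + of_int b * lam) / of_int (int N)" using less.prems(2) N0 by (simp add: field_simps)
      then show ?thesis using AlI'[of "int N" a b] False by simp
    next
      case True
      then obtain N' where N': "N = l * N'" by blast
      have l0: "(of_nat l :: complex) \<noteq> 0" using l_pos by simp
      consider "\<not> int l dvd a" | a' where "a = int l * a'" "\<not> int l dvd b" | a' b' where "a = int l * a'" "b = int l * b'"
        by (metis dvdE)
      then show ?thesis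
      proof cases
        \<comment> \<open>The norm M of the numerator is prime to l, so its conjugate gives an
          inverse in \<open>Al\<close>; l = - lam^2 from the denominator supplies the factor
          lam.\<close>
        case 1
        define M where "M = a ^ 2 + int l * b ^ 2"
        have M: "\<not> int l dvd M"
          unfolding M_def using 1 prime_int_l by (simp add: dvd_add_left_iff prime_dvd_power_iff)
        have M0: "(of_int M :: complex) \<noteq> 0" using M by auto
        define c where "c = - (of_nat N' * lam * (of_int a - of_int b * lam) / of_int M)"
        have "of_nat N' * lam * (of_int a - of_int b * lam) = of_int (int N' * int l * b) + of_int (int N' * a) * lam"
          using lam_square by (simp add: algebra_simps)
        then have "c \<in> Al" unfolding c_def by (simp only:) (intro Al_intros AlI' M)
        moreover have "lam * c * x = 1"
        proof -
          have "(of_int a + of_int b * lam) * (of_int a - of_int b * lam) = of_int M"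
            using lam_square by (simp add: M_def algebra_simps power2_eq_square)
          then have "(of_nat l * of_nat N' * x) * (of_int a - of_int b * lam) = of_int M"
            using less.prems(2) by (simp add: N')
          moreover have "lam * c * x = - (lam * lam) * of_nat N' * x * (of_int a - of_int b * lam) / of_int M"
            by (simp add: c_def)
          ultimately show ?thesis unfolding lam_square using M0 by (simp add: mult_ac)
        qed
        ultimately show ?thesis by blast
      next
        \<comment> \<open>Here a = - lam^2 a', so the numerator is lam times b - a' lam, whose norm
          M is prime to l.\<close>
        case 2
        define M where "M = b ^ 2 + int l * a' ^ 2"
        have M: "\<not> int l dvd M"
          unfolding M_def using 2 prime_int_l by (simp add: dvd_add_left_iff prime_dvd_power_iff)
        have M0: "(of_int M :: complex) \<noteq> 0" using M by auto
        define z where "z = of_int b - of_int a' * lam"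
        define c where "c = - (of_nat N' * (of_int b + of_int a' * lam) / of_int M)"
        have "of_nat N' * (of_int b + of_int a' * lam) = of_int (int N' * b) + of_int (int N' * a') * lam"
          by (simp add: algebra_simps)
        then have "c \<in> Al" unfolding c_def by (simp only:) (intro Al_intros AlI' M)
        moreover have "lam * c * x = 1"
        proof -
          have "of_nat l * (of_nat N' * x) = lam * z"
            using less.prems(2) lam_square by (simp add: N' 2(1) z_def algebra_simps)
          then have "lam * (of_nat l * (of_nat N' * x)) = lam * lam * z" by simp
          then have "of_nat l * (lam * of_nat N' * x) = of_nat l * (- z)" unfolding lam_square by (simp add: mult_ac)
          then have lz: "lam * of_nat N' * x = - z" using l0 by (metis mult_left_cancel)
          have "lam * c * x = - (lam * of_nat N' * x) * (of_int b + of_int a' * lam) / of_int M" by (simp add: c_def)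
          also have "\<dots> = z * (of_int b + of_int a' * lam) / of_int M" unfolding lz by simp
          also have "z * (of_int b + of_int a' * lam) = of_int M"
            using lam_square by (simp add: z_def M_def algebra_simps power2_eq_square)
          finally show ?thesis using M0 by simp
        qed
        ultimately show ?thesis by blast
      next
        case 3
        have "l > 1" using prime_l by (rule prime_gt_1_nat)
        then have "N' < N" "N' > 0" using less.prems(1) by (auto simp: N')
        moreover have "of_nat l * (of_nat N' * x) = of_nat l * (of_int a' + of_int b' * lam)"
          using less.prems(2) by (simp add: N' 3 algebra_simps)
        then have "of_nat N' * x = of_int a' + of_int b' * lam" using l0 by (metis mult_left_cancel)
        ultimately show ?thesis using less.IH by blast
      qed
    qed
  qed
  then show ?thesis using KlE[OF assms(1)] assms(2) by metis
qed

lemma Al_integral_over_Zl: "x \<in> Al \<Longrightarrow> integral_over Zl x"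
proof -
  note C = integral_over_csubring[OF Zl_subring]
  have lam: "integral_over Zl lam" by (rule integral_over_sqrt[OF Zl_subring]) (auto simp: lam_square intro: Zl_intros)
  assume "x \<in> Al"
  then obtain a b where "a \<in> Zl" "b \<in> Zl" "x = a + b * lam" unfolding Al_def by blast
  then have "x \<in> {x. integral_over Zl x}"
    using lam integral_overI[OF Zl_subring] by (auto intro!: csubring_add[OF C, simplified] csubring_mult[OF C, simplified])
  then show ?thesis by simp
qed

lemma integral_over_Al_imp_alg_int:
  assumes "integral_over Al z"
  obtains N :: int where "\<not> int l dvd N" "alg_int (of_int N * z)"
proof -
  have "integral_over Zl z"
    by (rule integral_over_quadratic[OF Zl_subring, of lam])
       (use assms in \<open>auto simp: lam_square Al_def intro: Zl_intros\<close>)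
  then show thesis using integral_over_Zl_imp_alg_int that by blast
qed

text \<open>Squaring lam c = 1 gives c^2 = - 1/l. A multiple of c^2 by some N prime to l would be a
  rational algebraic integer, forcing l to divide N.\<close>

lemma lam_not_unit:
  assumes c: "c \<in> Al"
  shows "lam * c \<noteq> 1"
proof
  assume 1: "lam * c = 1"
  have l0: "(of_nat l :: complex) \<noteq> 0" using l_pos by simp
  have "(lam * c) * (lam * c) = - of_nat l * (c * c)" using lam_square by (simp add: mult_ac)
  then have cc: "c * c = - 1 / of_nat l" unfolding 1 using l0 by (simp add: field_simps eq_neg_iff_add_eq_0)
  have "integral_over Zl (c * c)" by (intro Al_integral_over_Zl Al_intros c)
  then obtain N where N: "\<not> int l dvd N" "alg_int (of_int N * (c * c))" by (rule integral_over_Zl_imp_alg_int)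
  have "of_int N * (c * c) \<in> \<int>"
    by (rule alg_int_rational_imp_int[OF N(2)]) (simp add: cc)
  then obtain z where "of_int N * (c * c) = of_int z" by (auto elim: Ints_cases)
  then have "of_int N = (of_int (int l * - z) :: complex)" unfolding cc using l0 by (simp add: field_simps) (metis minus_minus)
  then have "N = int l * - z" by (simp only: of_int_eq_iff)
  then show False using N(1) by simp
qed

text \<open>If 1/x = lam c with c in \<open>Al\<close>, multiplying the integral equation of x by
  (lam c)^n puts 1 into lam \<open>Al\<close>.\<close>

lemma Al_integrally_closed:
  assumes x: "x \<in> Kl" "integral_over Al x"
  shows "x \<in> Al"
proof (rule ccontr)
  assume "x \<notin> Al"
  then obtain c where c: "c \<in> Al" "lam * c * x = 1" using Al_valuation x by blast
  obtain n where n: "x ^ n \<in> jspan Al {..<n} (\<lambda>k. x ^ k)" using integral_over_power[OF Al_csubring x(2)] by blast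
  then obtain a where a: "\<And>k. k \<in> {..<n} \<Longrightarrow> a k \<in> Al" "x ^ n = (\<Sum>k<n. a k * x ^ k)" unfolding jspan_def by auto
  define t where "t = lam * c"
  have tx: "t ^ k * x ^ k = 1" for k using c(2) by (simp add: t_def power_mult_distrib [symmetric])
  have "1 = t ^ n * (\<Sum>k<n. a k * x ^ k)" using tx[of n] a(2) by simp
  also have "\<dots> = (\<Sum>k<n. lam * (c * t ^ (n - Suc k) * a k))"
    unfolding sum_distrib_left
  proof (rule sum.cong[OF refl])
    fix k assume "k \<in> {..<n}"
    then have "t ^ n = t * t ^ (n - Suc k) * t ^ k" by (simp flip: power_add power_Suc)
    then have "t ^ n * (a k * x ^ k) = t * t ^ (n - Suc k) * a k * (t ^ k * x ^ k)" by simp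
    then show "t ^ n * (a k * x ^ k) = lam * (c * t ^ (n - Suc k) * a k)" unfolding tx by (simp add: t_def)
  qed
  finally have "lam * (\<Sum>k<n. c * t ^ (n - Suc k) * a k) = 1" by (simp add: sum_distrib_left)
  moreover have "(\<Sum>k<n. c * t ^ (n - Suc k) * a k) \<in> Al"
    unfolding t_def using a(1) c(1) by (intro Al_intros) auto
  ultimately show False using lam_not_unit by blast
qed

lemma alg_int_imp_integral_over_Al: "alg_int x \<Longrightarrow> integral_over Al x"
  unfolding alg_int_iff_integral_over by (erule integral_over_mono[rotated]) (auto elim!: Ints_cases intro: Al_intros)

section \<open>Comparison with the ring of integers of K\<close>

abbreviation "Rl \<equiv> ring_of_integers Kl"
abbreviation "Pl \<equiv> principal_ideal Rl lam"

lemma Rl_subset_Al: "Rl \<subseteq> Al"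
  using Al_integrally_closed alg_int_imp_integral_over_Al by (auto simp: ring_of_integers_def)

text \<open>A nonunit would be s = lam c with c in \<open>Al\<close>. Then l c = - lam s and some N
  c with N prime to l are algebraic integers, hence so is c, and s would lie in the ideal generated
  by lam.\<close>

lemma Rl_unit:
  assumes s: "s \<in> Rl - Pl"
  shows "\<exists>c\<in>Al. s * c = 1"
proof (cases "inverse s \<in> Al")
  case True
  have "0 \<in> Rl" using csubring_0[OF Kl_csubring] csubring_0[OF alg_int_csubring] by (simp add: ring_of_integers_def)
  then have "s \<noteq> 0" using s by (auto simp: principal_ideal_def)
  then show ?thesis using True by (intro bexI[of _ "inverse s"]) auto
next
  case False
  have sK: "s \<in> Kl" "alg_int s" using s by (auto simp: ring_of_integers_def)
  obtain c where c: "c \<in> Al" "lam * c * inverse s = 1" using Al_valuation[OF Kl_inverse[OF sK(1)] False] by blast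
  then have "s \<noteq> 0" by auto
  then have sc: "s = lam * c" using c(2) by (simp add: field_simps)
  obtain N where N: "\<not> int l dvd N" "alg_int (of_int N * c)"
    by (rule integral_over_Al_imp_alg_int[OF integral_overI[OF Al_csubring c(1)]])
  have "coprime (int l) N" using prime_int_l N(1) by (rule prime_imp_coprime)
  then obtain a b where ab: "a * int l + b * N = 1" by (metis bezout_int coprime_iff_gcd_eq_1)
  note C = csubring_intros[OF alg_int_csubring, simplified]
  have "alg_int lam"
    unfolding alg_int_iff_integral_over by (rule integral_over_sqrt[OF csubring_Ints]) (simp add: lam_square)
  then have "alg_int (- (lam * s))" using sK(2) by (intro C)
  moreover have "- (lam * s) = - (lam * lam) * c" by (simp add: sc)
  ultimately have "alg_int (of_nat l * c)" unfolding lam_square by simp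
  then have "alg_int (of_int a * (of_nat l * c))" by (rule C(5)[OF C(11)])
  moreover have "alg_int (of_int b * (of_int N * c))" using N(2) by (rule C(5)[OF C(11)])
  ultimately have "alg_int (of_int a * (of_nat l * c) + of_int b * (of_int N * c))" by (rule C(3))
  moreover have "of_int a * (of_nat l * c) + of_int b * (of_int N * c) = of_int (a * int l + b * N) * c"
    by (simp add: algebra_simps)
  ultimately have "alg_int c" unfolding ab by simp
  then have "c \<in> Rl" using c(1) Al_subset_Kl by (auto simp: ring_of_integers_def)
  then show ?thesis using s sc by (auto simp: principal_ideal_def)
qed

lemma of_int_in_Rl_not_Pl:
  assumes "\<not> int l dvd N"
  shows "of_int N \<in> Rl - Pl"
proof -
  have "of_int N \<in> Rl"
    using csubring_of_int[OF Kl_csubring] csubring_of_int[OF alg_int_csubring] by (auto simp: ring_of_integers_def)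
  moreover have "of_int N \<notin> Pl"
  proof
    assume "of_int N \<in> Pl"
    then obtain r where r: "r \<in> Al" "of_int N = lam * r" using Rl_subset_Al by (auto simp: principal_ideal_def)
    have N0: "(of_int N :: complex) \<noteq> 0" using assms by auto
    have "of_int 1 / of_int N \<in> Al" by (intro subsetD[OF Zl_subset_Al] Zl_int_div assms)
    then have "of_int 1 / of_int N * r \<in> Al" using r(1) by (rule Al_intros)
    moreover have "lam * (of_int 1 / of_int N * r) = 1" using r(2) N0 by (simp add: field_simps)
    ultimately show False using lam_not_unit by blast
  qed
  ultimately show ?thesis by blast
qed

text \<open>Identifies the fractions with denominator outside (lam) with the explicit ring
  \<open>Al\<close>: such denominators are units of \<open>Al\<close>, and conversely a denominator
  in \<int> prime to l suffices.\<close>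

lemma loc_integral_iff: "loc_integral Rl Pl x \<longleftrightarrow> x \<in> Al"
proof
  assume "loc_integral Rl Pl x"
  then obtain a b where ab: "a \<in> Rl" "b \<in> Rl - Pl" "x = a / b" by (auto simp: loc_integral_def)
  obtain c where c: "c \<in> Al" "b * c = 1" using Rl_unit[OF ab(2)] by blast
  then have "x = a * c" unfolding ab(3) by (metis divide_inverse inverse_unique)
  then show "x \<in> Al" using ab(1) c(1) Rl_subset_Al by (auto intro: Al_intros)
next
  assume x: "x \<in> Al"
  obtain N where N: "\<not> int l dvd N" "alg_int (of_int N * x)"
    by (rule integral_over_Al_imp_alg_int[OF integral_overI[OF Al_csubring x]])
  have "of_int N * x \<in> Kl" by (intro subsetD[OF Al_subset_Kl] Al_intros x)
  then have "of_int N * x \<in> Rl" using N(2) by (simp add: ring_of_integers_def)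
  moreover have "x = (of_int N * x) / of_int N" using N(1) by auto
  ultimately show "loc_integral Rl Pl x"
    using of_int_in_Rl_not_Pl[OF N(1)] unfolding loc_integral_def by blast
qed

text \<open>The residue field of \<open>Al\<close> at lam has l elements: b lam dies modulo lam and
  Fermat applies to a.\<close>

lemma Al_fermat:
  assumes "x \<in> Al"
  shows "\<exists>c\<in>Al. x ^ l = x + lam * c"
proof -
  obtain a b where ab: "a \<in> Zl" "b \<in> Zl" "x = a + b * lam" using assms unfolding Al_def by blast
  have abA: "a \<in> Al" "b \<in> Al" using ab Zl_subset_Al by auto
  obtain c where c: "c \<in> Al" "x ^ l = a ^ l + (b * lam) ^ l + of_nat l * c"
    unfolding ab(3) using csubring_freshman[OF Al_csubring prime_l abA(1) csubring_mult[OF Al_csubring abA(2) lam_in_Al]] by blast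
  obtain d where d: "d \<in> Zl" "a ^ l = a + of_nat l * d" using Zl_fermat[OF ab(1)] by blast
  have ll: "of_nat l = lam * (- lam)" using lam_square by simp
  obtain k where k: "l = Suc k" using l_pos by (metis gr0_implies_Suc)
  have "(b * lam) ^ l = lam * (b * (b * lam) ^ k)" unfolding k by simp
  then have "x ^ l = x + lam * (- lam * d - lam * c + b * (b * lam) ^ k - b)"
    unfolding c(2) d(2) ll by (simp add: ab(3) algebra_simps)
  moreover have "- lam * d - lam * c + b * (b * lam) ^ k - b \<in> Al"
    using c d abA Zl_subset_Al by (intro Al_intros) auto
  ultimately show ?thesis by blast
qed

end

section \<open>The minimal polynomial\<close>

lemma polys_pcompose:
  assumes J: "csubring J" and q: "q \<in> polys J" and p: "p \<in> polys J"
  shows "pcompose p q \<in> polys J"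
  using p
proof (induction p)
  case (pCons a p)
  have "Polynomial.coeff (pCons a p) k \<in> J" for k using pCons.prems by (rule polysD)
  from this[of 0] this[of "Suc _"] have "a \<in> J" "p \<in> polys J" by (simp_all add: polys_def)
  then show ?case unfolding pcompose_pCons
    by (intro csubring_add[OF polys_csubring[OF J]] csubring_mult[OF polys_csubring[OF J]] q pCons.IH polys_pCons[OF J]
        csubring_0[OF polys_csubring[OF J]])
qed (simp add: csubring_0[OF polys_csubring[OF J]])

lemma integral_over_unit_lead:
  assumes J: "csubring J" and f: "f \<in> polys J" "degree f \<le> N" "poly f x = 0"
    and u: "u \<in> J" "u * Polynomial.coeff f N = 1"
  shows "integral_over J x"
proof -
  define p where "p = Polynomial.smult u f"
  have c: "Polynomial.coeff p N = 1" using u(2) by (simp add: p_def)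
  have "N \<le> degree p" by (rule le_degree) (simp add: c)
  moreover have "degree p \<le> N" using f(2) degree_smult_le[of u f] by (simp add: p_def)
  ultimately have "lead_coeff p = 1" using c by (metis antisym)
  moreover have "p \<in> polys J" unfolding p_def by (rule polys_smult[OF J u(1) f(1)])
  moreover have "poly p x = 0" using f(3) by (simp add: p_def)
  ultimately show ?thesis unfolding integral_over_def polys_def by blast
qed

lemma integral_over_root:
  assumes J: "csubring J" and x: "integral_over J (x ^ k)" and k: "k > 0"
  shows "integral_over J x"
proof -
  obtain p where p: "lead_coeff p = 1" "p \<in> polys J" "poly p (x ^ k) = 0"
    using x unfolding integral_over_def polys_def by blast
  define X where "X = (Polynomial.monom 1 k :: complex poly)"
  have X: "degree X > 0" "lead_coeff X = 1" using k by (simp_all add: X_def degree_monom_eq)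
  have "lead_coeff (pcompose p X) = 1" unfolding lead_coeff_comp[OF X(1)] p(1) X(2) by simp
  moreover have "pcompose p X \<in> polys J"
    unfolding X_def by (intro polys_pcompose J p polys_monom csubring_1)
  moreover have "poly (pcompose p X) x = 0" using p(3) by (simp add: poly_pcompose X_def poly_monom)
  ultimately show ?thesis unfolding integral_over_def polys_def by blast
qed

lemma csubring_frobenius:
  assumes J: "csubring J" and p: "prime p" and x: "x \<in> J" and y: "y \<in> J"
  shows "\<exists>c\<in>J. (x + y) ^ (p ^ k) = x ^ (p ^ k) + y ^ (p ^ k) + of_nat p * c"
proof (induction k)
  case 0
  then show ?case using csubring_0[OF J] by (intro bexI[of _ 0]) auto
next
  case (Suc k)
  then obtain c where c: "c \<in> J" "(x + y) ^ (p ^ k) = x ^ (p ^ k) + y ^ (p ^ k) + of_nat p * c" by blast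
  define u v where "u = x ^ (p ^ k)" and "v = y ^ (p ^ k)"
  have uv: "u \<in> J" "v \<in> J" unfolding u_def v_def using x y by (auto intro: csubring_power[OF J])
  have pc: "of_nat p * c \<in> J" by (intro csubring_mult[OF J] csubring_of_nat[OF J] c)
  obtain d where d: "d \<in> J" "(u + v + of_nat p * c) ^ p = (u + v) ^ p + (of_nat p * c) ^ p + of_nat p * d"
    using csubring_freshman[OF J p csubring_add[OF J uv] pc] by blast
  obtain e where e: "e \<in> J" "(u + v) ^ p = u ^ p + v ^ p + of_nat p * e"
    using csubring_freshman[OF J p uv] by blast
  obtain p' where p': "p = Suc p'" using p by (metis not0_implies_Suc not_prime_0)
  have "(x + y) ^ (p ^ Suc k) = ((x + y) ^ (p ^ k)) ^ p" by (simp add: power_mult [symmetric] mult.commute)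
  also have "\<dots> = u ^ p + v ^ p + of_nat p * (e + c * (of_nat p * c) ^ p' + d)"
  proof -
    have "(of_nat p * c) ^ p = of_nat p * (c * (of_nat p * c) ^ p')" by (simp add: p')
    then show ?thesis unfolding c(2) u_def [symmetric] v_def [symmetric] d(2) e(2) by (simp only: distrib_left add_ac)
  qed
  also have "u ^ p = x ^ (p ^ Suc k)"
    by (simp add: u_def power_mult [symmetric] mult.commute)
  also have "v ^ p = y ^ (p ^ Suc k)"
    by (simp add: v_def power_mult [symmetric] mult.commute)
  finally show ?case
    using c(1) d(1) e(1) pc by (intro bexI[of _ "e + c * (of_nat p * c) ^ p' + d"])
      (auto intro!: csubring_add[OF J] csubring_mult[OF J] csubring_power[OF J] csubring_of_nat[OF J])
qed

lemma poly_eq_sum_lessThan: "degree r < n \<Longrightarrow> poly r x = (\<Sum>i<n. Polynomial.coeff r i * x ^ i)"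
  for r :: "complex poly"
  unfolding poly_altdef by (rule sum.mono_neutral_left) (auto simp: coeff_eq_0)

lemma min_polyD:
  assumes "is_min_poly K x m"
  shows "m \<in> polys K" "lead_coeff m = 1" "poly m x = 0" "degree m > 0"
    and "q \<in> polys K \<Longrightarrow> poly q x = 0 \<Longrightarrow> degree q < degree m \<Longrightarrow> q = 0"
proof -
  show m: "m \<in> polys K" "lead_coeff m = 1" "poly m x = 0" using assms by (auto simp: is_min_poly_def polys_def)
  show "degree m > 0"
  proof (rule ccontr)
    assume "\<not> degree m > 0"
    then obtain a where "m = [:a:]" using degree_0_id[of m] by (metis gr0I)
    then show False using m by auto
  qed
  show "q = 0" if q: "q \<in> polys K" "poly q x = 0" "degree q < degree m"
  proof (rule ccontr)
    assume "q \<noteq> 0"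
    then have "degree m \<le> degree q" using assms q(1,2) unfolding is_min_poly_def by (simp add: polys_def)
    then show False using q(3) by simp
  qed
qed

section \<open>Minimal polynomials and simple extensions\<close>

context
  fixes K :: "complex set"
  assumes K: "csubring K" and Kinv: "\<forall>x\<in>K. inverse x \<in> K"
begin

lemma min_poly_exists:
  assumes x: "integral_over K x"
  obtains m where "is_min_poly K x m"
proof -
  define S where "S = (\<lambda>n. \<exists>q\<in>polys K. q \<noteq> 0 \<and> poly q x = 0 \<and> degree q = n)"
  obtain F where F: "lead_coeff F = 1" "F \<in> polys K" "poly F x = 0"
    using x unfolding integral_over_def polys_def by blast
  then have "F \<noteq> 0" by auto
  then have SF: "S (degree F)" using F unfolding S_def by blast
  define n where "n = (LEAST n. S n)"
  have "S n" unfolding n_def using SF by (rule LeastI)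
  then obtain q where q: "q \<in> polys K" "q \<noteq> 0" "poly q x = 0" "degree q = n" unfolding S_def by blast
  have le: "n \<le> degree q'" if "q' \<noteq> 0 \<and> (\<forall>i. Polynomial.coeff q' i \<in> K) \<and> poly q' x = 0" for q'
    unfolding n_def by (rule Least_le) (use that in \<open>auto simp: S_def polys_def\<close>)
  define m where "m = Polynomial.smult (inverse (lead_coeff q)) q"
  have "lead_coeff q \<noteq> 0" using q(2) by simp
  then have "lead_coeff m = 1" "degree m = n" "poly m x = 0" using q by (simp_all add: m_def)
  moreover have "m \<in> polys K"
    unfolding m_def by (intro polys_smult[OF K] bspec[OF Kinv] q(1) polysD[OF q(1)])
  ultimately have "is_min_poly K x m" unfolding is_min_poly_def using le by (simp add: polys_def)
  then show thesis by (rule that)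
qed

text \<open>Powers of X are split off the relation until its constant coefficient is nonzero;
  solving for that coefficient exhibits the inverse.\<close>

lemma inverse_in_adjoin:
  assumes "p \<in> polys K" "p \<noteq> 0" "poly p x = 0" "x \<noteq> 0"
  shows "\<exists>q\<in>polys K. inverse x = poly q x"
  using assms(1-3)
proof (induction p)
  case (pCons a p)
  have "Polynomial.coeff (pCons a p) k \<in> K" for k using pCons.prems(1) by (rule polysD)
  from this[of 0] this[of "Suc _"] have aK: "a \<in> K" "p \<in> polys K" by (simp_all add: polys_def)
  show ?case
  proof (cases "a = 0")
    case True
    then show ?thesis using pCons aK assms(4) by auto
  next
    case False
    have "x * (- poly p x / a) = 1" using pCons.prems(3) False by (simp add: field_simps add_eq_0_iff)
    then have "inverse x = - poly p x / a" by (rule inverse_unique)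
    also have "\<dots> = poly (Polynomial.smult (- inverse a) p) x" by (simp add: field_simps)
    finally show ?thesis
      by (intro bexI[of _ "Polynomial.smult (- inverse a) p"] polys_smult[OF K] csubring_uminus[OF K] bspec[OF Kinv] aK)
  qed
qed simp

text \<open>K[x] is already a field, since each of its elements is integral over K and
  \<open>inverse_in_adjoin\<close> applies.\<close>

lemma field_adjoin_subset:
  assumes x: "integral_over K x"
  shows "field_adjoin K x \<subseteq> {poly p x | p. p \<in> polys K}"
proof -
  define F where "F = {poly p x | p. p \<in> polys K}"
  note P = csubring_intros[OF polys_csubring[OF K]]
  have FI: "poly p x \<in> F" if "p \<in> polys K" for p using that unfolding F_def by blast
  have "a - b \<in> F \<and> a * b \<in> F" if ab: "a \<in> F" "b \<in> F" for a b
  proof -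
    obtain p q where pq: "p \<in> polys K" "q \<in> polys K" "a = poly p x" "b = poly q x" using ab unfolding F_def by blast
    have "p - q \<in> polys K" "p * q \<in> polys K" using pq by (auto intro: P)
    from this[THEN FI] show ?thesis by (simp add: pq)
  qed
  moreover have KF: "K \<subseteq> F"
  proof
    fix c assume "c \<in> K"
    then have "[:c:] \<in> polys K" by (intro polys_pCons[OF K] P)
    from FI[OF this] show "c \<in> F" by simp
  qed
  ultimately have FC: "csubring F" using csubring_1[OF K] by (auto simp: csubring_def)
  have "[:0, 1:] \<in> polys K" by (intro polys_pCons[OF K] P csubring_0[OF K] csubring_1[OF K])
  from FI[OF this] have xF: "x \<in> F" by simp
  have inv: "inverse a \<in> F" if a: "a \<in> F" "a \<noteq> 0" for a
  proof -
    note I = integral_over_csubring[OF K]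
    have "F \<subseteq> {z. integral_over K z}"
    proof
      fix z assume "z \<in> F"
      then obtain p where p: "p \<in> polys K" "z = poly p x" unfolding F_def by blast
      have "poly p x \<in> {z. integral_over K z}"
        by (rule poly_in_csubring[OF I polys_mono[OF _ p(1)]]) (use x integral_overI[OF K] in auto)
      then show "z \<in> {z. integral_over K z}" by (simp add: p)
    qed
    then have "integral_over K a" using a by blast
    then obtain p where p: "lead_coeff p = 1" "p \<in> polys K" "poly p a = 0"
      unfolding integral_over_def polys_def by blast
    then have "p \<noteq> 0" by auto
    then obtain q where "q \<in> polys K" "inverse a = poly q a" using inverse_in_adjoin p a(2) by blast
    then show ?thesis using poly_in_csubring[OF FC polys_mono[OF KF] a(1)] by metis
  qed
  have "is_subfield F"
    unfolding is_subfield_def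
    by (intro conjI ballI impI csubring_0[OF FC] csubring_1[OF FC] csubring_add[OF FC] csubring_uminus[OF FC]
        csubring_mult[OF FC] inv)
  then show ?thesis unfolding field_adjoin_def F_def [symmetric] using KF xF by blast
qed

end

context lprime4
begin

text \<open>The roots of m are among those of F and hence integral over \<open>Al\<close>. So are
  the coefficients of m, which lie in K, and \<open>Al\<close> is integrally closed.\<close>

lemma min_poly_in_Al:
  assumes m: "is_min_poly Kl \<eta> m" and F: "F \<in> polys Kl" "poly F \<eta> = 0"
    and roots: "\<And>r. poly F r = 0 \<Longrightarrow> integral_over Al r"
  shows "m \<in> polys Al"
proof -
  note mD = min_polyD[OF m]
  note KP = csubring_intros[OF polys_csubring[OF Kl_csubring]]
  obtain q r where qr: "q \<in> polys Kl" "r \<in> polys Kl" "F = q * m + r" "degree r < degree m"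
    by (rule polys_monic_division[OF Kl_csubring mD(1,2,4) F(1)])
  have "r = 0" by (rule mD(5)[OF qr(2) _ qr(4)]) (use F(2) mD(3) qr(3) in simp)
  then have mr: "integral_over Al z" if "poly m z = 0" for z using that roots[of z] qr(3) by simp
  note I = integral_over_csubring[OF Al_csubring]
  have "(\<Prod>z | poly m z = 0. [:- z, 1:] ^ Polynomial.order z m) \<in> polys {z. integral_over Al z}"
    by (intro csubring_prod[OF polys_csubring[OF I]] csubring_power[OF polys_csubring[OF I]] polys_pCons[OF I]
        csubring_uminus[OF I] csubring_1[OF I] csubring_0[OF polys_csubring[OF I]]) (use mr in auto)
  moreover have "(\<Prod>z | poly m z = 0. [:- z, 1:] ^ Polynomial.order z m) = m"
    using complex_poly_decompose[of m] mD(2) by simp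
  ultimately have "integral_over Al (Polynomial.coeff m k)" for k by (metis mem_Collect_eq polysD)
  then show ?thesis using Al_integrally_closed polysD[OF mD(1)] by (simp add: polys_def)
qed

text \<open>The purely algebraic part: everything follows from the two relations for \<eta>^5 and
  the degree bound on p3.\<close>

lemma unramified_at_lam:
  assumes p: "p \<in> polys Al" "Polynomial.coeff p 0 = 0" and p2: "p2 \<in> polys Al" "Polynomial.coeff p2 0 = 0"
    and p3: "p3 \<in> polys Zl" "degree p3 \<le> 2 * l" and e: "e = 1 \<or> e = - 1" and \<eta>0: "\<eta> \<noteq> 0"
    and rel: "(\<eta> ^ 5) ^ l - \<eta> ^ 5 + of_nat l * poly p (\<eta> ^ 5) = - e * lam * poly p2 (\<eta> ^ 5)"
      "((\<eta> ^ 5) ^ l - \<eta> ^ 5) ^ 2 = of_nat l * poly p3 (\<eta> ^ 5)"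
  shows "\<exists>m. is_min_poly Kl \<eta> m \<and> poly_disc m \<notin> Pl \<and>
           (\<forall>\<alpha> \<in> field_adjoin Kl \<eta>.
              (\<exists>s \<in> Rl - Pl. alg_int (s * \<alpha>)) \<longleftrightarrow>
              (\<exists>c. (\<forall>i < degree m. loc_integral Rl Pl (c i)) \<and> \<alpha> = (\<Sum>i < degree m. c i * \<eta> ^ i)))"
proof -
  note AP = csubring_intros[OF polys_csubring[OF Al_csubring]]
  define \<beta> where "\<beta> = \<eta> ^ 5"
  have l4: "l \<ge> 4" using l_mod mod_less_eq_dividend[of l 5] by simp
  have ll: "of_nat l = lam * (- lam)" using lam_square by simp
  \<comment> \<open>This is (X^l - X)^2 - l p3, the relation satisfied by \<beta>.\<close>
  define f where "f = Polynomial.monom 1 (2 * l) - Polynomial.monom 2 (l + 1) + Polynomial.monom 1 2 -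
      Polynomial.smult (of_nat l) p3"
  have fe: "poly f b = (b ^ l - b) ^ 2 - of_nat l * poly p3 b" for b
  proof -
    have "b ^ (2 * l) = (b ^ l) ^ 2" "b ^ (l + 1) = b ^ l * b" by (simp_all add: power_mult [symmetric] mult.commute)
    moreover have "poly f b = b ^ (2 * l) - 2 * b ^ (l + 1) + b ^ 2 - of_nat l * poly p3 b" by (simp add: f_def poly_monom)
    ultimately show ?thesis unfolding power2_diff by simp
  qed
  have fA: "f \<in> polys Al"
    unfolding f_def using polys_mono[OF Zl_subset_Al p3(1)]
    by (intro AP polys_monom[OF Al_csubring] polys_smult[OF Al_csubring] Al_intros csubring_of_nat[OF Al_csubring, of 2, simplified])
  have fd: "degree f \<le> 2 * l"
    by (rule degree_le) (use l4 p3(2) in \<open>auto simp: f_def coeff_eq_0\<close>)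
  \<comment> \<open>Since deg p3 is at most 2 l, the coefficient of X^(2l) in f is 1 - l c, a unit
    of \<open>Al\<close> with inverse u; f is thus monic up to a unit.\<close>
  define c where "c = Polynomial.coeff p3 (2 * l)"
  have f2l: "Polynomial.coeff f (2 * l) = 1 - of_nat l * c" using l4 by (simp add: f_def c_def)
  have "c \<in> Zl" unfolding c_def by (rule polysD[OF p3(1)])
  then obtain bb aa :: int where ba: "\<not> int l dvd bb" "c = of_int aa / of_int bb" by (rule ZlE)
  have nd: "\<not> int l dvd bb - int l * aa" using ba(1) by (simp add: dvd_diff_left_iff dvd_diff_right_iff)
  define u where "u = (of_int bb / of_int (bb - int l * aa) :: complex)"
  have uA: "u \<in> Al" unfolding u_def by (intro subsetD[OF Zl_subset_Al] Zl_int_div nd)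
  have u1: "u * Polynomial.coeff f (2 * l) = 1"
  proof -
    have "(of_int bb :: complex) \<noteq> 0" using ba(1) by auto
    moreover have "(of_int (bb - int l * aa) :: complex) \<noteq> 0" using nd by (metis dvd_0_right of_int_eq_0_iff)
    ultimately show ?thesis unfolding f2l u_def ba(2) by (simp add: field_simps)
  qed
  define F where "F = pcompose f (Polynomial.monom 1 5)"
  have Fe: "poly F r = poly f (r ^ 5)" for r by (simp add: F_def poly_pcompose poly_monom)
  have roots: "integral_over Al r" if "poly F r = 0" for r
    by (rule integral_over_root[OF Al_csubring integral_over_unit_lead[OF Al_csubring fA fd _ uA u1]])
       (use that in \<open>auto simp: Fe\<close>)
  have FA: "F \<in> polys Al" unfolding F_def by (intro polys_pcompose Al_csubring fA polys_monom Al_intros)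
  have F\<eta>: "poly F \<eta> = 0" using rel(2) by (simp add: Fe fe)
  have \<eta>A: "integral_over Al \<eta>" by (rule roots[OF F\<eta>])
  have Kl_inv: "\<forall>x\<in>Kl. inverse x \<in> Kl" using Kl_inverse by blast
  have \<eta>K: "integral_over Kl \<eta>" by (rule integral_over_mono[OF Al_subset_Kl \<eta>A])
  obtain m where m: "is_min_poly Kl \<eta> m" by (rule min_poly_exists[OF Kl_csubring Kl_inv \<eta>K])
  note mD = min_polyD[OF m]
  have mA: "m \<in> polys Al" by (rule min_poly_in_Al[OF m polys_mono[OF Al_subset_Kl FA] F\<eta> roots])
  define n where "n = degree m"

  \<comment> \<open>\<open>B\<close> is the ring generated by \<eta> over \<open>Al\<close>.\<close>
  define B where "B = {poly q \<eta> | q. q \<in> polys Al}"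
  have BI: "poly q \<eta> \<in> B" if "q \<in> polys Al" for q using that unfolding B_def by blast
  have AB: "Al \<subseteq> B"
  proof
    fix a assume "a \<in> Al"
    then have "[:a:] \<in> polys Al" by (intro polys_pCons[OF Al_csubring] AP)
    from BI[OF this] show "a \<in> B" by simp
  qed
  have BC: "csubring B"
  proof -
    have "a - b \<in> B \<and> a * b \<in> B" if ab: "a \<in> B" "b \<in> B" for a b
    proof -
      obtain q q' where q: "q \<in> polys Al" "q' \<in> polys Al" "a = poly q \<eta>" "b = poly q' \<eta>" using ab unfolding B_def by blast
      have "q - q' \<in> polys Al" "q * q' \<in> polys Al" using q by (auto intro: AP)
      from this[THEN BI] show ?thesis by (simp add: q)
    qed
    then show ?thesis using AB Al_intros(1) by (auto simp: csubring_def)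
  qed
  note B = csubring_intros[OF BC]
  have "[:0, 1:] \<in> polys Al" by (intro polys_pCons[OF Al_csubring] AP Al_intros)
  from BI[OF this] have \<eta>B: "\<eta> \<in> B" by simp
  have \<beta>B: "\<beta> \<in> B" unfolding \<beta>_def by (intro B \<eta>B)
  have lamB: "lam \<in> B" using AB lam_in_Al by blast

  \<comment> \<open>The elements of \<open>B\<close> fixed by the l^2-power map modulo lam
    \<open>B\<close>. They form a ring, so it suffices to find \<open>Al\<close> and \<eta> in
    it.\<close>
  define T where "T = {x \<in> B. \<exists>y\<in>B. x ^ (l ^ 2) = x + lam * y}"
  have TC: "csubring T"
  proof -
    have add: "x + y \<in> T" if xy: "x \<in> T" "y \<in> T" for x y
    proof -
      obtain a b where ab: "x \<in> B" "y \<in> B" "a \<in> B" "b \<in> B" "x ^ (l ^ 2) = x + lam * a" "y ^ (l ^ 2) = y + lam * b"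
        using xy unfolding T_def by blast
      obtain c where c: "c \<in> B" "(x + y) ^ (l ^ 2) = x ^ (l ^ 2) + y ^ (l ^ 2) + of_nat l * c"
        using csubring_frobenius[OF BC prime_l ab(1,2)] by blast
      have "(x + y) ^ (l ^ 2) = x + y + lam * (a + b - lam * c)" unfolding c(2) ab(5,6) ll by (simp add: algebra_simps)
      moreover have "a + b - lam * c \<in> B" by (intro B ab lamB c)
      ultimately show ?thesis unfolding T_def using ab by (auto intro: B)
    qed
    have mult: "x * y \<in> T" if xy: "x \<in> T" "y \<in> T" for x y
    proof -
      obtain a b where ab: "x \<in> B" "y \<in> B" "a \<in> B" "b \<in> B" "x ^ (l ^ 2) = x + lam * a" "y ^ (l ^ 2) = y + lam * b"
        using xy unfolding T_def by blast
      have "(x * y) ^ (l ^ 2) = x * y + lam * (x * b + a * y + lam * a * b)"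
        unfolding power_mult_distrib ab(5,6) by (simp add: algebra_simps)
      moreover have "x * b + a * y + lam * a * b \<in> B" by (intro B ab lamB)
      ultimately show ?thesis unfolding T_def using ab by (auto intro: B)
    qed
    have "(- 1 :: complex) ^ (l ^ 2) = - 1 + lam * 0" "(1 :: complex) ^ (l ^ 2) = 1 + lam * 0"
      using l_odd by (simp_all add: uminus_power_if)
    then have one: "- 1 \<in> T" "1 \<in> T" unfolding T_def using B(1,2) B(6)[OF B(1)] by blast+
    have "x - y \<in> T" if "x \<in> T" "y \<in> T" for x y using add[OF that(1) mult[OF one(1) that(2)]] by simp
    then show ?thesis using mult one by (simp add: csubring_def)
  qed
  have AT: "Al \<subseteq> T"
  proof
    fix x assume x: "x \<in> Al"
    obtain c where c: "c \<in> Al" "x ^ l = x + lam * c" using Al_fermat[OF x] by blast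
    have "x ^ l \<in> Al" by (intro Al_intros x)
    then obtain d where d: "d \<in> Al" "(x ^ l) ^ l = x ^ l + lam * d" using Al_fermat by blast
    have "x ^ (l ^ 2) = (x ^ l) ^ l" by (simp add: power2_eq_square power_mult)
    then have "x ^ (l ^ 2) = x ^ l + lam * d" using d(2) by (rule trans)
    then have "x ^ (l ^ 2) = x + lam * (c + d)" using c(2) by (simp add: algebra_simps)
    moreover have "c + d \<in> B" using AB c d by (intro B) auto
    ultimately show "x \<in> T" unfolding T_def using AB x by blast
  qed
  have \<eta>T: "\<eta> \<in> T"
  proof -
    \<comment> \<open>Vanishing constant coefficients allow dividing the first relation by \<beta>,
      giving \<beta>^(l-1) = 1 + lam y with y in \<open>B\<close>.\<close>
    obtain p' where p': "p = pCons 0 p'" using p(2) by (cases p) auto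
    obtain p2' where p2': "p2 = pCons 0 p2'" using p2(2) by (cases p2) auto
    have "Polynomial.coeff p (Suc k) \<in> Al" "Polynomial.coeff p2 (Suc k) \<in> Al" for k
      by (rule polysD[OF p(1)], rule polysD[OF p2(1)])
    then have pA: "p' \<in> polys B" "p2' \<in> polys B" unfolding p' p2' using AB by (auto simp: polys_def)
    define y where "y = lam * poly p' \<beta> - e * poly p2' \<beta>"
    have eB: "e \<in> B" using e B(1) B(6)[OF B(1)] by auto
    have yB: "y \<in> B" unfolding y_def by (intro B lamB eB poly_in_csubring[OF BC] pA \<beta>B)
    obtain k where k: "l = Suc k" using l4 by (cases l) auto
    have "\<beta> * (\<beta> ^ k - (1 + lam * y)) = \<beta> ^ l - \<beta> - lam * lam * poly p \<beta> + e * lam * poly p2 \<beta>"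
      by (simp add: k p' p2' y_def algebra_simps)
    also have "\<dots> = 0" unfolding lam_square using rel(1) by (simp add: \<beta>_def)
    finally have \<beta>k: "\<beta> ^ k = 1 + lam * y" using \<eta>0 by (simp add: \<beta>_def)
    have "\<exists>z\<in>B. (1 + lam * y) ^ t = 1 + lam * z" for t
    proof (induction t)
      case (Suc t)
      then obtain z where z: "z \<in> B" "(1 + lam * y) ^ t = 1 + lam * z" by blast
      have "(1 + lam * y) ^ Suc t = 1 + lam * (y + z + lam * y * z)" unfolding power_Suc z(2) by (simp add: algebra_simps)
      then show ?case using z yB lamB by (intro bexI[of _ "y + z + lam * y * z"] B)
    qed (use B(2) in \<open>auto intro!: bexI[of _ 0]\<close>)
    then obtain z where z: "z \<in> B" "(1 + lam * y) ^ ((l + 1) div 5) = 1 + lam * z" by blast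
    define t where "t = (l + 1) div 5"
    have lt: "l + 1 = 5 * t" using l_mod unfolding t_def by presburger
    \<comment> \<open>l^2 - 1 = (l - 1)(l + 1) = 5 (l - 1) t, so \<eta>^(l^2) is \<eta> times the
      t-th power of \<beta>^(l-1).\<close>
    have "l ^ 2 = Suc (5 * (k * t))"
    proof -
      have "5 * (k * t) = k * (l + 1)" unfolding lt by simp
      then show ?thesis by (simp add: k power2_eq_square)
    qed
    then have "\<eta> ^ (l ^ 2) = \<eta> * (\<beta> ^ k) ^ t" by (simp add: \<beta>_def power_mult)
    also have "\<dots> = \<eta> + lam * (\<eta> * z)" unfolding \<beta>k t_def z(2) by (simp add: algebra_simps)
    finally show ?thesis unfolding T_def using \<eta>B B(5)[OF \<eta>B z(1)] by blast
  qed
  have BT: "B \<subseteq> T"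
    unfolding B_def using poly_in_csubring[OF TC polys_mono[OF AT] \<eta>T] by blast

  have "poly_disc m \<notin> Pl"
  proof
    assume "poly_disc m \<in> Pl"
    then obtain r where r: "r \<in> Al" "poly_disc m = lam * r" using Rl_subset_Al by (auto simp: principal_ideal_def)
    obtain y where y: "y \<in> B" "\<eta> ^ (l ^ 2) = \<eta> + lam * y" using \<eta>T unfolding T_def by blast
    obtain b where b: "b \<in> polys Al" "y = poly b \<eta>" using y(1) unfolding B_def by blast
    \<comment> \<open>\<open>G\<close> vanishes at \<eta> and is therefore Q m. Its derivative is -1
      modulo lam, because l^2 is divisible by lam, which gives the Bezout relation between m and its
      derivative.\<close>
    define G where "G = Polynomial.monom 1 (l ^ 2) - Polynomial.monom 1 1 - Polynomial.smult lam b"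
    have GA: "G \<in> polys Al" unfolding G_def
      by (intro AP polys_monom[OF Al_csubring] polys_smult[OF Al_csubring] Al_intros b)
    have G\<eta>: "poly G \<eta> = 0" using y(2) by (simp add: G_def poly_monom b(2))
    obtain Q s where Q: "Q \<in> polys Al" "s \<in> polys Al" "G = Q * m + s" "degree s < degree m"
      by (rule polys_monic_division[OF Al_csubring mA mD(2,4) GA])
    have "s = 0" by (rule mD(5)[OF polys_mono[OF Al_subset_Kl Q(2)] _ Q(4)]) (use G\<eta> mD(3) Q(3) in simp)
    then have "pderiv G = Q * pderiv m + pderiv Q * m" using Q(3) by (simp add: pderiv_mult mult.commute)
    moreover have "pderiv G = Polynomial.monom (of_nat (l ^ 2)) (l ^ 2 - 1) - 1 - Polynomial.smult lam (pderiv b)"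
      by (simp add: G_def pderiv_diff pderiv_monom pderiv_smult one_poly_eq_simps)
    moreover have "Polynomial.monom (of_nat (l ^ 2)) (l ^ 2 - 1) =
        Polynomial.smult lam (Polynomial.monom (- (lam * of_nat l)) (l ^ 2 - 1))"
      by (simp add: smult_monom power2_eq_square ll)
    ultimately have bez: "(- pderiv Q) * m + (- Q) * pderiv m =
        1 + Polynomial.smult lam (pderiv b - Polynomial.monom (- (lam * of_nat l)) (l ^ 2 - 1))"
      by (simp add: smult_diff_right algebra_simps)
    have "\<exists>y\<in>Al. \<exists>z\<in>Al. y * resultant m (pderiv m) = 1 + lam * z"
      by (rule resultant_cong_unit[OF Al_csubring lam_in_Al mA mD(2,4) _ _ _ _ bez])
         (intro AP polys_pderiv Al_csubring mA Q b polys_monom Al_intros)+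
    then obtain y z where yz: "y \<in> Al" "z \<in> Al" "y * resultant m (pderiv m) = 1 + lam * z" by blast
    define sg where "sg = ((- 1) ^ (degree m * (degree m - 1) div 2) :: complex)"
    have "sg * sg = 1" unfolding sg_def by (simp flip: power_mult_distrib)
    moreover have "sg * resultant m (pderiv m) = lam * r" using r(2) mD(2) by (simp add: poly_disc_def sg_def)
    ultimately have "resultant m (pderiv m) = sg * (lam * r)" by (metis mult.assoc mult_1)
    then have "lam * (y * sg * r - z) = 1" using yz(3) by (simp add: algebra_simps)
    moreover have "y * sg * r - z \<in> Al" unfolding sg_def by (intro Al_intros yz r)
    ultimately show False using lam_not_unit by blast
  qed
  moreover have "(\<exists>s \<in> Rl - Pl. alg_int (s * \<alpha>)) \<longleftrightarrow>
      (\<exists>c. (\<forall>i < degree m. loc_integral Rl Pl (c i)) \<and> \<alpha> = (\<Sum>i < degree m. c i * \<eta> ^ i))"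
    if \<alpha>: "\<alpha> \<in> field_adjoin Kl \<eta>" for \<alpha>
  proof
    assume "\<exists>s \<in> Rl - Pl. alg_int (s * \<alpha>)"
    then obtain s where s: "s \<in> Rl - Pl" "alg_int (s * \<alpha>)" by blast
    obtain s' where s': "s' \<in> Al" "s * s' = 1" using Rl_unit[OF s(1)] by blast
    have "s' * (s * \<alpha>) \<in> {z. integral_over Al z}"
      by (rule csubring_mult[OF integral_over_csubring[OF Al_csubring]])
         (use alg_int_imp_integral_over_Al[OF s(2)] integral_overI[OF Al_csubring s'(1)] in auto)
    moreover have "s' * (s * \<alpha>) = \<alpha>" using s'(2) by (metis mult.assoc mult.commute mult_1)
    ultimately have "integral_over Al \<alpha>" by simp
    then obtain N where "\<alpha> ^ N \<in> jspan Al {..<N} (\<lambda>k. \<alpha> ^ k)" using integral_over_power[OF Al_csubring] by blast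
    then obtain a where a: "\<And>i. i \<in> {..<N} \<Longrightarrow> a i \<in> Al" "\<alpha> ^ N = (\<Sum>i<N. a i * \<alpha> ^ i)" unfolding jspan_def by auto
    obtain q where q: "q \<in> polys Kl" "\<alpha> = poly q \<eta>"
      using field_adjoin_subset[OF Kl_csubring Kl_inv \<eta>K] \<alpha> by blast
    have "\<exists>k. lam ^ k * poly q \<eta> \<in> B" using q(1)
    proof (induction q)
      case 0
      then show ?case using B(2) by simp
    next
      case (pCons x q)
      have "Polynomial.coeff (pCons x q) k \<in> Kl" for k using pCons.prems by (rule polysD)
      from this[of 0] this[of "Suc _"] have xK: "x \<in> Kl" "q \<in> polys Kl" by (simp_all add: polys_def)
      obtain k where k: "lam ^ k * poly q \<eta> \<in> B" using pCons.IH xK(2) by blast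
      obtain j where j: "lam ^ j * x \<in> Al" using Al_denominator[OF xK(1)] by blast
      have jB: "lam ^ j * x \<in> B" using j AB by blast
      have "lam ^ k * (lam ^ j * x) + lam ^ j * (\<eta> * (lam ^ k * poly q \<eta>)) \<in> B"
        by (rule B(3)[OF B(5)[OF B(7)[OF lamB] jB] B(5)[OF B(7)[OF lamB] B(5)[OF \<eta>B k]]])
      then have "lam ^ (k + j) * poly (pCons x q) \<eta> \<in> B" by (simp add: power_add algebra_simps)
      then show ?case ..
    qed
    then have ex: "\<exists>k. lam ^ k * \<alpha> \<in> B" unfolding q(2) .
    \<comment> \<open>The least power of lam carrying \<alpha> into \<open>B\<close>; it is to be
      shown that none is needed.\<close>
    define k where "k = (LEAST k. lam ^ k * \<alpha> \<in> B)"
    have kB: "lam ^ k * \<alpha> \<in> B" unfolding k_def using ex by (rule LeastI_ex)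
    have "k = 0"
    proof (rule ccontr)
      assume "k \<noteq> 0"
      then obtain k' where k': "k = Suc k'" by (cases k) auto
      define \<gamma> where "\<gamma> = lam ^ k * \<alpha>"
      have \<gamma>B: "\<gamma> \<in> B" using kB by (simp add: \<gamma>_def)
      \<comment> \<open>Multiplying the integral equation of \<alpha> by lam^(k N) leaves at least
        one spare factor lam^k in each term, because i < N; k > 0 then makes \<gamma>^N divisible by
        lam in \<open>B\<close>.\<close>
      have \<gamma>N: "\<gamma> ^ N = lam * (\<Sum>i<N. a i * lam ^ (k' + k * (N - Suc i)) * \<gamma> ^ i)"
      proof -
        have "\<gamma> ^ N = (\<Sum>i<N. lam ^ (k * N) * (a i * \<alpha> ^ i))"
          unfolding \<gamma>_def power_mult_distrib a(2) by (simp add: sum_distrib_left power_mult)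
        also have "\<dots> = (\<Sum>i<N. lam * (a i * lam ^ (k' + k * (N - Suc i)) * \<gamma> ^ i))"
        proof (rule sum.cong[OF refl])
          fix i assume "i \<in> {..<N}"
          then have "N = i + Suc (N - Suc i)" by auto
          then have "k * N = Suc (k' + k * (N - Suc i)) + k * i" by (metis add.commute add_Suc distrib_left k' mult_Suc_right)
          then have "lam ^ (k * N) = lam * lam ^ (k' + k * (N - Suc i)) * lam ^ (k * i)" by (metis power_Suc power_add)
          then show "lam ^ (k * N) * (a i * \<alpha> ^ i) = lam * (a i * lam ^ (k' + k * (N - Suc i)) * \<gamma> ^ i)"
            by (simp add: \<gamma>_def power_mult_distrib power_mult)
        qed
        finally show ?thesis by (simp add: sum_distrib_left)
      qed
      define y where "y = (\<Sum>i<N. a i * lam ^ (k' + k * (N - Suc i)) * \<gamma> ^ i)"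
      have yB: "y \<in> B" unfolding y_def using a(1) AB by (intro B lamB \<gamma>B) auto
      \<comment> \<open>Iterating the l^2-power map, which is the identity modulo lam
        \<open>B\<close>.\<close>
      have it: "\<exists>z\<in>B. \<gamma> ^ ((l ^ 2) ^ j) = \<gamma> + lam * z" for j
      proof (induction j)
        case 0
        then show ?case using B(2) by (intro bexI[of _ 0]) auto
      next
        case (Suc j)
        then obtain z where z: "z \<in> B" "\<gamma> ^ ((l ^ 2) ^ j) = \<gamma> + lam * z" by blast
        have "\<gamma> + lam * z \<in> T" using BT by (rule subsetD) (intro B \<gamma>B lamB z)
        then obtain z' where z': "z' \<in> B" "(\<gamma> + lam * z) ^ (l ^ 2) = \<gamma> + lam * z + lam * z'" unfolding T_def by blast
        have "\<gamma> ^ ((l ^ 2) ^ Suc j) = (\<gamma> ^ ((l ^ 2) ^ j)) ^ (l ^ 2)" by (simp add: power_mult [symmetric] mult.commute)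
        also have "\<dots> = \<gamma> + lam * (z + z')" unfolding z(2) z'(2) by (simp add: algebra_simps)
        finally show ?case using z z' by (intro bexI[of _ "z + z'"] B)
      qed
      obtain z where z: "z \<in> B" "\<gamma> ^ ((l ^ 2) ^ N) = \<gamma> + lam * z" using it by blast
      \<comment> \<open>The exponent of the iterated map exceeds N, so \<gamma> agrees modulo lam
        with a multiple of \<gamma>^N and is divisible by lam in \<open>B\<close>, against
        minimality of k.\<close>
      have "N \<le> (l ^ 2) ^ N"
      proof -
        have "N \<le> 2 ^ N" by (rule less_imp_le[OF less_exp])
        also have "\<dots> \<le> (l ^ 2) ^ N" using l4 by (intro power_mono) (auto simp: power2_eq_square intro: order.trans[of 2 l])
        finally show ?thesis .
      qed
      then obtain M where M: "(l ^ 2) ^ N = N + M" using le_Suc_ex by blast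
      have "\<gamma> + lam * z = lam * y * \<gamma> ^ M" using z(2) unfolding M power_add \<gamma>N y_def by simp
      then have "\<gamma> = lam * (y * \<gamma> ^ M - z)" by (simp add: algebra_simps eq_diff_eq)
      then have "lam * (lam ^ k' * \<alpha>) = lam * (y * \<gamma> ^ M - z)" unfolding \<gamma>_def k' by (simp add: mult.assoc)
      then have "lam ^ k' * \<alpha> = y * \<gamma> ^ M - z" using lam_nonzero by (metis mult_left_cancel)
      moreover have "y * \<gamma> ^ M - z \<in> B" by (intro B yB \<gamma>B z)
      ultimately have "k \<le> k'" unfolding k_def by (intro Least_le) simp
      then show False using k' by simp
    qed
    then have "\<alpha> \<in> B" using kB by simp
    then obtain g where g: "g \<in> polys Al" "\<alpha> = poly g \<eta>" unfolding B_def by blast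
    obtain Q r where Q: "Q \<in> polys Al" "r \<in> polys Al" "g = Q * m + r" "degree r < degree m"
      by (rule polys_monic_division[OF Al_csubring mA mD(2,4) g(1)])
    have "\<alpha> = poly r \<eta>" using mD(3) by (simp add: g(2) Q(3))
    also have "\<dots> = (\<Sum>i<degree m. Polynomial.coeff r i * \<eta> ^ i)" by (rule poly_eq_sum_lessThan[OF Q(4)])
    finally show "\<exists>c. (\<forall>i < degree m. loc_integral Rl Pl (c i)) \<and> \<alpha> = (\<Sum>i < degree m. c i * \<eta> ^ i)"
      using polysD[OF Q(2)] unfolding loc_integral_iff by (intro exI[of _ "Polynomial.coeff r"] conjI) auto
  next
    assume "\<exists>c. (\<forall>i < degree m. loc_integral Rl Pl (c i)) \<and> \<alpha> = (\<Sum>i < degree m. c i * \<eta> ^ i)"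
    then obtain c where c: "\<And>i. i < degree m \<Longrightarrow> c i \<in> Al" "\<alpha> = (\<Sum>i < degree m. c i * \<eta> ^ i)"
      unfolding loc_integral_iff by blast
    note I = csubring_intros[OF integral_over_csubring[OF Al_csubring]]
    have "(\<Sum>i < degree m. c i * \<eta> ^ i) \<in> {z. integral_over Al z}"
      by (intro I) (use c(1) integral_overI[OF Al_csubring] \<eta>A in auto)
    then have "integral_over Al \<alpha>" unfolding c(2) by simp
    then obtain N where N: "\<not> int l dvd N" "alg_int (of_int N * \<alpha>)" by (rule integral_over_Al_imp_alg_int)
    then show "\<exists>s \<in> Rl - Pl. alg_int (s * \<alpha>)" using of_int_in_Rl_not_Pl by blast
  qed
  ultimately show ?thesis using m by blast
qed

end

theorem theorem4p2:
  fixes l d :: nat and v :: int and P :: "complex set"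
  defines "K \<equiv> quad_field l"
  defines "R \<equiv> ring_of_integers K"
  defines "w \<equiv> (of_int v + \<i> * of_real (sqrt (real d))) / 2"
  defines "\<eta> \<equiv> rr_cf (w / 5)"
  defines "\<ll> \<equiv> principal_ideal R (\<i> * of_real (sqrt (real l)))"
  assumes "prime l" and "l mod 5 = 4"
    and "(d = l \<and> l mod 4 = 3) \<or> d = 4 * l"
    and "alg_int w"
    and "is_prime_ideal R P" and "5 \<in> P"
    and "w \<in> ideal_mult R P P"
    and "d = 4 * l \<and> l mod 4 = 3 \<longrightarrow> odd ((v ^ 2 + int d) div 4)"
  shows "\<exists>m. is_min_poly K \<eta> m \<and> poly_disc m \<notin> \<ll> \<and>
           (\<forall>\<alpha> \<in> field_adjoin K \<eta>.
              (\<exists>s \<in> R - \<ll>. alg_int (s * \<alpha>)) \<longleftrightarrow>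
              (\<exists>c. (\<forall>i < degree m. loc_integral R \<ll> (c i)) \<and>
                   \<alpha> = (\<Sum>i < degree m. c i * \<eta> ^ i)))"
proof -
  interpret lprime4 l by unfold_locales fact+
  have "d = l \<or> d = 4 * l" using assms(8) by blast
  then obtain k u N :: int where cm: "Im w > 0" "\<not> int l dvd k" "lam = of_int k * w - of_int u"
    "lam * w = of_int u * w - of_int (k * N)" "k ^ 2 * N = u ^ 2 + int l" "5 dvd N"
    using cm_point[of d v P] assms(9-12) unfolding w_def R_def K_def by blast
  obtain p p2 p3 :: "complex poly" and e :: complex where rel:
    "\<And>k. Polynomial.coeff p k \<in> Zl" "\<And>k. Polynomial.coeff p2 k \<in> Zl" "\<And>k. Polynomial.coeff p3 k \<in> Zl"
    "Polynomial.coeff p 0 = 0" "Polynomial.coeff p2 0 = 0" "degree p3 \<le> 2 * l" "e = 1 \<or> e = - 1" "\<eta> ^ 5 \<noteq> 0"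
    "(\<eta> ^ 5) ^ l - \<eta> ^ 5 + of_nat l * poly p (\<eta> ^ 5) = - e * lam * poly p2 (\<eta> ^ 5)"
    "((\<eta> ^ 5) ^ l - \<eta> ^ 5) ^ 2 = of_nat l * poly p3 (\<eta> ^ 5)"
    using cm_relations[OF cm] unfolding \<eta>_def by metis
  have pA: "p \<in> polys Al" "p2 \<in> polys Al" "p3 \<in> polys Zl" using rel(1-3) Zl_subset_Al by (auto simp: polys_def)
  have "\<eta> \<noteq> 0" using rel(8) by auto
  show ?thesis unfolding \<ll>_def R_def K_def lam_def [symmetric]
    by (rule unramified_at_lam[OF pA(1) rel(4) pA(2) rel(5) pA(3) rel(6,7) \<open>\<eta> \<noteq> 0\<close> rel(9,10)])
qed

end
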